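(* Let $k$ be a field of characteristic $0$, let $V$ be a finite-dimensional vector space over $k$, and let $A=S(V)$ be the (co)free commutative cocommutative bialgebra on $V$. Then the Gerstenhaber–Schack cohomology of $A$ is $$H^m_{\mathrm{GS}}(A)=\bigoplus_{i+j=m,\ i,j\ge0}\Lambda^iV\otimes\Lambda^j(V^* ).$$
   Context: $S(V)$ is the symmetric algebra with its usual product and the coproduct for which elements of $V$ are primitive. The Gerstenhaber–Schack cohomology $H^\bullet_{\mathrm{GS}}(A)=H^\bullet_{\mathrm{GS}}(A,A)$ of a bialgebra $(A,*,\Delta)$ with unit and counit is the cohomology of the total complex of the bicomplex $\bigoplus_{m,n\ge0}\mathrm{Hom}_k(A^{\otimes m},A^{\otimes n})[-m-n]$ whose two differentials are, for $\Psi\colon A^{\otimes m}\to A^{\otimes n}$, $$(d_1\Psi)(a_0\otimes\dots\otimes a_m)=\Delta^{n-1}(a_0)*\Psi(a_1\otimes\dots\otimes a_m)+\sum_{i=0}^{m-1}(-1)^{i+1}\Psi(a_0\otimes\dots\otimes(a_i*a_{i+1})\otimes\dots\otimes a_m)+(-1)^{m-1}\Psi(a_0\otimes\dots\otimes a_{m-1})*\Delta^{n-1}(a_m),$$ $$(d_2\Psi)(a_1\otimes\dots\otimes a_m)=(\Delta^{(1)}(a_1)*\dots*\Delta^{(1)}(a_m))\otimes\Psi(\Delta^{(2)}(a_1)\otimes\dots\otimes\Delta^{(2)}(a_m))+\sum_{i=1}^n(-1)^i\Delta_i\Psi(a_1\otimes\dots\otimes a_m)+(-1)^{n+1}\Psi(\Delta^{(1)}(a_1)\otimes\dots\otimes\Delta^{(1)}(a_m))\otimes(\Delta^{(2)}(a_1)*\dots*\Delta^{(2)}(a_m)),$$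 where $\Delta(a)=\Delta^{(1)}(a)\otimes\Delta^{(2)}(a)$ (Sweedler notation), $\Delta^{n-1}\colon A\to A^{\otimes n}$ is the iterated coproduct, $\Delta_i$ applies $\Delta$ to the $i$-th tensor factor, and the usual sign is inserted when forming the total complex. *)

theory Defs
  imports
    "HOL-Algebra.Algebraic_Closure_Type"
    "HOL-Library.Multiset"
    "HOL-Library.Poly_Mapping"
begin

text \<open>
  The ground field is a type \<open>'k\<close> of class \<open>field\<close>. The spaces constructed from it are mostly
  quotients, whose elements are cosets, so they are given as HOL-Algebra modules over the
  ring record of \<open>'k\<close>.
\<close>

section \<open>Linear algebra\<close>

abbreviation ground :: "'k::field ring" where
  "ground \<equiv> ring_of_type_algebra"

definition scalars :: "('k::field, 'k) module" where
  "scalars = \<lparr>carrier = UNIV, monoid.mult = (*), one = 1, zero = 0, add = (+), module.smult = (*)\<rparr>"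

text \<open>
  The fields \<open>mult\<close> and \<open>one\<close> of the HOL-Algebra record are irrelevant for a vector space without
  product.
\<close>

definition space_of :: "('k::field \<Rightarrow> 'v::ab_group_add \<Rightarrow> 'v) \<Rightarrow> ('k, 'v) module" where
  "space_of scale =
     \<lparr>carrier = UNIV, monoid.mult = undefined, one = undefined, zero = 0, add = (+), module.smult = scale\<rparr>"

definition free_space :: "'x set \<Rightarrow> ('k::field, 'x \<Rightarrow>\<^sub>0 'k) module" where
  "free_space G =
     \<lparr>carrier = {p. Poly_Mapping.keys p \<subseteq> G}, monoid.mult = undefined, one = undefined, zero = 0, add = (+),
      module.smult = (\<lambda>c. Poly_Mapping.map ((*) c))\<rparr>"

definition gen_subspace :: "('k::field, 'a, 'z) module_scheme \<Rightarrow> 'a set \<Rightarrow> 'a set" where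
  "gen_subspace M S = \<Inter>{H. submodule H ground M \<and> S \<subseteq> H}"

definition quotient_space :: "('k::field, 'a, 'z) module_scheme \<Rightarrow> 'a set \<Rightarrow> ('k, 'a set) module" where
  "quotient_space M H =
     ring.extend (M Quot H) (module.fields (\<lambda>c C. \<Union>x\<in>C. H +>\<^bsub>M\<^esub> (c \<odot>\<^bsub>M\<^esub> x)))"

definition hom_space ::
    "('k::field, 'a, 'y) module_scheme \<Rightarrow> ('k, 'b, 'z) module_scheme \<Rightarrow> ('k, 'a \<Rightarrow> 'b) module" where
  "hom_space M N =
     \<lparr>carrier = {f \<in> carrier M \<rightarrow>\<^sub>E carrier N.
        (\<forall>x\<in>carrier M. \<forall>y\<in>carrier M. f (x \<oplus>\<^bsub>M\<^esub> y) = f x \<oplus>\<^bsub>N\<^esub> f y) \<and>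
        (\<forall>c. \<forall>x\<in>carrier M. f (c \<odot>\<^bsub>M\<^esub> x) = c \<odot>\<^bsub>N\<^esub> f x)},
      monoid.mult = undefined, one = undefined,
      zero = (\<lambda>x\<in>carrier M. \<zero>\<^bsub>N\<^esub>),
      add = (\<lambda>f g. \<lambda>x\<in>carrier M. f x \<oplus>\<^bsub>N\<^esub> g x),
      module.smult = (\<lambda>c f. \<lambda>x\<in>carrier M. c \<odot>\<^bsub>N\<^esub> f x)\<rparr>"

definition dual_space :: "('k::field, 'a, 'z) module_scheme \<Rightarrow> ('k, 'a \<Rightarrow> 'k) module" where
  "dual_space M = hom_space M scalars"

text \<open>Used for finite index sets only, where the direct sum is the product.\<close>

definition direct_sum :: "'i set \<Rightarrow> ('i \<Rightarrow> ('k::field, 'a, 'z) module_scheme) \<Rightarrow> ('k, 'i \<Rightarrow> 'a) module" where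
  "direct_sum I M =
     \<lparr>carrier = (\<Pi>\<^sub>E i\<in>I. carrier (M i)), monoid.mult = undefined, one = undefined,
      zero = (\<lambda>i\<in>I. \<zero>\<^bsub>M i\<^esub>),
      add = (\<lambda>x y. \<lambda>i\<in>I. x i \<oplus>\<^bsub>M i\<^esub> y i),
      module.smult = (\<lambda>c x. \<lambda>i\<in>I. c \<odot>\<^bsub>M i\<^esub> x i)\<rparr>"

definition linearly_isomorphic ::
    "('k::field, 'a, 'y) module_scheme \<Rightarrow> ('k, 'b, 'z) module_scheme \<Rightarrow> bool" where
  "linearly_isomorphic M N \<longleftrightarrow>
     (\<exists>f \<in> carrier (hom_space M N). bij_betw f (carrier M) (carrier N))"

text \<open>
  For a quotient of a free space on \<open>G\<close> and a map \<open>f\<close> from \<open>G\<close> to \<open>W\<close> that respects the relations,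
  this is the induced linear map: it evaluates any representative of the coset.
\<close>

definition linear_ext ::
    "('k::field, 'w, 'z) module_scheme \<Rightarrow> ('x \<Rightarrow> 'w) \<Rightarrow> ('x \<Rightarrow>\<^sub>0 'k) set \<Rightarrow> 'w" where
  "linear_ext W f P =
     (let p = (SOME p. p \<in> P) in \<Oplus>\<^bsub>W\<^esub>x\<in>Poly_Mapping.keys p. Poly_Mapping.lookup p x \<odot>\<^bsub>W\<^esub> f x)"


section \<open>Tensor products and exterior powers\<close>

definition bilinear_relations ::
    "('k::field, 'a, 'y) module_scheme \<Rightarrow> ('k, 'b, 'z) module_scheme \<Rightarrow> ('a \<times> 'b \<Rightarrow>\<^sub>0 'k) set" where
  "bilinear_relations M N =
     {Poly_Mapping.single (x \<oplus>\<^bsub>M\<^esub> x', y) 1 - Poly_Mapping.single (x, y) 1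
        - Poly_Mapping.single (x', y) 1 | x x' y.
        x \<in> carrier M \<and> x' \<in> carrier M \<and> y \<in> carrier N} \<union>
     {Poly_Mapping.single (x, y \<oplus>\<^bsub>N\<^esub> y') 1 - Poly_Mapping.single (x, y) 1
        - Poly_Mapping.single (x, y') 1 | x y y'.
        x \<in> carrier M \<and> y \<in> carrier N \<and> y' \<in> carrier N} \<union>
     {Poly_Mapping.single (c \<odot>\<^bsub>M\<^esub> x, y) 1 - Poly_Mapping.single (x, y) c | c x y.
        x \<in> carrier M \<and> y \<in> carrier N} \<union>
     {Poly_Mapping.single (x, c \<odot>\<^bsub>N\<^esub> y) 1 - Poly_Mapping.single (x, y) c | c x y.
        x \<in> carrier M \<and> y \<in> carrier N}"

definition tensor_product ::
    "('k::field, 'a, 'y) module_scheme \<Rightarrow> ('k, 'b, 'z) module_scheme \<Rightarrow>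
     ('k, ('a \<times> 'b \<Rightarrow>\<^sub>0 'k) set) module" where
  "tensor_product M N =
     (let F = free_space (carrier M \<times> carrier N)
      in quotient_space F (gen_subspace F (bilinear_relations M N)))"

type_synonym ('k, 'a) tensor = "('a list \<Rightarrow>\<^sub>0 'k) set"

definition words :: "('k::field, 'a, 'z) module_scheme \<Rightarrow> nat \<Rightarrow> 'a list set" where
  "words M n = {l. set l \<subseteq> carrier M \<and> length l = n}"

definition multilinear_relations ::
    "('k::field, 'a, 'z) module_scheme \<Rightarrow> nat \<Rightarrow> ('a list \<Rightarrow>\<^sub>0 'k) set" where
  "multilinear_relations M n =
     {Poly_Mapping.single (l[i := a \<oplus>\<^bsub>M\<^esub> b]) 1 - Poly_Mapping.single (l[i := a]) 1
        - Poly_Mapping.single (l[i := b]) 1 | l i a b.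
        l \<in> words M n \<and> i < n \<and> a \<in> carrier M \<and> b \<in> carrier M} \<union>
     {Poly_Mapping.single (l[i := c \<odot>\<^bsub>M\<^esub> a]) 1 - Poly_Mapping.single (l[i := a]) c | l i c a.
        l \<in> words M n \<and> i < n \<and> a \<in> carrier M}"

definition tensor_kernel ::
    "('k::field, 'a, 'z) module_scheme \<Rightarrow> nat \<Rightarrow> ('a list \<Rightarrow>\<^sub>0 'k) set" where
  "tensor_kernel M n = gen_subspace (free_space (words M n)) (multilinear_relations M n)"

definition tensor_space ::
    "('k::field, 'a, 'z) module_scheme \<Rightarrow> nat \<Rightarrow> ('k, ('k, 'a) tensor) module" where
  "tensor_space M n = quotient_space (free_space (words M n)) (tensor_kernel M n)"

text \<open>\<open>pure_tensor M n [a\<^sub>1, \<dots>, a\<^sub>n]\<close> is \<open>a\<^sub>1 \<otimes> \<dots> \<otimes> a\<^sub>n\<close>.\<close>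

definition pure_tensor :: "('k::field, 'a, 'z) module_scheme \<Rightarrow> nat \<Rightarrow> 'a list \<Rightarrow> ('k, 'a) tensor" where
  "pure_tensor M n l = tensor_kernel M n +>\<^bsub>free_space (words M n)\<^esub> Poly_Mapping.single l 1"

text \<open>The tensor product of tensors \<open>x\<close>, \<open>y\<close> whose degrees add up to \<open>N\<close>.\<close>

definition tconcat ::
    "('k::field, 'a, 'z) module_scheme \<Rightarrow> nat \<Rightarrow> ('k, 'a) tensor \<Rightarrow> ('k, 'a) tensor \<Rightarrow> ('k, 'a) tensor" where
  "tconcat M N x y =
     linear_ext (tensor_space M N)
       (\<lambda>l. linear_ext (tensor_space M N) (\<lambda>l'. pure_tensor M N (l @ l')) y) x"

definition exterior_power ::
    "('k::field, 'a, 'z) module_scheme \<Rightarrow> nat \<Rightarrow> ('k, ('k, 'a) tensor set) module" where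
  "exterior_power M n =
     quotient_space (tensor_space M n)
       (gen_subspace (tensor_space M n) {pure_tensor M n l | l. l \<in> words M n \<and> \<not> distinct l})"

text \<open>The tensor power of an algebra, with the factorwise product.\<close>

definition tensor_power ::
    "('k::field, 'a, 'z) module_scheme \<Rightarrow> nat \<Rightarrow> ('k, ('k, 'a) tensor) module" where
  "tensor_power A n =
     (tensor_space A n)
       \<lparr>monoid.mult := (\<lambda>x y. linear_ext (tensor_space A n)
          (\<lambda>l. linear_ext (tensor_space A n) (\<lambda>l'. pure_tensor A n (map2 (monoid.mult A) l l')) y) x),
        one := pure_tensor A n (replicate n \<one>\<^bsub>A\<^esub>)\<rparr>"


section \<open>Gerstenhaber--Schack cohomology\<close>

record (overloaded) ('k::zero, 'a) bialgebra = "('k, 'a) module" +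
  comult :: "'a \<Rightarrow> ('a list \<Rightarrow>\<^sub>0 'k) set"
  counit :: "'a \<Rightarrow> 'k"

text \<open>
  Factors are numbered from \<open>0\<close>: \<open>comult_at A n i\<close> maps the \<open>n\<close>-th to the \<open>n+1\<close>-st tensor power by
  applying the coproduct to factor \<open>i < n\<close>; it is \<open>\<Delta>\<^sub>i\<^sub>+\<^sub>1\<close> in the usual numbering.
\<close>

definition comult_at ::
    "('k::field, 'a) bialgebra \<Rightarrow> nat \<Rightarrow> nat \<Rightarrow> ('k, 'a) tensor \<Rightarrow> ('k, 'a) tensor" where
  "comult_at A n i =
     linear_ext (tensor_power A (Suc n))
       (\<lambda>l. tconcat A (Suc n) (pure_tensor A i (take i l))
              (tconcat A (Suc n - i) (comult A (l ! i)) (pure_tensor A (n - Suc i) (drop (Suc i) l))))"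

text \<open>
  \<open>iter_comult A n\<close> is \<open>\<Delta>\<^sup>n\<^sup>-\<^sup>1\<close> with values in the \<open>n\<close>-th tensor power: the counit for \<open>n = 0\<close>, and
  the identity for \<open>n = 1\<close>.
\<close>

fun iter_comult :: "('k::field, 'a) bialgebra \<Rightarrow> nat \<Rightarrow> 'a \<Rightarrow> ('k, 'a) tensor" where
  "iter_comult A 0 a = counit A a \<odot>\<^bsub>tensor_power A 0\<^esub> pure_tensor A 0 []"
| "iter_comult A (Suc 0) a = pure_tensor A 1 [a]"
| "iter_comult A (Suc (Suc n)) a = comult_at A (Suc n) 0 (iter_comult A (Suc n) a)"

definition alg_prod :: "('k::field, 'a) bialgebra \<Rightarrow> 'a list \<Rightarrow> 'a" where
  "alg_prod A l = foldr (monoid.mult A) l \<one>\<^bsub>A\<^esub>"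

text \<open>\<open>comults A [a\<^sub>1, \<dots>, a\<^sub>m]\<close> is \<open>\<Delta>(a\<^sub>1) \<otimes> \<dots> \<otimes> \<Delta>(a\<^sub>m)\<close> in the tensor power of order \<open>2m\<close>.\<close>

fun comults :: "('k::field, 'a) bialgebra \<Rightarrow> 'a list \<Rightarrow> ('k, 'a) tensor" where
  "comults A [] = pure_tensor A 0 []"
| "comults A (a # l) = tconcat A (2 * Suc (length l)) (comult A a) (comults A l)"

text \<open>
  Sweedler notation: for \<open>f\<close> multilinear in the entries of both lists, \<open>sweedler W A f [a\<^sub>1, \<dots>, a\<^sub>m]\<close> is
  \<open>f [\<Delta>\<^sup>(\<^sup>1\<^sup>)(a\<^sub>1), \<dots>, \<Delta>\<^sup>(\<^sup>1\<^sup>)(a\<^sub>m)] [\<Delta>\<^sup>(\<^sup>2\<^sup>)(a\<^sub>1), \<dots>, \<Delta>\<^sup>(\<^sup>2\<^sup>)(a\<^sub>m)]\<close>.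
\<close>

definition sweedler ::
    "('k::field, 'w, 'z) module_scheme \<Rightarrow> ('k, 'a) bialgebra \<Rightarrow>
     ('a list \<Rightarrow> 'a list \<Rightarrow> 'w) \<Rightarrow> 'a list \<Rightarrow> 'w" where
  "sweedler W A f l =
     linear_ext W
       (\<lambda>u. f (map (\<lambda>j. u ! (2 * j)) [0..<length l]) (map (\<lambda>j. u ! (2 * j + 1)) [0..<length l]))
       (comults A l)"

definition GS_bicomplex ::
    "('k::field, 'a) bialgebra \<Rightarrow> nat \<Rightarrow> nat \<Rightarrow> ('k, ('k, 'a) tensor \<Rightarrow> ('k, 'a) tensor) module" where
  "GS_bicomplex A m n = hom_space (tensor_power A m) (tensor_power A n)"

text \<open>
  The two differentials on \<open>GS_bicomplex A m n\<close>, given on a pure tensor \<open>a\<^sub>0 \<otimes> \<dots> \<otimes> a\<^sub>m\<close>, resp.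
  \<open>a\<^sub>1 \<otimes> \<dots> \<otimes> a\<^sub>m\<close>. The last sign of \<open>d\<^sub>1\<close> is written \<open>(-1)\<^sup>m\<^sup>+\<^sup>1\<close> instead of \<open>(-1)\<^sup>m\<^sup>-\<^sup>1\<close> since the
  exponent is a natural number and \<open>m\<close> may be \<open>0\<close>.
\<close>

definition GS_d1 ::
    "('k::field, 'a) bialgebra \<Rightarrow> nat \<Rightarrow> nat \<Rightarrow> (('k, 'a) tensor \<Rightarrow> ('k, 'a) tensor) \<Rightarrow>
     ('k, 'a) tensor \<Rightarrow> ('k, 'a) tensor" where
  "GS_d1 A m n \<Psi> =
     (let W = tensor_power A n in
      (\<lambda>x\<in>carrier (tensor_power A (Suc m)).
        linear_ext W
          (\<lambda>l. iter_comult A n (hd l) \<otimes>\<^bsub>W\<^esub> \<Psi> (pure_tensor A m (tl l))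
             \<oplus>\<^bsub>W\<^esub> (\<Oplus>\<^bsub>W\<^esub>i\<in>{..<m}. (-1) ^ (i + 1) \<odot>\<^bsub>W\<^esub>
                     \<Psi> (pure_tensor A m (take i l @ [l ! i \<otimes>\<^bsub>A\<^esub> l ! (i + 1)] @ drop (i + 2) l)))
             \<oplus>\<^bsub>W\<^esub> (-1) ^ (m + 1) \<odot>\<^bsub>W\<^esub> (\<Psi> (pure_tensor A m (butlast l)) \<otimes>\<^bsub>W\<^esub> iter_comult A n (last l)))
          x))"

definition GS_d2 ::
    "('k::field, 'a) bialgebra \<Rightarrow> nat \<Rightarrow> nat \<Rightarrow> (('k, 'a) tensor \<Rightarrow> ('k, 'a) tensor) \<Rightarrow>
     ('k, 'a) tensor \<Rightarrow> ('k, 'a) tensor" where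
  "GS_d2 A m n \<Psi> =
     (let W = tensor_power A (Suc n) in
      (\<lambda>x\<in>carrier (tensor_power A m).
        linear_ext W
          (\<lambda>l. sweedler W A (\<lambda>b c. tconcat A (Suc n) (pure_tensor A 1 [alg_prod A b]) (\<Psi> (pure_tensor A m c))) l
             \<oplus>\<^bsub>W\<^esub> (\<Oplus>\<^bsub>W\<^esub>i\<in>{1..n}. (-1) ^ i \<odot>\<^bsub>W\<^esub> comult_at A n (i - 1) (\<Psi> (pure_tensor A m l)))
             \<oplus>\<^bsub>W\<^esub> (-1) ^ (n + 1) \<odot>\<^bsub>W\<^esub>
                sweedler W A (\<lambda>b c. tconcat A (Suc n) (\<Psi> (pure_tensor A m b)) (pure_tensor A 1 [alg_prod A c])) l)
          x))"

definition GS_total ::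
    "('k::field, 'a) bialgebra \<Rightarrow> nat \<Rightarrow>
     ('k, nat \<times> nat \<Rightarrow> ('k, 'a) tensor \<Rightarrow> ('k, 'a) tensor) module" where
  "GS_total A N = direct_sum {(m, n). m + n = N} (\<lambda>(m, n). GS_bicomplex A m n)"

text \<open>As \<open>d\<^sub>1\<close> and \<open>d\<^sub>2\<close> commute, the total differential is \<open>d\<^sub>1 + (-1)\<^sup>m d\<^sub>2\<close> on bidegree \<open>(m, n)\<close>.\<close>

definition GS_differential ::
    "('k::field, 'a) bialgebra \<Rightarrow> nat \<Rightarrow> (nat \<times> nat \<Rightarrow> ('k, 'a) tensor \<Rightarrow> ('k, 'a) tensor) \<Rightarrow>
     (nat \<times> nat \<Rightarrow> ('k, 'a) tensor \<Rightarrow> ('k, 'a) tensor)" where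
  "GS_differential A N \<Phi> =
     (\<lambda>(m, n)\<in>{(m, n). m + n = Suc N}.
        (if m = 0 then \<zero>\<^bsub>GS_bicomplex A m n\<^esub> else GS_d1 A (m - 1) n (\<Phi> (m - 1, n)))
        \<oplus>\<^bsub>GS_bicomplex A m n\<^esub>
        (if n = 0 then \<zero>\<^bsub>GS_bicomplex A m n\<^esub>
         else (-1) ^ m \<odot>\<^bsub>GS_bicomplex A m n\<^esub> GS_d2 A m (n - 1) (\<Phi> (m, n - 1))))"

definition GS_cocycles ::
    "('k::field, 'a) bialgebra \<Rightarrow> nat \<Rightarrow> (nat \<times> nat \<Rightarrow> ('k, 'a) tensor \<Rightarrow> ('k, 'a) tensor) set" where
  "GS_cocycles A N =
     {\<Phi> \<in> carrier (GS_total A N). GS_differential A N \<Phi> = \<zero>\<^bsub>GS_total A (Suc N)\<^esub>}"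

fun GS_coboundaries ::
    "('k::field, 'a) bialgebra \<Rightarrow> nat \<Rightarrow> (nat \<times> nat \<Rightarrow> ('k, 'a) tensor \<Rightarrow> ('k, 'a) tensor) set" where
  "GS_coboundaries A 0 = {\<zero>\<^bsub>GS_total A 0\<^esub>}"
| "GS_coboundaries A (Suc N) = GS_differential A N ` carrier (GS_total A N)"

definition GS_cohomology ::
    "('k::field, 'a) bialgebra \<Rightarrow> nat \<Rightarrow>
     ('k, (nat \<times> nat \<Rightarrow> ('k, 'a) tensor \<Rightarrow> ('k, 'a) tensor) set) module" where
  "GS_cohomology A N =
     quotient_space ((GS_total A N)\<lparr>carrier := GS_cocycles A N\<rparr>) (GS_coboundaries A N)"


section \<open>The symmetric algebra as a bialgebra\<close>

text \<open>
  The free commutative algebra on the underlying set of \<open>V\<close>: polynomials with one variable for each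
  vector, a monomial being a finite multiset of vectors. The symmetric algebra is its quotient by
  the relations that make the inclusion of \<open>V\<close> linear.
\<close>

definition free_comm_algebra :: "('k::field, 'v multiset \<Rightarrow>\<^sub>0 'k) module" where
  "free_comm_algebra =
     \<lparr>carrier = UNIV, monoid.mult = (*), one = 1, zero = 0, add = (+),
      module.smult = (\<lambda>c. Poly_Mapping.map ((*) c))\<rparr>"

definition symmetric_ideal ::
    "('k::field \<Rightarrow> 'v::ab_group_add \<Rightarrow> 'v) \<Rightarrow> ('v multiset \<Rightarrow>\<^sub>0 'k) set" where
  "symmetric_ideal scale =
     Idl\<^bsub>free_comm_algebra\<^esub>
       ({Poly_Mapping.single {#v + w#} 1 - Poly_Mapping.single {#v#} 1
           - Poly_Mapping.single {#w#} 1 | v w. True} \<union>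
        {Poly_Mapping.single {#scale c v#} 1 - Poly_Mapping.single {#v#} c | c v. True})"

definition symmetric_algebra ::
    "('k::field \<Rightarrow> 'v::ab_group_add \<Rightarrow> 'v) \<Rightarrow> ('k, ('v multiset \<Rightarrow>\<^sub>0 'k) set) module" where
  "symmetric_algebra scale = quotient_space free_comm_algebra (symmetric_ideal scale)"

definition sym_incl ::
    "('k::field \<Rightarrow> 'v::ab_group_add \<Rightarrow> 'v) \<Rightarrow> 'v \<Rightarrow> ('v multiset \<Rightarrow>\<^sub>0 'k) set" where
  "sym_incl scale v =
     symmetric_ideal scale +>\<^bsub>free_comm_algebra\<^esub> Poly_Mapping.single {#v#} 1"

text \<open>
  Coproduct and counit are algebra homomorphisms; as \<open>V\<close> generates the algebra, they are determined
  by their values on \<open>V\<close>.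
\<close>

definition symmetric_comult ::
    "('k::field \<Rightarrow> 'v::ab_group_add \<Rightarrow> 'v) \<Rightarrow>
     ('v multiset \<Rightarrow>\<^sub>0 'k) set \<Rightarrow> ('k, ('v multiset \<Rightarrow>\<^sub>0 'k) set) tensor" where
  "symmetric_comult scale =
     (let S = symmetric_algebra scale; S2 = tensor_power S 2 in
      THE D. D \<in> carrier (hom_space S S2) \<and> D \<in> ring_hom S S2 \<and>
        (\<forall>v. D (sym_incl scale v) =
               pure_tensor S 2 [sym_incl scale v, \<one>\<^bsub>S\<^esub>] \<oplus>\<^bsub>S2\<^esub> pure_tensor S 2 [\<one>\<^bsub>S\<^esub>, sym_incl scale v]))"

definition symmetric_counit ::
    "('k::field \<Rightarrow> 'v::ab_group_add \<Rightarrow> 'v) \<Rightarrow> ('v multiset \<Rightarrow>\<^sub>0 'k) set \<Rightarrow> 'k" where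
  "symmetric_counit scale =
     (let S = symmetric_algebra scale in
      THE e. e \<in> carrier (hom_space S scalars) \<and> e \<in> ring_hom S scalars \<and>
        (\<forall>v. e (sym_incl scale v) = 0))"

definition symmetric_bialgebra ::
    "('k::field \<Rightarrow> 'v::ab_group_add \<Rightarrow> 'v) \<Rightarrow> ('k, ('v multiset \<Rightarrow>\<^sub>0 'k) set) bialgebra" where
  "symmetric_bialgebra scale =
     module.extend (symmetric_algebra scale)
       (bialgebra.fields (symmetric_comult scale) (symmetric_counit scale))"

end

theory Submission
  imports Defs
begin

text \<open>
  Choose a basis of \<open>V\<close>, so that \<open>A\<close> is a polynomial ring and \<open>A\<^sup>\<otimes>\<^sup>n\<close> is a polynomial ring in \<open>n\<close> copies
  of the variables. Assign to \<open>\<Psi>\<close> the generating function of its values on monomials, in divided powers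
  of dual variables \<open>\<xi>\<close>. In characteristic \<open>0\<close> one can multiply it by \<open>exp (- (\<Sum>i. \<xi>\<^sub>i) (\<Sum>j. x\<^sub>j))\<close>, and this
  conjugates \<open>d\<^sub>1\<close> into the bar differential of the monoid of monomials with trivial coefficients and
  \<open>d\<^sub>2\<close> into the cobar differential with trivial coefficients, which in divided power coefficients is
  the transpose of the bar differential. The bar complex of a free commutative monoid contracts, one
  letter after the other, onto the antisymmetrizations of words in distinct letters. Applying the
  contraction in both directions of the double complex leaves one dimension for each pair of sets of
  basis vectors of total size \<open>N\<close>, as in the sum of the \<open>\<Lambda>\<^sup>iV \<otimes> \<Lambda>\<^sup>j(V\<^sup>*)\<close>.
\<close>

section \<open>The bar complex of a free commutative monoid\<close>

text \<open>A cochain becomes a matrix \<open>F l l'\<close> indexed by two lists of monomials. For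
  each \<open>l\<close> only finitely many entries are nonzero, but infinitely many \<open>l\<close>
  may occur, so the two directions of the double complex are not symmetric. The homotopies are
  therefore explicit finite combinations of evaluations at lists with the same total monomial. Such
  operators apply to arbitrary functions of \<open>l\<close>; in \<open>l'\<close> they keep the
  support finite, because a monomial has only finitely many factorizations of a given length.

  The exponent comes from the iterated coproduct, which sends a variable to the sum of its copies in
  all tensor factors. The exponential has integral coefficients in divided powers; factorials are
  inverted on the side of the values, where \<open>evm\<close> rescales the coefficients of a
  polynomial, and 2 is inverted in the exterior powers.

  The isomorphism is not given by a formula on classes: every space receives coordinates on an
  explicit index set, and the two sides end up with the same one.\<close>

text \<open>
  \<open>evs S\<close> consists of the integer combinations of evaluations at points of \<open>S\<close>. All operators on cochains
  below are of this form, so they commute with each other when they act on different arguments.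
\<close>

inductive evs :: "'x set \<Rightarrow> (('x \<Rightarrow> 'w::ab_group_add) \<Rightarrow> 'w) \<Rightarrow> bool" for S where
  evs_zero: "evs S (\<lambda>f. 0)"
| evs_at: "x \<in> S \<Longrightarrow> evs S (\<lambda>f. f x)"
| evs_diff: "evs S T \<Longrightarrow> evs S U \<Longrightarrow> evs S (\<lambda>f. T f - U f)"

lemma evs_minus: "evs S T \<Longrightarrow> evs S (\<lambda>f. - T f)"
  using evs_diff[OF evs_zero, of S T] by simp

lemma evs_mono: "evs S T \<Longrightarrow> S \<subseteq> S' \<Longrightarrow> evs S' T"
  by (induction rule: evs.induct) (auto intro: evs.intros)

lemma evs_comp: "evs S T \<Longrightarrow> g ` S \<subseteq> S' \<Longrightarrow> evs S' (\<lambda>f. T (\<lambda>x. f (g x)))"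
  by (induction rule: evs.induct) (auto intro: evs.intros)

text \<open>Composition of operators: the composite evaluates only at points of the inner operators.
  In this way total monomial and length are tracked through \<open>contraction\<close> and
  \<open>alt\<close>.\<close>

lemma evs_bind:
  assumes "evs S T" "\<And>x. x \<in> S \<Longrightarrow> evs S' (U x)"
  shows "evs S' (\<lambda>f. T (\<lambda>x. U x f))"
  using assms by (induction rule: evs.induct) (auto intro: evs.intros)

lemma evs_cong: "evs S T \<Longrightarrow> (\<And>x. x \<in> S \<Longrightarrow> f x = g x) \<Longrightarrow> T f = T g"
  by (induction rule: evs.induct) auto

lemma evs_0: "evs S T \<Longrightarrow> T (\<lambda>x. 0) = 0"
  by (induction rule: evs.induct) auto

lemma evs_plus: "evs S T \<Longrightarrow> T (\<lambda>x. f x + g x) = T f + T g"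
  by (induction rule: evs.induct) (auto simp: algebra_simps)

lemma evs_uminus: "evs S T \<Longrightarrow> T (\<lambda>x. - f x) = - T f"
  by (induction rule: evs.induct) (auto simp: algebra_simps)

lemma evs_sub: "evs S T \<Longrightarrow> T (\<lambda>x. f x - g x) = T f - T g"
  by (induction rule: evs.induct) (auto simp: algebra_simps)

lemma evs_scale:
  fixes c :: "'w::comm_ring_1" shows "evs S T \<Longrightarrow> T (\<lambda>x. c * f x) = c * T f"
  by (induction rule: evs.induct) (auto simp: algebra_simps)

lemma evs_swap:
  assumes "evs S T" "evs S' U"
  shows "T (\<lambda>x. U (\<lambda>y. F x y)) = U (\<lambda>y. T (\<lambda>x. F x y))"
  using assms(1)
  by (induction rule: evs.induct) (auto simp: evs_0[OF assms(2)] evs_sub[OF assms(2)])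

lemma evs_supp:
  assumes "evs S T" "T f \<noteq> 0" obtains x where "x \<in> S" "f x \<noteq> 0"
  using evs_cong[OF assms(1), of f "\<lambda>x. 0"] evs_0[OF assms(1)] assms(2) by metis

text \<open>A finite combination of functions of \<open>y\<close> with finite support. It handles
  operators in the first argument of a cochain, where the support may be infinite.\<close>

lemma evs_finite:
  assumes "evs S T" "\<And>x. x \<in> S \<Longrightarrow> finite {y. F x y \<noteq> 0}"
  shows "finite {y. T (\<lambda>x. F x y) \<noteq> 0}"
  using assms
proof (induction rule: evs.induct)
  case (evs_diff T U)
  have "{y. T (\<lambda>x. F x y) - U (\<lambda>x. F x y) \<noteq> 0} \<subseteq>
     {y. T (\<lambda>x. F x y) \<noteq> 0} \<union> {y. U (\<lambda>x. F x y) \<noteq> 0}" by auto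
  with evs_diff show ?case by (meson finite_UnI finite_subset)
qed auto

text \<open>
  A cochain is a function of lists of monomials. The operator \<open>E\<close> is the action on the coefficients, here
  from both sides; \<open>bar\<close> contains the products of neighbours and the action of the last entry.
\<close>

fun bar :: "('a multiset \<Rightarrow> 'w \<Rightarrow> 'w) \<Rightarrow> ('a multiset list \<Rightarrow> 'w) \<Rightarrow> 'a multiset list \<Rightarrow> 'w::ab_group_add" where
  "bar E f [] = 0"
| "bar E f [a] = E a (f [])"
| "bar E f (a # c # l) = f ((a + c) # l) - bar E (\<lambda>l. f (a # l)) (c # l)"

fun lft :: "('a multiset \<Rightarrow> 'w \<Rightarrow> 'w) \<Rightarrow> ('a multiset list \<Rightarrow> 'w) \<Rightarrow> 'a multiset list \<Rightarrow> 'w::ab_group_add" where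
  "lft E f [] = 0"
| "lft E f (a # l) = E a (f l)"

text \<open>The Hochschild differential of the monoid of multisets, with the signs of
  \<open>GS_d1\<close>.\<close>

definition del where "del E f l = lft E f l - bar E f l"

text \<open>Trivial coefficients: a monomial acts by its counit.\<close>

definition aug :: "'a multiset \<Rightarrow> 'w::ab_group_add \<Rightarrow> 'w" where "aug a w = (if a = {#} then w else 0)"

lemma aug_simps[simp]: "aug {#} w = w" "aug (add_mset x a) w = 0" "aug a 0 = 0"
  by (auto simp: aug_def)

text \<open>The set of points records that the total monomial is preserved. With \<open>aug\<close>
  this includes the term that drops the last entry, since that entry must be empty to
  contribute.\<close>

lemma evs_bar: "evs {l'. sum_list l' = sum_list l \<and> Suc (length l') = length l} (\<lambda>f. bar aug f l)"
proof (induction l rule: induct_list012)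
  case 1 then show ?case by (auto intro: evs.intros)
next
  case (2 a) then show ?case
    by (cases "a = {#}") (auto simp: aug_def intro: evs.intros)
next
  case (3 a c l)
  show ?case unfolding bar.simps
    apply (rule evs_diff)
     apply (rule evs_at, simp add: ac_simps)
    apply (rule evs_comp[OF 3(2)], auto)
    done
qed

lemma evs_del: "evs {l'. sum_list l' = sum_list l \<and> Suc (length l') = length l} (\<lambda>f. del aug f l)"
proof -
  have "evs {l'. sum_list l' = sum_list l \<and> Suc (length l') = length l} (\<lambda>f. lft aug f l)"
    by (cases l; cases "hd l = {#}") (auto simp: aug_def intro: evs.intros)
  then show ?thesis unfolding del_def by (intro evs_diff evs_bar)
qed

lemma bar_cong: "(\<And>l'. Suc (length l') = length l \<Longrightarrow> f l' = g l') \<Longrightarrow> bar E f l = bar E g l"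
proof (induction l arbitrary: f g rule: induct_list012)
  case (3 a c l)
  have "bar E (\<lambda>l. f (a # l)) (c # l) = bar E (\<lambda>l. g (a # l)) (c # l)"
    by (rule 3(2)) (auto intro!: 3(3))
  then show ?case using 3(3)[of "(a+c)#l"] by simp
qed auto

lemma bar_aug_diff: "bar aug (\<lambda>l. f l - g l) l = bar aug f l - bar aug g l"
  by (rule evs_sub[OF evs_bar])

lemma bar_aug_0[simp]: "bar aug (\<lambda>l. 0) l = 0"
  by (rule evs_0[OF evs_bar])

lemma bar_aug_aug: "bar aug (\<lambda>l. aug a (f l)) l = aug a (bar aug f l)"
  by (auto simp: aug_def)

text \<open>Merging \<open>a\<close> into the first entry, with a dummy value at the empty list. The
  recursion of \<open>bar\<close> thereby becomes a difference of two functions of the tail, see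
  \<open>bar_Cons_ne\<close>.\<close>

fun pre :: "'a multiset \<Rightarrow> ('a multiset list \<Rightarrow> 'w) \<Rightarrow> 'a multiset list \<Rightarrow> 'w::zero" where
  "pre a f [] = 0"
| "pre a f (c # l) = f ((a + c) # l)"

lemma bar_Cons_ne: "l \<noteq> [] \<Longrightarrow> bar E f (a # l) = pre a f l - bar E (\<lambda>l. f (a # l)) l"
  by (cases l) auto

text \<open>After expanding the inner \<open>bar\<close> by \<open>bar_Cons_ne\<close>, the terms
  that merge three entries at the front agree by associativity, and the rest is the identity for a
  shorter list.\<close>

lemma bar_bar: "bar aug (bar aug f) l = 0"
proof (induction l arbitrary: f rule: induct_list012)
  case (3 a c l)
  show ?case
  proof (cases l)
    case Nil
    then show ?thesis by (auto simp: aug_def)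
  next
    case (Cons e m)
    have "bar aug (\<lambda>l. bar aug f (a # l)) (c # l) =
       bar aug (\<lambda>l. pre a f l - bar aug (\<lambda>l. f (a # l)) l) (c # l)"
      by (rule bar_cong) (auto simp: Cons intro!: bar_Cons_ne)
    also have "\<dots> = bar aug (pre a f) (c # l) - bar aug (bar aug (\<lambda>l. f (a # l))) (c # l)"
      by (rule bar_aug_diff)
    also have "bar aug (bar aug (\<lambda>l. f (a # l))) (c # l) = 0" by (rule 3(2))
    finally show ?thesis by (simp add: Cons add.assoc)
  qed
qed auto

lemma del_del: "del aug (del aug f) l = 0"
proof (cases l)
  case (Cons a m)
  show ?thesis
  proof (cases m)
    case Nil then show ?thesis by (simp add: Cons del_def)
  next
    case (Cons c k)
    have 1: "bar aug (lft aug f) (a # c # k) = aug (a + c) (f k) - aug a (bar aug f (c # k))"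
      using bar_aug_aug[of a f "c # k"] by simp
    have "bar aug (del aug f) (a # c # k) = bar aug (lft aug f) (a # c # k) - 0"
      unfolding del_def bar_aug_diff bar_bar ..
    then show ?thesis unfolding \<open>l = a # m\<close> Cons del_def[of aug "del aug f"] 1
      by (auto simp: del_def aug_def)
  qed
qed (simp add: del_def)

text \<open>
  Bar chains that contain the letter \<open>x\<close> contract, by splitting off the first occurrence of \<open>x\<close> as an entry
  of its own, onto the shuffles of \<open>x\<close> with chains without \<open>x\<close>; \<open>cut\<close> is a one-sided inverse of the
  shuffle, see \<open>del_split_off\<close> and \<open>shuf_cut\<close>.
\<close>

fun rmv :: "'a \<Rightarrow> 'a multiset list \<Rightarrow> 'a multiset list" where
  "rmv x [] = []"
| "rmv x (a # l) = (if x \<in># a then (a - {#x#}) # l else a # rmv x l)"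

text \<open>The entry \<open>{#x#}\<close> is inserted, with alternating signs, at every place up to
  the entry with the first occurrence of \<open>x\<close>, and this occurrence is removed.\<close>

fun split_off :: "'a \<Rightarrow> ('a multiset list \<Rightarrow> 'w::ab_group_add) \<Rightarrow> 'a multiset list \<Rightarrow> 'w" where
  "split_off x f [] = 0"
| "split_off x f (a # l) = f ({#x#} # rmv x (a # l)) - (if x \<in># a then 0 else split_off x (\<lambda>l. f (a # l)) l)"

fun shuf :: "'a \<Rightarrow> ('a multiset list \<Rightarrow> 'w::ab_group_add) \<Rightarrow> 'a multiset list \<Rightarrow> 'w" where
  "shuf x f [] = f [{#x#}]"
| "shuf x f (a # l) = f ({#x#} # a # l) - shuf x (\<lambda>l. f (a # l)) l"

text \<open>Explicitly: \<open>g (butlast l)\<close> with the sign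
  \<open>(-1) ^ (length l - 1)\<close> if the last entry is \<open>{#x#}\<close> and no other entry
  contains \<open>x\<close>, and zero otherwise.\<close>

fun cut :: "'a \<Rightarrow> ('a multiset list \<Rightarrow> 'w::ab_group_add) \<Rightarrow> 'a multiset list \<Rightarrow> 'w" where
  "cut x g [] = 0"
| "cut x g [a] = (if a = {#x#} then g [] else 0)"
| "cut x g (a # c # l) = (if x \<in># a then 0 else - cut x (\<lambda>l. g (a # l)) (c # l))"

lemma sum_rmv: "x \<in># sum_list l \<Longrightarrow> sum_list (rmv x l) = sum_list l - {#x#}"
proof (induction l)
  case (Cons a l)
  show ?case
  proof (cases "x \<in># a")
    case False
    with Cons.prems have x: "x \<in># sum_list l" by simp
    then have "a + sum_list l - {#x#} = a + (sum_list l - {#x#})"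
      by (intro multiset_diff_union_assoc) (simp only: mset_subset_eq_single)
    then show ?thesis using Cons.IH[OF x] False by simp
  qed (simp add: multiset_diff_union_assoc)
qed simp

lemma length_rmv[simp]: "length (rmv x l) = length l"
  by (induction l) auto

lemma evs_split_off:
  "x \<in># sum_list l \<Longrightarrow> evs {l'. sum_list l' = sum_list l \<and> length l' = Suc (length l)} (\<lambda>f::_ \<Rightarrow> 'w::ab_group_add. split_off x f l)"
proof (induction l)
  case (Cons a l)
  show ?case
  proof (cases "x \<in># a")
    case True
    then show ?thesis by (auto intro!: evs_at)
  next
    case False
    with Cons.prems have x: "x \<in># sum_list l" by simp
    have "evs {l'. sum_list l' = sum_list (a # l) \<and> length l' = Suc (length (a # l))} (\<lambda>f::_ \<Rightarrow> 'w. split_off x (\<lambda>l. f (a # l)) l)"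
      by (rule evs_comp[OF Cons.IH[OF x], where g = "\<lambda>l. a # l"]) auto
    with False show ?thesis
      by (auto intro!: evs_diff evs_at simp: sum_rmv[OF x] x multiset_diff_union_assoc)
        (metis add_mset_add_single insert_DiffM union_mset_add_mset_right x)
  qed
qed auto

lemma evs_shuf: "evs {l'. sum_list l' = add_mset x (sum_list l) \<and> length l' = Suc (length l)} (\<lambda>f. shuf x f l)"
proof (induction l)
  case (Cons a l)
  show ?case unfolding shuf.simps
    apply (rule evs_diff)
     apply (rule evs_at, simp)
    apply (rule evs_comp[OF Cons.IH], auto)
    done
qed (auto intro: evs_at)

lemma evs_cut: "evs {l'. add_mset x (sum_list l') = sum_list l \<and> Suc (length l') = length l \<and> x \<notin># sum_list l'} (\<lambda>f::_ \<Rightarrow> 'w::ab_group_add. cut x f l)"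
proof (induction l rule: induct_list012)
  case (3 a c l)
  show ?case
  proof (cases "x \<in># a")
    case True then show ?thesis by (auto intro: evs.intros)
  next
    case False
    have "evs {l'. add_mset x (sum_list l') = sum_list (a # c # l) \<and> Suc (length l') = length (a # c # l) \<and> x \<notin># sum_list l'}
       (\<lambda>f::_ \<Rightarrow> 'w. cut x (\<lambda>l. f (a # l)) (c # l))"
      by (rule evs_comp[OF 3(2), where g = "\<lambda>l. a # l"]) (use False in auto)
    with False show ?thesis by (auto intro: evs_minus)
  qed
next
  case (2 a)
  show ?case by (cases "a = {#x#}") (auto intro: evs.intros)
qed (auto intro: evs.intros)

lemma shuf_cong: "(\<And>l'. length l' = Suc (length l) \<Longrightarrow> f l' = g l') \<Longrightarrow> shuf x f l = shuf x g l"
  by (rule evs_cong[OF evs_shuf]) auto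

lemma shuf_aug: "shuf x (\<lambda>l. aug a (f l)) l = aug a (shuf x f l)"
  by (auto simp: aug_def evs_0[OF evs_shuf])

text \<open>Merging \<open>{#x#}\<close> with its right neighbour and merging it with the same entry
  from the other side give equal lists, as the monoid is commutative, with opposite signs. In last
  position \<open>{#x#}\<close> is killed by \<open>aug\<close>. The other terms merge old
  neighbours and cancel between the two sides.\<close>

lemma bar_shuf: "bar aug (shuf x f) l + shuf x (bar aug f) l = 0"
proof (induction l arbitrary: f rule: induct_list012)
  case (3 a c l)
  have "shuf x (\<lambda>l. bar aug f (a # l)) (c # l) = shuf x (\<lambda>l. pre a f l - bar aug (\<lambda>l. f (a # l)) l) (c # l)"
    by (rule shuf_cong) (auto intro!: bar_Cons_ne)
  also have "\<dots> = shuf x (pre a f) (c # l) - shuf x (bar aug (\<lambda>l. f (a # l))) (c # l)"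
    by (rule evs_sub[OF evs_shuf])
  finally have 1: "shuf x (\<lambda>l. bar aug f (a # l)) (c # l) = shuf x (pre a f) (c # l) - shuf x (bar aug (\<lambda>l. f (a # l))) (c # l)" .
  have 2: "bar aug (\<lambda>l. shuf x f (a # l)) (c # l) =
      bar aug (\<lambda>l. f ({#x#} # a # l)) (c # l) - bar aug (shuf x (\<lambda>l. f (a # l))) (c # l)"
    by (simp add: bar_aug_diff)
  have 4: "shuf x (pre a f) (c # l) = f ((a + {#x#}) # c # l) - shuf x (\<lambda>l. f ((a + c) # l)) l"
    by simp
  have IH: "bar aug (shuf x (\<lambda>l. f (a # l))) (c # l) = - shuf x (bar aug (\<lambda>l. f (a # l))) (c # l)"
    by (rule eq_neg_iff_add_eq_0[THEN iffD2, OF 3(2)])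
  show ?case
  proof -
    have L: "bar aug (shuf x f) (a # c # l) = shuf x f ((a + c) # l) - bar aug (\<lambda>l. shuf x f (a # l)) (c # l)"
      and R: "shuf x (bar aug f) (a # c # l) = bar aug f ({#x#} # a # c # l) - shuf x (\<lambda>l. bar aug f (a # l)) (c # l)"
      and R2: "bar aug f ({#x#} # a # c # l) = f ((a + {#x#}) # c # l) -
         (f ({#x#} # (a + c) # l) - bar aug (\<lambda>l. f ({#x#} # a # l)) (c # l))"
      and L2: "shuf x f ((a + c) # l) = f ({#x#} # (a + c) # l) - shuf x (\<lambda>l. f ((a + c) # l)) l"
      by (simp_all only: bar.simps shuf.simps add.commute[of "{#x#}"])
    show ?thesis unfolding L R 1 2 IH 4 R2 L2
      by (simp del: bar.simps shuf.simps add: algebra_simps)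
  qed
qed (auto simp: aug_def)

lemma lft_shuf: "lft aug (shuf x f) l + shuf x (lft aug f) l = 0"
  by (cases l) (auto simp: shuf_aug)

lemma del_shuf: "del aug (shuf x f) l = - shuf x (del aug f) l"
proof -
  have "shuf x (del aug f) l = shuf x (lft aug f) l - shuf x (bar aug f) l"
    unfolding del_def by (rule evs_sub[OF evs_shuf])
  then show ?thesis using bar_shuf[of x f l] lft_shuf[of x f l]
    by (simp add: del_def add_eq_0_iff)
qed

lemma cut_cong: "(\<And>l'. Suc (length l') = length l \<Longrightarrow> f l' = g l') \<Longrightarrow> cut x f l = cut x g l"
  by (rule evs_cong[OF evs_cut]) auto

text \<open>Merging creates a last entry \<open>{#x#}\<close> only out of \<open>{#x#}\<close> and
  an empty entry. These terms cancel against those in which \<open>aug\<close> drops an empty last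
  entry.\<close>

lemma bar_cut: "bar aug (cut x g) l + cut x (bar aug g) l = 0"
proof (induction l arbitrary: g rule: induct_list012)
  case (3 a c l)
  show ?case
  proof (cases l)
    case Nil
    then show ?thesis by (auto simp: aug_def union_is_single)
  next
    case (Cons e m)
    have 0: "bar aug (\<lambda>l. cut x g (a # l)) (c # l) =
        bar aug (\<lambda>l. if x \<in># a then 0 else - cut x (\<lambda>l. g (a # l)) l) (c # l)"
    proof (rule bar_cong)
      fix l' :: "'b multiset list" assume "Suc (length l') = length (c # l)"
      then obtain c' m' where "l' = c' # m'" by (cases l') (auto simp: Cons)
      then show "cut x g (a # l') = (if x \<in># a then 0 else - cut x (\<lambda>l. g (a # l)) l')" by simp
    qed
    show ?thesis
    proof (cases "x \<in># a")
      case True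
      with 0 show ?thesis by (simp add: Cons)
    next
      case False
      have 1: "cut x (\<lambda>l. bar aug g (a # l)) (c # l) = cut x (pre a g) (c # l) - cut x (bar aug (\<lambda>l. g (a # l))) (c # l)"
      proof -
        have "cut x (\<lambda>l. bar aug g (a # l)) (c # l) = cut x (\<lambda>l. pre a g l - bar aug (\<lambda>l. g (a # l)) l) (c # l)"
          by (rule cut_cong) (auto simp: Cons intro!: bar_Cons_ne)
        then show ?thesis by (simp only: evs_sub[OF evs_cut])
      qed
      have 2: "cut x (pre a g) (c # l) = (if x \<in># c then 0 else - cut x (\<lambda>l. g ((a + c) # l)) l)"
        unfolding Cons by simp
      have 4: "cut x g ((a + c) # l) = (if x \<in># c then 0 else - cut x (\<lambda>l. g ((a + c) # l)) l)"
        unfolding Cons using False by simp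
      have IH: "bar aug (cut x (\<lambda>l. g (a # l))) (c # l) = - cut x (bar aug (\<lambda>l. g (a # l))) (c # l)"
        by (rule eq_neg_iff_add_eq_0[THEN iffD2, OF 3(2)])
      have L: "bar aug (cut x g) (a # c # l) = cut x g ((a + c) # l) - bar aug (\<lambda>l. cut x g (a # l)) (c # l)"
        by (simp only: bar.simps)
      have R: "cut x (bar aug g) (a # c # l) = - cut x (\<lambda>l. bar aug g (a # l)) (c # l)"
        using False by (simp only: cut.simps if_False)
      have 0: "bar aug (\<lambda>l. cut x g (a # l)) (c # l) = - bar aug (cut x (\<lambda>l. g (a # l))) (c # l)"
        unfolding 0 using False by (simp only: if_False evs_uminus[OF evs_bar])
      show ?thesis unfolding L R 0 1 2 4 IH by (simp del: bar.simps cut.simps add: algebra_simps)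
    qed
  qed
qed (auto simp: aug_def)

lemma lft_cut: "lft aug (cut x g) l + cut x (lft aug g) l = 0"
proof (cases l)
  case (Cons a m)
  then show ?thesis by (cases m) (auto simp: aug_def evs_0[OF evs_cut])
qed auto

lemma del_cut: "del aug (cut x g) l = - cut x (del aug g) l"
proof -
  have "cut x (del aug g) l = cut x (lft aug g) l - cut x (bar aug g) l"
    unfolding del_def by (rule evs_sub[OF evs_cut])
  then show ?thesis using bar_cut[of x g l] lft_cut[of x g l]
    by (simp add: del_def add_eq_0_iff)
qed

lemma split_off_cong: "x \<in># sum_list l \<Longrightarrow> (\<And>l'. length l' = Suc (length l) \<Longrightarrow> f l' = g l') \<Longrightarrow> split_off x f l = split_off x g l"
  by (rule evs_cong[OF evs_split_off]) auto

lemma rmv_eq_Nil_iff[simp]: "rmv x l = [] \<longleftrightarrow> l = []"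
  by (cases l) auto

lemma add_diff_single: "x \<in># c \<Longrightarrow> a + c - {#x#} = a + (c - {#x#})"
  by (auto dest: multi_member_split)

text \<open>Removing \<open>x\<close> commutes with merging neighbours. The discrepancy is in the
  term of the last entry: if it is \<open>{#x#}\<close>, it becomes empty and \<open>aug\<close>
  changes from zero to the identity. This is the origin of \<open>cut\<close>.\<close>

lemma bar_rmv:
  "x \<in># sum_list l \<Longrightarrow> bar aug g (rmv x l) = bar aug (\<lambda>l. g (rmv x l)) l + cut x g l"
proof (induction l arbitrary: g rule: induct_list012)
  case (2 a)
  then show ?case by (auto simp: aug_def) (metis add_mset_remove_trivial_eq in_diffD insert_DiffM)
next
  case (3 a c l)
  show ?case
  proof (cases "x \<in># a")
    case True
    have "bar aug (\<lambda>l. g (rmv x (a # l))) (c # l) = bar aug (\<lambda>l. g ((a - {#x#}) # l)) (c # l)"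
      using True by simp
    moreover have "a - {#x#} + c = a + c - {#x#}" using True by (auto dest: multi_member_split)
    ultimately show ?thesis using True by simp
  next
    case False
    with 3(3) have x: "x \<in># sum_list (c # l)" by simp
    note IH = 3(2)[OF x, of "\<lambda>l. g (a # l)"]
    have *: "g ((a + hd (rmv x (c # l))) # tl (rmv x (c # l))) = g (rmv x ((a + c) # l))"
    proof (cases "x \<in># c")
      case True
      have "rmv x ((a + c) # l) = (a + (c - {#x#})) # l" using True add_diff_single[OF True, of a] by (simp only: rmv.simps) simp
      with True show ?thesis by simp
    next
      case False
      with \<open>x \<notin># a\<close> show ?thesis by simp
    qed
    obtain c' l' where c': "rmv x (c # l) = c' # l'" by (metis list.distinct(1) neq_Nil_conv rmv_eq_Nil_iff)
    have **: "bar aug g (a # rmv x (c # l)) = g (rmv x ((a + c) # l)) - bar aug (\<lambda>l. g (a # l)) (rmv x (c # l))"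
      using * by (simp only: c' bar.simps list.sel)
    have 5: "bar aug g (rmv x (a # c # l)) = bar aug g (a # rmv x (c # l))" using False by simp
    show ?thesis unfolding 5 ** IH using False by (simp del: rmv.simps add: rmv.simps(2)[of x a])
  qed
qed simp

text \<open>If \<open>{#x#}\<close> is inserted in front of \<open>l\<close>, then \<open>a\<close>
  merges with it. For the other places \<open>a\<close> merges with the first entry, as in
  \<open>split_off\<close> of the merged list, whose own front place has to be subtracted.\<close>

lemma split_off_pre: "x \<notin># a \<Longrightarrow> x \<in># sum_list l \<Longrightarrow>
   split_off x (pre a f) l = f ((a + {#x#}) # rmv x l) + pre a (split_off x f) l - pre a (\<lambda>l. f ({#x#} # l)) (rmv x l)"
proof (cases l)
  case (Cons c m)
  assume xa: "x \<notin># a" and x: "x \<in># sum_list l"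
  show ?thesis
  proof (cases "x \<in># c")
    case True
    have r: "rmv x ((a + c) # m) = (a + (c - {#x#})) # m" using True add_diff_single[OF True, of a] by (simp only: rmv.simps) simp
    have "x \<in># a + c" using True by simp
    then have "split_off x f ((a + c) # m) = f ({#x#} # (a + (c - {#x#})) # m)"
      by (simp only: split_off.simps r if_True) simp
    then show ?thesis using True by (simp add: Cons)
  next
    case False
    with xa show ?thesis by (simp add: Cons)
  qed
qed simp

text \<open>Merging \<open>{#x#}\<close> back into the entry from which it was split restores
  \<open>l\<close>. The other terms cancel, except for the \<open>cut\<close> terms that
  \<open>bar_rmv\<close> contributes.\<close>

lemma bar_split_off:
  "x \<in># sum_list l \<Longrightarrow> split_off x (bar aug f) l + bar aug (split_off x f) l = f l - cut x (shuf x f) l"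
proof (induction l arbitrary: f rule: induct_list012)
  case (2 a)
  then have "x \<in># a" by simp
  then obtain a' where a: "a = add_mset x a'" by (metis insert_DiffM)
  then show ?case by (auto simp: aug_def)
next
  case (3 a c l)
  show ?case
  proof (cases "x \<in># a")
    case True
    then obtain a' where a: "a = add_mset x a'" by (metis insert_DiffM)
    show ?thesis unfolding a by simp
  next
    case False
    with 3(3) have x: "x \<in># sum_list (c # l)" by simp
    let ?l = "c # l" and ?r = "rmv x (c # l)"
    let ?fa = "\<lambda>l. f (a # l)" and ?fxa = "\<lambda>l. f ({#x#} # a # l)"
    have r: "?r \<noteq> []" by simp
    have 0: "rmv x (a # ?l) = a # ?r" using False by simp
    have A: "split_off x (bar aug f) (a # ?l) = bar aug f ({#x#} # a # ?r) - split_off x (\<lambda>l. bar aug f (a # l)) ?l"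
      using False by (simp only: split_off.simps 0 if_False)
    have B: "split_off x (\<lambda>l. bar aug f (a # l)) ?l = split_off x (pre a f) ?l - split_off x (bar aug ?fa) ?l"
    proof -
      have "split_off x (\<lambda>l. bar aug f (a # l)) ?l = split_off x (\<lambda>l. pre a f l - bar aug ?fa l) ?l"
        by (rule split_off_cong[OF x]) (auto intro!: bar_Cons_ne)
      then show ?thesis by (simp only: evs_sub[OF evs_split_off[OF x]])
    qed
    have C: "bar aug f ({#x#} # a # ?r) = f ((a + {#x#}) # ?r) - (pre a (\<lambda>l. f ({#x#} # l)) ?r - bar aug ?fxa ?r)"
      by (simp only: bar.simps bar_Cons_ne[OF r] add.commute[of a])
    have D: "bar aug (split_off x f) (a # ?l) = pre a (split_off x f) ?l - (bar aug (\<lambda>l. ?fxa (rmv x l)) ?l - bar aug (split_off x ?fa) ?l)"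
    proof -
      have "bar aug (split_off x f) (a # ?l) = pre a (split_off x f) ?l - bar aug (\<lambda>l. split_off x f (a # l)) ?l"
        by (rule bar_Cons_ne) simp
      moreover have "(\<lambda>l. split_off x f (a # l)) = (\<lambda>l. ?fxa (rmv x l) - split_off x ?fa l)"
        using False by auto
      ultimately show ?thesis by (simp only: bar_aug_diff)
    qed
    have E: "cut x (shuf x f) (a # ?l) = - (cut x ?fxa ?l - cut x (shuf x ?fa) ?l)"
      using False by (simp only: cut.simps if_False shuf.simps evs_sub[OF evs_cut])
    show ?thesis
      unfolding A B C D E split_off_pre[OF False x] bar_rmv[OF x]
      using 3(2)[OF x, of ?fa] by (simp del: split_off.simps cut.simps bar.simps shuf.simps pre.simps add: algebra_simps)
  qed
qed simp

lemma split_off_lft: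
  "x \<in># sum_list l \<Longrightarrow> split_off x (lft aug f) l + lft aug (split_off x f) l = 0"
proof (cases l)
  case (Cons a m)
  assume x: "x \<in># sum_list l"
  show ?thesis
  proof (cases "x \<in># a")
    case True
    then have "a \<noteq> {#}" by auto
    with True show ?thesis by (auto simp: Cons aug_def)
  next
    case False
    with x Cons have "x \<in># sum_list m" by simp
    then show ?thesis using False by (auto simp: Cons aug_def evs_0[OF evs_split_off])
  qed
qed simp

text \<open>The sign is opposite to that of \<open>bar_split_off\<close>, since \<open>bar\<close>
  enters \<open>del\<close> negatively and the left action anticommutes with the splitting.\<close>

lemma del_split_off:
  assumes "x \<in># sum_list l"
  shows "split_off x (del aug f) l + del aug (split_off x f) l = cut x (shuf x f) l - f l"
proof -
  have "split_off x (del aug f) l = split_off x (lft aug f) l - split_off x (bar aug f) l"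
    unfolding del_def by (rule evs_sub[OF evs_split_off[OF assms]])
  then have "split_off x (del aug f) l + del aug (split_off x f) l =
     (split_off x (lft aug f) l + lft aug (split_off x f) l) - (split_off x (bar aug f) l + bar aug (split_off x f) l)"
    by (simp add: del_def)
  then show ?thesis by (simp add: bar_split_off[OF assms] split_off_lft[OF assms])
qed

section \<open>The contraction onto antisymmetrized words\<close>

fun contraction :: "'a list \<Rightarrow> ('a multiset list \<Rightarrow> 'w::ab_group_add) \<Rightarrow> 'a multiset list \<Rightarrow> 'w" where
  "contraction [] f l = f ({#} # l)"
| "contraction (x # xs) f l = (if x \<in># sum_list l then - split_off x f l - cut x (contraction xs (shuf x f)) l else contraction xs f l)"

text \<open>Iterated shuffles with one-letter entries: the signed sum of the values of
  \<open>f\<close> over all orders of the letters of \<open>s\<close>.\<close>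

fun alt :: "('a multiset list \<Rightarrow> 'w::ab_group_add) \<Rightarrow> 'a list \<Rightarrow> 'w" where
  "alt f [] = f []"
| "alt f (x # s) = alt (shuf x f) s"

text \<open>A section of \<open>alt\<close> without any division: instead of spreading
  \<open>g s\<close> over all orders of the letters, it puts the value, up to sign, on a single one,
  see \<open>rho_nonzero\<close>.\<close>

fun rho :: "'a list \<Rightarrow> ('a list \<Rightarrow> 'w::ab_group_add) \<Rightarrow> 'a multiset list \<Rightarrow> 'w" where
  "rho [] g l = (if l = [] then g [] else 0)"
| "rho (x # xs) g l = (if x \<in># sum_list l then cut x (rho xs (\<lambda>s. g (x # s))) l else rho xs g l)"

lemma evs_alt: "evs {l. sum_list l = mset s \<and> length l = length s} (\<lambda>f::_ \<Rightarrow> 'w::ab_group_add. alt f s)"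
proof (induction s)
  case (Cons x s)
  show ?case unfolding alt.simps
    by (rule evs_bind[OF Cons.IH]) (auto intro!: evs_mono[OF evs_shuf])
qed (auto intro: evs_at)

lemma evs_contraction: "evs {l'. sum_list l' = sum_list l \<and> length l' = Suc (length l)} (\<lambda>f::_ \<Rightarrow> 'w::ab_group_add. contraction xs f l)"
proof (induction xs arbitrary: l)
  case (Cons x xs)
  show ?case
  proof (cases "x \<in># sum_list l")
    case True
    have "evs {l'. sum_list l' = sum_list l \<and> length l' = Suc (length l)}
       (\<lambda>f::_ \<Rightarrow> 'w. cut x (\<lambda>k. contraction xs (\<lambda>k'. shuf x f k') k) l)"
    proof (rule evs_bind[OF evs_cut], rule evs_bind[OF Cons.IH])
      fix k k' :: "'a multiset list"
      assume "k \<in> {l'. add_mset x (sum_list l') = sum_list l \<and> Suc (length l') = length l \<and> x \<notin># sum_list l'}"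
        "k' \<in> {l'. sum_list l' = sum_list k \<and> length l' = Suc (length k)}"
      then show "evs {l'. sum_list l' = sum_list l \<and> length l' = Suc (length l)} (\<lambda>f::_ \<Rightarrow> 'w. shuf x f k')"
        by (intro evs_mono[OF evs_shuf]) auto
    qed
    with True show ?thesis by (auto intro!: evs_diff evs_minus evs_split_off simp del: set_mset_sum_list)
  next
    case False
    with Cons.IH show ?thesis by simp
  qed
qed (auto intro!: evs_at)

lemma evs_del_any: "evs UNIV (\<lambda>f. del aug f l)" by (rule evs_mono[OF evs_del]) simp

lemma del_cong: "(\<And>l'. sum_list l' = sum_list l \<Longrightarrow> Suc (length l') = length l \<Longrightarrow> f l' = g l') \<Longrightarrow> del aug f l = del aug g l"
  by (rule evs_cong[OF evs_del]) auto

text \<open>Two homotopies are composed for each letter \<open>x\<close>: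
  \<open>- split_off x\<close> leads from the identity to \<open>cut x\<close> after
  \<open>shuf x\<close>, and between the two the contraction for the remaining letters is applied,
  where \<open>x\<close> no longer occurs. It needs a minus sign because \<open>del\<close>
  anticommutes with \<open>cut\<close> and \<open>shuf\<close>. If no letters are left, all entries
  are empty, and prepending an empty entry contracts the bar complex of the trivial monoid.\<close>

lemma contraction_homotopy:
  assumes "set_mset (sum_list l) \<subseteq> set xs"
  shows "contraction xs (del aug f) l + del aug (contraction xs f) l = f l - rho xs (alt f) l"
  using assms
proof (induction xs arbitrary: f l)
  case Nil
  then have l: "sum_list l = {#}" by (metis list.set(1) set_mset_eq_empty_iff subset_empty)
  show ?case
  proof (cases l)
    case Nil
    then show ?thesis by (simp add: del_def)
  next
    case (Cons a m)
    with l have "a = {#}" by simp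
    then show ?thesis by (simp add: Cons del_def)
  qed
next
  case (Cons x xs)
  show ?case
  proof (cases "x \<in># sum_list l")
    case False
    have "del aug (contraction (x # xs) f) l = del aug (contraction xs f) l"
      by (rule del_cong) (use False in auto)
    moreover have "rho (x # xs) (alt f) l = rho xs (alt f) l" using False by simp
    moreover have "set_mset (sum_list l) \<subseteq> set xs" using Cons.prems False by auto
    moreover have "contraction (x # xs) (del aug f) l = contraction xs (del aug f) l" using False by simp
    ultimately show ?thesis using Cons.IH[of l f] by (simp only:)
  next
    case True
    have "del aug (contraction (x # xs) f) l = del aug (\<lambda>l. - split_off x f l - cut x (contraction xs (shuf x f)) l) l"
      by (rule del_cong) (use True in auto)
    also have "\<dots> = - del aug (split_off x f) l + cut x (del aug (contraction xs (shuf x f))) l"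
      by (simp only: evs_sub[OF evs_del] evs_uminus[OF evs_del] del_cut) simp
    finally have 1: "del aug (contraction (x # xs) f) l = - del aug (split_off x f) l + cut x (del aug (contraction xs (shuf x f))) l" .
    have 2: "cut x (contraction xs (shuf x (del aug f))) l = - cut x (contraction xs (del aug (shuf x f))) l"
    proof -
      have *: "shuf x (del aug f) = (\<lambda>l. - del aug (shuf x f) l)" by (simp add: fun_eq_iff del_shuf)
      have **: "contraction xs (\<lambda>l. - del aug (shuf x f) l) = (\<lambda>k. - contraction xs (del aug (shuf x f)) k)"
        by (rule ext) (rule evs_uminus[OF evs_contraction])
      show ?thesis unfolding * ** by (rule evs_uminus[OF evs_cut])
    qed
    \<comment> \<open>The induction hypothesis applies because \<open>cut x\<close> evaluates only
      at lists that do not contain \<open>x\<close>.\<close>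
    have 3: "cut x (contraction xs (del aug (shuf x f))) l + cut x (del aug (contraction xs (shuf x f))) l =
       cut x (shuf x f) l - cut x (rho xs (alt (shuf x f))) l"
    proof -
      have "cut x (\<lambda>l. contraction xs (del aug (shuf x f)) l + del aug (contraction xs (shuf x f)) l) l =
         cut x (\<lambda>l. shuf x f l - rho xs (alt (shuf x f)) l) l"
      proof (rule evs_cong[OF evs_cut], rule Cons.IH)
        fix k assume k: "k \<in> {l'. add_mset x (sum_list l') = sum_list l \<and> Suc (length l') = length l \<and> x \<notin># sum_list l'}"
        from k have e: "add_mset x (sum_list k) = sum_list l" and n: "x \<notin># sum_list k" by blast+
        have "insert x (set_mset (sum_list k)) \<subseteq> insert x (set xs)"
          using Cons.prems unfolding e[symmetric] set_mset_add_mset_insert list.set .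
        with n show "set_mset (sum_list k) \<subseteq> set xs" by blast
      qed
      then show ?thesis by (simp only: evs_sub[OF evs_cut] evs_plus[OF evs_cut])
    qed
    have 4: "contraction (x # xs) (del aug f) l = - split_off x (del aug f) l - cut x (contraction xs (shuf x (del aug f))) l"
      using True by simp
    have 5: "rho (x # xs) (alt f) l = cut x (rho xs (alt (shuf x f))) l"
      using True by simp
    show ?thesis unfolding 1 4 5 2 using 3 del_split_off[OF True, of f]
      by (simp add: algebra_simps)
  qed
qed

text \<open>Every shuffle anticommutes with \<open>del\<close>, and \<open>del\<close> vanishes at
  the empty list.\<close>

lemma alt_del: "alt (del aug f) s = 0"
proof (induction s arbitrary: f)
  case (Cons x s)
  have *: "shuf x (del aug f) = (\<lambda>l. - del aug (shuf x f) l)" by (simp add: fun_eq_iff del_shuf)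
  show ?case unfolding alt.simps * evs_uminus[OF evs_alt] by (simp add: Cons)
qed (simp add: del_def)

lemma del_rho: "del aug (rho xs g) l = 0"
proof (induction xs arbitrary: g l)
  case Nil
  have *: "rho [] g = (\<lambda>l. if l = [] then g [] else 0)" by auto
  show ?case unfolding * by (cases l rule: remdups_adj.cases) (auto simp: del_def)
next
  case (Cons x xs)
  show ?case
  proof (cases "x \<in># sum_list l")
    case False
    have "del aug (rho (x # xs) g) l = del aug (rho xs g) l"
      by (rule del_cong) (use False in auto)
    then show ?thesis by (simp only: Cons.IH)
  next
    case True
    have "del aug (rho (x # xs) g) l = del aug (cut x (rho xs (\<lambda>s. g (x # s)))) l"
      by (rule del_cong) (use True in auto)
    also have "\<dots> = - cut x (\<lambda>l. 0) l" unfolding del_cut using Cons.IH[of "\<lambda>s. g (x # s)"] by presburger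
    finally show ?thesis by (simp only: evs_0[OF evs_cut] minus_zero)
  qed
qed

text \<open>Of all places at which \<open>{#x#}\<close> can be inserted, \<open>cut\<close> accepts
  only the last one, and the sign of the shuffle there is the sign contained in
  \<open>cut\<close>.\<close>

lemma shuf_cut: "x \<notin># sum_list l \<Longrightarrow> shuf x (cut x g) l = g l"
proof (induction l arbitrary: g)
  case (Cons a l)
  have "(\<lambda>l. cut x g (a # l)) = (\<lambda>l. if l = [] then cut x g [a] else - cut x (\<lambda>l. g (a # l)) l)"
    using Cons.prems by (auto simp: fun_eq_iff neq_Nil_conv)
  then have "shuf x (\<lambda>l. cut x g (a # l)) l = shuf x (\<lambda>l. if l = [] then cut x g [a] else - cut x (\<lambda>l. g (a # l)) l) l"
    by simp
  \<comment> \<open>A shuffle evaluates only at nonempty lists, so the exceptional value at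
    \<open>[]\<close> drops out.\<close>
  also have "\<dots> = shuf x (\<lambda>l. - cut x (\<lambda>l. g (a # l)) l) l" by (rule shuf_cong) auto
  also have "\<dots> = - shuf x (cut x (\<lambda>l. g (a # l))) l" by (rule evs_uminus[OF evs_shuf])
  finally show ?case using Cons by simp
qed simp

lemma alt_rho:
  assumes "s \<in> set (subseqs xs)" "distinct xs"
  shows "alt (rho xs g) s = g s"
  using assms
proof (induction xs arbitrary: g s)
  case (Cons x xs)
  from Cons.prems consider "s \<in> set (subseqs xs)" | s' where "s = x # s'" "s' \<in> set (subseqs xs)"
    by (auto simp: Let_def)
  then show ?case
  proof cases
    case 1
    then have "set s \<subseteq> set xs" using subseqs_powset[of xs] by auto
    with Cons.prems have x: "x \<notin> set s" by auto
    have "alt (rho (x # xs) g) s = alt (rho xs g) s"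
      by (rule evs_cong[OF evs_alt]) (use x in auto)
    also have "\<dots> = g s" using Cons.IH[OF 1] Cons.prems by simp
    finally show ?thesis .
  next
    case 2
    then have "set s' \<subseteq> set xs" using subseqs_powset[of xs] by auto
    with Cons.prems have x: "x \<notin> set s'" by auto
    have "alt (shuf x (rho (x # xs) g)) s' = alt (rho xs (\<lambda>s. g (x # s))) s'"
    proof (rule evs_cong[OF evs_alt])
      fix l assume "l \<in> {l. sum_list l = mset s' \<and> length l = length s'}"
      with x have l: "x \<notin># sum_list l" by simp
      have "shuf x (rho (x # xs) g) l = shuf x (cut x (rho xs (\<lambda>s. g (x # s)))) l"
        by (rule evs_cong[OF evs_shuf]) simp
      then show "shuf x (rho (x # xs) g) l = rho xs (\<lambda>s. g (x # s)) l"
        using shuf_cut[OF l] by simp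
    qed
    also have "\<dots> = g (x # s')" using Cons.IH[OF 2(2)] Cons.prems by simp
    finally show ?thesis unfolding 2(1) alt.simps .
  qed
qed simp

lemma cut_nonzero: "cut x G l \<noteq> 0 \<Longrightarrow> \<exists>k. l = k @ [{#x#}] \<and> G k \<noteq> 0"
proof (induction x G l rule: cut.induct)
  case (3 x g a c l)
  then show ?case by (auto split: if_splits)
qed (auto split: if_splits)

text \<open>Each \<open>cut\<close> takes off the last entry, so the letters appear in reverse
  order. The support is used twice later: it makes the representatives of classes finite, and it
  ties \<open>length l\<close> to \<open>length s\<close> when signs are compared.\<close>

lemma rho_nonzero:
  "rho xs g l \<noteq> 0 \<Longrightarrow> \<exists>s\<in>set (subseqs xs). l = rev (map (\<lambda>x. {#x#}) s) \<and> g s \<noteq> 0"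
proof (induction xs arbitrary: g l)
  case Nil
  then show ?case by (auto split: if_splits)
next
  case (Cons x xs)
  show ?case
  proof (cases "x \<in># sum_list l")
    case False
    with Cons.prems have "rho xs g l \<noteq> 0" by simp
    from Cons.IH[OF this] show ?thesis by (auto simp: Let_def)
  next
    case True
    from True Cons.prems have "cut x (rho xs (\<lambda>s. g (x # s))) l \<noteq> 0" by simp
    from cut_nonzero[OF this] obtain k where k: "l = k @ [{#x#}]" "rho xs (\<lambda>s. g (x # s)) k \<noteq> 0" by blast
    from Cons.IH[OF k(2)] obtain s where "s \<in> set (subseqs xs)" "k = rev (map (\<lambda>x. {#x#}) s)" "g (x # s) \<noteq> 0" by blast
    with k show ?thesis by (intro bexI[of _ "x # s"]) (auto simp: Let_def)
  qed
qed

lemma evs_rho: "evs (set (subseqs xs)) (\<lambda>g::_ \<Rightarrow> 'w::ab_group_add. rho xs g l)"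
proof (induction xs arbitrary: l)
  case (Cons x xs)
  have "evs (set (subseqs (x # xs))) (\<lambda>g::_ \<Rightarrow> 'w. cut x (\<lambda>k. rho xs (\<lambda>s. g (x # s)) k) l)"
    by (rule evs_bind[OF evs_cut], rule evs_comp[OF Cons.IH]) (auto simp: Let_def)
  moreover have "evs (set (subseqs (x # xs))) (\<lambda>g::_ \<Rightarrow> 'w. rho xs g l)"
    by (rule evs_mono[OF Cons.IH]) (auto simp: Let_def)
  ultimately show ?case by (cases "x \<in># sum_list l") (simp_all only: rho.simps if_True if_False)
next
  case Nil
  show ?case by (cases "l = []") (auto intro: evs.intros)
qed

section \<open>The double complex of two bar complexes\<close>

definition sgn1 :: "nat \<Rightarrow> 'w::comm_ring_1" where "sgn1 n = (-1) ^ n"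

lemma sgn1_simps[simp]: "sgn1 0 = 1" "sgn1 (Suc n) = - sgn1 n" "sgn1 n * sgn1 n = 1"
  "sgn1 n * (sgn1 n * w) = w"
  by (auto simp: sgn1_def simp flip: power_add mult.assoc)

text \<open>The total complex of the tensor product of two bar complexes; \<open>theta\<close> will be an isomorphism on cohomology.\<close>

definition tdel :: "('a multiset list \<Rightarrow> 'a multiset list \<Rightarrow> 'w::comm_ring_1) \<Rightarrow> 'a multiset list \<Rightarrow> 'a multiset list \<Rightarrow> 'w" where
  "tdel F l l' = del aug (\<lambda>l. F l l') l + sgn1 (length l) * del aug (F l) l'"

definition theta where "theta F s t = alt (\<lambda>l. alt (F l) t) s"

definition lists_over :: "'a set \<Rightarrow> 'a multiset list \<Rightarrow> bool" where "lists_over Z l \<longleftrightarrow> set_mset (sum_list l) \<subseteq> Z"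

text \<open>
  \<open>F l l'\<close> stands for the coefficient at the monomial tensor \<open>l'\<close> of the value at the monomial tensor \<open>l\<close>,
  hence finiteness is required in \<open>l'\<close> only.
\<close>

definition cochains :: "'a set \<Rightarrow> nat \<Rightarrow> ('a multiset list \<Rightarrow> 'a multiset list \<Rightarrow> 'w::comm_ring_1) set" where
  "cochains Z N = {F. (\<forall>l l'. F l l' \<noteq> 0 \<longrightarrow> lists_over Z l \<and> lists_over Z l' \<and> length l + length l' = N) \<and> (\<forall>l. finite {l'. F l l' \<noteq> 0})}"

lemma tdel_tdel: "tdel (tdel F) l l' = 0"
proof -
  have 1: "del aug (\<lambda>l. tdel F l l') l = del aug (\<lambda>l. sgn1 (length l) * del aug (F l) l') l"
    unfolding tdel_def evs_plus[OF evs_del] using del_del[of "\<lambda>l. F l l'" l] by simp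
  \<comment> \<open>The lists at which \<open>del\<close> evaluates are shorter by one, hence the
    change of sign.\<close>
  also have "\<dots> = del aug (\<lambda>k. - sgn1 (length l) * del aug (F k) l') l"
    by (rule del_cong) (metis minus_minus sgn1_simps(2))
  also have "\<dots> = - sgn1 (length l) * del aug (\<lambda>k. del aug (F k) l') l"
    by (rule evs_scale[OF evs_del])
  also have "del aug (\<lambda>k. del aug (F k) l') l = del aug (\<lambda>k'. del aug (\<lambda>k. F k k') l) l'"
    by (rule evs_swap[OF evs_del evs_del])
  finally have 1: "del aug (\<lambda>l. tdel F l l') l = - sgn1 (length l) * del aug (\<lambda>k'. del aug (\<lambda>k. F k k') l) l'" .
  have "del aug (tdel F l) l' = del aug (\<lambda>k'. del aug (\<lambda>k. F k k') l + sgn1 (length l) * del aug (F l) k') l'"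
    unfolding tdel_def ..
  also have "\<dots> = del aug (\<lambda>k'. del aug (\<lambda>k. F k k') l) l'"
    unfolding evs_plus[OF evs_del] evs_scale[OF evs_del] by (simp add: del_del)
  finally show ?thesis using 1 by (simp add: tdel_def[of "tdel F"])
qed

lemma theta_tdel: "theta (tdel F) s t = 0"
proof -
  have "alt (tdel F l) t = del aug (\<lambda>k. alt (F k) t) l" for l
  proof -
    have "alt (tdel F l) t = alt (\<lambda>k'. del aug (\<lambda>k. F k k') l + sgn1 (length l) * del aug (F l) k') t"
      unfolding tdel_def ..
    also have "\<dots> = alt (\<lambda>k'. del aug (\<lambda>k. F k k') l) t"
      unfolding evs_plus[OF evs_alt] evs_scale[OF evs_alt] by (simp add: alt_del)
    finally show ?thesis by (simp only: evs_swap[OF evs_alt evs_del_any])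
  qed
  then have "theta (tdel F) s t = alt (del aug (\<lambda>k. alt (F k) t)) s"
    unfolding theta_def by simp
  then show ?thesis by (simp add: alt_del)
qed

text \<open>Every entry is a submultiset of the total monomial, which leaves finitely many choices.
  For this the total monomial is tracked in the sets of evaluation points.\<close>

lemma finite_lists_over:
  fixes W :: "'a multiset set"
  assumes "finite W" shows "finite {l. sum_list l \<in> W \<and> length l = n}"
proof -
  have "finite {l. set l \<subseteq> (\<Union>w\<in>W. {a. a \<subseteq># w}) \<and> length l = n}"
  proof (rule finite_lists_length_eq, rule finite_UN_I[OF assms])
    fix w :: "'a multiset"
    have "{a. a \<subseteq># w} \<subseteq> mset ` {xs. set xs \<subseteq> set_mset w \<and> length xs \<le> size w}"
    proof clarify
      fix a assume "a \<subseteq># w"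
      then show "a \<in> mset ` {xs. set xs \<subseteq> set_mset w \<and> length xs \<le> size w}"
        by (metis (mono_tags, lifting) ex_mset image_eqI mem_Collect_eq set_mset_mono set_mset_mset size_mset size_mset_mono)
    qed
    then show "finite {a. a \<subseteq># w}" by (rule finite_subset) (simp add: finite_lists_length_le)
  qed
  moreover have "{l. sum_list l \<in> W \<and> length l = n} \<subseteq> {l. set l \<subseteq> (\<Union>w\<in>W. {a. a \<subseteq># w}) \<and> length l = n}"
  proof -
    have "a \<in> set l \<Longrightarrow> a \<subseteq># sum_list l" for a and l :: "'a multiset list"
      by (induction l) (auto intro: subset_mset.order_trans)
    then show ?thesis by auto
  qed
  ultimately show ?thesis by (rule finite_subset[rotated])
qed

text \<open>For operators in the finitely supported argument: a nonzero value at \<open>l'\<close>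
  requires a point in the support of \<open>f\<close> with the same total monomial, and the length
  of \<open>l'\<close> is fixed.\<close>

lemma finite_evs_support:
  fixes f :: "'a multiset list \<Rightarrow> 'w::ab_group_add"
  assumes "\<And>l'. evs (S l') (\<lambda>f. T f l')" "finite {k. f k \<noteq> 0}"
    and "\<And>k l'. k \<in> S l' \<Longrightarrow> f k \<noteq> 0 \<Longrightarrow> sum_list k = sum_list l' \<and> length l' = n"
  shows "finite {l'. T f l' \<noteq> 0}"
proof (rule finite_subset)
  show "{l'. T f l' \<noteq> 0} \<subseteq> {l'. sum_list l' \<in> sum_list ` {k. f k \<noteq> 0} \<and> length l' = n}"
  proof clarify
    fix l' assume "T f l' \<noteq> 0"
    then obtain k where "k \<in> S l'" "f k \<noteq> 0" using evs_supp[OF assms(1)] by blast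
    with assms(3)[of k l'] show "sum_list l' \<in> sum_list ` {k. f k \<noteq> 0} \<and> length l' = n"
      by (metis (mono_tags, lifting) imageI mem_Collect_eq)
  qed
qed (intro finite_lists_over finite_imageI assms(2))

lemma tdel_cochains:
  assumes F: "F \<in> cochains Z N" shows "tdel F \<in> cochains Z (Suc N)"
  unfolding cochains_def
proof (intro CollectI conjI allI impI)
  fix l
  have Fl: "F l k \<noteq> 0 \<Longrightarrow> length l + length k = N" for k using F by (auto simp: cochains_def)
  have "finite {l'. del aug (\<lambda>k. F k l') l \<noteq> 0}"
    by (rule evs_finite[OF evs_del]) (use F in \<open>auto simp: cochains_def\<close>)
  moreover have "finite {l'. del aug (F l) l' \<noteq> 0}"
    by (rule finite_evs_support[OF evs_del, where n = "Suc N - length l"]) (use F in \<open>auto simp: cochains_def dest!: Fl\<close>)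
  moreover have "{l'. tdel F l l' \<noteq> 0} \<subseteq> {l'. del aug (\<lambda>k. F k l') l \<noteq> 0} \<union> {l'. del aug (F l) l' \<noteq> 0}"
    by (auto simp: tdel_def)
  ultimately show "finite {l'. tdel F l l' \<noteq> 0}" by (meson finite_UnI finite_subset)
next
  fix l l' assume "tdel F l l' \<noteq> 0"
  then consider "del aug (\<lambda>k. F k l') l \<noteq> 0" | "del aug (F l) l' \<noteq> 0" unfolding tdel_def by (metis add_0 mult_zero_right)
  then have "lists_over Z l \<and> lists_over Z l' \<and> length l + length l' = Suc N"
  proof cases
    case 1
    obtain k where "sum_list k = sum_list l" "Suc (length k) = length l" "F k l' \<noteq> 0"
      by (rule evs_supp[OF evs_del[of l], where f = "\<lambda>k. F k l'"]) (use 1 in auto)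
    with F show ?thesis unfolding cochains_def lists_over_def by (metis (mono_tags, lifting) add_Suc mem_Collect_eq)
  next
    case 2
    obtain k where "sum_list k = sum_list l'" "Suc (length k) = length l'" "F l k \<noteq> 0"
      by (rule evs_supp[OF evs_del[of l'], where f = "F l"]) (use 2 in auto)
    with F show ?thesis unfolding cochains_def lists_over_def by (metis (mono_tags, lifting) add_Suc_right mem_Collect_eq)
  qed
  then show "lists_over Z l" "lists_over Z l'" "length l + length l' = Suc N" by auto
qed

text \<open>Applying \<open>rho\<close> in both arguments gives a matrix annihilated by both
  differentials, by \<open>del_rho\<close>, and \<open>alt_rho\<close> recovers \<open>g\<close> one
  argument at a time.\<close>

lemma theta_surj:
  fixes g :: "'a list \<Rightarrow> 'a list \<Rightarrow> 'w::comm_ring_1"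
  assumes xs: "distinct xs" and g: "\<And>s t. g s t \<noteq> 0 \<Longrightarrow> length s + length t = N"
  obtains F where "F \<in> cochains (set xs) N" "\<And>l l'. tdel F l l' = 0"
    "\<And>s t. s \<in> set (subseqs xs) \<Longrightarrow> t \<in> set (subseqs xs) \<Longrightarrow> theta F s t = g s t"
proof
  let ?F = "\<lambda>l l'. rho xs (\<lambda>s. rho xs (g s) l') l"
  show "tdel ?F l l' = 0" for l l'
    unfolding tdel_def evs_swap[OF evs_del evs_rho] by (simp add: del_rho evs_0[OF evs_rho])
  show "theta ?F s t = g s t" if "s \<in> set (subseqs xs)" "t \<in> set (subseqs xs)" for s t
    unfolding theta_def evs_swap[OF evs_alt evs_rho] using that xs by (simp add: alt_rho)
  have supp: "\<exists>s\<in>set (subseqs xs). \<exists>t\<in>set (subseqs xs).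
      l = rev (map (\<lambda>x. {#x#}) s) \<and> l' = rev (map (\<lambda>x. {#x#}) t) \<and> g s t \<noteq> 0"
    if "?F l l' \<noteq> 0" for l l'
    using rho_nonzero[OF that] rho_nonzero by blast
  have sub: "s \<in> set (subseqs xs) \<Longrightarrow> set s \<subseteq> set xs" for s using subseqs_powset[of xs] by auto
  show "?F \<in> cochains (set xs) N"
    unfolding cochains_def
  proof (intro CollectI conjI allI impI)
    fix l
    have "{l'. ?F l l' \<noteq> 0} \<subseteq> (\<lambda>t. rev (map (\<lambda>x. {#x#}) t)) ` set (subseqs xs)" using supp by blast
    then show "finite {l'. ?F l l' \<noteq> 0}" by (rule finite_subset) simp
  next
    fix l l' assume "?F l l' \<noteq> 0"
    from supp[OF this] obtain s t where st: "s \<in> set (subseqs xs)" "t \<in> set (subseqs xs)"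
      "l = rev (map (\<lambda>x. {#x#}) s)" "l' = rev (map (\<lambda>x. {#x#}) t)" "g s t \<noteq> 0" by blast
    then show "lists_over (set xs) l" "lists_over (set xs) l'" "length l + length l' = N"
      using g[OF st(5)] sub by (auto simp: lists_over_def)
  qed
qed

text \<open>The homotopy in the first argument reduces \<open>F\<close> to
  \<open>rho xs (alt F)\<close> in that argument. As \<open>F\<close> is a cocycle, the alternated
  rows are cocycles in the second argument, and the homotopy there bounds them: the part that it
  leaves over is \<open>theta F\<close>, which vanishes.\<close>

lemma theta_exact:
  fixes F :: "'a multiset list \<Rightarrow> 'a multiset list \<Rightarrow> 'w::comm_ring_1"
  assumes xs: "distinct xs" and F: "F \<in> cochains (set xs) N" and cocyc: "\<And>l l'. tdel F l l' = 0"
    and th: "\<And>s t. s \<in> set (subseqs xs) \<Longrightarrow> t \<in> set (subseqs xs) \<Longrightarrow> theta F s t = 0"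
  shows "if N = 0 then F = (\<lambda>_ _. 0) else \<exists>G\<in>cochains (set xs) (N - 1). tdel G = F"
proof (cases "N = 0")
  case True
  have nil: "[] \<in> set (subseqs xs)" by (induction xs) (auto simp: Let_def)
  then have "F [] [] = 0" using th[of "[]" "[]"] using nil by (simp add: theta_def)
  moreover have "F l l' \<noteq> 0 \<Longrightarrow> l = [] \<and> l' = []" for l l' using F True unfolding cochains_def by fastforce
  ultimately show ?thesis using True by (auto simp: fun_eq_iff)
next
  case False
  \<comment> \<open>The sign anticipates the factor \<open>sgn1 (length l)\<close> of the second
    differential in \<open>tdel\<close>.\<close>
  define Y where "Y k l' = sgn1 (length k) * contraction xs (F k) l'" for k l'
  define X1 where "X1 l l' = contraction xs (\<lambda>k. F k l') l" for l l'
  define X2 where "X2 l l' = rho xs (alt (\<lambda>k. Y k l')) l" for l l'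
  \<comment> \<open>The homotopy identities hold only for lists over \<open>xs\<close>. Cutting off
    outside the admissible range does no harm, since \<open>del\<close> preserves the total monomial
    and changes the length by one.\<close>
  define G where "G l l' = (if lists_over (set xs) l \<and> lists_over (set xs) l' \<and> length l + length l' = N - 1
      then X1 l l' + X2 l l' else 0)" for l l'
  have cocyc': "del aug (F k) k' = - sgn1 (length k) * del aug (\<lambda>k. F k k') k" for k k'
  proof -
    have "sgn1 (length k) * tdel F k k' = 0" by (simp add: cocyc)
    then show ?thesis by (simp add: tdel_def distrib_left add_eq_0_iff)
  qed
  have X1: "del aug (\<lambda>l. X1 l l') l + sgn1 (length l) * del aug (X1 l) l' = F l l' - rho xs (alt (\<lambda>k. F k l')) l"
    if "lists_over (set xs) l" for l l'
  proof -
    have 1: "del aug (\<lambda>l. X1 l l') l = F l l' - rho xs (alt (\<lambda>k. F k l')) l - contraction xs (del aug (\<lambda>k. F k l')) l"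
      unfolding X1_def using contraction_homotopy[OF that[unfolded lists_over_def], of "\<lambda>k. F k l'"]
      by (simp add: algebra_simps)
    have "del aug (X1 l) l' = del aug (\<lambda>k'. contraction xs (\<lambda>k. F k k') l) l'"
      by (rule arg_cong[of _ _ "\<lambda>f. del aug f l'"]) (simp add: X1_def fun_eq_iff)
    also have "\<dots> = contraction xs (\<lambda>k. del aug (F k) l') l" by (rule evs_swap[OF evs_del evs_contraction])
    also have "\<dots> = contraction xs (\<lambda>k. sgn1 (length l) * del aug (\<lambda>k. F k l') k) l"
      by (rule evs_cong[OF evs_contraction]) (simp add: cocyc')
    \<comment> \<open>The cocycle condition is used at lists longer by one, which turns its minus
      sign into \<open>sgn1 (length l)\<close>.\<close>
    also have "\<dots> = sgn1 (length l) * contraction xs (del aug (\<lambda>k. F k l')) l" by (rule evs_scale[OF evs_contraction])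
    finally show ?thesis using 1 by simp
  qed
  have X2: "del aug (\<lambda>l. X2 l l') l + sgn1 (length l) * del aug (X2 l) l' = rho xs (alt (\<lambda>k. F k l')) l"
    if "lists_over (set xs) l'" for l l'
  proof -
    have A: "alt (\<lambda>k. del aug (Y k) l') s = sgn1 (length s) * alt (\<lambda>k. F k l') s" if s: "s \<in> set (subseqs xs)" for s
    proof -
      have "del aug (Y k) l' = sgn1 (length k) * (F k l' - rho xs (alt (F k)) l' - contraction xs (del aug (F k)) l')" for k
      proof -
        have Yk: "Y k = (\<lambda>l'. sgn1 (length k) * contraction xs (F k) l')" by (simp add: Y_def fun_eq_iff)
        have "del aug (contraction xs (F k)) l' = F k l' - rho xs (alt (F k)) l' - contraction xs (del aug (F k)) l'"
          using contraction_homotopy[OF \<open>lists_over (set xs) l'\<close>[unfolded lists_over_def], of "F k"] by (simp add: algebra_simps)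
        then show ?thesis unfolding Yk evs_scale[OF evs_del] by simp
      qed
      then have "alt (\<lambda>k. del aug (Y k) l') s =
          alt (\<lambda>k. sgn1 (length s) * (F k l' - rho xs (alt (F k)) l' - contraction xs (del aug (F k)) l')) s"
        by (intro evs_cong[OF evs_alt]) simp
      also have "\<dots> = sgn1 (length s) * (alt (\<lambda>k. F k l') s - alt (\<lambda>k. rho xs (alt (F k)) l') s
          - alt (\<lambda>k. contraction xs (del aug (F k)) l') s)"
        by (simp only: evs_scale[OF evs_alt] evs_sub[OF evs_alt])
      also have "alt (\<lambda>k. rho xs (alt (F k)) l') s = rho xs (\<lambda>t. alt (\<lambda>k. alt (F k) t) s) l'"
        by (rule evs_swap[OF evs_alt evs_rho])
      also have "\<dots> = rho xs (\<lambda>t. 0) l'"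
        by (rule evs_cong[OF evs_rho]) (use th[OF s] in \<open>simp add: theta_def\<close>)
      also have "\<dots> = 0" by (rule evs_0[OF evs_rho])
      also have "alt (\<lambda>k. contraction xs (del aug (F k)) l') s = contraction xs (\<lambda>k'. alt (\<lambda>k. del aug (F k) k') s) l'"
        by (rule evs_swap[OF evs_alt evs_contraction])
      also have "\<dots> = contraction xs (\<lambda>k'. 0) l'"
      proof (rule evs_cong[OF evs_contraction])
        fix k'
        have "alt (\<lambda>k. del aug (F k) k') s = alt (\<lambda>k. - sgn1 (length s) * del aug (\<lambda>k. F k k') k) s"
          by (intro evs_cong[OF evs_alt]) (simp add: cocyc')
        then show "alt (\<lambda>k. del aug (F k) k') s = 0"
          by (simp only: evs_scale[OF evs_alt] alt_del) simp
      qed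
      also have "\<dots> = 0" by (rule evs_0[OF evs_contraction])
      finally show ?thesis by simp
    qed
    have "del aug (X2 l) l' = rho xs (\<lambda>s. alt (\<lambda>k. del aug (Y k) l') s) l"
    proof -
      have "evs UNIV (\<lambda>f::_ \<Rightarrow> 'w. rho xs (alt f) l)"
        by (rule evs_bind[OF evs_rho]) (auto intro: evs_mono[OF evs_alt])
      from evs_swap[OF evs_del[of l'] this, of "\<lambda>k' k. Y k k'"]
      moreover have "X2 l = (\<lambda>x. rho xs (alt (\<lambda>y. Y y x)) l)" by (simp add: X2_def fun_eq_iff)
      ultimately show ?thesis by simp
    qed
    also have "\<dots> = rho xs (\<lambda>s. sgn1 (length s) * alt (\<lambda>k. F k l') s) l"
      by (rule evs_cong[OF evs_rho]) (rule A)
    \<comment> \<open>\<open>rho\<close> is nonzero at \<open>l\<close> only through words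
      \<open>s\<close> of the same length.\<close>
    also have "\<dots> = sgn1 (length l) * rho xs (alt (\<lambda>k. F k l')) l"
    proof -
      have "rho xs (\<lambda>s. sgn1 (length s) * a s - sgn1 (length l) * a s) l = 0" for a :: "'a list \<Rightarrow> 'w"
      proof (rule ccontr)
        assume "rho xs (\<lambda>s. sgn1 (length s) * a s - sgn1 (length l) * a s) l \<noteq> 0"
        from rho_nonzero[OF this] show False by auto
      qed
      from this[of "alt (\<lambda>k. F k l')"] show ?thesis
        by (simp only: evs_sub[OF evs_rho] evs_scale[OF evs_rho]) simp
    qed
    finally show ?thesis by (simp add: X2_def del_rho)
  qed
  have "tdel G l l' = F l l'" for l l'
  proof (cases "lists_over (set xs) l \<and> lists_over (set xs) l' \<and> length l + length l' = N")
    case True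
    have 1: "del aug (\<lambda>l. G l l') l = del aug (\<lambda>l. X1 l l' + X2 l l') l"
      by (rule del_cong) (use True in \<open>auto simp: G_def lists_over_def\<close>)
    have 2: "del aug (G l) l' = del aug (\<lambda>l'. X1 l l' + X2 l l') l'"
      by (rule del_cong) (use True in \<open>auto simp: G_def lists_over_def\<close>)
    show ?thesis unfolding tdel_def 1 2 evs_plus[OF evs_del]
      using X1[of l l'] X2[of l' l] True by (simp add: algebra_simps)
  next
    case no: False
    have 1: "del aug (\<lambda>l. G l l') l = del aug (\<lambda>l. 0) l"
      by (rule del_cong) (use no False in \<open>auto simp: G_def lists_over_def\<close>)
    have 2: "del aug (G l) l' = del aug (\<lambda>l'. 0) l'"
      by (rule del_cong) (use no False in \<open>auto simp: G_def lists_over_def\<close>)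
    have "F l l' = 0" using no F unfolding cochains_def by blast
    then show ?thesis unfolding tdel_def 1 2 evs_0[OF evs_del] by simp
  qed
  moreover have "G \<in> cochains (set xs) (N - 1)"
    unfolding cochains_def
  proof (intro CollectI conjI allI impI)
    fix l
    have Ff: "finite {l'. F k l' \<noteq> 0}" for k using F by (simp add: cochains_def)
    have "finite {l'. X1 l l' \<noteq> 0}"
      unfolding X1_def by (rule evs_finite[OF evs_contraction]) (rule Ff)
    moreover have "finite {l'. X2 l l' \<noteq> 0}"
    proof -
      have Fl: "F k l \<noteq> 0 \<Longrightarrow> length k + length l = N" for k l using F by (auto simp: cochains_def)
      have "finite {l'. Y k l' \<noteq> 0}" for k
      proof (rule finite_subset)
        show "{l'. Y k l' \<noteq> 0} \<subseteq> {l'. contraction xs (F k) l' \<noteq> 0}" by (auto simp: Y_def)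
        show "finite {l'. contraction xs (F k) l' \<noteq> 0}"
          by (rule finite_evs_support[OF evs_contraction, where n = "N - 1 - length k"]) (use F Fl in \<open>auto simp: cochains_def dest!: Fl\<close>)
      qed
      moreover have "evs UNIV (\<lambda>f::_ \<Rightarrow> 'w. rho xs (alt f) l)"
        by (rule evs_bind[OF evs_rho]) (auto intro: evs_mono[OF evs_alt])
      ultimately show ?thesis unfolding X2_def by (intro evs_finite[where T = "\<lambda>f. rho xs (alt f) l"])
    qed
    moreover have "{l'. G l l' \<noteq> 0} \<subseteq> {l'. X1 l l' \<noteq> 0} \<union> {l'. X2 l l' \<noteq> 0}"
      by (auto simp: G_def)
    ultimately show "finite {l'. G l l' \<noteq> 0}" by (meson finite_UnI finite_subset)
  qed (auto simp: G_def split: if_splits)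
  ultimately show ?thesis using False by (auto simp: fun_eq_iff intro!: bexI[of _ G])
qed

section \<open>Finitely supported functions\<close>

abbreviation smul :: "'k::field \<Rightarrow> ('i \<Rightarrow>\<^sub>0 'k) \<Rightarrow> ('i \<Rightarrow>\<^sub>0 'k)" where
  "smul c \<equiv> Poly_Mapping.map ((*) c)"

abbreviation "sing \<equiv> Poly_Mapping.single"
abbreviation "lkp \<equiv> Poly_Mapping.lookup"

lemma lookup_smul[simp]: "lkp (smul c p) i = c * lkp p i"
  by (simp add: Poly_Mapping.map.rep_eq when_def)

lemma smul_simps[simp]:
  "smul c (p + q) = smul c p + smul c q" "smul c (p - q) = smul c p - smul c q"
  "smul c (- p) = - smul c p" "smul c 0 = 0" "smul 0 p = 0" "smul 1 p = p"
  "smul a (smul b p) = smul (a * b) p" "smul (- c) p = - smul c p"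
  by (rule poly_mapping_eqI, simp add: lookup_add lookup_minus algebra_simps)+

lemma smul_add_left: "smul (a + b) p = smul a p + smul b p"
  by (rule poly_mapping_eqI) (simp add: lookup_add algebra_simps)

lemma smul_sum: "smul c (sum f S) = (\<Sum>i\<in>S. smul c (f i))"
  by (induction S rule: infinite_finite_induct) auto

lemma smul_sing[simp]: "smul c (sing i a) = sing i (c * a)"
  by (rule poly_mapping_eqI) (simp add: lookup_single when_def)

definition fsp :: "'i set \<Rightarrow> ('i \<Rightarrow>\<^sub>0 'k::zero) set" where "fsp I = {p. Poly_Mapping.keys p \<subseteq> I}"

lemma fsp_iff: "p \<in> fsp I \<longleftrightarrow> (\<forall>i. lkp p i \<noteq> 0 \<longrightarrow> i \<in> I)"
  by (auto simp: fsp_def in_keys_iff)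

lemma fsp_closed[simp, intro]:
  fixes p :: "'i \<Rightarrow>\<^sub>0 'k::field"
  shows "p \<in> fsp I \<Longrightarrow> q \<in> fsp I \<Longrightarrow> p + q \<in> fsp I"
    "p \<in> fsp I \<Longrightarrow> q \<in> fsp I \<Longrightarrow> p - q \<in> fsp I" "p \<in> fsp I \<Longrightarrow> - p \<in> fsp I"
    "p \<in> fsp I \<Longrightarrow> smul c p \<in> fsp I" "0 \<in> fsp I" "i \<in> I \<Longrightarrow> sing i a \<in> fsp I"
  unfolding fsp_iff
  by (auto simp: lookup_add lookup_minus lookup_single when_def) (metis add_0, metis)

lemma fsp_sum[intro]:
  fixes f :: "_ \<Rightarrow> 'i \<Rightarrow>\<^sub>0 'k::field"
  shows "(\<And>x. x \<in> S \<Longrightarrow> f x \<in> fsp I) \<Longrightarrow> sum f S \<in> fsp I"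
  by (induction S rule: infinite_finite_induct) auto

lemma fsp_UNIV[simp]: "fsp UNIV = UNIV" by (auto simp: fsp_def)

lemma fsp_induct[consumes 1, case_names zero add]:
  fixes p :: "'i \<Rightarrow>\<^sub>0 'k::field"
  assumes "p \<in> fsp I" "P 0" "\<And>p i c. p \<in> fsp I \<Longrightarrow> i \<in> I \<Longrightarrow> P p \<Longrightarrow> P (p + sing i c)"
  shows "P p"
proof -
  have "finite F \<Longrightarrow> Poly_Mapping.keys p \<subseteq> F \<Longrightarrow> p \<in> fsp I \<Longrightarrow> P p" for F
  proof (induction F arbitrary: p rule: finite_induct)
    case empty
    then have "p = 0" by simp
    then show ?case using assms(2) by simp
  next
    case (insert i F)
    let ?q = "p - sing i (lkp p i)"
    have q: "lkp ?q j = (if j = i then 0 else lkp p j)" for j by (auto simp: lookup_minus lookup_single when_def)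
    have "?q \<in> fsp I" "Poly_Mapping.keys ?q \<subseteq> F" using insert.prems unfolding fsp_iff
      by (auto simp: q in_keys_iff subset_iff split: if_splits)
    then have "P ?q" by (intro insert.IH)
    show ?case
    proof (cases "i \<in> I")
      case True
      from assms(3)[OF \<open>?q \<in> fsp I\<close> this \<open>P ?q\<close>, of "lkp p i"] show ?thesis by simp
    next
      case False
      then have "lkp p i = 0" using insert.prems unfolding fsp_iff by auto
      then show ?thesis using \<open>P ?q\<close> by simp
    qed
  qed
  from this[OF finite_keys subset_refl assms(1)] show ?thesis .
qed

definition lin :: "('i \<Rightarrow> 'j \<Rightarrow>\<^sub>0 'k::field) \<Rightarrow> ('i \<Rightarrow>\<^sub>0 'k) \<Rightarrow> ('j \<Rightarrow>\<^sub>0 'k)" where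
  "lin g p = (\<Sum>i\<in>Poly_Mapping.keys p. smul (lkp p i) (g i))"

lemma lin_superset: "finite S \<Longrightarrow> Poly_Mapping.keys p \<subseteq> S \<Longrightarrow> lin g p = (\<Sum>i\<in>S. smul (lkp p i) (g i))"
  unfolding lin_def by (rule sum.mono_neutral_left) (auto simp: in_keys_iff)

lemma lin_add[simp]: "lin g (p + q) = lin g p + lin g q"
proof -
  let ?S = "Poly_Mapping.keys p \<union> Poly_Mapping.keys q"
  have "lin g (p + q) = (\<Sum>i\<in>?S. smul (lkp (p + q) i) (g i))"
    by (rule lin_superset) (auto simp: in_keys_iff lookup_add)
  moreover have "lin g p = (\<Sum>i\<in>?S. smul (lkp p i) (g i))" "lin g q = (\<Sum>i\<in>?S. smul (lkp q i) (g i))"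
    by (rule lin_superset; auto)+
  ultimately show ?thesis by (simp add: lookup_add smul_add_left sum.distrib)
qed

lemma lin_smul[simp]: "lin g (smul c p) = smul c (lin g p)"
proof -
  have "lin g (smul c p) = (\<Sum>i\<in>Poly_Mapping.keys p. smul (lkp (smul c p) i) (g i))"
    by (rule lin_superset) (auto simp: in_keys_iff)
  then show ?thesis by (simp add: lin_def smul_sum)
qed

lemma lin_zero[simp]: "lin g 0 = 0" by (simp add: lin_def)

lemma lin_sing[simp]: "lin g (sing i c) = smul c (g i)"
  by (cases "c = 0") (auto simp: lin_def)

lemma lin_uminus[simp]: "lin g (- p) = - lin g p"
  using lin_smul[of g "-1" p] by (simp)

lemma lin_diff[simp]: "lin g (p - q) = lin g p - lin g q"
  using lin_add[of g p "- q"] by simp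

lemma lin_cong: "(\<And>i. i \<in> Poly_Mapping.keys p \<Longrightarrow> f i = g i) \<Longrightarrow> lin f p = lin g p"
  by (simp add: lin_def)

lemma lin_cong_fsp: "p \<in> fsp I \<Longrightarrow> (\<And>i. i \<in> I \<Longrightarrow> f i = g i) \<Longrightarrow> lin f p = lin g p"
  by (rule lin_cong) (auto simp: fsp_def)

lemma lin_fsp: "(\<And>i. i \<in> Poly_Mapping.keys p \<Longrightarrow> g i \<in> fsp J) \<Longrightarrow> lin g p \<in> fsp J"
  unfolding lin_def by (rule fsp_sum) auto

lemma lin_fsp': "p \<in> fsp I \<Longrightarrow> (\<And>i. i \<in> I \<Longrightarrow> g i \<in> fsp J) \<Longrightarrow> lin g p \<in> fsp J"
  by (rule lin_fsp) (auto simp: fsp_def)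

definition plin :: "(('i \<Rightarrow>\<^sub>0 'k::field) \<Rightarrow> ('j \<Rightarrow>\<^sub>0 'k)) \<Rightarrow> bool" where
  "plin T \<longleftrightarrow> (\<forall>p q. T (p + q) = T p + T q) \<and> (\<forall>c p. T (smul c p) = smul c (T p))"

lemma plin_lin[intro!, simp]: "plin (lin g)" by (simp add: plin_def)

lemma plinD: assumes "plin T" shows "T (p + q) = T p + T q" "T (smul c p) = smul c (T p)" "T 0 = 0"
  "T (- p) = - T p" "T (p - q) = T p - T q"
proof -
  show "T (p + q) = T p + T q" "T (smul c p) = smul c (T p)" for p q c using assms by (auto simp: plin_def)
  note * = this
  show "T 0 = 0" using *(2)[of 0 0] by simp
  show m: "T (- p) = - T p" for p using *(2)[of "-1" p] by simp
  show "T (p - q) = T p - T q" using *(1)[of p "- q"] m[of q] by simp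
qed

lemma plin_sum: "plin T \<Longrightarrow> T (sum f S) = (\<Sum>x\<in>S. T (f x))"
  by (induction S rule: infinite_finite_induct) (auto simp: plinD)

lemma plin_lin_comp: "plin T \<Longrightarrow> T (lin g p) = lin (\<lambda>i. T (g i)) p"
  by (simp add: lin_def plin_sum plinD)

lemma lin_lin: "lin f (lin g p) = lin (\<lambda>i. lin f (g i)) p"
  by (rule plin_lin_comp) simp

lemma lin_self[simp]: "lin (\<lambda>i. sing i 1) p = p"
proof -
  have "p \<in> fsp UNIV" by simp
  then show ?thesis by (induction rule: fsp_induct) auto
qed

lemma plin_eq_lin: "plin T \<Longrightarrow> T p = lin (\<lambda>i. T (sing i 1)) p"
  using plin_lin_comp[of T "\<lambda>i. sing i 1" p] by simp

lemma plin_ext: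
  assumes "plin S" "plin T" "p \<in> fsp I" "\<And>i. i \<in> I \<Longrightarrow> S (sing i 1) = T (sing i 1)"
  shows "S p = T p"
  unfolding plin_eq_lin[OF assms(1), of p] plin_eq_lin[OF assms(2), of p]
  by (rule lin_cong_fsp[OF assms(3,4)])

lemma lin_add_fun: "lin (\<lambda>i. f i + g i) p = lin f p + lin g p"
  by (simp add: lin_def sum.distrib)

lemma lin_diff_fun: "lin (\<lambda>i. f i - g i) p = lin f p - lin g p"
  by (simp add: lin_def sum_subtractf)

lemma lin_smul_fun: "lin (\<lambda>i. smul c (f i)) p = smul c (lin f p)"
  by (simp add: lin_def smul_sum mult.commute)

lemma lin_zero_fun[simp]: "lin (\<lambda>i. 0) p = 0"
  by (simp add: lin_def)

lemma plin_comp: "plin S \<Longrightarrow> plin T \<Longrightarrow> plin (\<lambda>p. S (T p))" by (auto simp: plin_def)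

lemma plin_lin2: "(\<And>i. plin (\<lambda>q. g q i)) \<Longrightarrow> plin (\<lambda>q. lin (g q) p)"
proof -
  assume "\<And>i. plin (\<lambda>q. g q i)"
  then have "g (a + b) = (\<lambda>i. g a i + g b i)" "g (smul c a) = (\<lambda>i. smul c (g a i))" for a b c
    by (auto simp: plin_def fun_eq_iff)
  then show ?thesis by (simp add: plin_def lin_add_fun lin_smul_fun)
qed

definition psub :: "('j \<Rightarrow>\<^sub>0 'k::field) set \<Rightarrow> bool" where
  "psub K \<longleftrightarrow> 0 \<in> K \<and> (\<forall>p\<in>K. \<forall>q\<in>K. p + q \<in> K) \<and> (\<forall>c. \<forall>p\<in>K. smul c p \<in> K)"

lemma psubD: assumes "psub K" shows "0 \<in> K" "p \<in> K \<Longrightarrow> q \<in> K \<Longrightarrow> p + q \<in> K" "p \<in> K \<Longrightarrow> smul c p \<in> K"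
  "p \<in> K \<Longrightarrow> - p \<in> K" "p \<in> K \<Longrightarrow> q \<in> K \<Longrightarrow> p - q \<in> K"
proof -
  show "0 \<in> K" "p \<in> K \<Longrightarrow> q \<in> K \<Longrightarrow> p + q \<in> K" "p \<in> K \<Longrightarrow> smul c p \<in> K" for p q c
    using assms by (auto simp: psub_def)
  note * = this
  show m: "p \<in> K \<Longrightarrow> - p \<in> K" for p using *(3)[of p "-1"] by simp
  show "p \<in> K \<Longrightarrow> q \<in> K \<Longrightarrow> p - q \<in> K" using *(2)[of p "- q"] m[of q] by simp
qed

lemma psub_sum: "psub K \<Longrightarrow> (\<And>x. x \<in> S \<Longrightarrow> f x \<in> K) \<Longrightarrow> sum f S \<in> K"
  by (induction S rule: infinite_finite_induct) (auto simp: psubD)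

lemma psub_lin: "psub K \<Longrightarrow> (\<And>i. i \<in> Poly_Mapping.keys p \<Longrightarrow> g i \<in> K) \<Longrightarrow> lin g p \<in> K"
  unfolding lin_def by (intro psub_sum psubD(3))

section \<open>Coordinates\<close>

lemma ground_simps[simp]: "carrier ground = UNIV" "a \<oplus>\<^bsub>ground\<^esub> b = a + b" "a \<otimes>\<^bsub>ground\<^esub> b = a * b"
  "\<one>\<^bsub>ground\<^esub> = 1" "\<zero>\<^bsub>ground\<^esub> = 0"
  by (simp_all add: ring_of_type_algebra_def)

definition lin_on :: "('k::field, 'a, 'z) module_scheme \<Rightarrow> ('a \<Rightarrow> ('i \<Rightarrow>\<^sub>0 'k)) \<Rightarrow> bool" where
  "lin_on M f \<longleftrightarrow> (\<forall>x\<in>carrier M. \<forall>y\<in>carrier M. f (x \<oplus>\<^bsub>M\<^esub> y) = f x + f y) \<and>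
     (\<forall>c. \<forall>x\<in>carrier M. f (c \<odot>\<^bsub>M\<^esub> x) = smul c (f x))"

lemma lin_onD: "lin_on M f \<Longrightarrow> x \<in> carrier M \<Longrightarrow> y \<in> carrier M \<Longrightarrow> f (x \<oplus>\<^bsub>M\<^esub> y) = f x + f y"
  "lin_on M f \<Longrightarrow> x \<in> carrier M \<Longrightarrow> f (c \<odot>\<^bsub>M\<^esub> x) = smul c (f x)"
  by (auto simp: lin_on_def)

lemma lin_on_zero:
  assumes "module ground M" "lin_on M f" shows "f \<zero>\<^bsub>M\<^esub> = 0"
proof -
  interpret module ground M by fact
  have "f (0 \<odot>\<^bsub>M\<^esub> \<zero>\<^bsub>M\<^esub>) = smul 0 (f \<zero>\<^bsub>M\<^esub>)" using assms(2) by (intro lin_onD) auto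
  moreover have "0 \<odot>\<^bsub>M\<^esub> \<zero>\<^bsub>M\<^esub> = \<zero>\<^bsub>M\<^esub>" using smult_r_null[of 0] by simp
  ultimately show ?thesis by simp
qed

lemma lin_on_finsum:
  assumes "module ground M" "lin_on M f" "g \<in> S \<rightarrow> carrier M" "finite S"
  shows "f (finsum M g S) = (\<Sum>x\<in>S. f (g x))"
proof -
  interpret module ground M by fact
  from \<open>finite S\<close> \<open>g \<in> S \<rightarrow> carrier M\<close> show ?thesis
    by (induction S rule: finite_induct) (auto simp: lin_on_zero[OF assms(1,2)] lin_onD[OF assms(2)] finsum_insert finsum_closed Pi_def)
qed

text \<open>A basis of \<open>M\<close> indexed by \<open>I\<close>, as a linear bijection onto the
  free space on \<open>I\<close>. The module axioms are included, so that every construction passes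
  on what the next one requires.\<close>

definition coord :: "('k::field, 'a, 'z) module_scheme \<Rightarrow> ('a \<Rightarrow> ('i \<Rightarrow>\<^sub>0 'k)) \<Rightarrow> 'i set \<Rightarrow> bool" where
  "coord M \<kappa> I \<longleftrightarrow> module ground M \<and> lin_on M \<kappa> \<and> bij_betw \<kappa> (carrier M) (fsp I)"

text \<open>The axioms are equations and can be checked after a jointly injective family of linear
  maps. A family instead of a single map serves the space of cocycles, whose elements are separated
  only by all their values together.\<close>

lemma module_transfer:
  fixes M :: "('k::field, 'a, 'z) module_scheme" and \<kappa> :: "'y \<Rightarrow> 'a \<Rightarrow> 'i \<Rightarrow>\<^sub>0 'k"
  assumes inj: "\<And>x x'. x \<in> carrier M \<Longrightarrow> x' \<in> carrier M \<Longrightarrow> (\<And>y. \<kappa> y x = \<kappa> y x') \<Longrightarrow> x = x'"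
    and l: "\<And>y. lin_on M (\<kappa> y)"
    and cl: "\<And>x y. x \<in> carrier M \<Longrightarrow> y \<in> carrier M \<Longrightarrow> x \<oplus>\<^bsub>M\<^esub> y \<in> carrier M"
      "\<And>c x. x \<in> carrier M \<Longrightarrow> c \<odot>\<^bsub>M\<^esub> x \<in> carrier M" "\<zero>\<^bsub>M\<^esub> \<in> carrier M"
    and z: "\<And>y. \<kappa> y \<zero>\<^bsub>M\<^esub> = 0"
  shows "module ground M"
proof (rule moduleI)
  note [simp] = cl lin_onD[OF l] z
  show "cring (ground :: 'k ring)" by (rule cring_from_type_algebra)
  show "abelian_group M"
  proof (rule abelian_groupI)
    fix x assume x: "x \<in> carrier M"
    show "\<exists>y\<in>carrier M. y \<oplus>\<^bsub>M\<^esub> x = \<zero>\<^bsub>M\<^esub>"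
      by (rule bexI[of _ "(-1) \<odot>\<^bsub>M\<^esub> x"]) (auto intro!: inj simp: x)
  qed (auto intro!: inj simp: algebra_simps)
qed (auto intro!: inj simp: cl lin_onD[OF l] z smul_add_left)

lemma coordI:
  assumes bij: "bij_betw \<kappa> (carrier M) (fsp I)" and l: "lin_on M \<kappa>"
    and cl: "\<And>x y. x \<in> carrier M \<Longrightarrow> y \<in> carrier M \<Longrightarrow> x \<oplus>\<^bsub>M\<^esub> y \<in> carrier M"
      "\<And>c x. x \<in> carrier M \<Longrightarrow> c \<odot>\<^bsub>M\<^esub> x \<in> carrier M" "\<zero>\<^bsub>M\<^esub> \<in> carrier M"
    and z: "\<kappa> \<zero>\<^bsub>M\<^esub> = 0"
  shows "coord M \<kappa> I"
proof -
  have "module ground M"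
    by (rule module_transfer[where \<kappa> = "\<lambda>_::unit. \<kappa>"])
      (use bij l cl z in \<open>auto simp: bij_betw_def inj_on_def\<close>)
  then show ?thesis using bij l by (simp add: coord_def)
qed

lemma coordD:
  assumes "coord M \<kappa> I"
  shows "module ground M" "lin_on M \<kappa>" "bij_betw \<kappa> (carrier M) (fsp I)" "inj_on \<kappa> (carrier M)"
    "x \<in> carrier M \<Longrightarrow> \<kappa> x \<in> fsp I"
    "x \<in> carrier M \<Longrightarrow> y \<in> carrier M \<Longrightarrow> \<kappa> (x \<oplus>\<^bsub>M\<^esub> y) = \<kappa> x + \<kappa> y"
    "x \<in> carrier M \<Longrightarrow> \<kappa> (c \<odot>\<^bsub>M\<^esub> x) = smul c (\<kappa> x)" "\<kappa> \<zero>\<^bsub>M\<^esub> = 0"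
    "x \<in> carrier M \<Longrightarrow> y \<in> carrier M \<Longrightarrow> x \<oplus>\<^bsub>M\<^esub> y \<in> carrier M"
    "x \<in> carrier M \<Longrightarrow> c \<odot>\<^bsub>M\<^esub> x \<in> carrier M" "\<zero>\<^bsub>M\<^esub> \<in> carrier M"
    "x \<in> carrier M \<Longrightarrow> y \<in> carrier M \<Longrightarrow> \<kappa> x = \<kappa> y \<Longrightarrow> x = y"
proof -
  show m: "module ground M" and l: "lin_on M \<kappa>" and b: "bij_betw \<kappa> (carrier M) (fsp I)" using assms by (auto simp: coord_def)
  interpret module ground M by fact
  show "inj_on \<kappa> (carrier M)" using b by (auto simp: bij_betw_def)
  then show "x \<in> carrier M \<Longrightarrow> y \<in> carrier M \<Longrightarrow> \<kappa> x = \<kappa> y \<Longrightarrow> x = y" by (auto simp: inj_on_def)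
  show "x \<in> carrier M \<Longrightarrow> \<kappa> x \<in> fsp I" using b by (auto simp: bij_betw_def)
  show "\<kappa> \<zero>\<^bsub>M\<^esub> = 0" by (rule lin_on_zero[OF m l])
  show "\<zero>\<^bsub>M\<^esub> \<in> carrier M" by simp
qed (use assms in \<open>auto simp: coord_def lin_on_def intro: module.smult_closed abelian_group.axioms
   abelian_monoid.a_closed module.axioms\<close>)

lemma lin_isoI:
  assumes M: "coord M \<kappa> I" and N: "coord N \<kappa>' I"
  shows "linearly_isomorphic M N"
proof -
  define f where "f = restrict (\<lambda>x. inv_into (carrier N) \<kappa>' (\<kappa> x)) (carrier M)"
  note M' = coordD[OF M] and N' = coordD[OF N]
  have f: "f x \<in> carrier N" "\<kappa>' (f x) = \<kappa> x" if "x \<in> carrier M" for x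
  proof -
    have "\<kappa> x \<in> \<kappa>' ` carrier N" using M'(5)[OF that] N'(3) by (auto simp: bij_betw_def)
    then show "f x \<in> carrier N" "\<kappa>' (f x) = \<kappa> x"
      using that by (auto simp: f_def f_inv_into_f inv_into_into)
  qed
  have "f \<in> carrier (hom_space M N)"
  proof -
    have "f (x \<oplus>\<^bsub>M\<^esub> y) = f x \<oplus>\<^bsub>N\<^esub> f y" if "x \<in> carrier M" "y \<in> carrier M" for x y
      using that by (intro N'(12)) (auto simp: f M' N')
    moreover have "f (c \<odot>\<^bsub>M\<^esub> x) = c \<odot>\<^bsub>N\<^esub> f x" if "x \<in> carrier M" for c x
      using that by (intro N'(12)) (auto simp: f M' N')
    moreover have "f \<in> carrier M \<rightarrow>\<^sub>E carrier N" using f(1) by (auto simp: f_def)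
    ultimately show ?thesis by (simp add: hom_space_def)
  qed
  moreover have "bij_betw f (carrier M) (carrier N)"
  proof (rule bij_betw_imageI)
    show "inj_on f (carrier M)" by (rule inj_onI) (metis f(2) M'(12))
    show "f ` carrier M = carrier N"
    proof (intro equalityI subsetI)
      fix y assume y: "y \<in> carrier N"
      then have "\<kappa>' y \<in> \<kappa> ` carrier M" using N'(5) M'(3) by (auto simp: bij_betw_def)
      then obtain x where "x \<in> carrier M" "\<kappa> x = \<kappa>' y" by auto
      then have "f x = y" using f y by (auto intro: N'(12))
      with \<open>x \<in> carrier M\<close> show "y \<in> f ` carrier M" by blast
    qed (use f in auto)
  qed
  ultimately show ?thesis unfolding linearly_isomorphic_def by blast
qed

definition bas :: "('k::field, 'a, 'z) module_scheme \<Rightarrow> ('a \<Rightarrow> ('i \<Rightarrow>\<^sub>0 'k)) \<Rightarrow> 'i \<Rightarrow> 'a" where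
  "bas M \<kappa> i = inv_into (carrier M) \<kappa> (sing i 1)"

lemma bas: assumes "coord M \<kappa> I" "i \<in> I" shows "bas M \<kappa> i \<in> carrier M" "\<kappa> (bas M \<kappa> i) = sing i 1"
proof -
  have "sing i 1 \<in> \<kappa> ` carrier M" using coordD(3)[OF assms(1)] assms(2) by (auto simp: bij_betw_def)
  then show "bas M \<kappa> i \<in> carrier M" "\<kappa> (bas M \<kappa> i) = sing i 1"
    by (auto simp: bas_def f_inv_into_f inv_into_into)
qed

lemma coord_cong:
  assumes "coord M \<kappa> I" "carrier N = carrier M" "add N = add M" "\<zero>\<^bsub>N\<^esub> = \<zero>\<^bsub>M\<^esub>" "module.smult N = module.smult M"
  shows "coord N \<kappa> I"
  using coordD[OF assms(1)] assms by (intro coordI) (auto simp: lin_on_def)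

text \<open>For spaces given by generators and relations: \<open>g\<close> sends a vector to the
  generator it labels and is linear only modulo the relations \<open>K\<close>. The lemma reduces
  the generator to those labelled by basis vectors. For \<open>K = {0}\<close> it is the expansion
  of a linear map.\<close>

lemma expand_mod:
  assumes M: "coord M \<kappa> I" and K: "psub K" and a: "a \<in> carrier M"
    and add: "\<And>a b. a \<in> carrier M \<Longrightarrow> b \<in> carrier M \<Longrightarrow> g (a \<oplus>\<^bsub>M\<^esub> b) - g a - g b \<in> K"
    and scal: "\<And>c a. a \<in> carrier M \<Longrightarrow> g (c \<odot>\<^bsub>M\<^esub> a) - smul c (g a) \<in> K"
  shows "g a - lin (\<lambda>i. g (bas M \<kappa> i)) (\<kappa> a) \<in> K"
proof -
  note M' = coordD[OF M]
  have "p \<in> fsp I \<Longrightarrow> a \<in> carrier M \<Longrightarrow> \<kappa> a = p \<Longrightarrow> g a - lin (\<lambda>i. g (bas M \<kappa> i)) p \<in> K" for p a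
  proof (induction p arbitrary: a rule: fsp_induct)
    case zero
    then have a: "a = \<zero>\<^bsub>M\<^esub>" using M' by metis
    have z: "0 \<odot>\<^bsub>M\<^esub> \<zero>\<^bsub>M\<^esub> = \<zero>\<^bsub>M\<^esub>" by (rule M'(12)) (auto simp: M')
    show ?case using scal[OF M'(11), of 0] unfolding z a by simp
  next
    case (add p i c)
    have "p \<in> \<kappa> ` carrier M" using add.hyps M'(3) by (auto simp: bij_betw_def)
    then obtain a' where a': "a' \<in> carrier M" "\<kappa> a' = p" by auto
    let ?b = "c \<odot>\<^bsub>M\<^esub> bas M \<kappa> i"
    have b: "bas M \<kappa> i \<in> carrier M" "?b \<in> carrier M" using bas[OF M add.hyps(2)] M' by auto
    have "a = a' \<oplus>\<^bsub>M\<^esub> ?b"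
      by (rule M'(12)) (use a' b add.prems bas[OF M add.hyps(2)] in \<open>auto simp: M'\<close>)
    then have 1: "g a - g a' - g ?b \<in> K" using assms(4)[OF a'(1) b(2)] by simp
    have 2: "g ?b - smul c (g (bas M \<kappa> i)) \<in> K" using scal b by simp
    have 3: "g a' - lin (\<lambda>i. g (bas M \<kappa> i)) p \<in> K" using add.IH a' by simp
    from psubD(2)[OF K psubD(2)[OF K 1 2] 3] show ?case by (simp add: algebra_simps)
  qed
  then show ?thesis using a M' by blast
qed

lemma expand_lin_on:
  assumes "coord M \<kappa> I" "a \<in> carrier M" "lin_on M g"
  shows "g a = lin (\<lambda>i. g (bas M \<kappa> i)) (\<kappa> a)"
  using expand_mod[OF assms(1) _ assms(2), of "{0}" g] assms(3) by (auto simp: psub_def lin_on_def)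

section \<open>Quotients\<close>

lemma quotient_space_simps:
  "carrier (quotient_space M H) = (\<lambda>x. H +>\<^bsub>M\<^esub> x) ` carrier M"
  "add (quotient_space M H) = set_add M" "\<zero>\<^bsub>quotient_space M H\<^esub> = H"
  "c \<odot>\<^bsub>quotient_space M H\<^esub> C = (\<Union>x\<in>C. H +>\<^bsub>M\<^esub> (c \<odot>\<^bsub>M\<^esub> x))"
  unfolding quotient_space_def ring.defs module.defs FactRing_def A_RCOSETS_def'[abs_def] by auto

text \<open>The first isomorphism theorem in coordinates. The coordinate of a coset is read off from
  \<open>SOME\<close> element, as in \<open>linear_ext\<close>. Tensor spaces, tensor products,
  exterior powers, the symmetric algebra and the cohomology are all handled by exhibiting a map with
  the right kernel and image.\<close>

lemma
  assumes M: "module ground M" and l: "lin_on M \<phi>" and img: "\<phi> ` carrier M = fsp I"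
    and H: "H = {x \<in> carrier M. \<phi> x = 0}"
  shows quotient_coset: "x \<in> carrier M \<Longrightarrow> H +>\<^bsub>M\<^esub> x = {y \<in> carrier M. \<phi> y = \<phi> x}"
    and coord_quotient: "coord (quotient_space M H) (\<lambda>C. \<phi> (SOME x. x \<in> C)) I"
    and quotient_coord: "x \<in> carrier M \<Longrightarrow> \<phi> (SOME y. y \<in> H +>\<^bsub>M\<^esub> x) = \<phi> x"
proof -
  interpret module ground M by fact
  have minus: "\<phi> (\<ominus>\<^bsub>M\<^esub> x) = - \<phi> x" if "x \<in> carrier M" for x
  proof -
    have "\<phi> (x \<oplus>\<^bsub>M\<^esub> \<ominus>\<^bsub>M\<^esub> x) = \<phi> x + \<phi> (\<ominus>\<^bsub>M\<^esub> x)" using that by (intro lin_onD[OF l]) auto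
    then show ?thesis using that lin_on_zero[OF M l] by (simp add: M.r_neg eq_neg_iff_add_eq_0 add.commute)
  qed
  have fib: "H +>\<^bsub>M\<^esub> x = {y \<in> carrier M. \<phi> y = \<phi> x}" if x: "x \<in> carrier M" for x
  proof (intro equalityI subsetI)
    fix y assume "y \<in> {y \<in> carrier M. \<phi> y = \<phi> x}"
    then have y: "y \<in> carrier M" "\<phi> y = \<phi> x" by auto
    have "y = (y \<oplus>\<^bsub>M\<^esub> \<ominus>\<^bsub>M\<^esub> x) \<oplus>\<^bsub>M\<^esub> x" using x y by (simp add: M.a_assoc M.l_neg)
    moreover have "y \<oplus>\<^bsub>M\<^esub> \<ominus>\<^bsub>M\<^esub> x \<in> H" using x y by (auto simp: H lin_onD[OF l] minus)
    ultimately show "y \<in> H +>\<^bsub>M\<^esub> x" unfolding a_r_coset_def' by blast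
  qed (use x in \<open>auto simp: a_r_coset_def' H lin_onD[OF l]\<close>)
  then show "x \<in> carrier M \<Longrightarrow> H +>\<^bsub>M\<^esub> x = {y \<in> carrier M. \<phi> y = \<phi> x}" .
  have val: "\<phi> (SOME y. y \<in> H +>\<^bsub>M\<^esub> x) = \<phi> x" if x: "x \<in> carrier M" for x
    using someI[of "\<lambda>y. y \<in> H +>\<^bsub>M\<^esub> x" x] x fib by auto
  then show "x \<in> carrier M \<Longrightarrow> \<phi> (SOME y. y \<in> H +>\<^bsub>M\<^esub> x) = \<phi> x" .
  have add: "(H +>\<^bsub>M\<^esub> x) <+>\<^bsub>M\<^esub> (H +>\<^bsub>M\<^esub> y) = H +>\<^bsub>M\<^esub> (x \<oplus>\<^bsub>M\<^esub> y)" if x: "x \<in> carrier M" and y: "y \<in> carrier M" for x y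
  proof (intro equalityI subsetI)
    fix z assume "z \<in> H +>\<^bsub>M\<^esub> (x \<oplus>\<^bsub>M\<^esub> y)"
    then have z: "z \<in> carrier M" "\<phi> z = \<phi> x + \<phi> y" using x y by (auto simp: fib lin_onD[OF l])
    have "z = x \<oplus>\<^bsub>M\<^esub> (z \<oplus>\<^bsub>M\<^esub> \<ominus>\<^bsub>M\<^esub> x)" using x z by (metis M.a_comm M.a_lcomm M.a_inv_closed M.r_neg M.r_zero)
    moreover have "z \<oplus>\<^bsub>M\<^esub> \<ominus>\<^bsub>M\<^esub> x \<in> H +>\<^bsub>M\<^esub> y" using x y z by (auto simp: fib lin_onD[OF l] minus)
    moreover have "x \<in> H +>\<^bsub>M\<^esub> x" using x by (auto simp: fib)
    ultimately show "z \<in> (H +>\<^bsub>M\<^esub> x) <+>\<^bsub>M\<^esub> (H +>\<^bsub>M\<^esub> y)" unfolding set_add_def' by blast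
  qed (use x y in \<open>auto simp: set_add_def' fib lin_onD[OF l]\<close>)
  have smu: "(\<Union>z\<in>H +>\<^bsub>M\<^esub> x. H +>\<^bsub>M\<^esub> (c \<odot>\<^bsub>M\<^esub> z)) = H +>\<^bsub>M\<^esub> (c \<odot>\<^bsub>M\<^esub> x)" if x: "x \<in> carrier M" for x c
  proof -
    have "H +>\<^bsub>M\<^esub> (c \<odot>\<^bsub>M\<^esub> z) = H +>\<^bsub>M\<^esub> (c \<odot>\<^bsub>M\<^esub> x)" if "z \<in> H +>\<^bsub>M\<^esub> x" for z
      using that x by (auto simp: fib lin_onD[OF l])
    moreover have "x \<in> H +>\<^bsub>M\<^esub> x" using x by (auto simp: fib)
    ultimately show ?thesis by blast
  qed
  have qsm: "c \<odot>\<^bsub>quotient_space M H\<^esub> (H +>\<^bsub>M\<^esub> x) = H +>\<^bsub>M\<^esub> (c \<odot>\<^bsub>M\<^esub> x)" if "x \<in> carrier M" for c x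
    unfolding quotient_space_simps using smu[OF that] .
  have zero: "H = H +>\<^bsub>M\<^esub> \<zero>\<^bsub>M\<^esub>" by (simp add: fib lin_on_zero[OF M l]) (simp add: H)
  show "coord (quotient_space M H) (\<lambda>C. \<phi> (SOME x. x \<in> C)) I"
  proof (rule coordI)
    show "bij_betw (\<lambda>C. \<phi> (SOME x. x \<in> C)) (carrier (quotient_space M H)) (fsp I)"
      unfolding quotient_space_simps
    proof (rule bij_betw_imageI)
      show "inj_on (\<lambda>C. \<phi> (SOME x. x \<in> C)) ((+>\<^bsub>M\<^esub>) H ` carrier M)"
      proof (rule inj_onI, elim imageE)
        fix C D x y assume "\<phi> (SOME x. x \<in> C) = \<phi> (SOME x. x \<in> D)" "C = H +>\<^bsub>M\<^esub> x" "x \<in> carrier M"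
          "D = H +>\<^bsub>M\<^esub> y" "y \<in> carrier M"
        then have "\<phi> x = \<phi> y" using val by simp
        then show "C = D" using \<open>C = _\<close> \<open>D = _\<close> \<open>x \<in> carrier M\<close> \<open>y \<in> carrier M\<close> fib by simp
      qed
      show "(\<lambda>C. \<phi> (SOME x. x \<in> C)) ` (+>\<^bsub>M\<^esub>) H ` carrier M = fsp I"
        unfolding img[symmetric] image_image by (rule image_cong) (auto simp: val)
    qed
    show "lin_on (quotient_space M H) (\<lambda>C. \<phi> (SOME x. x \<in> C))"
      unfolding lin_on_def quotient_space_simps(1,2) by (auto simp: qsm add val lin_onD[OF l])
    show "\<phi> (SOME x. x \<in> \<zero>\<^bsub>quotient_space M H\<^esub>) = 0"
      unfolding quotient_space_simps by (subst zero, subst val) (auto simp: lin_on_zero[OF M l])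
    show "\<zero>\<^bsub>quotient_space M H\<^esub> \<in> carrier (quotient_space M H)"
      unfolding quotient_space_simps using zero by auto
  qed (auto simp: quotient_space_simps add smu)
qed

lemma free_space_simps[simp]:
  "carrier (free_space G) = fsp G" "\<zero>\<^bsub>free_space G\<^esub> = 0" "p \<oplus>\<^bsub>free_space G\<^esub> q = p + q" "c \<odot>\<^bsub>free_space G\<^esub> p = smul c p"
  by (auto simp: free_space_def fsp_def)

lemma coord_free_space: "coord (free_space G) (\<lambda>p. p) G"
  by (rule coordI) (auto simp: lin_on_def bij_betw_def)

lemma gen_subspace_free:
  assumes "S \<subseteq> fsp G"
  shows "psub (gen_subspace (free_space G) S)" "S \<subseteq> gen_subspace (free_space G) S" "gen_subspace (free_space G) S \<subseteq> fsp G"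
proof -
  interpret module ground "free_space G" using coord_free_space by (rule coordD)
  have sub: "submodule H ground (free_space G) \<longleftrightarrow> H \<subseteq> fsp G \<and> psub H" for H
  proof
    assume "submodule H ground (free_space G)"
    then interpret H: submodule H ground "free_space G" .
    show "H \<subseteq> fsp G \<and> psub H" using H.subset H.one_closed H.m_closed H.smult_closed
      by (auto simp: psub_def)
  next
    assume H: "H \<subseteq> fsp G \<and> psub H"
    then have psub: "psub H" by simp
    show "submodule H ground (free_space G)"
    proof (rule submoduleI)
      fix a assume a: "a \<in> H"
      have "\<ominus>\<^bsub>free_space G\<^esub> a = - a" by (rule M.minus_equality) (use a H in auto)
      then show "\<ominus>\<^bsub>free_space G\<^esub> a \<in> H" using a psubD[OF psub] by simp
    qed (use H psubD[OF psub] in auto)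
  qed
  show "psub (gen_subspace (free_space G) S)" "S \<subseteq> gen_subspace (free_space G) S"
    unfolding gen_subspace_def sub by (auto simp: psub_def)
  have "submodule (fsp G) ground (free_space G)" using sub by (auto simp: psub_def)
  then show "gen_subspace (free_space G) S \<subseteq> fsp G" unfolding gen_subspace_def using assms by auto
qed

lemma submoduleI':
  assumes M: "module ground M" and "H \<subseteq> carrier M" "\<zero>\<^bsub>M\<^esub> \<in> H" "\<And>x y. x \<in> H \<Longrightarrow> y \<in> H \<Longrightarrow> x \<oplus>\<^bsub>M\<^esub> y \<in> H"
    "\<And>c x. x \<in> H \<Longrightarrow> c \<odot>\<^bsub>M\<^esub> x \<in> H"
  shows "submodule H ground M"
proof -
  interpret module ground M by fact
  show ?thesis
  proof (rule submoduleI)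
    fix a assume a: "a \<in> H"
    then have "a \<in> carrier M" using assms(2) by auto
    then have "(-1) \<odot>\<^bsub>M\<^esub> a \<oplus>\<^bsub>M\<^esub> a = \<zero>\<^bsub>M\<^esub>"
      using smult_l_distr[of "-1" 1 a] smult_one[of a] smult_l_null[of a] by simp
    then have "\<ominus>\<^bsub>M\<^esub> a = (-1) \<odot>\<^bsub>M\<^esub> a"
      using \<open>a \<in> carrier M\<close> by (intro M.minus_equality) auto
    then show "\<ominus>\<^bsub>M\<^esub> a \<in> H" using assms a by simp
  qed (use assms in auto)
qed

lemma gen_subspace_kernel:
  assumes M: "module ground M" and l: "lin_on M \<phi>" and "S \<subseteq> carrier M" "\<And>x. x \<in> S \<Longrightarrow> \<phi> x = 0"
  shows "gen_subspace M S \<subseteq> {x \<in> carrier M. \<phi> x = 0}"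
proof -
  interpret module ground M by fact
  have "submodule {x \<in> carrier M. \<phi> x = 0} ground M"
    by (rule submoduleI'[OF M]) (auto simp: lin_onD[OF l] lin_on_zero[OF M l])
  then show ?thesis unfolding gen_subspace_def using assms(3,4) by blast
qed

lemma linear_ext_coord:
  assumes W: "coord W \<kappa> J" and f: "\<And>x. x \<in> Poly_Mapping.keys (SOME p. p \<in> P) \<Longrightarrow> f x \<in> carrier W"
  shows "linear_ext W f P \<in> carrier W" "\<kappa> (linear_ext W f P) = lin (\<lambda>x. \<kappa> (f x)) (SOME p. p \<in> P)"
proof -
  note W' = coordD[OF W]
  interpret module ground W by (rule W')
  have g: "(\<lambda>x. lkp (SOME p. p \<in> P) x \<odot>\<^bsub>W\<^esub> f x) \<in> Poly_Mapping.keys (SOME p. p \<in> P) \<rightarrow> carrier W"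
    using f W' by auto
  show "linear_ext W f P \<in> carrier W"
    unfolding linear_ext_def Let_def using g by (rule M.finsum_closed)
  show "\<kappa> (linear_ext W f P) = lin (\<lambda>x. \<kappa> (f x)) (SOME p. p \<in> P)"
    unfolding linear_ext_def Let_def lin_on_finsum[OF W'(1,2) g finite_keys] lin_def
    using f W' by (intro sum.cong) auto
qed

lemma coord_reindex:
  fixes M :: "('k::field, 'a, 'z) module_scheme" and \<kappa> :: "'a \<Rightarrow> 'i \<Rightarrow>\<^sub>0 'k" and h :: "'i \<Rightarrow> 'j"
  assumes M: "coord M \<kappa> I" and h: "bij_betw h I J"
  shows "coord M (\<lambda>x. lin (\<lambda>i. sing (h i) 1) (\<kappa> x)) J"
proof (rule coordI)
  note M' = coordD[OF M]
  let ?h = "\<lambda>p :: 'i \<Rightarrow>\<^sub>0 'k. lin (\<lambda>i. sing (h i) 1) p"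
    and ?g = "\<lambda>p :: 'j \<Rightarrow>\<^sub>0 'k. lin (\<lambda>j. sing (inv_into I h j) 1) p"
  have "bij_betw ?h (fsp I) (fsp J)"
  proof (rule bij_betw_byWitness[of _ ?g])
    show "\<forall>p\<in>fsp I. ?g (?h p) = p"
    proof
      fix p :: "'i \<Rightarrow>\<^sub>0 'k" assume p: "p \<in> fsp I"
      show "?g (?h p) = p" unfolding lin_lin
        by (rule trans[OF lin_cong_fsp[OF p] lin_self]) (use h in \<open>simp add: bij_betw_inv_into_left\<close>)
    qed
    show "\<forall>p\<in>fsp J. ?h (?g p) = p"
    proof
      fix p :: "'j \<Rightarrow>\<^sub>0 'k" assume p: "p \<in> fsp J"
      show "?h (?g p) = p" unfolding lin_lin
        by (rule trans[OF lin_cong_fsp[OF p] lin_self]) (use h in \<open>simp add: bij_betw_inv_into_right\<close>)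
    qed
    show "?h ` fsp I \<subseteq> fsp J" using h by (auto intro!: lin_fsp' simp: bij_betw_def)
    show "?g ` fsp J \<subseteq> fsp I"
      by (clarify, rule lin_fsp', assumption) (use bij_betw_inv_into[OF h] in \<open>auto simp: bij_betw_def\<close>)
  qed
  then show "bij_betw (\<lambda>x. lin (\<lambda>i. sing (h i) 1) (\<kappa> x)) (carrier M) (fsp J)"
    using bij_betw_trans[OF M'(3)] by (auto simp: comp_def)
qed (use coordD[OF M] in \<open>auto simp: lin_on_def\<close>)

section \<open>Tensor products\<close>

primrec tens :: "('i \<Rightarrow>\<^sub>0 'k::field) list \<Rightarrow> ('i list \<Rightarrow>\<^sub>0 'k)" where
  "tens [] = sing [] 1"
| "tens (p # ps) = lin (\<lambda>i. lin (\<lambda>w. sing (i # w) 1) (tens ps)) p"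

abbreviation "wds I n \<equiv> {w. set w \<subseteq> I \<and> length w = n}"

lemma tens_fsp: "set ps \<subseteq> fsp I \<Longrightarrow> tens ps \<in> fsp (wds I (length ps))"
proof (induction ps)
  case (Cons p ps)
  then have p: "p \<in> fsp I" and t: "tens ps \<in> fsp (wds I (length ps))" by auto
  show ?case unfolding tens.simps
    by (rule lin_fsp'[OF p], rule lin_fsp'[OF t]) auto
qed auto

lemma tens_sing: "tens (map (\<lambda>i. sing i 1) w) = sing w 1"
  by (induction w) auto

lemma lin_tens_Cons: "lin F (tens (p # ps)) = lin (\<lambda>i. lin (\<lambda>w. F (i # w)) (tens ps)) p"
  by (simp add: lin_lin)

text \<open>Recursion on the first argument suits inductions over lists;
  \<open>multilin_update\<close> translates it into the form used in
  \<open>multilinear_relations\<close>.\<close>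

primrec multilin :: "('k::field, 'a, 'z) module_scheme \<Rightarrow> nat \<Rightarrow> ('a list \<Rightarrow> ('i \<Rightarrow>\<^sub>0 'k)) \<Rightarrow> bool" where
  "multilin M 0 G = True"
| "multilin M (Suc n) G = ((\<forall>l\<in>words M n. lin_on M (\<lambda>a. G (a # l))) \<and> (\<forall>a\<in>carrier M. multilin M n (\<lambda>l. G (a # l))))"

lemma words_Suc: "a # l \<in> words M (Suc n) \<longleftrightarrow> a \<in> carrier M \<and> l \<in> words M n"
  by (auto simp: words_def)

lemma words_0[simp]: "words M 0 = {[]}" by (auto simp: words_def)

lemma words_Suc_cases: assumes "l \<in> words M (Suc n)" obtains a k where "l = a # k" "a \<in> carrier M" "k \<in> words M n"
  using assms by (cases l) (auto simp: words_def)

lemma multilin_plin: "multilin M n G \<Longrightarrow> plin T \<Longrightarrow> multilin M n (\<lambda>l. T (G l))"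
  by (induction n arbitrary: G) (auto simp: lin_on_def plinD)

lemma multilin_add: "multilin M n G \<Longrightarrow> multilin M n H \<Longrightarrow> multilin M n (\<lambda>l. G l + H l)"
  by (induction n arbitrary: G H) (auto simp: lin_on_def)

lemma multilin_0: "multilin M n (\<lambda>l. 0)"
  by (induction n) (auto simp: lin_on_def)

lemma multilin_sum: "(\<And>x. x \<in> S \<Longrightarrow> multilin M n (G x)) \<Longrightarrow> multilin M n (\<lambda>l. \<Sum>x\<in>S. G x l)"
  by (induction S rule: infinite_finite_induct) (auto intro: multilin_0 multilin_add)

lemma plin_smul: "plin (smul c)"
  unfolding plin_def by (auto intro!: poly_mapping_eqI)

lemma multilin_smul: "multilin M n G \<Longrightarrow> multilin M n (\<lambda>l. smul c (G l))"
  by (erule multilin_plin[OF _ plin_smul])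

lemma multilin_tens:
  assumes "coord M \<kappa> I" shows "multilin M n (\<lambda>l. tens (map \<kappa> l))"
proof (induction n)
  case (Suc n)
  have "multilin M n (\<lambda>l. lin (\<lambda>i. lin (\<lambda>w. sing (i # w) 1) (tens (map \<kappa> l))) (\<kappa> a))" for a
    by (rule multilin_plin[OF Suc]) (auto intro!: plin_lin2)
  then show ?case using coordD(2)[OF assms] by (auto simp: lin_on_def)
qed simp

lemma multilin_expand:
  assumes M: "coord M \<kappa> I" shows "multilin M n G \<Longrightarrow> l \<in> words M n \<Longrightarrow>
    G l = lin (\<lambda>w. G (map (bas M \<kappa>) w)) (tens (map \<kappa> l))"
proof (induction n arbitrary: G l)
  case (Suc n)
  from Suc.prems(2) obtain a k where l: "l = a # k" "a \<in> carrier M" "k \<in> words M n" by (rule words_Suc_cases)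
  have "G (a # k) = lin (\<lambda>i. G (bas M \<kappa> i # k)) (\<kappa> a)"
    by (rule expand_lin_on[OF M, of a "\<lambda>a. G (a # k)"]) (use Suc.prems l in auto)
  also have "\<dots> = lin (\<lambda>i. lin (\<lambda>w. G (bas M \<kappa> i # map (bas M \<kappa>) w)) (tens (map \<kappa> k))) (\<kappa> a)"
    by (rule lin_cong_fsp[OF coordD(5)[OF M l(2)]], rule Suc.IH[OF _ l(3)])
      (use Suc.prems bas[OF M] in auto)
  finally show ?case unfolding l list.map lin_tens_Cons .
qed simp

lemma multilin_update:
  assumes "multilin M n G" "l \<in> words M n" "i < n" "a \<in> carrier M"
  shows "b \<in> carrier M \<Longrightarrow> G (l[i := a \<oplus>\<^bsub>M\<^esub> b]) = G (l[i := a]) + G (l[i := b])"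
    "G (l[i := c \<odot>\<^bsub>M\<^esub> a]) = smul c (G (l[i := a]))"
proof -
  have "(b \<in> carrier M \<longrightarrow> G (l[i := a \<oplus>\<^bsub>M\<^esub> b]) = G (l[i := a]) + G (l[i := b])) \<and>
     G (l[i := c \<odot>\<^bsub>M\<^esub> a]) = smul c (G (l[i := a]))"
    using assms
  proof (induction n arbitrary: G l i)
    case (Suc n)
    from Suc.prems(2) obtain x k where l: "l = x # k" "x \<in> carrier M" "k \<in> words M n" by (rule words_Suc_cases)
    show ?case
    proof (cases i)
      case 0
      then show ?thesis using Suc.prems l by (auto simp: lin_on_def)
    next
      case (Suc j)
      then show ?thesis using Suc.IH[of "\<lambda>k. G (x # k)" k j] Suc.prems l by simp
    qed
  qed simp
  then show "b \<in> carrier M \<Longrightarrow> G (l[i := a \<oplus>\<^bsub>M\<^esub> b]) = G (l[i := a]) + G (l[i := b])"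
    "G (l[i := c \<odot>\<^bsub>M\<^esub> a]) = smul c (G (l[i := a]))" by auto
qed

lemma words_update: "l \<in> words M n \<Longrightarrow> a \<in> carrier M \<Longrightarrow> l[i := a] \<in> words M n"
  using set_update_subset_insert[of l i a] by (auto simp: words_def)

definition tcoord :: "('a \<Rightarrow> ('i \<Rightarrow>\<^sub>0 'k::field)) \<Rightarrow> ('k, 'a) tensor \<Rightarrow> ('i list \<Rightarrow>\<^sub>0 'k)" where
  "tcoord \<kappa> P = lin (\<lambda>l. tens (map \<kappa> l)) (SOME p. p \<in> P)"

context
  fixes M :: "('k::field, 'a, 'z) module_scheme" and \<kappa> :: "'a \<Rightarrow> ('i \<Rightarrow>\<^sub>0 'k)" and I :: "'i set"
  assumes M: "coord M \<kappa> I"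
begin

private lemma M': "x \<in> carrier M \<Longrightarrow> y \<in> carrier M \<Longrightarrow> x \<oplus>\<^bsub>M\<^esub> y \<in> carrier M"
  "x \<in> carrier M \<Longrightarrow> c \<odot>\<^bsub>M\<^esub> x \<in> carrier M" using coordD[OF M] by auto

lemma multilinear_relations_subset: "multilinear_relations M n \<subseteq> fsp (words M n)"
  unfolding multilinear_relations_def by (auto intro!: fsp_closed words_update M')

text \<open>The entries are replaced by their basis expansions from left to right, modulo the
  relations; \<open>l1\<close> is the part that has been passed already.\<close>

lemma tensor_kernel_word:
  "l1 @ l2 \<in> words M n \<Longrightarrow>
   sing (l1 @ l2) 1 - lin (\<lambda>w. sing (l1 @ map (bas M \<kappa>) w) 1) (tens (map \<kappa> l2)) \<in> tensor_kernel M n"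
proof (induction l2 arbitrary: l1)
  case Nil
  then show ?case using psubD(1)[OF gen_subspace_free(1)[OF multilinear_relations_subset]] by (simp add: tensor_kernel_def)
next
  case (Cons a l2)
  note K = gen_subspace_free[OF multilinear_relations_subset, of n, folded tensor_kernel_def]
  have a: "a \<in> carrier M" and i: "length l1 < n" using Cons.prems by (auto simp: words_def)
  have 1: "sing (l1 @ a # l2) 1 - lin (\<lambda>i. sing (l1 @ bas M \<kappa> i # l2) 1) (\<kappa> a) \<in> tensor_kernel M n"
  proof (rule expand_mod[OF M K(1) a])
    fix x y c assume x: "x \<in> carrier M"
    show "sing (l1 @ (c \<odot>\<^bsub>M\<^esub> x) # l2) 1 - smul c (sing (l1 @ x # l2) 1) \<in> tensor_kernel M n"
      unfolding smul_sing
      by (rule subsetD[OF K(2)], unfold multilinear_relations_def, rule UnI2, rule CollectI)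
        (rule exI[of _ "l1 @ a # l2"], rule exI[of _ "length l1"], use x Cons.prems i in auto)
    assume y: "y \<in> carrier M"
    show "sing (l1 @ (x \<oplus>\<^bsub>M\<^esub> y) # l2) 1 - sing (l1 @ x # l2) 1 - sing (l1 @ y # l2) 1 \<in> tensor_kernel M n"
      by (rule subsetD[OF K(2)], unfold multilinear_relations_def, rule UnI1, rule CollectI)
        (rule exI[of _ "l1 @ a # l2"], rule exI[of _ "length l1"], use x y Cons.prems i in auto)
  qed
  have 2: "lin (\<lambda>i. sing (l1 @ bas M \<kappa> i # l2) 1 - lin (\<lambda>w. sing (l1 @ bas M \<kappa> i # map (bas M \<kappa>) w) 1) (tens (map \<kappa> l2))) (\<kappa> a) \<in> tensor_kernel M n"
  proof (rule psub_lin[OF K(1)])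
    fix i assume "i \<in> Poly_Mapping.keys (\<kappa> a)"
    then have "i \<in> I" using coordD(5)[OF M a] by (auto simp: fsp_def)
    then show "sing (l1 @ bas M \<kappa> i # l2) 1 - lin (\<lambda>w. sing (l1 @ bas M \<kappa> i # map (bas M \<kappa>) w) 1) (tens (map \<kappa> l2)) \<in> tensor_kernel M n"
      using Cons.IH[of "l1 @ [bas M \<kappa> i]"] Cons.prems bas(1)[OF M] by (auto simp: words_def)
  qed
  show ?case using psubD(2)[OF K(1) 1 2] by (simp only: lin_diff_fun list.map lin_tens_Cons) simp
qed

text \<open>One inclusion is multilinearity of \<open>tens\<close>. For the other, \<open>p\<close>
  is congruent to a combination of words in basis vectors whose coefficients are those of its image
  under \<open>tens\<close>, hence to zero.\<close>

lemma tensor_kernel_eq: "tensor_kernel M n = {p \<in> fsp (words M n). lin (\<lambda>l. tens (map \<kappa> l)) p = 0}"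
proof (intro equalityI subsetI)
  fix p assume "p \<in> tensor_kernel M n"
  moreover have "gen_subspace (free_space (words M n)) (multilinear_relations M n) \<subseteq>
    {p \<in> carrier (free_space (words M n)). lin (\<lambda>l. tens (map \<kappa> l)) p = 0}"
    by (rule gen_subspace_kernel[OF coordD(1)[OF coord_free_space]])
      (use multilinear_relations_subset in \<open>auto simp: lin_on_def multilinear_relations_def
         multilin_update(1)[OF multilin_tens[OF M]] multilin_update(2)[OF multilin_tens[OF M]]\<close>)
  ultimately show "p \<in> {p \<in> fsp (words M n). lin (\<lambda>l. tens (map \<kappa> l)) p = 0}"
    by (auto simp: tensor_kernel_def)
next
  fix p assume "p \<in> {p \<in> fsp (words M n). lin (\<lambda>l. tens (map \<kappa> l)) p = 0}"
  then have p: "p \<in> fsp (words M n)" "lin (\<lambda>l. tens (map \<kappa> l)) p = 0" by auto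
  note K = gen_subspace_free[OF multilinear_relations_subset, of n, folded tensor_kernel_def]
  have "lin (\<lambda>l. sing l 1 - lin (\<lambda>w. sing (map (bas M \<kappa>) w) 1) (tens (map \<kappa> l))) p \<in> tensor_kernel M n"
    by (rule psub_lin[OF K(1)]) (use p(1) tensor_kernel_word[of "[]"] in \<open>auto simp: fsp_def\<close>)
  also have "lin (\<lambda>l. sing l 1 - lin (\<lambda>w. sing (map (bas M \<kappa>) w) 1) (tens (map \<kappa> l))) p =
     p - lin (\<lambda>w. sing (map (bas M \<kappa>) w) 1) (lin (\<lambda>l. tens (map \<kappa> l)) p)"
    by (simp add: lin_diff_fun lin_lin)
  finally show "p \<in> tensor_kernel M n" by (simp add: p)
qed

lemma tens_map_bas: "w \<in> wds I n \<Longrightarrow> tens (map \<kappa> (map (bas M \<kappa>) w)) = sing w 1"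
proof -
  assume "w \<in> wds I n"
  then have "map \<kappa> (map (bas M \<kappa>) w) = map (\<lambda>i. sing i 1) w" using bas(2)[OF M] by auto
  then show ?thesis using tens_sing[of w] by (simp only:)
qed

lemma words_bas: "w \<in> wds I n \<Longrightarrow> map (bas M \<kappa>) w \<in> words M n"
  using bas(1)[OF M] by (auto simp: words_def)

private lemma tensor_img: "(lin (\<lambda>l. tens (map \<kappa> l))) ` carrier (free_space (words M n)) = fsp (wds I n)"
proof (intro equalityI subsetI)
  fix q assume "q \<in> (lin (\<lambda>l. tens (map \<kappa> l))) ` carrier (free_space (words M n))"
  then obtain p where p: "p \<in> fsp (words M n)" "q = lin (\<lambda>l. tens (map \<kappa> l)) p" by auto
  show "q \<in> fsp (wds I n)" unfolding p(2)
  proof (rule lin_fsp'[OF p(1)])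
    fix l assume "l \<in> words M n"
    then have "set (map \<kappa> l) \<subseteq> fsp I" "length l = n" using coordD(5)[OF M] by (auto simp: words_def)
    then show "tens (map \<kappa> l) \<in> fsp (wds I n)" using tens_fsp[of "map \<kappa> l" I] by simp
  qed
next
  fix q :: "'i list \<Rightarrow>\<^sub>0 'k" assume q: "q \<in> fsp (wds I n)"
  have "lin (\<lambda>l. tens (map \<kappa> l)) (lin (\<lambda>w. sing (map (bas M \<kappa>) w) 1) q) = q"
    unfolding lin_lin by (rule trans[OF lin_cong_fsp[OF q] lin_self]) (simp add: tens_map_bas del: map_map)
  moreover have "lin (\<lambda>w. sing (map (bas M \<kappa>) w) 1) q \<in> fsp (words M n)"
    by (rule lin_fsp'[OF q]) (use words_bas in auto)
  ultimately show "q \<in> (lin (\<lambda>l. tens (map \<kappa> l))) ` carrier (free_space (words M n))"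
    by (auto intro: image_eqI[OF sym])
qed

private lemma lin_on_lin: "lin_on (free_space G) (lin f)" by (simp add: lin_on_def)

lemmas tensor_quot = coordD(1)[OF coord_free_space] lin_on_lin tensor_img tensor_kernel_eq[unfolded free_space_simps(1)[symmetric]]

lemma coord_tensor_space: "coord (tensor_space M n) (tcoord \<kappa>) (wds I n)"
  unfolding tensor_space_def tcoord_def[abs_def] by (rule coord_quotient[OF tensor_quot])

lemma tcoord_pure: "l \<in> words M n \<Longrightarrow> tcoord \<kappa> (pure_tensor M n l) = tens (map \<kappa> l)"
  unfolding pure_tensor_def tcoord_def by (subst quotient_coord[OF tensor_quot]) auto

lemma pure_in: "l \<in> words M n \<Longrightarrow> pure_tensor M n l \<in> carrier (tensor_space M n)"
  unfolding pure_tensor_def tensor_space_def quotient_space_simps by auto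

lemma tensor_rep:
  assumes "P \<in> carrier (tensor_space M n)" shows "(SOME p. p \<in> P) \<in> fsp (words M n)"
proof -
  from assms obtain p where p: "p \<in> fsp (words M n)" "P = tensor_kernel M n +>\<^bsub>free_space (words M n)\<^esub> p"
    unfolding tensor_space_def quotient_space_simps by auto
  then have P: "P = {q \<in> fsp (words M n). lin (\<lambda>l. tens (map \<kappa> l)) q = lin (\<lambda>l. tens (map \<kappa> l)) p}"
    using quotient_coset[OF tensor_quot, of p] by auto
  then show ?thesis using p someI[of "\<lambda>q. q \<in> P" p] by auto
qed

text \<open>\<open>linear_ext\<close> looks at one representative of the coset only. A multilinear
  \<open>f\<close> factors through \<open>tens\<close>, so the result depends on the coordinates of
  the coset alone.\<close>

lemma linear_ext_tensor:
  assumes W: "coord W \<kappa>' J" and f: "\<And>l. l \<in> words M n \<Longrightarrow> f l \<in> carrier W"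
    and ml: "multilin M n (\<lambda>l. \<kappa>' (f l))" and P: "P \<in> carrier (tensor_space M n)"
  shows "linear_ext W f P \<in> carrier W"
    "\<kappa>' (linear_ext W f P) = lin (\<lambda>w. \<kappa>' (f (map (bas M \<kappa>) w))) (tcoord \<kappa> P)"
proof -
  note rep = tensor_rep[OF P]
  show "linear_ext W f P \<in> carrier W" by (rule linear_ext_coord[OF W]) (use rep f in \<open>auto simp: fsp_def\<close>)
  have "\<kappa>' (linear_ext W f P) = lin (\<lambda>l. \<kappa>' (f l)) (SOME p. p \<in> P)"
    by (rule linear_ext_coord[OF W]) (use rep f in \<open>auto simp: fsp_def\<close>)
  also have "\<dots> = lin (\<lambda>l. lin (\<lambda>w. \<kappa>' (f (map (bas M \<kappa>) w))) (tens (map \<kappa> l))) (SOME p. p \<in> P)"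
    by (rule lin_cong_fsp[OF rep]) (rule multilin_expand[OF M ml])
  finally show "\<kappa>' (linear_ext W f P) = lin (\<lambda>w. \<kappa>' (f (map (bas M \<kappa>) w))) (tcoord \<kappa> P)"
    by (simp add: tcoord_def lin_lin)
qed

lemma linear_ext_pure:
  assumes W: "coord W \<kappa>' J" and f: "\<And>l. l \<in> words M n \<Longrightarrow> f l \<in> carrier W"
    and ml: "multilin M n (\<lambda>l. \<kappa>' (f l))" and l: "l \<in> words M n"
  shows "linear_ext W f (pure_tensor M n l) = f l"
proof (rule coordD(12)[OF W])
  note * = linear_ext_tensor[OF W f ml pure_in[OF l]]
  show "linear_ext W f (pure_tensor M n l) \<in> carrier W" by (rule *)
  show "\<kappa>' (linear_ext W f (pure_tensor M n l)) = \<kappa>' (f l)"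
    using *(2) multilin_expand[OF M ml l] tcoord_pure[OF l] by simp
qed (rule f[OF l])

end

section \<open>Coordinates on tensor products, duals and direct sums\<close>

definition tens2 :: "('i \<Rightarrow>\<^sub>0 'k::field) \<Rightarrow> ('j \<Rightarrow>\<^sub>0 'k) \<Rightarrow> ('i \<times> 'j \<Rightarrow>\<^sub>0 'k)" where
  "tens2 p q = lin (\<lambda>i. lin (\<lambda>j. sing (i, j) 1) q) p"

lemma tens2_simps[simp]:
  "tens2 (p + p') q = tens2 p q + tens2 p' q" "tens2 (smul c p) q = smul c (tens2 p q)"
  "tens2 p (q + q') = tens2 p q + tens2 p q'" "tens2 p (smul c q) = smul c (tens2 p q)"
  "tens2 (sing i 1) (sing j 1) = sing (i, j) 1"
  by (auto simp: tens2_def lin_add_fun lin_smul_fun)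

lemma coord_tensor_product:
  fixes M :: "('k::field, 'a, 'y) module_scheme" and \<kappa> :: "'a \<Rightarrow> 'i \<Rightarrow>\<^sub>0 'k"
    and N :: "('k, 'b, 'z) module_scheme" and \<kappa>' :: "'b \<Rightarrow> 'j \<Rightarrow>\<^sub>0 'k"
  assumes M: "coord M \<kappa> I" and N: "coord N \<kappa>' J"
  shows "\<exists>\<phi>. coord (tensor_product M N) \<phi> (I \<times> J)"
proof -
  let ?G = "carrier M \<times> carrier N" and ?R = "bilinear_relations M N"
  let ?\<phi> = "lin (\<lambda>(x, y). tens2 (\<kappa> x) (\<kappa>' y))"
  note M' = coordD[OF M] and N' = coordD[OF N]
  have R: "?R \<subseteq> fsp ?G"
    unfolding bilinear_relations_def by (auto intro!: fsp_closed M' N')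
  let ?K = "gen_subspace (free_space ?G) ?R"
  note K = gen_subspace_free[OF R]
  have 1: "sing (x, y) 1 - lin (\<lambda>i. sing (bas M \<kappa> i, y) 1) (\<kappa> x) \<in> ?K" if "x \<in> carrier M" "y \<in> carrier N" for x y
  proof (rule expand_mod[OF M K(1) that(1)])
    fix a b c assume a: "a \<in> carrier M"
    show "sing (c \<odot>\<^bsub>M\<^esub> a, y) 1 - smul c (sing (a, y) 1) \<in> ?K"
      using a that unfolding smul_sing mult_1_right
      by (intro subsetD[OF K(2)]) (unfold bilinear_relations_def, blast)
    assume b: "b \<in> carrier M"
    show "sing (a \<oplus>\<^bsub>M\<^esub> b, y) 1 - sing (a, y) 1 - sing (b, y) 1 \<in> ?K"
      using a b that by (intro subsetD[OF K(2)]) (unfold bilinear_relations_def, blast)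
  qed
  have 2: "sing (x, y) 1 - lin (\<lambda>j. sing (x, bas N \<kappa>' j) 1) (\<kappa>' y) \<in> ?K" if "x \<in> carrier M" "y \<in> carrier N" for x y
  proof (rule expand_mod[OF N K(1) that(2)])
    fix a b c assume a: "a \<in> carrier N"
    show "sing (x, c \<odot>\<^bsub>N\<^esub> a) 1 - smul c (sing (x, a) 1) \<in> ?K"
      using a that unfolding smul_sing mult_1_right
      by (intro subsetD[OF K(2)]) (unfold bilinear_relations_def, blast)
    assume b: "b \<in> carrier N"
    show "sing (x, a \<oplus>\<^bsub>N\<^esub> b) 1 - sing (x, a) 1 - sing (x, b) 1 \<in> ?K"
      using a b that by (intro subsetD[OF K(2)]) (unfold bilinear_relations_def, blast)
  qed
  have 3: "sing (x, y) 1 - lin (\<lambda>(i, j). sing (bas M \<kappa> i, bas N \<kappa>' j) 1) (tens2 (\<kappa> x) (\<kappa>' y)) \<in> ?K"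
    if xy: "x \<in> carrier M" "y \<in> carrier N" for x y
  proof -
    have "lin (\<lambda>i. sing (bas M \<kappa> i, y) 1 - lin (\<lambda>j. sing (bas M \<kappa> i, bas N \<kappa>' j) 1) (\<kappa>' y)) (\<kappa> x) \<in> ?K"
      by (rule psub_lin[OF K(1)], rule 2) (use M'(5)[OF xy(1)] bas(1)[OF M] xy in \<open>auto simp: fsp_def\<close>)
    from psubD(2)[OF K(1) 1[OF xy] this] show ?thesis
      by (simp add: lin_diff_fun tens2_def lin_lin)
  qed
  have ker: "?K = {p \<in> carrier (free_space ?G). ?\<phi> p = 0}"
  proof (intro equalityI subsetI)
    fix p assume "p \<in> ?K"
    moreover have "?K \<subseteq> {p \<in> carrier (free_space ?G). ?\<phi> p = 0}"
      by (rule gen_subspace_kernel[OF coordD(1)[OF coord_free_space]])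
        (use R in \<open>auto simp: lin_on_def bilinear_relations_def M' N'\<close>)
    ultimately show "p \<in> {p \<in> carrier (free_space ?G). ?\<phi> p = 0}" by auto
  next
    fix p assume "p \<in> {p \<in> carrier (free_space ?G). ?\<phi> p = 0}"
    then have p: "p \<in> fsp ?G" "?\<phi> p = 0" by auto
    have "lin (\<lambda>z. sing z 1 - lin (\<lambda>(i, j). sing (bas M \<kappa> i, bas N \<kappa>' j) 1) (case z of (x, y) \<Rightarrow> tens2 (\<kappa> x) (\<kappa>' y))) p \<in> ?K"
      by (rule psub_lin[OF K(1)]) (use p(1) 3 in \<open>auto simp: fsp_def\<close>)
    also have "lin (\<lambda>z. sing z 1 - lin (\<lambda>(i, j). sing (bas M \<kappa> i, bas N \<kappa>' j) 1) (case z of (x, y) \<Rightarrow> tens2 (\<kappa> x) (\<kappa>' y))) p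
      = p - lin (\<lambda>(i, j). sing (bas M \<kappa> i, bas N \<kappa>' j) 1) (?\<phi> p)"
      by (simp add: lin_diff_fun lin_lin)
    finally show "p \<in> ?K" by (simp add: p)
  qed
  have img: "?\<phi> ` carrier (free_space ?G) = fsp (I \<times> J)"
  proof (intro equalityI subsetI)
    fix q assume "q \<in> ?\<phi> ` carrier (free_space ?G)"
    then obtain p where p: "p \<in> fsp ?G" "q = ?\<phi> p" by auto
    show "q \<in> fsp (I \<times> J)" unfolding p(2)
    proof (rule lin_fsp'[OF p(1)], clarify)
      fix x y assume "x \<in> carrier M" "y \<in> carrier N"
      then show "tens2 (\<kappa> x) (\<kappa>' y) \<in> fsp (I \<times> J)" unfolding tens2_def
        by (intro lin_fsp'[OF M'(5)] lin_fsp'[OF N'(5)]) auto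
    qed
  next
    fix q :: "'i \<times> 'j \<Rightarrow>\<^sub>0 'k" assume q: "q \<in> fsp (I \<times> J)"
    have "?\<phi> (lin (\<lambda>(i, j). sing (bas M \<kappa> i, bas N \<kappa>' j) 1) q) = q"
      unfolding lin_lin by (rule trans[OF lin_cong_fsp[OF q] lin_self]) (auto simp: bas[OF M] bas[OF N])
    moreover have "lin (\<lambda>(i, j). sing (bas M \<kappa> i, bas N \<kappa>' j) 1) q \<in> fsp ?G"
      by (rule lin_fsp'[OF q]) (auto simp: bas[OF M] bas[OF N])
    ultimately show "q \<in> ?\<phi> ` carrier (free_space ?G)" by (auto intro: image_eqI[OF sym])
  qed
  show ?thesis unfolding tensor_product_def Let_def
    by (rule exI, rule coord_quotient[OF coordD(1)[OF coord_free_space] _ img ker]) (simp add: lin_on_def)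
qed

lemma scalars_simps[simp]: "carrier scalars = UNIV" "a \<oplus>\<^bsub>scalars\<^esub> b = a + b" "c \<odot>\<^bsub>scalars\<^esub> a = c * a" "\<zero>\<^bsub>scalars\<^esub> = 0"
  "a \<otimes>\<^bsub>scalars\<^esub> b = a * b" "\<one>\<^bsub>scalars\<^esub> = 1"
  by (auto simp: scalars_def)

lemma coord_dual_space:
  fixes M :: "('k::field, 'a, 'z) module_scheme" and \<kappa> :: "'a \<Rightarrow> 'i \<Rightarrow>\<^sub>0 'k"
  assumes M: "coord M \<kappa> I" and I: "finite I"
  shows "coord (dual_space M) (\<lambda>f. \<Sum>i\<in>I. sing i (f (bas M \<kappa> i))) I"
proof -
  note M' = coordD[OF M]
  let ?b = "bas M \<kappa>"
  have lk: "lkp (\<Sum>i\<in>I. sing i (c i)) j = (if j \<in> I then c j else 0)" for c :: "'i \<Rightarrow> 'k" and j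
    using I by (auto simp: lookup_sum lookup_single when_def)
  have expand: "f x = (\<Sum>i\<in>I. lkp (\<kappa> x) i * f (?b i))" if f: "f \<in> carrier (dual_space M)" and x: "x \<in> carrier M" for f x
  proof -
    \<comment> \<open>Scalars are regarded as functions on a one-point set, so that the expansion of
      linear maps with values in a free space applies to functionals.\<close>
    have "lin_on M (\<lambda>x. sing () (f x))"
      using f by (auto simp: lin_on_def dual_space_def hom_space_def single_add)
    from expand_lin_on[OF M x this]
    have "sing () (f x) = lin (\<lambda>i. sing () (f (?b i))) (\<kappa> x)" .
    also have "\<dots> = (\<Sum>i\<in>I. smul (lkp (\<kappa> x) i) (sing () (f (?b i))))"
      using M'(5)[OF x] I by (intro lin_superset) (auto simp: fsp_def)
    finally have "lkp (sing () (f x)) () = lkp (\<Sum>i\<in>I. smul (lkp (\<kappa> x) i) (sing () (f (?b i)))) ()" by simp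
    then show ?thesis by (simp add: lookup_sum)
  qed
  show ?thesis
  proof (rule coordI)
    show "bij_betw (\<lambda>f. \<Sum>i\<in>I. sing i (f (?b i))) (carrier (dual_space M)) (fsp I)"
    proof (rule bij_betw_byWitness[of _ "\<lambda>p. \<lambda>x\<in>carrier M. \<Sum>i\<in>I. lkp (\<kappa> x) i * lkp p i"])
      show "\<forall>f\<in>carrier (dual_space M). (\<lambda>x\<in>carrier M. \<Sum>i\<in>I. lkp (\<kappa> x) i * lkp (\<Sum>i\<in>I. sing i (f (?b i))) i) = f"
      proof
        fix f assume f: "f \<in> carrier (dual_space M)"
        then have "f \<in> extensional (carrier M)" by (auto simp: dual_space_def hom_space_def PiE_def)
        then show "(\<lambda>x\<in>carrier M. \<Sum>i\<in>I. lkp (\<kappa> x) i * lkp (\<Sum>i\<in>I. sing i (f (?b i))) i) = f"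
          by (intro extensionalityI[of _ "carrier M"]) (simp_all add: lk expand[OF f])
      qed
      show "\<forall>p\<in>fsp I. (\<Sum>i\<in>I. sing i ((\<lambda>x\<in>carrier M. \<Sum>i\<in>I. lkp (\<kappa> x) i * lkp p i) (?b i))) = p"
      proof
        fix p :: "'i \<Rightarrow>\<^sub>0 'k" assume p: "p \<in> fsp I"
        show "(\<Sum>i\<in>I. sing i ((\<lambda>x\<in>carrier M. \<Sum>i\<in>I. lkp (\<kappa> x) i * lkp p i) (?b i))) = p"
          using p I by (intro poly_mapping_eqI) (auto simp: lk bas[OF M] lookup_single when_def fsp_iff if_distrib[of "\<lambda>x. x * _"] cong: if_cong)
      qed
      show "(\<lambda>p. \<lambda>x\<in>carrier M. \<Sum>i\<in>I. lkp (\<kappa> x) i * lkp p i) ` fsp I \<subseteq> carrier (dual_space M)"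
        by (auto simp: dual_space_def hom_space_def M' lookup_add algebra_simps sum.distrib sum_distrib_left)
    qed (auto intro!: fsp_sum)
    show "lin_on (dual_space M) (\<lambda>f. \<Sum>i\<in>I. sing i (f (?b i)))"
      by (auto simp: lin_on_def dual_space_def hom_space_def bas[OF M] single_add sum.distrib smul_sum)
  qed (auto simp: dual_space_def hom_space_def M' algebra_simps bas[OF M])
qed

lemma coord_direct_sum:
  fixes M :: "'t \<Rightarrow> ('k::field, 'a, 'z) module_scheme" and \<kappa> :: "'t \<Rightarrow> 'a \<Rightarrow> 'i \<Rightarrow>\<^sub>0 'k"
  assumes M: "\<And>t. t \<in> T \<Longrightarrow> coord (M t) (\<kappa> t) (I t)" and T: "finite T"
  shows "coord (direct_sum T M) (\<lambda>x. \<Sum>t\<in>T. lin (\<lambda>i. sing (t, i) 1) (\<kappa> t (x t))) (Sigma T I)"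
proof -
  note M' = coordD[OF M]
  have lk0: "lkp (lin (\<lambda>i. sing (t, i) 1) p) (s, j) = (if s = t then lkp p j else 0)" for p :: "'i \<Rightarrow>\<^sub>0 'k" and s t :: 't and j
  proof -
    have "p \<in> fsp UNIV" by simp
    then show ?thesis by (induction rule: fsp_induct) (auto simp: lookup_add lookup_single when_def)
  qed
  have lk: "lkp (\<Sum>t\<in>T. lin (\<lambda>i. sing (t, i) 1) (p t)) (s, j) = (if s \<in> T then lkp (p s) j else 0)"
    for p :: "'t \<Rightarrow> 'i \<Rightarrow>\<^sub>0 'k" and s j
    using T by (simp add: lookup_sum lk0)
  show ?thesis
  proof (rule coordI)
    show "bij_betw (\<lambda>x. \<Sum>t\<in>T. lin (\<lambda>i. sing (t, i) 1) (\<kappa> t (x t))) (carrier (direct_sum T M)) (fsp (Sigma T I))"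
    proof (rule bij_betw_imageI)
      show "inj_on (\<lambda>x. \<Sum>t\<in>T. lin (\<lambda>i. sing (t, i) 1) (\<kappa> t (x t))) (carrier (direct_sum T M))"
      proof (rule inj_onI)
        fix x y assume x: "x \<in> carrier (direct_sum T M)" and y: "y \<in> carrier (direct_sum T M)"
          and eq: "(\<Sum>t\<in>T. lin (\<lambda>i. sing (t, i) 1) (\<kappa> t (x t))) = (\<Sum>t\<in>T. lin (\<lambda>i. sing (t, i) 1) (\<kappa> t (y t)))"
        have "x t = y t" if t: "t \<in> T" for t
        proof (rule M'(12)[OF t])
          show "\<kappa> t (x t) = \<kappa> t (y t)"
            using arg_cong[OF eq, of "\<lambda>p. lkp p (t, _)"] t by (intro poly_mapping_eqI) (simp add: lk)
        qed (use x y t in \<open>auto simp: direct_sum_def\<close>)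
        with x y show "x = y" by (intro extensionalityI[of _ T]) (auto simp: direct_sum_def PiE_def)
      qed
      show "(\<lambda>x. \<Sum>t\<in>T. lin (\<lambda>i. sing (t, i) 1) (\<kappa> t (x t))) ` carrier (direct_sum T M) = fsp (Sigma T I)"
      proof (intro equalityI subsetI)
        fix p assume "p \<in> (\<lambda>x. \<Sum>t\<in>T. lin (\<lambda>i. sing (t, i) 1) (\<kappa> t (x t))) ` carrier (direct_sum T M)"
        then show "p \<in> fsp (Sigma T I)"
          by (auto simp: direct_sum_def intro!: fsp_sum lin_fsp'[OF M'(5)])
      next
        fix p :: "'t \<times> 'i \<Rightarrow>\<^sub>0 'k" assume p: "p \<in> fsp (Sigma T I)"
        define q where "q t = Poly_Mapping.map_key (Pair t) p" for t
        have lq: "lkp (q t) j = lkp p (t, j)" for t j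
          unfolding q_def by (simp add: Poly_Mapping.map_key.rep_eq inj_on_def)
        have "q t \<in> \<kappa> t ` carrier (M t)" if "t \<in> T" for t
          using p that M'(3)[OF that] by (auto simp: bij_betw_def fsp_iff lq)
        then have "\<forall>t\<in>T. \<exists>x. x \<in> carrier (M t) \<and> \<kappa> t x = q t" by (metis imageE)
        then obtain x where x: "\<And>t. t \<in> T \<Longrightarrow> x t \<in> carrier (M t) \<and> \<kappa> t (x t) = q t" by metis
        have "p = (\<Sum>t\<in>T. lin (\<lambda>i. sing (t, i) 1) (\<kappa> t (restrict x T t)))"
        proof (rule poly_mapping_eqI)
          fix k :: "'t \<times> 'i" obtain t j where k: "k = (t, j)" by (cases k)
          have "lkp p (t, j) = 0" if "t \<notin> T" using p that unfolding fsp_iff by (metis SigmaD1)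
          then show "lkp p k = lkp (\<Sum>t\<in>T. lin (\<lambda>i. sing (t, i) 1) (\<kappa> t (restrict x T t))) k"
            by (auto simp: k lk x lq)
        qed
        then show "p \<in> (\<lambda>x. \<Sum>t\<in>T. lin (\<lambda>i. sing (t, i) 1) (\<kappa> t (x t))) ` carrier (direct_sum T M)"
          by (rule image_eqI[where x = "restrict x T"]) (use x in \<open>auto simp: direct_sum_def\<close>)
      qed
    qed
    show "lin_on (direct_sum T M) (\<lambda>x. \<Sum>t\<in>T. lin (\<lambda>i. sing (t, i) 1) (\<kappa> t (x t)))"
      using M'(6,7) by (auto simp: lin_on_def direct_sum_def smul_sum PiE_iff sum.distrib[symmetric] intro!: sum.cong)
  qed (use M' in \<open>auto simp: direct_sum_def PiE_iff intro!: sum.neutral\<close>)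
qed

section \<open>Coordinates of \<open>V\<close> in a numbered basis\<close>

lemma space_of_simps[simp]: "carrier (space_of scale) = UNIV" "v \<oplus>\<^bsub>space_of scale\<^esub> w = v + w"
  "c \<odot>\<^bsub>space_of scale\<^esub> v = scale c v" "\<zero>\<^bsub>space_of scale\<^esub> = 0"
  by (auto simp: space_of_def)

context
  fixes scale :: "'k::field \<Rightarrow> 'v::ab_group_add \<Rightarrow> 'v" and Basis :: "'v set" and e :: "nat \<Rightarrow> 'v" and d :: nat
  assumes fd: "finite_dimensional_vector_space scale Basis" and e: "bij_betw e {..<d} Basis"
begin

text \<open>Numbering the basis vectors provides the linear order of letters on which sorted words
  and signs rest.\<close>

definition vcoord :: "'v \<Rightarrow> (nat \<Rightarrow>\<^sub>0 'k)" where
  "vcoord v = (\<Sum>i<d. sing i (module.representation scale Basis v (e i)))"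

interpretation V: finite_dimensional_vector_space scale Basis by (rule fd)

lemma vcoord_add: "vcoord (v + w) = vcoord v + vcoord w"
  unfolding vcoord_def by (simp add: V.representation_add[OF V.independent_Basis] V.span_Basis single_add sum.distrib)

lemma vcoord_scale: "vcoord (scale c v) = smul c (vcoord v)"
  unfolding vcoord_def by (simp add: V.representation_scale[OF V.independent_Basis] V.span_Basis smul_sum)

lemma vcoord_e: "i < d \<Longrightarrow> vcoord (e i) = sing i 1"
proof -
  assume i: "i < d"
  have "vcoord (e i) = (\<Sum>j<d. if j = i then sing i 1 else 0)"
    unfolding vcoord_def
  proof (rule sum.cong)
    fix j assume j: "j \<in> {..<d}"
    have "e i \<in> Basis" using e i by (auto simp: bij_betw_def)
    moreover have "e j = e i \<longleftrightarrow> j = i" using e i j by (auto simp: bij_betw_def inj_on_def)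
    ultimately show "sing j (module.representation scale Basis (e i) (e j)) = (if j = i then sing i 1 else 0)"
      by (simp add: V.representation_basis[OF V.independent_Basis])
  qed simp
  then show ?thesis using i by simp
qed

lemma vcoord_expand: "v = (\<Sum>i<d. scale (lkp (vcoord v) i) (e i))"
proof -
  have "(\<Sum>b\<in>Basis. scale (module.representation scale Basis v b) b) = v"
    using V.sum_representation_eq[OF V.independent_Basis _ V.finite_Basis subset_refl, of v] V.span_Basis by auto
  moreover have "(\<Sum>b\<in>Basis. scale (module.representation scale Basis v b) b) =
      (\<Sum>i<d. scale (module.representation scale Basis v (e i)) (e i))"
    by (rule sum.reindex_bij_betw[OF e, symmetric])
  moreover have "lkp (vcoord v) i = module.representation scale Basis v (e i)" if "i < d" for i
    using that by (simp add: vcoord_def lookup_sum lookup_single when_def)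
  ultimately show ?thesis by simp
qed

lemma coord_space_of: "coord (space_of scale) vcoord {..<d}"
proof (rule coordI)
  show lin: "lin_on (space_of scale) vcoord" by (simp add: lin_on_def vcoord_add vcoord_scale)
  have sum: "vcoord (sum f S) = (\<Sum>i\<in>S. vcoord (f i))" for f and S :: "nat set"
  proof -
    have "vcoord 0 = 0" using vcoord_scale[of 0 0] by simp
    then show ?thesis by (induction S rule: infinite_finite_induct) (auto simp: vcoord_add)
  qed
  have *: "vcoord (\<Sum>i<d. scale (lkp p i) (e i)) = p" if "p \<in> fsp {..<d}" for p
    using that by (intro poly_mapping_eqI) (auto simp: sum vcoord_scale vcoord_e lookup_sum lookup_single when_def fsp_iff)
  show "bij_betw vcoord (carrier (space_of scale)) (fsp {..<d})"
    by (rule bij_betw_byWitness[of _ "\<lambda>p. \<Sum>i<d. scale (lkp p i) (e i)"])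
      (use vcoord_expand * in \<open>auto simp: vcoord_def intro!: fsp_sum fsp_closed\<close>)
  show "vcoord \<zero>\<^bsub>space_of scale\<^esub> = 0" using vcoord_scale[of 0 0] by simp
qed auto

end

section \<open>Exterior powers\<close>

text \<open>The sign of the permutation that sorts a word with distinct letters.\<close>

primrec wsign :: "nat list \<Rightarrow> 'k::comm_ring_1" where
  "wsign [] = 1"
| "wsign (a # w) = (-1) ^ length (filter (\<lambda>b. b < a) w) * wsign w"

text \<open>The termination measure for sorting a word by adjacent transpositions.\<close>

primrec inversions :: "nat list \<Rightarrow> nat" where
  "inversions [] = 0"
| "inversions (a # w) = length (filter (\<lambda>b. b < a) w) + inversions w"

text \<open>The normal form of a wedge product of basis vectors; this becomes the coordinate map of
  the exterior power.\<close>

definition ext :: "(nat list \<Rightarrow>\<^sub>0 'k::field) \<Rightarrow> (nat list \<Rightarrow>\<^sub>0 'k)" where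
  "ext = lin (\<lambda>w. if distinct w then sing (sort w) (wsign w) else 0)"

lemma wsign_swap: "a \<noteq> b \<Longrightarrow> wsign (xs @ b # a # ys) = - wsign (xs @ a # b # ys)"
  by (induction xs) auto

lemma inversions_swap: "b < a \<Longrightarrow> inversions (xs @ b # a # ys) < inversions (xs @ a # b # ys)"
  by (induction xs) auto

lemma sort_swap: "sort (xs @ b # a # ys) = sort (xs @ a # b # ys)"
  by (rule properties_for_sort) auto

lemma wsign_sorted: "sorted w \<Longrightarrow> wsign w = 1"
proof (induction w)
  case (Cons a w)
  then have "filter (\<lambda>b. b < a) w = []" by (auto simp: filter_empty_conv)
  with Cons show ?case by simp
qed simp

lemma unsorted_descent: "\<not> sorted w \<Longrightarrow> \<exists>xs a b ys. w = xs @ a # b # ys \<and> b < (a::nat)"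
proof (induction w rule: induct_list012)
  case (3 a b w)
  show ?case
  proof (cases "a \<le> b")
    case True
    with 3(3) have "\<not> sorted (b # w)" by (simp only: sorted2) simp
    from 3(2)[OF this] obtain xs c c' ys where "b # w = xs @ c # c' # ys" "c' < c" by blast
    then show ?thesis by (intro exI[of _ "a # xs"]) auto
  qed (intro exI[of _ "[]"], auto)
qed auto

fun swapat :: "nat \<Rightarrow> 'a list \<Rightarrow> 'a list" where
  "swapat 0 (a # b # l) = b # a # l"
| "swapat (Suc k) (a # l) = a # swapat k l"
| "swapat k l = l"

lemma swapat_append: "swapat (length xs) (xs @ a # b # ys) = xs @ b # a # ys"
  by (induction xs) auto

lemma tens_swap: "tens (xs @ q # p # ys) = lin (\<lambda>w. sing (swapat (length xs) w) 1) (tens (xs @ p # q # ys))"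
proof (induction xs)
  case Nil
  have swap: "lin (\<lambda>i. lin (\<lambda>j. F i j) q) p = lin (\<lambda>j. lin (\<lambda>i. F i j) p) q"
    for F :: "'a \<Rightarrow> 'a \<Rightarrow> 'a list \<Rightarrow>\<^sub>0 'b" and p q
    unfolding lin_def smul_sum by (subst sum.swap) (simp add: mult.commute)
  show ?case by (simp add: lin_lin) (rule swap)
next
  case (Cons r xs)
  then show ?case by (simp add: lin_lin)
qed

text \<open>Antisymmetry for arbitrary vectors: exchanging two neighbours exchanges the
  corresponding letters in every word of the expansion.\<close>

lemma ext_swap:
  fixes p q :: "nat \<Rightarrow>\<^sub>0 'k::field"
  shows "ext (tens (xs @ q # p # ys)) = - ext (tens (xs @ p # q # ys))"
proof -
  have "tens (xs @ p # q # ys) \<in> fsp (wds UNIV (length (xs @ p # q # ys)))"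
    by (rule tens_fsp) simp
  then have "lin (\<lambda>w. ext (sing (swapat (length xs) w) 1)) (tens (xs @ p # q # ys)) = lin (\<lambda>w. - ext (sing w 1)) (tens (xs @ p # q # ys))"
  proof (rule lin_cong_fsp)
    fix w :: "nat list" assume "w \<in> wds UNIV (length (xs @ p # q # ys))"
    then have w: "length w = length xs + 2 + length ys" by simp
    define us where "us = take (length xs) w"
    have "length (drop (length xs) w) = length ys + 2" using w by simp
    then obtain a b vs where d: "drop (length xs) w = a # b # vs"
      by (metis (no_types, opaque_lifting) Suc_eq_plus1 add_2_eq_Suc' length_Suc_conv)
    have weq: "w = us @ a # b # vs" using d by (metis append_take_drop_id us_def)
    have us: "length us = length xs" using w by (simp add: us_def)
    show "ext (sing (swapat (length xs) w) 1) = - ext (sing w 1)"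
      unfolding weq us[symmetric] swapat_append
      by (cases "a = b") (auto simp: ext_def sort_swap[of us b a vs] wsign_swap[of a b us vs] single_uminus)
  qed
  also have "lin (\<lambda>w. - ext (sing w 1)) (tens (xs @ p # q # ys)) = - ext (tens (xs @ p # q # ys))"
  proof -
    have "plin (ext :: (nat list \<Rightarrow>\<^sub>0 'k) \<Rightarrow> _)" by (simp add: ext_def)
    from plin_eq_lin[OF this] have "ext q = lin (\<lambda>w. ext (sing w 1)) q" for q :: "nat list \<Rightarrow>\<^sub>0 'k" .
    moreover have "lin (\<lambda>w. - ext (sing w 1)) q = - lin (\<lambda>w. ext (sing w 1)) q" for q :: "nat list \<Rightarrow>\<^sub>0 'k"
      using lin_diff_fun[of "\<lambda>w. 0" "\<lambda>w. ext (sing w 1)" q] by simp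
    ultimately show ?thesis by metis
  qed
  also have "lin (\<lambda>w. ext (sing (swapat (length xs) w) 1)) (tens (xs @ p # q # ys)) = ext (tens (xs @ q # p # ys))"
    unfolding tens_swap[of xs q p ys] by (rule plin_lin_comp[symmetric]) (simp add: ext_def)
  finally show ?thesis .
qed

text \<open>Moving the two equal vectors next to each other costs only signs. Then antisymmetry
  makes twice the value zero, and 2 is invertible.\<close>

lemma ext_repeat:
  fixes p :: "nat \<Rightarrow>\<^sub>0 'k::field_char_0"
  shows "ext (tens (xs @ p # ys @ p # zs)) = 0"
proof (induction ys arbitrary: xs)
  case Nil
  have "ext (tens (xs @ p # p # zs)) = - ext (tens (xs @ p # p # zs))" by (rule ext_swap)
  then have "smul 2 (ext (tens (xs @ p # p # zs))) = smul (1 + 1) 0"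
    unfolding one_add_one[symmetric] smul_add_left by (metis add.right_inverse smul_simps(4,6) add_0)
  then have "smul (1/2) (smul 2 (ext (tens (xs @ p # p # zs)))) = 0" by simp
  then show ?case by simp
next
  case (Cons y ys)
  show ?case using ext_swap[of xs p y "ys @ p # zs"] Cons[of "xs @ [y]"] by simp
qed

lemma gen_subspace_submodule:
  assumes M: "module ground M" and S: "S \<subseteq> carrier M"
  shows "submodule (gen_subspace M S) ground M" "S \<subseteq> gen_subspace M S"
proof -
  interpret module ground M by fact
  have sub: "submodule H ground M \<Longrightarrow> \<zero>\<^bsub>M\<^esub> \<in> H \<and> (\<forall>x\<in>H. \<forall>y\<in>H. x \<oplus>\<^bsub>M\<^esub> y \<in> H) \<and> (\<forall>c. \<forall>x\<in>H. c \<odot>\<^bsub>M\<^esub> x \<in> H)" for H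
  proof -
    assume H: "submodule H ground M"
    interpret H: submodule H ground M by fact
    show ?thesis using H.one_closed H.m_closed H.smult_closed by auto
  qed
  show "submodule (gen_subspace M S) ground M"
  proof (rule submoduleI'[OF M])
    show "gen_subspace M S \<subseteq> carrier M" unfolding gen_subspace_def using carrier_is_submodule S by auto
  qed (use sub in \<open>auto simp: gen_subspace_def\<close>)
qed (auto simp: gen_subspace_def)

text \<open>Everything is computed with the image \<open>K\<close> of the relations in the
  coordinates of the tensor space. Modulo \<open>K\<close>, adjacent letters anticommute, so
  induction on the number of inversions brings every word to its normal form under
  \<open>ext\<close>. Hence the kernel of \<open>ext\<close> is no larger than the
  relations.\<close>

lemma coord_exterior_power:
  fixes M :: "('k::field_char_0, 'a, 'z) module_scheme" and \<kappa> :: "'a \<Rightarrow> nat \<Rightarrow>\<^sub>0 'k"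
  assumes M: "coord M \<kappa> I"
  shows "\<exists>\<phi>. coord (exterior_power M n) \<phi> {s \<in> wds I n. sorted s \<and> distinct s}"
proof -
  let ?T = "tensor_space M n" and ?b = "bas M \<kappa>"
  note T = coord_tensor_space[OF M, of n]
  note T' = coordD[OF T]
  let ?S = "{pure_tensor M n l | l. l \<in> words M n \<and> \<not> distinct l}"
  let ?N = "gen_subspace ?T ?S" and ?\<phi> = "\<lambda>P. ext (tcoord \<kappa> P)"
  have S: "?S \<subseteq> carrier ?T" using pure_in[OF M] by auto
  note N = gen_subspace_submodule[OF T'(1) S]
  interpret N: submodule ?N ground ?T by (rule N(1))
  have Nc: "?N \<subseteq> carrier ?T" using N.subset by simp
  have plin_ext: "plin ext" by (simp add: ext_def)
  have lin: "lin_on ?T ?\<phi>" using T' by (auto simp: lin_on_def plinD[OF plin_ext])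
  define K where "K = tcoord \<kappa> ` ?N"
  have K: "psub K" unfolding psub_def
  proof (intro conjI ballI allI)
    have "\<zero>\<^bsub>?T\<^esub> \<in> ?N" using N.one_closed by simp
    then show "0 \<in> K" unfolding K_def by (rule rev_image_eqI) (rule T'(8)[symmetric])
    fix p q assume "p \<in> K" "q \<in> K"
    then obtain P Q where PQ: "P \<in> ?N" "Q \<in> ?N" "p = tcoord \<kappa> P" "q = tcoord \<kappa> Q" by (auto simp: K_def)
    then have "P \<in> carrier ?T" "Q \<in> carrier ?T" using Nc by blast+
    then have "p + q = tcoord \<kappa> (P \<oplus>\<^bsub>?T\<^esub> Q)" by (simp only: PQ T'(6))
    then show "p + q \<in> K" unfolding K_def by (rule image_eqI) (use N.m_closed PQ in simp)
  next
    fix p c assume "p \<in> K"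
    then obtain P where P: "P \<in> ?N" "p = tcoord \<kappa> P" by (auto simp: K_def)
    then have "P \<in> carrier ?T" using Nc by blast
    then have "smul c p = tcoord \<kappa> (c \<odot>\<^bsub>?T\<^esub> P)" by (simp only: P T'(7))
    then show "smul c p \<in> K" unfolding K_def by (rule image_eqI) (use N.smult_closed P in simp)
  qed
  have Krep: "tens (map \<kappa> l) \<in> K" if "l \<in> words M n" "\<not> distinct l" for l
  proof -
    have "pure_tensor M n l \<in> ?N" using N(2) that by blast
    then have "tcoord \<kappa> (pure_tensor M n l) \<in> K" unfolding K_def by (rule imageI)
    then show ?thesis by (simp only: tcoord_pure[OF M that(1)])
  qed
  have Ksing: "sing w 1 \<in> K" if "w \<in> wds I n" "\<not> distinct w" for w
  proof -
    have "\<not> distinct (map ?b w)" using that(2) by (auto simp: distinct_map)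
    from Krep[OF words_bas[OF M that(1)] this] show ?thesis using tens_map_bas[OF M that(1)] by simp
  qed
  have Kswap: "sing (xs @ b # a # ys) 1 + sing (xs @ a # b # ys) 1 \<in> K" if w: "xs @ a # b # ys \<in> wds I n" for xs a b ys
  proof -
    \<comment> \<open>Polarization: a pure tensor that contains this sum twice in a row is a
      relation and expands into four words, two of which repeat a letter and lie in \<open>K\<close>
      themselves.\<close>
    let ?v = "?b a \<oplus>\<^bsub>M\<^esub> ?b b"
    let ?l = "map ?b xs @ ?v # ?v # map ?b ys"
    have ab: "a \<in> I" "b \<in> I" using w by auto
    have l: "?l \<in> words M n" using w bas(1)[OF M] coordD(9)[OF M] by (auto simp: words_def)
    have "\<not> distinct ?l" by simp
    note 1 = Krep[OF l this]
    have add: "tens (us @ (p + q) # vs) = tens (us @ p # vs) + tens (us @ q # vs)" for us vs and p q :: "nat \<Rightarrow>\<^sub>0 'k"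
      by (induction us) (simp_all add: lin_add_fun)
    have "\<kappa> ?v = sing a 1 + sing b 1" using ab bas[OF M] coordD(6)[OF M] by simp
    moreover have "map \<kappa> (map ?b xs) = map (\<lambda>i. sing i 1) xs" "map \<kappa> (map ?b ys) = map (\<lambda>i. sing i 1) ys"
      using w bas(2)[OF M] by auto
    ultimately have "tens (map \<kappa> ?l) = tens (map (\<lambda>i. sing i 1) xs @ (sing a 1 + sing b 1) # (sing a 1 + sing b 1) # map (\<lambda>i. sing i 1) ys)"
      by (simp only: map_append list.map)
    also have "\<dots> = tens (map (\<lambda>i. sing i 1) (xs @ a # a # ys)) + tens (map (\<lambda>i. sing i 1) (xs @ a # b # ys))
        + (tens (map (\<lambda>i. sing i 1) (xs @ b # a # ys)) + tens (map (\<lambda>i. sing i 1) (xs @ b # b # ys)))"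
      unfolding add using add[of "map (\<lambda>i. sing i 1) xs @ [_]"] by simp
    finally have eq: "tens (map \<kappa> ?l) = sing (xs @ a # a # ys) 1 + sing (xs @ a # b # ys) 1 + (sing (xs @ b # a # ys) 1 + sing (xs @ b # b # ys) 1)"
      unfolding tens_sing .
    have "sing (xs @ a # a # ys) 1 \<in> K" "sing (xs @ b # b # ys) 1 \<in> K"
      by (rule Ksing; use w in auto)+
    then have "tens (map \<kappa> ?l) - sing (xs @ a # a # ys) 1 - sing (xs @ b # b # ys) 1 \<in> K" using 1 by (intro psubD(5)[OF K])
    then show ?thesis unfolding eq by (simp add: algebra_simps)
  qed
  have Ksort: "sing w 1 - ext (sing w 1) \<in> K" if "w \<in> wds I n" for w
    using that
  proof (induction "inversions w" arbitrary: w rule: less_induct)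
    case less
    show ?case
    proof (cases "sorted w")
      case True
      show ?thesis
      proof (cases "distinct w")
        case d: True
        then show ?thesis using True psubD(1)[OF K] by (simp add: ext_def wsign_sorted sorted_sort_id)
      next
        case False
        then show ?thesis using Ksing[OF less.prems] by (simp add: ext_def)
      qed
    next
      case False
      from unsorted_descent[OF this] obtain xs a b ys where w: "w = xs @ a # b # ys" "b < a" by blast
      have w': "xs @ b # a # ys \<in> wds I n" using less.prems w by auto
      have 1: "sing (xs @ b # a # ys) 1 - ext (sing (xs @ b # a # ys) 1) \<in> K"
        using less.hyps[OF _ w'] inversions_swap[OF w(2)] w(1) by simp
      have 2: "ext (sing (xs @ b # a # ys) 1) = - ext (sing (xs @ a # b # ys) 1)"
        using w(2) by (auto simp: ext_def sort_swap[of xs b a ys] wsign_swap[of a b xs ys] single_uminus)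
      show ?thesis using psubD(5)[OF K Kswap[OF less.prems[unfolded w(1)]] 1] unfolding w(1) 2 by simp
    qed
  qed
  have ker: "?N = {P \<in> carrier ?T. ?\<phi> P = 0}"
  proof (intro equalityI subsetI)
    fix P assume "P \<in> ?N"
    moreover have "?N \<subseteq> {P \<in> carrier ?T. ?\<phi> P = 0}"
    proof (rule gen_subspace_kernel[OF T'(1) lin S])
      fix P assume "P \<in> ?S"
      then obtain l where l: "P = pure_tensor M n l" "l \<in> words M n" "\<not> distinct l" by auto
      then obtain xs a ys zs where "l = xs @ [a] @ ys @ [a] @ zs" using not_distinct_decomp by blast
      then show "?\<phi> P = 0" using l(1) tcoord_pure[OF M l(2)] ext_repeat[of "map \<kappa> xs" "\<kappa> a" "map \<kappa> ys" "map \<kappa> zs"] by simp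
    qed
    ultimately show "P \<in> {P \<in> carrier ?T. ?\<phi> P = 0}" by blast
  next
    fix P assume "P \<in> {P \<in> carrier ?T. ?\<phi> P = 0}"
    then have P: "P \<in> carrier ?T" "?\<phi> P = 0" by auto
    have "lin (\<lambda>w. sing w 1 - ext (sing w 1)) (tcoord \<kappa> P) \<in> K"
      by (rule psub_lin[OF K], rule Ksort) (use T'(5)[OF P(1)] in \<open>auto simp: fsp_def\<close>)
    moreover have "lin (\<lambda>w. sing w 1 - ext (sing w 1)) (tcoord \<kappa> P) = tcoord \<kappa> P - ?\<phi> P"
      by (simp add: lin_diff_fun plin_eq_lin[OF plin_ext, symmetric])
    ultimately have "tcoord \<kappa> P \<in> K" using P by simp
    then obtain Q where "Q \<in> ?N" "tcoord \<kappa> P = tcoord \<kappa> Q" by (auto simp: K_def)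
    then show "P \<in> ?N" using T'(12)[OF P(1), of Q] Nc by auto
  qed
  have img: "?\<phi> ` carrier ?T = fsp {s \<in> wds I n. sorted s \<and> distinct s}"
  proof (intro equalityI subsetI)
    fix q assume "q \<in> ?\<phi> ` carrier ?T"
    then obtain P where P: "P \<in> carrier ?T" "q = ext (tcoord \<kappa> P)" by auto
    show "q \<in> fsp {s \<in> wds I n. sorted s \<and> distinct s}"
      unfolding P(2) ext_def by (rule lin_fsp'[OF T'(5)[OF P(1)]]) auto
  next
    fix q :: "nat list \<Rightarrow>\<^sub>0 'k" assume q: "q \<in> fsp {s \<in> wds I n. sorted s \<and> distinct s}"
    then have "q \<in> fsp (wds I n)" by (auto simp: fsp_iff)
    then have "q \<in> tcoord \<kappa> ` carrier ?T" using T'(3) by (auto simp: bij_betw_def)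
    then obtain P where P: "P \<in> carrier ?T" "tcoord \<kappa> P = q" by auto
    have "ext q = q" unfolding ext_def
      by (rule trans[OF lin_cong_fsp[OF q] lin_self]) (auto simp: wsign_sorted sorted_sort_id)
    then have "q = ?\<phi> P" using P by simp
    then show "q \<in> ?\<phi> ` carrier ?T" using P by blast
  qed
  show ?thesis unfolding exterior_power_def
    by (rule exI, rule coord_quotient[OF T'(1) lin img ker])
qed

section \<open>Polynomials and substitution\<close>

type_synonym ('x, 'k) poly = "'x multiset \<Rightarrow>\<^sub>0 'k"

abbreviation "pvar x \<equiv> sing {#x#} 1"
abbreviation "mons B \<equiv> {M. set_mset M \<subseteq> B}"

lemma smul_mult: fixes p :: "('x, 'k::field) poly" shows "smul c p * q = smul c (p * q)" "p * smul c q = smul c (p * q)"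
  by (simp_all add: mult_map_scale_conv_mult ac_simps)

lemma plin_mult: "plin (\<lambda>p. q * p)" "plin (\<lambda>p. p * q)" for q :: "('x, 'k::field) poly"
  by (auto simp: plin_def smul_mult algebra_simps)

lemma lin_mult: fixes q :: "('x, 'k::field) poly" shows "q * lin g p = lin (\<lambda>i. q * g i) p" "lin g p * q = lin (\<lambda>i. g i * q) p"
  by (rule plin_lin_comp[OF plin_mult(1)], rule plin_lin_comp[OF plin_mult(2)])

lemma sing_mult: fixes a :: "'k::field" shows "sing M a * sing N b = sing (M + N) (a * b)"
  by (rule mult_single)

lemma sing_add_mset: "sing (add_mset x M) (1::'k::field) = pvar x * sing M 1"
  by (simp add: sing_mult)

lemma poly_one: "(1 :: ('x, 'k::field) poly) = sing {#} 1"
  by (metis single_one zero_multiset_def)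

definition subst :: "('x \<Rightarrow> ('y, 'k::field) poly) \<Rightarrow> ('x, 'k) poly \<Rightarrow> ('y, 'k) poly" where
  "subst f = lin (\<lambda>M. \<Prod>x\<in>#M. f x)"

lemma plin_subst[simp]: "plin (subst f)" by (simp add: subst_def)

lemma subst_simps[simp]: "subst f (p + q) = subst f p + subst f q" "subst f (p - q) = subst f p - subst f q"
  "subst f (- p) = - subst f p" "subst f 0 = 0" "subst f (smul c p) = smul c (subst f p)"
  "subst f (sing M c) = smul c (\<Prod>x\<in>#M. f x)"
  by (simp_all add: subst_def)

lemma subst_1[simp]: "subst f 1 = 1"
  using subst_simps(6)[of f "{#}" 1] by simp

lemma subst_sum: "subst f (sum g S) = (\<Sum>x\<in>S. subst f (g x))"
  by (rule plin_sum) simp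

lemma subst_mult[simp]: "subst f (p * q) = subst f p * subst f q"
proof (rule plin_ext[where I = UNIV and S = "\<lambda>p. subst f (p * q)" and T = "\<lambda>p. subst f p * subst f q"])
  fix M
  show "subst f (sing M 1 * q) = subst f (sing M 1) * subst f q"
    by (rule plin_ext[where I = UNIV and S = "\<lambda>q. subst f (sing M 1 * q)" and T = "\<lambda>q. subst f (sing M 1) * subst f q"])
      (auto simp: plin_def smul_mult sing_mult algebra_simps)
qed (auto simp: plin_def smul_mult algebra_simps)

lemma subst_prod_mset: "subst f (\<Prod>x\<in>#M. g x) = (\<Prod>x\<in>#M. subst f (g x))"
  by (induction M) auto

lemma subst_subst: "subst g (subst f p) = subst (\<lambda>x. subst g (f x)) p"
  by (rule plin_ext[where I = UNIV and S = "\<lambda>p. subst g (subst f p)"]) (auto simp: plin_def subst_prod_mset)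

lemma prod_var: "(\<Prod>x\<in>#M. pvar x) = sing M (1::'k::field)"
  by (induction M) (auto simp: sing_mult)

lemma subst_var[simp]: "subst pvar p = p"
  by (rule plin_ext[where I = UNIV and T = "\<lambda>p. p"]) (auto simp: plin_def prod_var)

lemma subst_cong: "p \<in> fsp (mons B) \<Longrightarrow> (\<And>x. x \<in> B \<Longrightarrow> f x = g x) \<Longrightarrow> subst f p = subst g p"
  unfolding subst_def by (rule lin_cong_fsp) (auto intro!: arg_cong[of _ _ prod_mset] image_mset_cong)

lemma prod_mset_image_var: "(\<Prod>x\<in>#M. pvar (h x)) = sing (image_mset h M) (1::'k::field)"
  by (induction M) (auto simp: sing_mult)

text \<open>Evaluation at the origin, which is the counit of the symmetric algebra.\<close>

lemma subst_0: "subst (\<lambda>v. 0) p = smul (lkp p {#}) 1" for p :: "('y, 'k::field) poly"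
proof (rule plin_ext[where I = UNIV and T = "\<lambda>p. smul (lkp p {#}) 1"])
  fix M :: "'y multiset"
  show "subst (\<lambda>v. 0 :: ('z, 'k) poly) (sing M 1) = smul (lkp (sing M 1) {#}) 1"
    by (cases M) (auto simp: lookup_single when_def)
qed (auto simp: plin_def lookup_add smul_add_left)

lemma fsp_mons_mult[intro]:
  fixes p :: "('x, 'k::field) poly"
  assumes "p \<in> fsp (mons B)" "q \<in> fsp (mons B)" shows "p * q \<in> fsp (mons B)"
proof -
  have "p * q = lin (\<lambda>M. lin (\<lambda>N. sing M 1 * sing N 1) q) p"
    by (simp only: lin_mult[symmetric] lin_self)
  also have "\<dots> \<in> fsp (mons B)"
    by (rule lin_fsp'[OF assms(1)], rule lin_fsp'[OF assms(2)]) (auto simp: sing_mult)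
  finally show ?thesis .
qed

lemma fsp_mons_1[intro, simp]: "(1 :: ('x, 'k::field) poly) \<in> fsp (mons B)"
  unfolding poly_one by (rule fsp_closed) simp

lemma subst_fsp: "p \<in> fsp (mons B) \<Longrightarrow> (\<And>x. x \<in> B \<Longrightarrow> f x \<in> fsp (mons C)) \<Longrightarrow> subst f p \<in> fsp (mons C)"
  unfolding subst_def
proof (rule lin_fsp', assumption)
  fix M assume f: "\<And>x. x \<in> B \<Longrightarrow> f x \<in> fsp (mons C)" and M: "M \<in> mons B"
  from M show "(\<Prod>x\<in>#M. f x) \<in> fsp (mons C)" by (induction M) (auto intro: f)
qed

lemma multilin_cong:
  assumes "coord M \<kappa> I"
  shows "multilin M n H \<Longrightarrow> (\<And>l. l \<in> words M n \<Longrightarrow> G l = H l) \<Longrightarrow> multilin M n G"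
proof (induction n arbitrary: G H)
  case (Suc n)
  have "lin_on M (\<lambda>a. G (a # l))" if "l \<in> words M n" for l
    using Suc.prems that coordD(9,10)[OF assms] by (auto simp: lin_on_def words_Suc)
  moreover have "multilin M n (\<lambda>l. G (a # l))" if "a \<in> carrier M" for a
    by (rule Suc.IH[of "\<lambda>l. H (a # l)"]) (use Suc.prems that in \<open>auto simp: words_Suc\<close>)
  ultimately show ?case by simp
qed simp

text \<open>Multilinearity of \<open>f\<close> need not be checked separately: it follows as soon as
  the coordinates of \<open>f l\<close> are a linear function \<open>T\<close> of the tensor
  \<open>l\<close>, and then \<open>T\<close> describes the extension too.\<close>

lemma linear_ext_through:
  assumes M: "coord M \<kappa> I" and W: "coord W \<kappa>' J" and f: "\<And>l. l \<in> words M n \<Longrightarrow> f l \<in> carrier W"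
    and T: "plin T" and fT: "\<And>l. l \<in> words M n \<Longrightarrow> \<kappa>' (f l) = T (tens (map \<kappa> l))" and P: "P \<in> carrier (tensor_space M n)"
  shows "linear_ext W f P \<in> carrier W" "\<kappa>' (linear_ext W f P) = T (tcoord \<kappa> P)"
proof -
  have ml: "multilin M n (\<lambda>l. \<kappa>' (f l))"
    by (rule multilin_cong[OF M multilin_plin[OF multilin_tens[OF M] T]]) (rule fT)
  note * = linear_ext_tensor[OF M W f ml P]
  show "linear_ext W f P \<in> carrier W" by (rule *)
  have "lin (\<lambda>w. \<kappa>' (f (map (bas M \<kappa>) w))) (tcoord \<kappa> P) = lin (\<lambda>w. T (sing w 1)) (tcoord \<kappa> P)"
    by (rule lin_cong_fsp[OF coordD(5)[OF coord_tensor_space[OF M] P]])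
      (simp add: fT words_bas[OF M] tens_map_bas[OF M] del: map_map)
  then show "\<kappa>' (linear_ext W f P) = T (tcoord \<kappa> P)"
    using *(2) plin_eq_lin[OF T, of "tcoord \<kappa> P"] by simp
qed

section \<open>Tensor powers of polynomial rings\<close>

text \<open>The variable \<open>(j, v)\<close> is \<open>v\<close> in the \<open>j\<close>-th tensor factor.\<close>

primrec enc :: "nat \<Rightarrow> 'x multiset list \<Rightarrow> (nat \<times> 'x) multiset" where
  "enc j [] = {#}"
| "enc j (a # w) = image_mset (Pair j) a + enc (Suc j) w"

definition emb :: "nat \<Rightarrow> ('x, 'k::field) poly \<Rightarrow> (nat \<times> 'x, 'k) poly" where
  "emb j = subst (\<lambda>v. pvar (j, v))"

primrec pens :: "nat \<Rightarrow> ('x, 'k::field) poly list \<Rightarrow> (nat \<times> 'x, 'k) poly" where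
  "pens j [] = 1"
| "pens j (p # ps) = emb j p * pens (Suc j) ps"

text \<open>Words of monomials are identified with monomials in the variables \<open>(j, v)\<close>,
  so that tensoring becomes multiplication of polynomials in separate variables.\<close>

lemma lin_enc_tens: "lin (\<lambda>w. sing (enc j w) 1) (tens ps) = pens j ps"
proof (induction ps arbitrary: j)
  case (Cons p ps)
  have e: "emb j p = lin (\<lambda>M. sing (image_mset (Pair j) M) 1) p"
    by (simp add: emb_def subst_def prod_mset_image_var)
  have "lin (\<lambda>w. sing (enc j w) 1) (tens (p # ps)) =
      lin (\<lambda>M. lin (\<lambda>w. sing (image_mset (Pair j) M) 1 * sing (enc (Suc j) w) 1) (tens ps)) p"
    by (simp add: lin_lin sing_mult)
  also have "\<dots> = lin (\<lambda>M. sing (image_mset (Pair j) M) 1 * pens (Suc j) ps) p"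
    by (simp only: lin_mult(1)[symmetric] Cons)
  also have "\<dots> = pens j (p # ps)" by (simp only: e lin_mult(2) pens.simps)
  finally show ?case .
qed simp

lemma count_image_Pair: "count (image_mset (Pair j) a) (i, v) = (if i = j then count a v else 0)"
  by (induction a) auto

lemma count_enc: "count (enc j w) (i, v) = (if j \<le> i \<and> i < j + length w then count (w ! (i - j)) v else 0)"
proof (induction w arbitrary: j)
  case (Cons a w)
  show ?case by (auto simp: count_image_Pair Cons nth_Cons' Suc_diff_Suc dest: le_neq_implies_less)
qed simp

definition slot :: "nat \<Rightarrow> (nat \<times> 'x) multiset \<Rightarrow> 'x multiset" where
  "slot j M = image_mset snd (filter_mset (\<lambda>x. fst x = j) M)"

lemma count_slot: "count (slot j M) v = count M (j, v)"
  by (induction M) (auto simp: slot_def)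

lemma enc_bij: "bij_betw (enc 0) (wds (mons B) n) (mons ({..<n} \<times> B))"
proof (rule bij_betw_byWitness[of _ "\<lambda>M. map (\<lambda>j. slot j M) [0..<n]"])
  show "\<forall>w\<in>wds (mons B) n. map (\<lambda>j. slot j (enc 0 w)) [0..<n] = w"
    by (auto intro!: nth_equalityI multiset_eqI simp: count_slot count_enc)
  show "\<forall>M\<in>mons ({..<n} \<times> B). enc 0 (map (\<lambda>j. slot j M) [0..<n]) = M"
  proof
    fix M assume M: "M \<in> mons ({..<n} \<times> B)"
    show "enc 0 (map (\<lambda>j. slot j M) [0..<n]) = M"
    proof (rule multiset_eqI)
      fix x :: "nat \<times> 'a" obtain i v where x: "x = (i, v)" by (cases x)
      have "count M (i, v) = 0" if "\<not> i < n" using M that by (auto simp: count_eq_zero_iff)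
      then show "count (enc 0 (map (\<lambda>j. slot j M) [0..<n])) x = count M x"
        by (auto simp: x count_enc count_slot)
    qed
  qed
  show "enc 0 ` wds (mons B) n \<subseteq> mons ({..<n} \<times> B)"
  proof clarify
    fix w i v assume w: "set w \<subseteq> mons B" "n = length w" and iv: "(i, v) \<in># enc 0 w"
    then have "0 < count (enc 0 w) (i, v)" by simp
    then have "i < length w \<and> 0 < count (w ! i) v" unfolding count_enc by (simp split: if_splits)
    then have "i < length w" "v \<in># w ! i" by simp_all
    moreover from this w have "w ! i \<in> mons B" by (meson nth_mem subsetD)
    ultimately show "i \<in> {..<length w} \<and> v \<in> B" by auto
  qed
  show "(\<lambda>M. map (\<lambda>j. slot j M) [0..<n]) ` mons ({..<n} \<times> B) \<subseteq> wds (mons B) n"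
  proof (clarsimp simp: slot_def)
    fix M :: "(nat \<times> 'a) multiset" and j v assume M: "set_mset M \<subseteq> {..<n} \<times> B" and jv: "(j, v) \<in># M"
    from subsetD[OF M jv] show "v \<in> B" by simp
  qed
qed

text \<open>Coordinates of a tensor power as polynomials in the variables \<open>(j, v)\<close>. In
  these the factorwise product is the product, concatenation is a product with a shift, and
  coproducts are substitutions.\<close>

definition pcoord :: "('a \<Rightarrow> ('x, 'k::field) poly) \<Rightarrow> ('k, 'a) tensor \<Rightarrow> (nat \<times> 'x, 'k) poly" where
  "pcoord \<kappa> P = lin (\<lambda>w. sing (enc 0 w) 1) (tcoord \<kappa> P)"

lemma pens_append: "pens j (xs @ ys) = pens j xs * pens (j + length xs) ys"
  by (induction xs arbitrary: j) (auto simp: ac_simps)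

lemma subst_pens:
  "(\<And>i v. j \<le> i \<Longrightarrow> i < j + length ps \<Longrightarrow> g (i, v) = pvar (i + c, v)) \<Longrightarrow> subst g (pens j ps) = pens (j + c) ps"
proof (induction ps arbitrary: j)
  case (Cons p ps)
  have "subst g (pens (Suc j) ps) = pens (Suc j + c) ps" by (rule Cons.IH) (auto intro: Cons.prems)
  moreover have "subst g (emb j p) = emb (j + c) p"
    by (simp add: emb_def subst_subst Cons.prems)
  ultimately show ?case by simp
qed simp

definition shift :: "nat \<Rightarrow> (nat \<times> 'x, 'k::field) poly \<Rightarrow> (nat \<times> 'x, 'k) poly" where
  "shift c = subst (\<lambda>(i, v). pvar (i + c, v))"

lemma shift_pens: "shift c (pens j ps) = pens (j + c) ps"
  unfolding shift_def by (rule subst_pens) simp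

text \<open>The coproduct at the \<open>i\<close>-th tensor factor, counted from \<open>0\<close>.\<close>

definition theta_at :: "nat \<Rightarrow> (nat \<times> 'x, 'k::field) poly \<Rightarrow> (nat \<times> 'x, 'k) poly" where
  "theta_at i = subst (\<lambda>(j, v). if j < i then pvar (j, v) else if j = i then pvar (i, v) + pvar (Suc i, v) else pvar (Suc j, v))"

text \<open>The algebra keeps its own elements, which for the symmetric algebra are cosets, and is
  compared with a polynomial ring through \<open>\<kappa>\<close>. The general constructions on
  \<open>A\<close> can thus be evaluated without replacing \<open>A\<close>.\<close>

locale poly_algebra =
  fixes A :: "('k::field, 'a, 'z) module_scheme" and \<kappa> :: "'a \<Rightarrow> ('x, 'k) poly" and B :: "'x set"
  assumes coord: "coord A \<kappa> (mons B)"
    and mult_closed: "a \<in> carrier A \<Longrightarrow> b \<in> carrier A \<Longrightarrow> a \<otimes>\<^bsub>A\<^esub> b \<in> carrier A"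
    and coord_mult: "a \<in> carrier A \<Longrightarrow> b \<in> carrier A \<Longrightarrow> \<kappa> (a \<otimes>\<^bsub>A\<^esub> b) = \<kappa> a * \<kappa> b"
    and one_closed: "\<one>\<^bsub>A\<^esub> \<in> carrier A" and coord_one: "\<kappa> \<one>\<^bsub>A\<^esub> = 1"
begin

lemma tensor_power_simps[simp]: "carrier (tensor_power A n) = carrier (tensor_space A n)"
  "add (tensor_power A n) = add (tensor_space A n)" "\<zero>\<^bsub>tensor_power A n\<^esub> = \<zero>\<^bsub>tensor_space A n\<^esub>"
  "module.smult (tensor_power A n) = module.smult (tensor_space A n)"
  by (auto simp: tensor_power_def)

lemma coord_tensor_power: "coord (tensor_power A n) (pcoord \<kappa>) (mons ({..<n} \<times> B))"
  unfolding pcoord_def[abs_def]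
  by (rule coord_reindex[OF coord_cong[OF coord_tensor_space[OF coord]] enc_bij]) auto

lemma coord_tensor_space': "coord (tensor_space A n) (pcoord \<kappa>) (mons ({..<n} \<times> B))"
  by (rule coord_cong[OF coord_tensor_power]) auto

lemma pcoord_pure: "l \<in> words A n \<Longrightarrow> pcoord \<kappa> (pure_tensor A n l) = pens 0 (map \<kappa> l)"
  by (simp add: pcoord_def tcoord_pure[OF coord] lin_enc_tens)

lemmas pure_carrier = pure_in[OF coord]

lemma linear_ext_pens:
  assumes W: "coord W \<kappa>' J" and f: "\<And>l. l \<in> words A n \<Longrightarrow> f l \<in> carrier W"
    and T: "plin T" and fT: "\<And>l. l \<in> words A n \<Longrightarrow> \<kappa>' (f l) = T (pens 0 (map \<kappa> l))" and P: "P \<in> carrier (tensor_space A n)"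
  shows "linear_ext W f P \<in> carrier W" "\<kappa>' (linear_ext W f P) = T (pcoord \<kappa> P)"
proof -
  have T': "plin (\<lambda>q. T (lin (\<lambda>w. sing (enc 0 w) 1) q))" by (rule plin_comp[OF T]) simp
  note * = linear_ext_through[OF coord W f T' _ P, unfolded lin_enc_tens, OF _ fT]
  show "linear_ext W f P \<in> carrier W" "\<kappa>' (linear_ext W f P) = T (pcoord \<kappa> P)"
    using * by (auto simp: pcoord_def)
qed

lemma tensor_mult:
  assumes x: "x \<in> carrier (tensor_power A n)" and y: "y \<in> carrier (tensor_power A n)"
  shows "x \<otimes>\<^bsub>tensor_power A n\<^esub> y \<in> carrier (tensor_power A n)"
    "pcoord \<kappa> (x \<otimes>\<^bsub>tensor_power A n\<^esub> y) = pcoord \<kappa> x * pcoord \<kappa> y"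
proof -
  let ?T = "tensor_space A n" and ?f = "\<lambda>l l'. pure_tensor A n (map2 (monoid.mult A) l l')"
  have w: "map2 (monoid.mult A) l l' \<in> words A n" if "l \<in> words A n" "l' \<in> words A n" for l l'
    using that by (auto simp: words_def set_zip intro!: mult_closed)
  have p: "pens j (map \<kappa> (map2 (monoid.mult A) l l')) = pens j (map \<kappa> l) * pens j (map \<kappa> l')"
    if "l \<in> words A n" "l' \<in> words A n" for l l' j
  proof -
    have "length l = length l'" "set l \<subseteq> carrier A" "set l' \<subseteq> carrier A" using that by (auto simp: words_def)
    then show ?thesis
      by (induction l l' arbitrary: j rule: list_induct2) (auto simp: coord_mult emb_def ac_simps)
  qed
  have 1: "linear_ext ?T (?f l) y \<in> carrier ?T \<and> pcoord \<kappa> (linear_ext ?T (?f l) y) = pens 0 (map \<kappa> l) * pcoord \<kappa> y"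
    if l: "l \<in> words A n" for l
    using linear_ext_pens[OF coord_tensor_space'[of n] _ plin_mult(1)[of "pens 0 (map \<kappa> l)"], where n = n and f = "?f l" and P = y]
      y l by (simp add: pure_carrier w pcoord_pure p del: map_map)
  have "linear_ext ?T (\<lambda>l. linear_ext ?T (?f l) y) x \<in> carrier ?T \<and>
     pcoord \<kappa> (linear_ext ?T (\<lambda>l. linear_ext ?T (?f l) y) x) = pcoord \<kappa> x * pcoord \<kappa> y"
    using linear_ext_pens[OF coord_tensor_space'[of n] _ plin_mult(2)[of "pcoord \<kappa> y"], where n = n and f = "\<lambda>l. linear_ext ?T (?f l) y" and P = x]
      x 1 by simp
  then show "x \<otimes>\<^bsub>tensor_power A n\<^esub> y \<in> carrier (tensor_power A n)"
    "pcoord \<kappa> (x \<otimes>\<^bsub>tensor_power A n\<^esub> y) = pcoord \<kappa> x * pcoord \<kappa> y"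
    by (auto simp: tensor_power_def)
qed

lemma tensor_one: "\<one>\<^bsub>tensor_power A n\<^esub> \<in> carrier (tensor_power A n)" "pcoord \<kappa> \<one>\<^bsub>tensor_power A n\<^esub> = 1"
proof -
  have w: "replicate n \<one>\<^bsub>A\<^esub> \<in> words A n" by (auto simp: words_def one_closed)
  have "pens j (replicate m 1) = (1 :: (nat \<times> 'x, 'k) poly)" for j m
    by (induction m arbitrary: j) (auto simp: emb_def)
  then show "\<one>\<^bsub>tensor_power A n\<^esub> \<in> carrier (tensor_power A n)" "pcoord \<kappa> \<one>\<^bsub>tensor_power A n\<^esub> = 1"
    using pure_carrier[OF w] pcoord_pure[OF w] by (auto simp: tensor_power_def coord_one)
qed

lemma tconcat:
  assumes x: "x \<in> carrier (tensor_space A m)" and y: "y \<in> carrier (tensor_space A n)" and N: "N = m + n"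
  shows "tconcat A N x y \<in> carrier (tensor_space A N)"
    "pcoord \<kappa> (tconcat A N x y) = pcoord \<kappa> x * shift m (pcoord \<kappa> y)"
proof -
  let ?T = "tensor_space A N" and ?f = "\<lambda>l l'. pure_tensor A N (l @ l')"
  have w: "l @ l' \<in> words A N" if "l \<in> words A m" "l' \<in> words A n" for l l'
    using that by (auto simp: words_def N)
  have plin: "plin (\<lambda>q. c * shift m q)" for c :: "(nat \<times> 'x, 'k) poly"
    by (auto simp: plin_def shift_def smul_mult algebra_simps)
  have 1: "linear_ext ?T (?f l) y \<in> carrier ?T \<and> pcoord \<kappa> (linear_ext ?T (?f l) y) = pens 0 (map \<kappa> l) * shift m (pcoord \<kappa> y)"
    if l: "l \<in> words A m" for l
  proof -
    have len: "length l = m" using l by (simp add: words_def)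
    show ?thesis
      using linear_ext_pens[OF coord_tensor_space'[of N] _ plin[of "pens 0 (map \<kappa> l)"], where n = n and f = "?f l" and P = y]
        y l by (simp add: pure_carrier w pcoord_pure pens_append shift_pens len)
  qed
  have "linear_ext ?T (\<lambda>l. linear_ext ?T (?f l) y) x \<in> carrier ?T \<and>
     pcoord \<kappa> (linear_ext ?T (\<lambda>l. linear_ext ?T (?f l) y) x) = pcoord \<kappa> x * shift m (pcoord \<kappa> y)"
    using linear_ext_pens[OF coord_tensor_space'[of N] _ plin_mult(2)[of "shift m (pcoord \<kappa> y)"], where n = m and f = "\<lambda>l. linear_ext ?T (?f l) y" and P = x]
      x 1 by simp
  then show "tconcat A N x y \<in> carrier (tensor_space A N)"
    "pcoord \<kappa> (tconcat A N x y) = pcoord \<kappa> x * shift m (pcoord \<kappa> y)" by (auto simp: tconcat_def)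
qed

end

locale poly_bialgebra = poly_algebra A \<kappa> B for A :: "('k::field, 'a) bialgebra" and \<kappa> :: "'a \<Rightarrow> ('x, 'k) poly" and B +
  assumes comult_closed: "a \<in> carrier A \<Longrightarrow> comult A a \<in> carrier (tensor_space A 2)"
    and coord_comult: "a \<in> carrier A \<Longrightarrow> pcoord \<kappa> (comult A a) = subst (\<lambda>v. pvar (0, v) + pvar (Suc 0, v)) (\<kappa> a)"
    and coord_counit: "a \<in> carrier A \<Longrightarrow> counit A a = lkp (\<kappa> a) {#}"
begin

lemma comult_at:
  assumes i: "i < n" and P: "P \<in> carrier (tensor_space A n)"
  shows "comult_at A n i P \<in> carrier (tensor_space A (Suc n))"
    "pcoord \<kappa> (comult_at A n i P) = theta_at i (pcoord \<kappa> P)"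
proof -
  let ?f = "\<lambda>l. tconcat A (Suc n) (pure_tensor A i (take i l))
     (tconcat A (Suc n - i) (comult A (l ! i)) (pure_tensor A (n - Suc i) (drop (Suc i) l)))"
  have 1: "?f l \<in> carrier (tensor_space A (Suc n)) \<and> pcoord \<kappa> (?f l) = theta_at i (pens 0 (map \<kappa> l))"
    if l: "l \<in> words A n" for l
  proof -
    define us a vs where d: "us = take i l" "a = l ! i" "vs = drop (Suc i) l"
    have len: "length l = n" using l by (simp add: words_def)
    then have leq: "l = us @ a # vs" unfolding d using i by (simp add: id_take_nth_drop)
    have us: "us \<in> words A i" "length us = i" and vs: "vs \<in> words A (n - Suc i)" "length vs = n - Suc i" and a: "a \<in> carrier A"
      using l i len unfolding d by (auto simp: words_def dest: in_set_takeD in_set_dropD)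
    note 2 = tconcat[OF comult_closed[OF a] pure_carrier[OF vs(1)], of "Suc n - i"]
    note 3 = tconcat[OF pure_carrier[OF us(1)] 2(1), of "Suc n"]
    have e: "Suc n - i = 2 + (n - Suc i)" "Suc n = i + (Suc n - i)" using i by auto
    have "theta_at i (pens 0 (map \<kappa> l)) = theta_at i (pens 0 (map \<kappa> us)) * (theta_at i (emb i (\<kappa> a)) * theta_at i (pens (Suc i) (map \<kappa> vs)))"
      unfolding leq by (simp add: pens_append us theta_at_def)
    also have "theta_at i (pens 0 (map \<kappa> us)) = pens 0 (map \<kappa> us)"
      unfolding theta_at_def using subst_pens[of 0 "map \<kappa> us" _ 0] us by auto
    also have "theta_at i (pens (Suc i) (map \<kappa> vs)) = pens (Suc i + 1) (map \<kappa> vs)"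
      unfolding theta_at_def by (rule subst_pens) auto
    also have "theta_at i (emb i (\<kappa> a)) = shift i (pcoord \<kappa> (comult A a))"
      by (simp add: coord_comult[OF a] theta_at_def emb_def shift_def subst_subst)
    also have "pens (Suc i + 1) (map \<kappa> vs) = shift i (shift 2 (pens 0 (map \<kappa> vs)))" by (simp add: shift_pens)
    finally show ?thesis
      using 2 3 e us vs unfolding d[symmetric] by (simp add: pcoord_pure shift_def)
  qed
  have "plin (theta_at i :: (nat \<times> 'x, 'k) poly \<Rightarrow> _)" by (simp add: theta_at_def)
  from linear_ext_pens[OF coord_tensor_power _ this _ P, of ?f "Suc n"] 1
  show "comult_at A n i P \<in> carrier (tensor_space A (Suc n))"
    "pcoord \<kappa> (comult_at A n i P) = theta_at i (pcoord \<kappa> P)"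
    by (auto simp: comult_at_def)
qed

text \<open>The coproduct at factor 0 splits the first copy of \<open>v\<close> into two and shifts
  the others. For \<open>n = 0\<close> the empty sum means evaluation at the origin, in accordance
  with the counit.\<close>

lemma iter_comult:
  assumes a: "a \<in> carrier A"
  shows "iter_comult A n a \<in> carrier (tensor_space A n) \<and>
    pcoord \<kappa> (iter_comult A n a) = subst (\<lambda>v. \<Sum>j<n. pvar (j, v)) (\<kappa> a)"
proof (induction n rule: induct_nat_012)
  case 0
  have "[] \<in> words A 0" by simp
  from pure_carrier[OF this] pcoord_pure[OF this] show ?case
    using coordD[OF coord_tensor_space'[of 0]] by (simp add: subst_0 coord_counit[OF a])
next
  case 1
  have "[a] \<in> words A 1" using a by (auto simp: words_def)
  from pure_carrier[OF this] pcoord_pure[OF this] show ?case by (simp add: emb_def)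
next
  case (ge2 n)
  have "theta_at 0 (\<Sum>j<Suc n. pvar (j, v)) = (\<Sum>j<Suc (Suc n). pvar (j, v) :: (nat \<times> 'x, 'k) poly)" for v
    unfolding theta_at_def subst_sum sum.lessThan_Suc_shift by (simp add: add.assoc subst_sum)
  with ge2(2) comult_at[of 0 "Suc n" "iter_comult A (Suc n) a"] show ?case
    by (simp add: theta_at_def subst_subst del: sum.lessThan_Suc)
qed

end

lemma tensor_space_cong:
  assumes "carrier N = carrier M" "add N = add M" "module.smult N = module.smult M"
  shows "tensor_space N n = tensor_space M n"
  using assms by (simp add: tensor_space_def tensor_kernel_def multilinear_relations_def words_def)

lemma (in poly_algebra) bas_mons: "M \<in> mons B \<Longrightarrow> bas A \<kappa> M \<in> carrier A" "M \<in> mons B \<Longrightarrow> \<kappa> (bas A \<kappa> M) = sing M 1"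
  by (rule bas[OF coord], simp)+

text \<open>The uniqueness half of the definite descriptions by which coproduct and counit are
  defined: a homomorphism into polynomials is determined by its values on the variables.\<close>

lemma (in poly_algebra) hom_unique:
  assumes g: "lin_on A g" and gm: "\<And>a b. a \<in> carrier A \<Longrightarrow> b \<in> carrier A \<Longrightarrow> g (a \<otimes>\<^bsub>A\<^esub> b) = g a * g b"
    and g1: "g \<one>\<^bsub>A\<^esub> = 1" and gv: "\<And>x. x \<in> B \<Longrightarrow> g (bas A \<kappa> {#x#}) = f x" and a: "a \<in> carrier A"
  shows "g a = subst f (\<kappa> a)"
proof -
  have "M \<in> mons B \<Longrightarrow> g (bas A \<kappa> M) = (\<Prod>x\<in>#M. f x)" for M
  proof (induction M)
    case empty
    have "bas A \<kappa> {#} = \<one>\<^bsub>A\<^esub>"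
      by (rule coordD(12)[OF coord]) (use bas_mons[of "{#}"] one_closed coord_one in auto)
    then show ?case by (simp add: g1)
  next
    case (add x M)
    then have x: "x \<in> B" "{#x#} \<in> mons B" "M \<in> mons B" by auto
    have "bas A \<kappa> (add_mset x M) = bas A \<kappa> {#x#} \<otimes>\<^bsub>A\<^esub> bas A \<kappa> M"
      by (rule coordD(12)[OF coord])
        (use bas_mons[OF add.prems] bas_mons[OF x(2)] bas_mons[OF x(3)] mult_closed coord_mult in \<open>auto simp: sing_mult\<close>)
    with add.IH x gv gm bas_mons(1)[OF x(2)] bas_mons(1)[OF x(3)] show ?case by simp
  qed
  then have "lin (\<lambda>M. g (bas A \<kappa> M)) (\<kappa> a) = lin (\<lambda>M. \<Prod>x\<in>#M. f x) (\<kappa> a)"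
    by (intro lin_cong_fsp[OF coordD(5)[OF coord a]]) auto
  then show ?thesis using expand_lin_on[OF coord a g] by (simp add: subst_def)
qed

section \<open>The free commutative algebra and its ideals\<close>

lemma free_comm_algebra_simps[simp]: "carrier free_comm_algebra = UNIV" "p \<oplus>\<^bsub>free_comm_algebra\<^esub> q = p + q"
  "p \<otimes>\<^bsub>free_comm_algebra\<^esub> q = p * q" "\<one>\<^bsub>free_comm_algebra\<^esub> = 1" "\<zero>\<^bsub>free_comm_algebra\<^esub> = 0"
  "c \<odot>\<^bsub>free_comm_algebra\<^esub> p = smul c p"
  by (auto simp: free_comm_algebra_def)

lemma coord_free_comm_algebra: "coord free_comm_algebra (\<lambda>p. p) UNIV"
  by (rule coordI) (auto simp: lin_on_def bij_betw_def)

lemma ring_free_comm_algebra: "ring free_comm_algebra"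
proof -
  interpret module ground free_comm_algebra by (rule coordD(1)[OF coord_free_comm_algebra])
  show ?thesis
    by (rule ringI) (auto intro!: M.abelian_group_axioms monoidI simp: algebra_simps)
qed

lemma ideal_free_comm_algebra: "ideal I free_comm_algebra \<longleftrightarrow> psub I \<and> (\<forall>p\<in>I. \<forall>q. q * p \<in> I)"
proof
  assume "ideal I free_comm_algebra"
  then interpret ideal I free_comm_algebra .
  interpret sg: subgroup I "add_monoid free_comm_algebra" by (rule a_subgroup)
  have m: "q * p \<in> I" if "p \<in> I" for p q using I_l_closed[OF that, of q] by simp
  have "smul c p \<in> I" if "p \<in> I" for c p using m[OF that, of "sing {#} c"] by (simp add: mult_map_scale_conv_mult)
  then show "psub I \<and> (\<forall>p\<in>I. \<forall>q. q * p \<in> I)"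
    using m sg.one_closed sg.m_closed by (auto simp: psub_def)
next
  assume I: "psub I \<and> (\<forall>p\<in>I. \<forall>q. q * p \<in> I)"
  interpret module ground free_comm_algebra by (rule coordD(1)[OF coord_free_comm_algebra])
  have "submodule I ground free_comm_algebra"
    by (rule submoduleI'[OF coordD(1)[OF coord_free_comm_algebra]]) (use I in \<open>auto simp: psub_def\<close>)
  then have "subgroup I (add_monoid free_comm_algebra)" by (rule submodule.axioms)
  then show "ideal I free_comm_algebra"
    by (rule idealI[OF ring_free_comm_algebra]) (use I in \<open>auto simp: mult.commute\<close>)
qed

section \<open>The symmetric algebra\<close>

context
  fixes scale :: "'k::field \<Rightarrow> 'v::ab_group_add \<Rightarrow> 'v" and Basis :: "'v set" and e :: "nat \<Rightarrow> 'v" and d :: nat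
  assumes fd: "finite_dimensional_vector_space scale Basis" and e: "bij_betw e {..<d} Basis"
begin

private abbreviation "vc \<equiv> vcoord scale Basis e d"
private abbreviation "S \<equiv> symmetric_algebra scale"
private abbreviation "F \<equiv> free_comm_algebra :: ('k, 'v multiset \<Rightarrow>\<^sub>0 'k) module"

definition vpoly :: "'v \<Rightarrow> (nat, 'k) poly" where "vpoly v = lin (\<lambda>i. pvar i) (vc v)"

definition scoord :: "('v multiset \<Rightarrow>\<^sub>0 'k) set \<Rightarrow> (nat, 'k) poly" where
  "scoord C = subst vpoly (SOME p. p \<in> C)"

text \<open>Modulo the ideal each variable \<open>v\<close> equals its expansion in variables of
  basis vectors, hence so does each polynomial. This expansion factors through
  \<open>subst vpoly\<close>, so the kernel of \<open>subst vpoly\<close> lies in the ideal.\<close>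

lemma symmetric_ideal_eq: "symmetric_ideal scale = {p \<in> carrier F. subst vpoly p = 0}"
proof (intro equalityI subsetI)
  let ?G = "{sing {#v + w#} 1 - sing {#v#} 1 - sing {#w#} 1 | v w. True} \<union> {sing {#scale c v#} (1::'k) - sing {#v#} c | c v. True}"
  interpret ring F by (rule ring_free_comm_algebra)
  have I: "ideal (symmetric_ideal scale) F" unfolding symmetric_ideal_def by (rule genideal_ideal) simp
  have G: "?G \<subseteq> symmetric_ideal scale" unfolding symmetric_ideal_def by (rule genideal_self) simp
  have K: "psub (symmetric_ideal scale)" and m: "\<And>p q. p \<in> symmetric_ideal scale \<Longrightarrow> q * p \<in> symmetric_ideal scale"
    using I by (auto simp: ideal_free_comm_algebra)
  {
    fix p assume "p \<in> symmetric_ideal scale"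
    moreover have "symmetric_ideal scale \<subseteq> {p. subst vpoly p = 0}"
      unfolding symmetric_ideal_def
      by (rule genideal_minimal)
        (auto simp: ideal_free_comm_algebra psub_def vpoly_def vcoord_add[OF fd e] vcoord_scale[OF fd e])
    ultimately show "p \<in> {p \<in> carrier F. subst vpoly p = 0}" by auto
  }
  fix p assume "p \<in> {p \<in> carrier F. subst vpoly p = 0}"
  then have p: "subst vpoly p = 0" by simp
  let ?\<tau> = "\<lambda>v. lin (\<lambda>i. pvar (e i)) (vc v) :: ('v, 'k) poly"
  have cs: "coord (space_of scale) vc {..<d}" by (rule coord_space_of[OF fd e])
  have bas: "bas (space_of scale) vc i = e i" if "i < d" for i
    by (rule coordD(12)[OF cs]) (use that bas[OF cs] vcoord_e[OF fd e that] in auto)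
  have v: "pvar v - ?\<tau> v \<in> symmetric_ideal scale" for v
  proof -
    have "pvar v - lin (\<lambda>i. pvar (bas (space_of scale) vc i)) (vc v) \<in> symmetric_ideal scale"
    proof (rule expand_mod[OF cs K])
      fix a b :: 'v and c :: 'k
      show "pvar (a \<oplus>\<^bsub>space_of scale\<^esub> b) - pvar a - pvar b \<in> symmetric_ideal scale"
        by (rule subsetD[OF G]) auto
      have "pvar (c \<odot>\<^bsub>space_of scale\<^esub> a) - sing {#a#} c \<in> symmetric_ideal scale"
        by (rule subsetD[OF G]) auto
      then show "pvar (c \<odot>\<^bsub>space_of scale\<^esub> a) - smul c (pvar a) \<in> symmetric_ideal scale" by simp
    qed simp
    moreover have "lin (\<lambda>i. pvar (bas (space_of scale) vc i)) (vc v) = ?\<tau> v"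
      by (rule lin_cong_fsp[OF coordD(5)[OF cs]]) (auto simp: bas)
    ultimately show ?thesis by simp
  qed
  have M: "sing M 1 - subst ?\<tau> (sing M 1) \<in> symmetric_ideal scale" for M
  proof (induction M)
    case empty
    then show ?case using psubD(1)[OF K] by simp
  next
    case (add x M)
    \<comment> \<open>The difference of two products, telescoped into multiples of the two known
      differences.\<close>
    have "pvar x * (sing M 1 - subst ?\<tau> (sing M 1)) + subst ?\<tau> (sing M 1) * (pvar x - ?\<tau> x) \<in> symmetric_ideal scale"
      by (intro psubD(2)[OF K] m add v)
    also have "pvar x * (sing M 1 - subst ?\<tau> (sing M 1)) + subst ?\<tau> (sing M 1) * (pvar x - ?\<tau> x) =
       sing (add_mset x M) 1 - subst ?\<tau> (sing (add_mset x M) 1)"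
      unfolding sing_add_mset[of x M] subst_mult by (simp add: algebra_simps)
    finally show ?case .
  qed
  have "lin (\<lambda>M. sing M 1 - subst ?\<tau> (sing M 1)) p \<in> symmetric_ideal scale"
    by (rule psub_lin[OF K M])
  also have "lin (\<lambda>M. sing M 1 - subst ?\<tau> (sing M 1)) p = p - subst ?\<tau> p"
    by (simp only: lin_diff_fun lin_self plin_eq_lin[OF plin_subst, symmetric])
  also have "subst ?\<tau> p = subst (\<lambda>i. pvar (e i)) (subst vpoly p)"
    by (simp only: subst_subst vpoly_def plin_lin_comp[OF plin_subst]) simp
  finally show "p \<in> symmetric_ideal scale" using p by simp
qed

private lemma img: "subst vpoly ` carrier F = fsp (mons {..<d})"
proof (intro equalityI subsetI)
  fix q assume "q \<in> subst vpoly ` carrier F"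
  then obtain p where q: "q = subst vpoly p" by auto
  have cs: "coord (space_of scale) vc {..<d}" by (rule coord_space_of[OF fd e])
  have "vc v \<in> fsp {..<d}" for v using coordD(5)[OF cs] by simp
  then have "vpoly v \<in> fsp (mons {..<d})" for v unfolding vpoly_def by (rule lin_fsp') auto
  then show "q \<in> fsp (mons {..<d})" unfolding q by (intro subst_fsp[of p UNIV]) auto
next
  fix q :: "(nat, 'k) poly" assume q: "q \<in> fsp (mons {..<d})"
  have "subst vpoly (subst (\<lambda>i. pvar (e i)) q) = subst pvar q"
    unfolding subst_subst by (rule subst_cong[OF q]) (simp add: vpoly_def vcoord_e[OF fd e])
  then have "q = subst vpoly (subst (\<lambda>i. pvar (e i)) q)" by simp
  then show "q \<in> subst vpoly ` carrier F" by (rule image_eqI) simp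
qed

private lemma lin_F: "lin_on F (subst vpoly)" by (simp add: lin_on_def)

lemmas sym_quot = coordD(1)[OF coord_free_comm_algebra] lin_F img symmetric_ideal_eq

lemma scoord_coset: "scoord (symmetric_ideal scale +>\<^bsub>F\<^esub> p) = subst vpoly p"
  unfolding scoord_def by (rule quotient_coord[OF sym_quot]) simp

lemma symmetric_algebra_simps: "monoid.mult S = rcoset_mult F (symmetric_ideal scale)"
  "\<one>\<^bsub>S\<^esub> = symmetric_ideal scale +>\<^bsub>F\<^esub> 1"
  unfolding symmetric_algebra_def quotient_space_def ring.defs module.defs FactRing_def by auto

lemma poly_algebra_sym: "poly_algebra S scoord {..<d}"
proof
  show c: "coord S scoord (mons {..<d})"
    unfolding symmetric_algebra_def scoord_def[abs_def] by (rule coord_quotient[OF sym_quot])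
  have S: "carrier S = (\<lambda>p. symmetric_ideal scale +>\<^bsub>F\<^esub> p) ` UNIV"
    unfolding symmetric_algebra_def quotient_space_simps by simp
  have cos: "q \<in> symmetric_ideal scale +>\<^bsub>F\<^esub> p \<longleftrightarrow> subst vpoly q = subst vpoly p" for p q
    using quotient_coset[OF sym_quot, of p] by auto
  have cos_eq: "subst vpoly q = subst vpoly p \<Longrightarrow> symmetric_ideal scale +>\<^bsub>F\<^esub> q = symmetric_ideal scale +>\<^bsub>F\<^esub> p" for p q
    by (intro Set.set_eqI) (simp only: cos)
  have mult: "(symmetric_ideal scale +>\<^bsub>F\<^esub> p) \<otimes>\<^bsub>S\<^esub> (symmetric_ideal scale +>\<^bsub>F\<^esub> q) = symmetric_ideal scale +>\<^bsub>F\<^esub> (p * q)" for p q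
  proof -
    have "symmetric_ideal scale +>\<^bsub>F\<^esub> (p' * q') = symmetric_ideal scale +>\<^bsub>F\<^esub> (p * q)"
      if "p' \<in> symmetric_ideal scale +>\<^bsub>F\<^esub> p" "q' \<in> symmetric_ideal scale +>\<^bsub>F\<^esub> q" for p' q'
      by (rule cos_eq) (use that cos in simp)
    then have "(\<Union>p'\<in>symmetric_ideal scale +>\<^bsub>F\<^esub> p. \<Union>q'\<in>symmetric_ideal scale +>\<^bsub>F\<^esub> q. symmetric_ideal scale +>\<^bsub>F\<^esub> (p' * q')) =
       (\<Union>p'\<in>symmetric_ideal scale +>\<^bsub>F\<^esub> p. \<Union>q'\<in>symmetric_ideal scale +>\<^bsub>F\<^esub> q. symmetric_ideal scale +>\<^bsub>F\<^esub> (p * q))"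
      by (intro SUP_cong refl)
    moreover have "p \<in> symmetric_ideal scale +>\<^bsub>F\<^esub> p" "q \<in> symmetric_ideal scale +>\<^bsub>F\<^esub> q" by (simp_all only: cos)
    then have "symmetric_ideal scale +>\<^bsub>F\<^esub> p \<noteq> {}" "symmetric_ideal scale +>\<^bsub>F\<^esub> q \<noteq> {}" by (metis emptyE)+
    ultimately show ?thesis unfolding symmetric_algebra_simps rcoset_mult_def free_comm_algebra_simps
      by (simp only: UN_constant if_False)
  qed
  show "a \<otimes>\<^bsub>S\<^esub> b \<in> carrier S" if "a \<in> carrier S" "b \<in> carrier S" for a b
    using that by (auto simp: S mult)
  show "scoord (a \<otimes>\<^bsub>S\<^esub> b) = scoord a * scoord b" if "a \<in> carrier S" "b \<in> carrier S" for a b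
    using that by (auto simp: S mult scoord_coset)
  show "\<one>\<^bsub>S\<^esub> \<in> carrier S" "scoord \<one>\<^bsub>S\<^esub> = 1"
    by (auto simp: symmetric_algebra_simps scoord_coset S)
qed

interpretation S: poly_algebra S scoord "{..<d}" by (rule poly_algebra_sym)

private lemma sym_incl: "sym_incl scale v \<in> carrier S" "scoord (sym_incl scale v) = vpoly v"
  unfolding sym_incl_def by (auto simp: scoord_coset symmetric_algebra_def quotient_space_simps)

private lemma bas_var: "i < d \<Longrightarrow> bas S scoord {#i#} = sym_incl scale (e i)"
  by (rule coordD(12)[OF S.coord]) (use S.bas_mons[of "{#i#}"] sym_incl in \<open>auto simp: vpoly_def vcoord_e[OF fd e]\<close>)

private abbreviation "dlt \<equiv> subst (\<lambda>v. pvar (0, v) + pvar (Suc 0, v)) :: (nat, 'k) poly \<Rightarrow> (nat \<times> nat, 'k) poly"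

text \<open>The description is unfolded by constructing a candidate \<open>D\<close> through
  coordinates, verifying its properties there, and showing that any other candidate has the same
  values on basis vectors of \<open>V\<close>.\<close>

lemma symmetric_comult:
  assumes a: "a \<in> carrier S"
  shows "symmetric_comult scale a \<in> carrier (tensor_power S 2)"
    "pcoord scoord (symmetric_comult scale a) = dlt (scoord a)"
proof -
  let ?T = "tensor_power S 2"
  note T = S.coord_tensor_power[of 2]
  note T' = coordD[OF T] and S' = coordD[OF S.coord]
  define prim where "prim v = pure_tensor S 2 [sym_incl scale v, \<one>\<^bsub>S\<^esub>] \<oplus>\<^bsub>?T\<^esub> pure_tensor S 2 [\<one>\<^bsub>S\<^esub>, sym_incl scale v]" for v
  let ?P = "\<lambda>D. D \<in> carrier (hom_space S ?T) \<and> D \<in> ring_hom S ?T \<and> (\<forall>v. D (sym_incl scale v) = prim v)"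
  have w: "[sym_incl scale v, \<one>\<^bsub>S\<^esub>] \<in> words S 2" "[\<one>\<^bsub>S\<^esub>, sym_incl scale v] \<in> words S 2" for v
    using sym_incl(1) S.one_closed by (auto simp: words_def)
  have prim: "prim v \<in> carrier ?T" "pcoord scoord (prim v) = dlt (vpoly v)" for v
  proof -
    show "prim v \<in> carrier ?T" unfolding prim_def using w S.pure_carrier by (intro T') auto
    have "pcoord scoord (prim v) = emb 0 (vpoly v) + emb (Suc 0) (vpoly v)"
      unfolding prim_def using w S.pure_carrier S.pcoord_pure
      by (subst T'(6)) (auto simp: sym_incl S.coord_one emb_def)
    also have "\<dots> = dlt (vpoly v)"
      unfolding vpoly_def emb_def by (simp add: plin_lin_comp[OF plin_subst] lin_add_fun)
    finally show "pcoord scoord (prim v) = dlt (vpoly v)" .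
  qed
  define D where "D = (\<lambda>a\<in>carrier S. inv_into (carrier ?T) (pcoord scoord) (dlt (scoord a)))"
  have D: "D a \<in> carrier ?T" "pcoord scoord (D a) = dlt (scoord a)" if "a \<in> carrier S" for a
  proof -
    have "dlt (scoord a) \<in> fsp (mons ({..<2} \<times> {..<d}))"
      by (rule subst_fsp[OF S'(5)[OF that]]) auto
    then have "dlt (scoord a) \<in> pcoord scoord ` carrier ?T" using T'(3) by (auto simp: bij_betw_def)
    then show "D a \<in> carrier ?T" "pcoord scoord (D a) = dlt (scoord a)"
      using that by (auto simp: D_def f_inv_into_f inv_into_into)
  qed
  have PD: "?P D"
  proof (intro conjI allI)
    show "D \<in> carrier (hom_space S ?T)"
    proof -
      have "D (x \<oplus>\<^bsub>S\<^esub> y) = D x \<oplus>\<^bsub>?T\<^esub> D y" if "x \<in> carrier S" "y \<in> carrier S" for x y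
        by (rule T'(12)) (use that D S' T' in simp_all)
      moreover have "D (c \<odot>\<^bsub>S\<^esub> x) = c \<odot>\<^bsub>?T\<^esub> D x" if "x \<in> carrier S" for x c
        by (rule T'(12)) (use that D S' T' in simp_all)
      ultimately show ?thesis using D(1) by (simp add: hom_space_def D_def)
    qed
    show "D \<in> ring_hom S ?T"
    proof (rule ring_hom_memI)
      show "D (x \<oplus>\<^bsub>S\<^esub> y) = D x \<oplus>\<^bsub>?T\<^esub> D y" if "x \<in> carrier S" "y \<in> carrier S" for x y
        by (rule T'(12)) (use that D S' T' in simp_all)
      show "D (x \<otimes>\<^bsub>S\<^esub> y) = D x \<otimes>\<^bsub>?T\<^esub> D y" if "x \<in> carrier S" "y \<in> carrier S" for x y
        by (rule T'(12)) (use that D S.mult_closed S.coord_mult S.tensor_mult in simp_all)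
      show "D \<one>\<^bsub>S\<^esub> = \<one>\<^bsub>?T\<^esub>"
        by (rule T'(12)) (use D S.one_closed S.coord_one S.tensor_one in simp_all)
    qed (use D in auto)
    show "D (sym_incl scale v) = prim v" for v
      by (rule T'(12)) (use D sym_incl prim in simp_all)
  qed
  have "D' = D" if P: "?P D'" for D'
  proof (rule extensionalityI[of _ "carrier S"])
    show "D' \<in> extensional (carrier S)" using P by (auto simp: hom_space_def PiE_def)
    show "D \<in> extensional (carrier S)" by (simp add: D_def)
    fix a assume a: "a \<in> carrier S"
    have c: "D' x \<in> carrier ?T" if "x \<in> carrier S" for x using P that by (auto simp: hom_space_def)
    have "pcoord scoord (D' a) = dlt (scoord a)"
    proof (rule S.hom_unique[OF _ _ _ _ a, of "\<lambda>a. pcoord scoord (D' a)"])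
      have "D' (x \<oplus>\<^bsub>S\<^esub> y) = D' x \<oplus>\<^bsub>?T\<^esub> D' y" if "x \<in> carrier S" "y \<in> carrier S" for x y
        using P that by (simp add: hom_space_def)
      moreover have "D' (c \<odot>\<^bsub>S\<^esub> x) = c \<odot>\<^bsub>?T\<^esub> D' x" if "x \<in> carrier S" for x c
        using P that by (simp add: hom_space_def)
      ultimately show "lin_on S (\<lambda>a. pcoord scoord (D' a))"
        using c T' by (simp add: lin_on_def)
      show "pcoord scoord (D' (x \<otimes>\<^bsub>S\<^esub> y)) = pcoord scoord (D' x) * pcoord scoord (D' y)" if "x \<in> carrier S" "y \<in> carrier S" for x y
        using P ring_hom_mult[of D' S ?T x y] that c S.tensor_mult by simp
      show "pcoord scoord (D' \<one>\<^bsub>S\<^esub>) = 1" using P ring_hom_one[of D' S ?T] S.tensor_one by simp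
      show "pcoord scoord (D' (bas S scoord {#i#})) = pvar (0, i) + pvar (Suc 0, i)" if "i \<in> {..<d}" for i
        using that P prim(2)[of "e i"] by (simp add: bas_var vpoly_def vcoord_e[OF fd e])
    qed
    then show "D' a = D a" using D[OF a] c[OF a] by (intro T'(12)) simp_all
  qed
  with PD have "(THE D. ?P D) = D" by (rule the_equality)
  then have "symmetric_comult scale = D" by (simp add: symmetric_comult_def Let_def prim_def)
  then show "symmetric_comult scale a \<in> carrier (tensor_power S 2)"
    "pcoord scoord (symmetric_comult scale a) = dlt (scoord a)" using D[OF a] by auto
qed

lemma symmetric_counit:
  assumes a: "a \<in> carrier S" shows "symmetric_counit scale a = lkp (scoord a) {#}"
proof -
  note S' = coordD[OF S.coord]
  let ?P = "\<lambda>D. D \<in> carrier (hom_space S scalars) \<and> D \<in> ring_hom S scalars \<and> (\<forall>v. D (sym_incl scale v) = 0)"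
  define D where "D = (\<lambda>a\<in>carrier S. lkp (scoord a) {#})"
  have lk: "smul (lkp (p * q) {#}) (1 :: (nat, 'k) poly) = smul (lkp p {#} * lkp q {#}) 1" for p q :: "(nat, 'k) poly"
    unfolding subst_0[symmetric] subst_mult by (simp add: subst_0 smul_mult mult.commute)
  have inj: "a = b" if "smul a (1 :: (nat, 'k) poly) = smul b 1" for a b
    using arg_cong[OF that, of "\<lambda>p. lkp p {#}"] by simp
  have PD: "?P D"
  proof (intro conjI allI)
    show "D \<in> carrier (hom_space S scalars)"
      using S' by (auto simp: hom_space_def D_def lookup_add)
    show "D \<in> ring_hom S scalars"
      by (rule ring_hom_memI) (use S' S.mult_closed S.coord_mult S.one_closed S.coord_one inj[OF lk] in \<open>simp_all add: D_def lookup_add\<close>)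
    have "lkp (lin (\<lambda>i. pvar i) p) {#} = 0" for p :: "nat \<Rightarrow>\<^sub>0 'k"
    proof -
      have "p \<in> fsp UNIV" by simp
      then show ?thesis by (induction rule: fsp_induct) (auto simp: lookup_add lookup_single when_def)
    qed
    then show "D (sym_incl scale v) = 0" for v by (simp add: D_def sym_incl vpoly_def)
  qed
  have "D' = D" if P: "?P D'" for D'
  proof (rule extensionalityI[of _ "carrier S"])
    show "D' \<in> extensional (carrier S)" using P by (auto simp: hom_space_def PiE_def)
    show "D \<in> extensional (carrier S)" by (simp add: D_def)
    fix a assume a: "a \<in> carrier S"
    \<comment> \<open>Scalars are embedded as constant polynomials, so that
      \<open>hom_unique\<close> applies to the counit.\<close>
    have "smul (D' a) (1 :: (nat, 'k) poly) = subst (\<lambda>v. 0) (scoord a)"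
    proof (rule S.hom_unique[OF _ _ _ _ a, of "\<lambda>a. smul (D' a) (1 :: (nat, 'k) poly)"])
      show "lin_on S (\<lambda>a. smul (D' a) (1 :: (nat, 'k) poly))"
        using P by (simp add: hom_space_def lin_on_def smul_add_left)
      show "smul (D' (x \<otimes>\<^bsub>S\<^esub> y)) (1 :: (nat, 'k) poly) = smul (D' x) 1 * smul (D' y) 1" if "x \<in> carrier S" "y \<in> carrier S" for x y
        using P ring_hom_mult[of D' S scalars x y] that by (simp add: smul_mult mult.commute)
      show "smul (D' \<one>\<^bsub>S\<^esub>) (1 :: (nat, 'k) poly) = 1" using P ring_hom_one[of D' S scalars] by simp
      show "smul (D' (bas S scoord {#i#})) (1 :: (nat, 'k) poly) = 0" if "i \<in> {..<d}" for i
        using that P by (simp add: bas_var)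
    qed
    then have "smul (D' a) (1 :: (nat, 'k) poly) = smul (lkp (scoord a) {#}) 1" by (simp only: subst_0)
    then show "D' a = D a" using a inj by (simp add: D_def)
  qed
  with PD have "(THE D. ?P D) = D" by (rule the_equality)
  then have "symmetric_counit scale = D" by (simp add: symmetric_counit_def Let_def)
  then show ?thesis using a by (simp add: D_def)
qed

lemma symmetric_bialgebra_simps:
  "carrier (symmetric_bialgebra scale) = carrier S" "add (symmetric_bialgebra scale) = add S"
  "\<zero>\<^bsub>symmetric_bialgebra scale\<^esub> = \<zero>\<^bsub>S\<^esub>" "monoid.mult (symmetric_bialgebra scale) = monoid.mult S"
  "\<one>\<^bsub>symmetric_bialgebra scale\<^esub> = \<one>\<^bsub>S\<^esub>" "module.smult (symmetric_bialgebra scale) = module.smult S"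
  "comult (symmetric_bialgebra scale) = symmetric_comult scale" "counit (symmetric_bialgebra scale) = symmetric_counit scale"
  unfolding symmetric_bialgebra_def module.defs bialgebra.defs by auto

lemma poly_bialgebra_sym: "poly_bialgebra (symmetric_bialgebra scale) scoord {..<d}"
proof
  have T: "tensor_space (symmetric_bialgebra scale) n = tensor_space S n" for n
    by (rule tensor_space_cong) (simp_all add: symmetric_bialgebra_simps)
  show "coord (symmetric_bialgebra scale) scoord (mons {..<d})"
    by (rule coord_cong[OF S.coord]) (simp_all add: symmetric_bialgebra_simps)
  show "comult (symmetric_bialgebra scale) a \<in> carrier (tensor_space (symmetric_bialgebra scale) 2)"
    if "a \<in> carrier (symmetric_bialgebra scale)" for a
    using symmetric_comult(1)[of a] that by (simp add: T symmetric_bialgebra_simps)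
qed (use symmetric_comult(2) symmetric_counit in
  \<open>simp_all add: symmetric_bialgebra_simps S.mult_closed S.coord_mult S.one_closed S.coord_one\<close>)

end

section \<open>Multiplication by an exponential\<close>

text \<open>
  A function \<open>f\<close> of a multiset stands for the series with the coefficient \<open>f a\<close> at the divided power
  \<open>\<xi>\<^sup>a / a!\<close>; then \<open>conv L f\<close> is its product with the exponential of the linear form \<open>\<Sum>v. \<xi>\<^sub>v L v\<close>.
\<close>

definition conv_step :: "('x \<Rightarrow> 'r::comm_ring_1) \<Rightarrow> 'x \<Rightarrow> ('x multiset \<Rightarrow> 'r) \<Rightarrow> 'x multiset \<Rightarrow> 'r" where
  "conv_step L v f = (\<lambda>a. L v * f a + f (add_mset v a))"

definition conv :: "('x \<Rightarrow> 'r::comm_ring_1) \<Rightarrow> ('x multiset \<Rightarrow> 'r) \<Rightarrow> 'x multiset \<Rightarrow> 'r" where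
  "conv L f a = fold_mset (conv_step L) f a {#}"

interpretation conv_step: comp_fun_commute "conv_step L"
  by standard (auto simp: conv_step_def fun_eq_iff algebra_simps add_mset_commute)

lemma conv_empty[simp]: "conv L f {#} = f {#}"
  by (simp add: conv_def)

lemma conv_step_lin: "fold_mset (conv_step L) (\<lambda>a. c * f a + g a) a b =
    c * fold_mset (conv_step L) f a b + fold_mset (conv_step L) g a b"
  by (induction a arbitrary: b) (auto simp: conv_step.fold_mset_add_mset conv_step_def algebra_simps)

text \<open>Shifting the index by \<open>v\<close> is differentiation by
  \<open>\<xi>\<^sub>v\<close>; this is the product rule for the multiplication by the
  exponential.\<close>

lemma conv_add_mset[simp]: "conv L f (add_mset v a) = L v * conv L f a + conv L (\<lambda>a. f (add_mset v a)) a"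
proof -
  have "conv L f (add_mset v a) = fold_mset (conv_step L) (conv_step L v f) a {#}"
    by (simp add: conv_def conv_step.fold_mset_fun_left_comm)
  then show ?thesis unfolding conv_step_def[of L v f] conv_step_lin by (simp add: conv_def)
qed

lemma conv_lin: "conv L (\<lambda>a. c * f a) a = c * conv L f a" "conv L (\<lambda>a. f a + g a) a = conv L f a + conv L g a"
  "conv L (\<lambda>a. f a - g a) a = conv L f a - conv L g a" "conv L (\<lambda>a. 0) a = 0"
proof -
  show s: "conv L (\<lambda>a. c * f a) a = c * conv L f a" for c f
    by (induction a arbitrary: f) (auto simp: algebra_simps)
  show p: "conv L (\<lambda>a. f a + g a) a = conv L f a + conv L g a" for f g
    by (induction a arbitrary: f g) (auto simp: algebra_simps)
  show "conv L (\<lambda>a. f a - g a) a = conv L f a - conv L g a"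
    using p[of f "\<lambda>a. - 1 * g a"] s[of "- 1" g] by simp
  show "conv L (\<lambda>a. 0) a = 0" using s[of 0 f] by simp
qed

text \<open>As a function of two multisets, \<open>f (a + c)\<close> is the series in a sum of two
  sets of dual variables, on which the exponential is a product.\<close>

lemma conv_union: "conv L f (a + c) = conv L (\<lambda>a'. conv L (\<lambda>c'. f (a' + c')) c) a"
  by (induction a arbitrary: f) (auto simp: conv_lin)

lemma conv_conv: "conv L (conv L' f) a = conv (\<lambda>v. L v + L' v) f a"
proof (induction a arbitrary: f)
  case (add v a)
  have "conv L (conv L' f) (add_mset v a) = L v * conv L (conv L' f) a +
     (L' v * conv L (conv L' f) a + conv L (conv L' (\<lambda>a. f (add_mset v a))) a)"
    by (simp add: conv_lin)
  with add show ?case by (simp add: algebra_simps)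
qed simp

lemma conv_zero[simp]: "conv (\<lambda>v. 0) f a = f a"
  by (induction a arbitrary: f) auto

lemma conv_cong: "(\<And>b. b \<subseteq># a \<Longrightarrow> f b = g b) \<Longrightarrow> conv L f a = conv L g a"
proof (induction a arbitrary: f g)
  case (add v a)
  have "conv L f a = conv L g a" by (rule add.IH) (auto intro!: add.prems intro: subset_mset.order_trans)
  moreover have "conv L (\<lambda>a. f (add_mset v a)) a = conv L (\<lambda>a. g (add_mset v a)) a"
    by (rule add.IH) (auto intro!: add.prems)
  ultimately show ?case by simp
qed simp

text \<open>The products of the \<open>L' v\<close> are the coefficients of the exponential of
  \<open>L'\<close>, and exponentials multiply by adding their exponents.\<close>

lemma conv_prod: "conv L (\<lambda>a. (\<Prod>v\<in>#a. L' v) * w) a = (\<Prod>v\<in>#a. L v + L' v) * w"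
proof (induction a)
  case (add v a)
  have "conv L (\<lambda>a. L' v * ((\<Prod>v\<in>#a. L' v) * w)) a = L' v * conv L (\<lambda>a. (\<Prod>v\<in>#a. L' v) * w) a"
    by (rule conv_lin)
  with add show ?case by (simp add: algebra_simps)
qed simp

lemma conv_swap: "conv L (\<lambda>a. conv L' (\<lambda>b. F a b) b) a = conv L' (\<lambda>b. conv L (\<lambda>a. F a b) a) b"
  by (induction a arbitrary: F) (auto simp: conv_lin)

fun convl :: "('x \<Rightarrow> 'r::comm_ring_1) \<Rightarrow> ('x multiset list \<Rightarrow> 'r) \<Rightarrow> 'x multiset list \<Rightarrow> 'r" where
  "convl L f [] = f []"
| "convl L f (a # l) = conv L (\<lambda>a'. convl L (\<lambda>l'. f (a' # l')) l) a"

lemma convl_lin: "convl L (\<lambda>l. c * f l) l = c * convl L f l" "convl L (\<lambda>l. f l + g l) l = convl L f l + convl L g l"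
  "convl L (\<lambda>l. f l - g l) l = convl L f l - convl L g l" "convl L (\<lambda>l. 0) l = 0"
proof -
  show s: "convl L (\<lambda>l. c * f l) l = c * convl L f l" for c f
    by (induction l arbitrary: f) (auto simp: conv_lin)
  show p: "convl L (\<lambda>l. f l + g l) l = convl L f l + convl L g l" for f g
    by (induction l arbitrary: f g) (auto simp: conv_lin)
  show "convl L (\<lambda>l. f l - g l) l = convl L f l - convl L g l"
    using p[of f "\<lambda>l. - 1 * g l"] s[of "- 1" g] by simp
  show "convl L (\<lambda>l. 0) l = 0" using s[of 0 f] by simp
qed

lemma convl_sum: "convl L (\<lambda>l. \<Sum>i\<in>S. f i l) l = (\<Sum>i\<in>S. convl L (f i) l)"
  by (induction S rule: infinite_finite_induct) (auto simp: convl_lin)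

lemma convl_conv_swap: "convl L (\<lambda>l. conv L' (\<lambda>b. F b l) b) l = conv L' (\<lambda>b. convl L (F b) l) b"
  by (induction l arbitrary: F) (auto simp: conv_swap[of L L'])

lemma convl_convl: "convl L (convl L' f) l = convl (\<lambda>v. L v + L' v) f l"
proof (induction l arbitrary: f)
  case (Cons a l)
  show ?case by (simp add: convl_conv_swap conv_conv[unfolded fun_eq_iff] Cons conv_conv)
qed simp

lemma convl_zero[simp]: "convl (\<lambda>v. 0) f l = f l"
  by (induction l arbitrary: f) auto

lemma convl_cong:
  "(\<And>k. length k = length l \<Longrightarrow> sum_list k \<subseteq># sum_list l \<Longrightarrow> f k = g k) \<Longrightarrow> convl L f l = convl L g l"
proof (induction l arbitrary: f g)
  case (Cons a l)
  have "convl L (\<lambda>l'. f (b # l')) l = convl L (\<lambda>l'. g (b # l')) l" if "b \<subseteq># a" for b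
    by (rule Cons.IH) (auto intro!: Cons.prems subset_mset.add_mono that)
  then show ?case by (auto intro!: conv_cong)
qed simp

lemma conv_bar_swap:
  "conv L (\<lambda>b. bar (\<lambda>a w. E a * w) (F b) l) b = bar (\<lambda>a w. E a * w) (\<lambda>l. conv L (\<lambda>b. F b l) b) l"
  by (induction l arbitrary: F rule: induct_list012) (auto simp: conv_lin)

abbreviation act :: "('x \<Rightarrow> 'r::comm_ring_1) \<Rightarrow> 'x multiset \<Rightarrow> 'r \<Rightarrow> 'r" where
  "act L \<equiv> \<lambda>a w. (\<Prod>v\<in>#a. L v) * w"

text \<open>Merging entries commutes with the multiplication by \<open>conv_union\<close>. The
  action of the last entry is itself an exponential, so its exponent changes from \<open>L'\<close>
  to the sum of \<open>L\<close> and \<open>L'\<close>. With opposite exponents the coefficients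
  become trivial.\<close>

lemma convl_bar: "convl L (bar (act L') f) l = bar (act (\<lambda>v. L v + L' v)) (convl L f) l"
proof (induction l arbitrary: f rule: induct_list012)
  case (2 a)
  then show ?case by (simp add: conv_prod)
next
  case (3 a c l)
  have "convl L (bar (act L') f) (a # c # l) =
      conv L (\<lambda>a'. convl L (\<lambda>l'. pre a' f l' - bar (act L') (\<lambda>l. f (a' # l)) l') (c # l)) a"
    unfolding convl.simps(2)[of L _ a]
    by (intro conv_cong convl_cong) (auto intro!: bar_Cons_ne)
  also have "\<dots> = conv L (\<lambda>a'. convl L (pre a' f) (c # l)) a -
      conv L (\<lambda>a'. convl L (bar (act L') (\<lambda>l. f (a' # l))) (c # l)) a"
    unfolding convl_lin conv_lin ..
  also have "conv L (\<lambda>a'. convl L (pre a' f) (c # l)) a = convl L f ((a + c) # l)"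
    by (simp add: conv_union)
  also have "conv L (\<lambda>a'. convl L (bar (act L') (\<lambda>l. f (a' # l))) (c # l)) a =
      conv L (\<lambda>a'. bar (act (\<lambda>v. L v + L' v)) (convl L (\<lambda>l. f (a' # l))) (c # l)) a"
    unfolding 3(2) ..
  also have "\<dots> = bar (act (\<lambda>v. L v + L' v)) (\<lambda>l. convl L f (a # l)) (c # l)"
    unfolding conv_bar_swap by simp
  finally show ?case by simp
qed simp

lemma convl_lft: "convl L (lft (act L') f) l = lft (act (\<lambda>v. L v + L' v)) (convl L f) l"
proof (cases l)
  case (Cons a k)
  have "conv L (\<lambda>a'. convl L (\<lambda>l'. act L' a' (f l')) k) a = conv L (\<lambda>a'. act L' a' (convl L f k)) a"
    unfolding convl_lin ..
  then show ?thesis by (simp add: Cons conv_prod)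
qed simp

lemma convl_del: "convl L (del (act L') f) l = del (act (\<lambda>v. L v + L' v)) (convl L f) l"
  unfolding del_def convl_lin convl_bar convl_lft ..

lemma act_zero': "act (\<lambda>v. 0) a w = aug a w"
  by (cases a) auto

lemma act_zero: "act (\<lambda>v. 0) = aug"
  by (intro ext) (rule act_zero')

lemma subst_conv: "subst g (conv L f a) = conv (\<lambda>v. subst g (L v)) (\<lambda>a. subst g (f a)) a"
  by (induction a arbitrary: f) auto

lemma subst_convl: "subst g (convl L f l) = convl (\<lambda>v. subst g (L v)) (\<lambda>l. subst g (f l)) l"
  by (induction l arbitrary: f) (auto simp: subst_conv)

lemma conv_fsp:
  fixes L :: "'x \<Rightarrow> ('y, 'k::field) poly"
  shows "(\<And>v. v \<in># a \<Longrightarrow> L v \<in> fsp (mons C)) \<Longrightarrow> (\<And>b. b \<subseteq># a \<Longrightarrow> f b \<in> fsp (mons C)) \<Longrightarrow> conv L f a \<in> fsp (mons C)"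
proof (induction a arbitrary: f)
  case (add v a)
  have "conv L f a \<in> fsp (mons C)" by (rule add.IH) (auto intro!: add.prems intro: subset_mset.order_trans)
  moreover have "conv L (\<lambda>a. f (add_mset v a)) a \<in> fsp (mons C)" by (rule add.IH) (auto intro!: add.prems)
  ultimately show ?case using add.prems(1)[of v] by auto
qed simp

lemma convl_fsp:
  fixes L :: "'x \<Rightarrow> ('y, 'k::field) poly"
  shows "(\<And>v. v \<in># sum_list l \<Longrightarrow> L v \<in> fsp (mons C)) \<Longrightarrow>
    (\<And>k. length k = length l \<Longrightarrow> sum_list k \<subseteq># sum_list l \<Longrightarrow> f k \<in> fsp (mons C)) \<Longrightarrow> convl L f l \<in> fsp (mons C)"
proof (induction l arbitrary: f)
  case (Cons a l)
  show ?case unfolding convl.simps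
  proof (rule conv_fsp)
    fix b assume b: "b \<subseteq># a"
    show "convl L (\<lambda>l'. f (b # l')) l \<in> fsp (mons C)"
      by (rule Cons.IH) (auto intro!: Cons.prems subset_mset.add_mono b)
  qed (auto intro!: Cons.prems)
qed simp

text \<open>The closed form of the recursion, for comparison with the sums in \<open>GS_d1\<close>
  and \<open>cobar\<close>.\<close>

lemma bar_sum:
  fixes f :: "'x multiset list \<Rightarrow> 'r::comm_ring_1"
  shows "length l = Suc m \<Longrightarrow> bar E f l =
    (\<Sum>i<m. (-1) ^ i * f (take i l @ [l ! i + l ! Suc i] @ drop (i + 2) l)) + (-1) ^ m * E (last l) (f (butlast l))"
proof (induction l arbitrary: f m rule: induct_list012)
  case (3 a c l)
  then obtain m' where m: "m = Suc m'" by (cases m) auto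
  have IH: "bar E (\<lambda>l. f (a # l)) (c # l) =
    (\<Sum>i<m'. (-1) ^ i * f (a # take i (c # l) @ [(c # l) ! i + (c # l) ! Suc i] @ drop (i + 2) (c # l)))
    + (-1) ^ m' * E (last (c # l)) (f (a # butlast (c # l)))"
    by (rule 3(2)) (use 3(3) m in simp)
  show ?case unfolding bar.simps IH m sum.lessThan_Suc_shift
    by (simp add: sum_negf)
qed auto

section \<open>Divided power coefficients\<close>

definition mfact :: "'y multiset \<Rightarrow> 'k::field_char_0" where
  "mfact M = (\<Prod>y\<in>set_mset M. fact (count M y))"

lemma mfact_nonzero[simp]: "mfact M \<noteq> 0"
  by (simp add: mfact_def)

lemma mfact_empty[simp]: "mfact {#} = 1"
  by (simp add: mfact_def)

lemma mfact_add: "(mfact (add_mset y M) :: 'k::field_char_0) = of_nat (Suc (count M y)) * mfact M"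
proof (cases "y \<in># M")
  case True
  then have s: "set_mset (add_mset y M) = insert y (set_mset M - {y})" "set_mset M = insert y (set_mset M - {y})" by auto
  have "(mfact (add_mset y M) :: 'k) = fact (Suc (count M y)) * (\<Prod>z\<in>set_mset M - {y}. fact (count M z))"
    unfolding mfact_def s(1) by (subst prod.insert) (auto intro!: prod.cong split: if_splits)
  moreover have "(mfact M :: 'k) = fact (count M y) * (\<Prod>z\<in>set_mset M - {y}. fact (count M z))"
    unfolding mfact_def by (subst s(2), subst prod.insert) auto
  ultimately show ?thesis by simp
next
  case False
  then have "(mfact (add_mset y M) :: 'k) = fact 1 * (\<Prod>z\<in>set_mset M. fact (count (add_mset y M) z))"
    unfolding mfact_def by (simp add: not_in_iff)
  also have "\<dots> = mfact M" unfolding mfact_def mult_1 fact_1 by (rule prod.cong) (use False in auto)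
  finally show ?thesis using False by (simp add: not_in_iff)
qed

text \<open>The value at the origin of the derivative of \<open>p\<close> along the monomial
  \<open>M\<close>.\<close>

definition evm :: "'y multiset \<Rightarrow> ('y, 'k::field_char_0) poly \<Rightarrow> 'k" where
  "evm M p = mfact M * lkp p M"

lemma evm_simps[simp]: "evm M (p + q) = evm M p + evm M q" "evm M (p - q) = evm M p - evm M q"
  "evm M (smul c p) = c * evm M p" "evm M 0 = 0" "evm M (- p) = - evm M p"
  by (auto simp: evm_def lookup_add lookup_minus algebra_simps)

lemma evm_sum: "evm M (\<Sum>x\<in>S. f x) = (\<Sum>x\<in>S. evm M (f x))"
  by (induction S rule: infinite_finite_induct) auto

text \<open>The product rule for the derivative along \<open>M\<close>, evaluated where
  \<open>y\<close> vanishes. It drives the induction in \<open>evm_pullback\<close>.\<close>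

lemma evm_var: "evm M (pvar y * p) = of_nat (count M y) * evm (M - {#y#}) p"
proof -
  have lk: "lkp (pvar y * p) M = (if y \<in># M then lkp p (M - {#y#}) else 0)"
  proof -
    have "p \<in> fsp UNIV" by simp
    then show ?thesis
    proof (induction rule: fsp_induct)
      case (add p N c)
      have "add_mset y N = M \<longleftrightarrow> y \<in># M \<and> N = M - {#y#}" by auto
      with add show ?case by (auto simp: distrib_left lookup_add sing_mult lookup_single when_def)
    qed simp
  qed
  show ?thesis
  proof (cases "y \<in># M")
    case True
    then obtain N where "M = add_mset y N" by (metis insert_DiffM)
    then show ?thesis unfolding evm_def lk by (simp add: mfact_add)
  next
    case False
    then have "count M y = 0" by (simp only: not_in_iff)
    with False show ?thesis by (simp add: evm_def lk)
  qed
qed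

text \<open>This is why the cobar differential is the transpose of the bar differential.\<close>

lemma evm_pullback:
  fixes p :: "('z, 'k::field_char_0) poly"
  assumes fin: "\<And>z. finite {y. r y = z}"
  shows "evm M (subst (\<lambda>z. \<Sum>y | r y = z. pvar y) p) = evm (image_mset r M) p"
proof -
  let ?f = "\<lambda>z. \<Sum>y | r y = z. pvar y"
  have *: "evm M (subst ?f (sing N (1 :: 'k))) = evm (image_mset r M) (sing N 1)" for N M
  proof (induction N arbitrary: M)
    case empty
    then show ?case by (auto simp: evm_def lookup_one when_def)
  next
    case (add z N)
    have "evm M (subst ?f (sing (add_mset z N) (1 :: 'k))) = (\<Sum>y | r y = z. evm M (pvar y * subst ?f (sing N (1 :: 'k))))"
      unfolding sing_add_mset[of z N] subst_mult by (simp add: sum_distrib_right evm_sum)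
    also have "\<dots> = (\<Sum>y | r y = z. of_nat (count M y) * evm (image_mset r M - {#z#}) (sing N (1 :: 'k)))"
    proof (rule sum.cong[OF refl])
      fix y assume y: "y \<in> {y. r y = z}"
      show "evm M (pvar y * subst ?f (sing N (1 :: 'k))) = of_nat (count M y) * evm (image_mset r M - {#z#}) (sing N (1 :: 'k))"
      proof (cases "y \<in># M")
        case True
        then have "image_mset r (M - {#y#}) = image_mset r M - {#z#}" using y by (simp add: image_mset_Diff)
        then show ?thesis using add.IH[of "M - {#y#}"] by (simp only: evm_var)
      qed (simp only: evm_var not_in_iff, simp)
    qed
    also have "\<dots> = of_nat (\<Sum>y | r y = z. count M y) * evm (image_mset r M - {#z#}) (sing N (1 :: 'k))"
      by (simp add: sum_distrib_right)
    also have "(\<Sum>y | r y = z. count M y) = count (image_mset r M) z"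
    proof -
      have "(\<Sum>y | r y = z. count M y) = (\<Sum>y\<in>{y \<in> set_mset M. r y = z}. count M y)"
        by (rule sum.mono_neutral_right) (auto simp: fin not_in_iff)
      then show ?thesis by (simp add: count_image_mset') (rule sum.cong; auto)
    qed
    also have "of_nat (count (image_mset r M) z) * evm (image_mset r M - {#z#}) (sing N (1 :: 'k)) = evm (image_mset r M) (sing (add_mset z N) (1 :: 'k))"
      unfolding sing_add_mset[of z N] evm_var ..
    finally show ?case .
  qed
  have "p \<in> fsp UNIV" by simp
  then show ?thesis
  proof (induction rule: fsp_induct)
    case (add p N c)
    have 1: "evm M (subst ?f (sing N c)) = c * evm M (subst ?f (sing N 1))"
      by (simp only: subst_simps smul_simps evm_simps mult_1_right)
    have 2: "evm (image_mset r M) (sing N c) = c * evm (image_mset r M) (sing N 1)"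
      by (simp add: evm_def lookup_single when_def)
    show ?case unfolding subst_simps(1) evm_simps(1) add.IH 1 2 * ..
  qed simp
qed

lemma image_enc_unshift: "(\<And>i v. j \<le> i \<Longrightarrow> i < j + length l \<Longrightarrow> r (Suc i, v) = (i, v)) \<Longrightarrow> image_mset r (enc (Suc j) l) = enc j l"
proof (induction l arbitrary: j)
  case (Cons a l)
  have "image_mset r (enc (Suc (Suc j)) l) = enc (Suc j) l" by (rule Cons.IH) (auto intro!: Cons.prems)
  moreover have "image_mset r (image_mset (Pair (Suc j)) a) = image_mset (Pair j) a"
    by (simp add: image_mset.compositionality comp_def Cons.prems)
  ultimately show ?case by simp
qed simp

lemma enc_append: "enc j (k @ l) = enc j k + enc (j + length k) l"
  by (induction k arbitrary: j) (auto simp: ac_simps)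

text \<open>\<open>shift 1 p\<close> stands for the tensor of 1 and \<open>p\<close>, so only an
  empty first entry contributes.\<close>

lemma evm_shift:
  assumes p: "p \<in> fsp (mons ({..<n} \<times> UNIV))" and l: "length l = n"
  shows "evm (enc 0 (a # l)) (shift 1 p) = aug a (evm (enc 0 l) p)"
proof -
  \<comment> \<open>The inverse of the shift has to be completed to a total map. Factor 0 is sent to
    factor \<open>n\<close>, where \<open>p\<close> has no variables, so that \<open>r\<close>
    permutes the factors up to \<open>n\<close> and has one-point fibres.\<close>
  define r :: "nat \<times> 'a \<Rightarrow> nat \<times> 'a" where "r = (\<lambda>(j, v). if j = 0 then (n, v) else if j \<le> n then (j - 1, v) else (j, v))"
  have fib: "{y. r y = (j, v)} = (if j < n then {(Suc j, v)} else if j = n then {(0, v)} else {(j, v)})" for j v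
    by (auto simp: r_def split: if_splits)
  have "shift 1 p = subst (\<lambda>z. \<Sum>y | r y = z. pvar y) p"
    unfolding shift_def by (rule subst_cong[OF p]) (auto simp: fib)
  then have "evm (enc 0 (a # l)) (shift 1 p) = evm (image_mset r (enc 0 (a # l))) p"
    using evm_pullback[of r "enc 0 (a # l)" p] fib by (auto simp: finite_subset)
  also have "image_mset r (enc 0 (a # l)) = image_mset (Pair n) a + enc 0 l"
  proof -
    have "image_mset r (enc (Suc 0) l) = enc 0 l" by (rule image_enc_unshift) (auto simp: r_def l)
    then show ?thesis by (simp add: image_mset.compositionality comp_def r_def)
  qed
  also have "evm (image_mset (Pair n) a + enc 0 l) p = aug a (evm (enc 0 l) p)"
  proof (cases a)
    case (add v b)
    then have "image_mset (Pair n) a + enc 0 l \<notin> mons ({..<n} \<times> UNIV)" by auto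
    then have "lkp p (image_mset (Pair n) a + enc 0 l) = 0" using p unfolding fsp_iff by blast
    then show ?thesis by (simp add: evm_def add)
  qed simp
  finally show ?thesis .
qed

lemma evm_last:
  assumes p: "p \<in> fsp (mons ({..<n} \<times> UNIV))" and l: "length l = n"
  shows "evm (enc 0 (l @ [a])) p = aug a (evm (enc 0 l) p)"
proof (cases a)
  case (add v b)
  then have "enc 0 (l @ [a]) \<notin> mons ({..<n} \<times> UNIV)" by (auto simp: enc_append l)
  then have "lkp p (enc 0 (l @ [a])) = 0" using p unfolding fsp_iff by blast
  then show ?thesis by (simp add: evm_def add)
qed (simp add: enc_append)

lemma enc_merge:
  "i + 1 < length l \<Longrightarrow> (\<And>k v. r (k, v) = (if k \<le> j + i then (k, v) else (k - 1, v))) \<Longrightarrow>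
   image_mset r (enc j l) = enc j (take i l @ [l ! i + l ! Suc i] @ drop (i + 2) l)"
proof (induction i arbitrary: j l)
  case 0
  then obtain a c k where l: "l = a # c # k" by (metis (no_types, opaque_lifting) One_nat_def Suc_le_length_iff add.left_neutral less_eq_Suc_le)
  have "image_mset r (enc (Suc (Suc j)) k) = enc (Suc j) k" by (rule image_enc_unshift) (auto simp: 0(2))
  then show ?case by (simp add: l image_mset.compositionality comp_def 0(2) ac_simps)
next
  case (Suc i)
  then obtain a k where l: "l = a # k" by (cases l) auto
  have "image_mset r (enc (Suc j) k) = enc (Suc j) (take i k @ [k ! i + k ! Suc i] @ drop (i + 2) k)"
    by (rule Suc.IH) (use Suc.prems l in auto)
  then show ?case by (simp add: l image_mset.compositionality comp_def Suc.prems(2))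
qed

text \<open>The coproduct at factor \<open>i\<close> replaces a variable by the sum over its fibre
  under the map that merges the factors \<open>i\<close> and \<open>Suc i\<close>;
  \<open>evm_pullback\<close> turns it into merging the two entries.\<close>

lemma evm_theta:
  assumes i: "i + 1 < length l"
  shows "evm (enc 0 l) (theta_at i p) = evm (enc 0 (take i l @ [l ! i + l ! Suc i] @ drop (i + 2) l)) p"
proof -
  define r :: "nat \<times> 'a \<Rightarrow> nat \<times> 'a" where "r = (\<lambda>(k, v). if k \<le> i then (k, v) else (k - 1, v))"
  have fib: "{y. r y = (j, v)} = (if j < i then {(j, v)} else if j = i then {(i, v), (Suc i, v)} else {(Suc j, v)})" for j v
    by (auto simp: r_def split: if_splits)
  have "theta_at i p = subst (\<lambda>z. \<Sum>y | r y = z. pvar y) p"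
    unfolding theta_at_def by (rule arg_cong[of _ _ "\<lambda>f. subst f p"]) (auto simp: fib fun_eq_iff)
  moreover have "finite {y. r y = z}" for z by (cases z) (simp add: fib)
  ultimately have "evm (enc 0 l) (theta_at i p) = evm (image_mset r (enc 0 l)) p"
    using evm_pullback[of r "enc 0 l" p] by simp
  also have "image_mset r (enc 0 l) = enc 0 (take i l @ [l ! i + l ! Suc i] @ drop (i + 2) l)"
    by (rule enc_merge[OF i]) (auto simp: r_def)
  finally show ?thesis .
qed

text \<open>The outer summands put a factor 1 in front of and behind \<open>p\<close>. Behind, the
  variables keep their numbers and the polynomial is \<open>p\<close> itself.\<close>

definition cobar :: "nat \<Rightarrow> (nat \<times> 'x, 'k::field) poly \<Rightarrow> (nat \<times> 'x, 'k) poly" where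
  "cobar n p = shift 1 p + (\<Sum>i=1..n. (-1) ^ i * theta_at (i - 1) p) + (-1) ^ (n + 1) * p"

lemma minus_one_power_smul: "(-1) ^ i * p = smul ((-1) ^ i) p" for p :: "('y, 'k::field) poly"
proof (cases "even i")
  case True
  then have "(-1 :: 'k) ^ i = 1" "(-1 :: ('y, 'k) poly) ^ i = 1" by simp_all
  then show ?thesis by (simp only: smul_simps mult_1_left)
next
  case False
  then have "(-1 :: 'k) ^ i = - 1" "(-1 :: ('y, 'k) poly) ^ i = - 1" by simp_all
  then show ?thesis by (simp only: smul_simps mult_minus_left mult_1_left)
qed

lemma evm_cobar:
  assumes p: "p \<in> fsp (mons ({..<n} \<times> UNIV))" and l: "length l = Suc n"
  shows "evm (enc 0 l) (cobar n p) = del aug (\<lambda>k. evm (enc 0 k) p) l"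
proof -
  obtain a k where ak: "l = a # k" "length k = n" using l by (cases l) auto
  have "(\<Sum>i=1..n. (-1) ^ i * evm (enc 0 l) (theta_at (i - 1) p)) = (\<Sum>i<n. (-1) ^ Suc i * evm (enc 0 l) (theta_at i p))"
    by (rule sum.reindex_bij_witness[of _ Suc "\<lambda>i. i - 1"]) auto
  also have "\<dots> = - (\<Sum>i<n. (-1) ^ i * evm (enc 0 (take i l @ [l ! i + l ! Suc i] @ drop (i + 2) l)) p)"
    unfolding sum_negf[symmetric] by (rule sum.cong[OF refl]) (use l in \<open>simp add: evm_theta\<close>)
  moreover have "evm (enc 0 l) p = aug (last l) (evm (enc 0 (butlast l)) p)"
    using evm_last[OF p, of "butlast l" "last l"] l by (simp add: append_butlast_last_id[of l, symmetric] del: append_butlast_last_id) (metis append_butlast_last_id l length_0_conv nat.simps(3))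
  moreover have "evm (enc 0 l) (shift 1 p) = lft aug (\<lambda>k. evm (enc 0 k) p) l"
    using evm_shift[OF p ak(2)] ak by simp
  ultimately show ?thesis
    unfolding del_def bar_sum[OF l] cobar_def minus_one_power_smul by (simp add: evm_sum)
qed

section \<open>Values of cochains on monomial tensors\<close>

lemma hom_spaceD:
  assumes "f \<in> carrier (hom_space M N)"
  shows "x \<in> carrier M \<Longrightarrow> f x \<in> carrier N"
    "x \<in> carrier M \<Longrightarrow> y \<in> carrier M \<Longrightarrow> f (x \<oplus>\<^bsub>M\<^esub> y) = f x \<oplus>\<^bsub>N\<^esub> f y"
    "x \<in> carrier M \<Longrightarrow> f (c \<odot>\<^bsub>M\<^esub> x) = c \<odot>\<^bsub>N\<^esub> f x" "f \<in> extensional (carrier M)"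
  using assms by (auto simp: hom_space_def PiE_def)

lemma hom_space_lin_on: "f \<in> carrier (hom_space M N) \<Longrightarrow> coord N \<kappa> J \<Longrightarrow> lin_on M (\<lambda>x. \<kappa> (f x))"
  unfolding lin_on_def by (simp add: hom_spaceD coordD)

context poly_algebra
begin

lemma A_distr:
  assumes "a \<in> carrier A" "b \<in> carrier A" "c \<in> carrier A"
  shows "(a \<oplus>\<^bsub>A\<^esub> b) \<otimes>\<^bsub>A\<^esub> c = a \<otimes>\<^bsub>A\<^esub> c \<oplus>\<^bsub>A\<^esub> b \<otimes>\<^bsub>A\<^esub> c" "c \<otimes>\<^bsub>A\<^esub> (a \<oplus>\<^bsub>A\<^esub> b) = c \<otimes>\<^bsub>A\<^esub> a \<oplus>\<^bsub>A\<^esub> c \<otimes>\<^bsub>A\<^esub> b"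
    "(s \<odot>\<^bsub>A\<^esub> a) \<otimes>\<^bsub>A\<^esub> c = s \<odot>\<^bsub>A\<^esub> (a \<otimes>\<^bsub>A\<^esub> c)" "c \<otimes>\<^bsub>A\<^esub> (s \<odot>\<^bsub>A\<^esub> a) = s \<odot>\<^bsub>A\<^esub> (c \<otimes>\<^bsub>A\<^esub> a)"
  by (rule coordD(12)[OF coord]; use assms coordD[OF coord] in \<open>simp add: mult_closed coord_mult algebra_simps smul_mult\<close>)+

lemma merge_words: "l \<in> words A (Suc m) \<Longrightarrow> i < m \<Longrightarrow> take i l @ [l ! i \<otimes>\<^bsub>A\<^esub> l ! (i + 1)] @ drop (i + 2) l \<in> words A m"
  by (auto simp: words_def intro!: mult_closed dest: in_set_takeD in_set_dropD)

lemma multilin_merge: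
  "multilin A m G \<Longrightarrow> i < m \<Longrightarrow> multilin A (Suc m) (\<lambda>l. G (take i l @ [l ! i \<otimes>\<^bsub>A\<^esub> l ! (i + 1)] @ drop (i + 2) l))"
proof (induction i arbitrary: m G)
  case 0
  then obtain m' where m: "m = Suc m'" by (cases m) auto
  have G: "\<And>l. l \<in> words A m' \<Longrightarrow> lin_on A (\<lambda>a. G (a # l))" "\<And>a. a \<in> carrier A \<Longrightarrow> multilin A m' (\<lambda>l. G (a # l))"
    using 0(1) by (auto simp: m)
  have "lin_on A (\<lambda>a. G (a \<otimes>\<^bsub>A\<^esub> c # k)) \<and> lin_on A (\<lambda>a. G (c \<otimes>\<^bsub>A\<^esub> a # k))" if "c \<in> carrier A" "k \<in> words A m'" for c k
    using G(1)[OF that(2)] that(1) coordD(9,10)[OF coord] by (simp add: lin_on_def A_distr mult_closed)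
  then show ?case using G(2) mult_closed by (auto simp: m elim!: words_Suc_cases)
next
  case (Suc i)
  then obtain m' where m: "m = Suc m'" "i < m'" by (cases m) auto
  have G: "\<And>l. l \<in> words A m' \<Longrightarrow> lin_on A (\<lambda>a. G (a # l))" "\<And>a. a \<in> carrier A \<Longrightarrow> multilin A m' (\<lambda>l. G (a # l))"
    using Suc.prems(1) by (auto simp: m)
  have "multilin A (Suc m') (\<lambda>l. G (a # take i l @ [l ! i \<otimes>\<^bsub>A\<^esub> l ! (i + 1)] @ drop (i + 2) l))" if "a \<in> carrier A" for a
    by (rule Suc.IH[of m' "\<lambda>l. G (a # l)"]) (use G(2) that m in auto)
  then show ?case using G(1)[OF merge_words[OF _ m(2)]] unfolding m(1) multilin.simps(2)[of A "Suc m'"] by auto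
qed

lemma multilin_snoc:
  assumes L: "lin_on A L"
  shows "multilin A m G \<Longrightarrow> multilin A (Suc m) (\<lambda>l. G (butlast l) * (L (last l) :: ('y, 'k) poly))"
proof (induction m arbitrary: G)
  case 0
  then show ?case using L by (auto simp: lin_on_def distrib_left smul_mult)
next
  case (Suc m)
  have "multilin A (Suc m) (\<lambda>l. G (butlast (a # l)) * L (last (a # l)))" if "a \<in> carrier A" for a
    by (rule multilin_cong[OF coord Suc.IH[of "\<lambda>l. G (a # l)"]])
      (use Suc.prems that in \<open>auto elim!: words_Suc_cases\<close>)
  moreover have "lin_on A (\<lambda>a. G (butlast (a # l)) * L (last (a # l)))" if l: "l \<in> words A (Suc m)" for l
  proof -
    have ne: "l \<noteq> []" and b: "butlast l \<in> words A m" using l by (auto simp: words_def dest: in_set_butlastD)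
    show ?thesis using Suc.prems b ne by (auto simp: lin_on_def distrib_right smul_mult)
  qed
  ultimately show ?case by (simp del: butlast.simps last.simps)
qed

lemma bas_mult: "a \<in> mons B \<Longrightarrow> b \<in> mons B \<Longrightarrow> bas A \<kappa> a \<otimes>\<^bsub>A\<^esub> bas A \<kappa> b = bas A \<kappa> (a + b)"
proof (rule coordD(12)[OF coord])
  assume ab: "a \<in> mons B" "b \<in> mons B"
  then have "a + b \<in> mons B" by auto
  with ab show "\<kappa> (bas A \<kappa> a \<otimes>\<^bsub>A\<^esub> bas A \<kappa> b) = \<kappa> (bas A \<kappa> (a + b))" "bas A \<kappa> (a + b) \<in> carrier A"
    "bas A \<kappa> a \<otimes>\<^bsub>A\<^esub> bas A \<kappa> b \<in> carrier A"
    using bas_mons by (simp_all add: coord_mult mult_closed sing_mult del: set_mset_union)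
qed

lemma map_bas_words: "l \<in> wds (mons B) n \<Longrightarrow> map (bas A \<kappa>) l \<in> words A n"
  by (rule words_bas[OF coord])

lemma pens_map_bas: "l \<in> wds (mons B) n \<Longrightarrow> pens j (map \<kappa> (map (bas A \<kappa>) l)) = sing (enc j l) 1"
  using tens_map_bas[OF coord, of l n] lin_enc_tens[of j "map \<kappa> (map (bas A \<kappa>) l)"] by simp

text \<open>The values on tensors of monomials, written as polynomials; they determine the whole map
  by \<open>psi_expand\<close>.\<close>

definition psi :: "nat \<Rightarrow> (('k, 'a) tensor \<Rightarrow> ('k, 'a) tensor) \<Rightarrow> 'x multiset list \<Rightarrow> (nat \<times> 'x, 'k) poly" where
  "psi m \<Psi> l = pcoord \<kappa> (\<Psi> (pure_tensor A m (map (bas A \<kappa>) l)))"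

lemma coord_tensor_power': "coord (tensor_power A n) (tcoord \<kappa>) (wds (mons B) n)"
  by (rule coord_cong[OF coord_tensor_space[OF coord]]) auto

lemma bas_tensor: "w \<in> wds (mons B) n \<Longrightarrow> bas (tensor_power A n) (tcoord \<kappa>) w = pure_tensor A n (map (bas A \<kappa>) w)"
proof (rule coordD(12)[OF coord_tensor_power'[of n]])
  assume w: "w \<in> wds (mons B) n"
  note b = bas[OF coord_tensor_power' w] and m = map_bas_words[OF w]
  show "bas (tensor_power A n) (tcoord \<kappa>) w \<in> carrier (tensor_power A n)" by (rule b)
  show "pure_tensor A n (map (bas A \<kappa>) w) \<in> carrier (tensor_power A n)" using pure_carrier[OF m] by simp
  show "tcoord \<kappa> (bas (tensor_power A n) (tcoord \<kappa>) w) = tcoord \<kappa> (pure_tensor A n (map (bas A \<kappa>) w))"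
    by (simp only: b tcoord_pure[OF coord m] tens_map_bas[OF coord w])
qed

lemma psi_expand:
  assumes \<Psi>: "\<Psi> \<in> carrier (hom_space (tensor_power A m) (tensor_power A n))" and P: "P \<in> carrier (tensor_space A m)"
  shows "pcoord \<kappa> (\<Psi> P) = lin (psi m \<Psi>) (tcoord \<kappa> P)"
proof -
  have P': "P \<in> carrier (tensor_power A m)" using P by simp
  have "pcoord \<kappa> (\<Psi> P) = lin (\<lambda>w. pcoord \<kappa> (\<Psi> (bas (tensor_power A m) (tcoord \<kappa>) w))) (tcoord \<kappa> P)"
    by (rule expand_lin_on[OF coord_tensor_power' P' hom_space_lin_on[OF \<Psi> coord_tensor_power]])
  also have "\<dots> = lin (psi m \<Psi>) (tcoord \<kappa> P)"
    by (rule lin_cong_fsp[OF coordD(5)[OF coord_tensor_power' P']]) (simp add: bas_tensor psi_def)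
  finally show ?thesis .
qed

lemma psi_pure:
  assumes "\<Psi> \<in> carrier (hom_space (tensor_power A m) (tensor_power A n))" "l \<in> words A m"
  shows "pcoord \<kappa> (\<Psi> (pure_tensor A m l)) = lin (psi m \<Psi>) (tens (map \<kappa> l))"
  using psi_expand[OF assms(1) pure_carrier[OF assms(2)]] tcoord_pure[OF coord assms(2)] by simp

lemma psi_multilin:
  assumes "\<Psi> \<in> carrier (hom_space (tensor_power A m) (tensor_power A n))"
  shows "multilin A m (\<lambda>l. pcoord \<kappa> (\<Psi> (pure_tensor A m l)))"
  by (rule multilin_cong[OF coord multilin_plin[OF multilin_tens[OF coord]]]) (auto simp: psi_pure[OF assms])

lemma psi_fsp:
  assumes "\<Psi> \<in> carrier (hom_space (tensor_power A m) (tensor_power A n))" "l \<in> wds (mons B) m"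
  shows "psi m \<Psi> l \<in> fsp (mons ({..<n} \<times> B))"
  unfolding psi_def
  by (rule coordD(5)[OF coord_tensor_power], rule hom_spaceD(1)[OF assms(1)]) (use pure_carrier[OF map_bas_words[OF assms(2)]] in simp)

lemma hom_linear_ext:
  assumes W: "coord W \<kappa>' J" and f: "\<And>l. l \<in> words A m \<Longrightarrow> f l \<in> carrier W" and ml: "multilin A m (\<lambda>l. \<kappa>' (f l))"
  shows "(\<lambda>x\<in>carrier (tensor_power A m). linear_ext W f x) \<in> carrier (hom_space (tensor_power A m) W)"
proof -
  note * = linear_ext_tensor[OF coord W f ml]
  note T = coordD[OF coord_tensor_power'[of m]] and W' = coordD[OF W]
  have "linear_ext W f (x \<oplus>\<^bsub>tensor_power A m\<^esub> y) = linear_ext W f x \<oplus>\<^bsub>W\<^esub> linear_ext W f y"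
    if "x \<in> carrier (tensor_power A m)" "y \<in> carrier (tensor_power A m)" for x y
    by (rule W'(12)) (use that * T(6,9)[OF that] W' in simp_all)
  moreover have "linear_ext W f (c \<odot>\<^bsub>tensor_power A m\<^esub> x) = c \<odot>\<^bsub>W\<^esub> linear_ext W f x"
    if "x \<in> carrier (tensor_power A m)" for x c
    by (rule W'(12)) (use that * T(7,10)[OF that] W' in simp_all)
  ultimately show ?thesis using *(1) T(9,10) by (auto simp: hom_space_def)
qed

end

section \<open>Sweedler sums\<close>

text \<open>
  Comultiplication at every factor, the two parts of the \<open>j\<close>-th factor going to the factors \<open>2 j\<close> and
  \<open>2 j + 1\<close>.
\<close>

definition dbl :: "(nat \<times> 'x, 'k::field) poly \<Rightarrow> (nat \<times> 'x, 'k) poly" where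
  "dbl = subst (\<lambda>(j, v). pvar (2 * j, v) + pvar (Suc (2 * j), v))"

lemma lin_one: "lin H (1 :: ('y, 'k::field) poly) = H {#}"
  using lin_sing[of H "{#}" 1] by simp

lemma lin_var_mult: "lin H (pvar y * q) = lin (\<lambda>N. H (add_mset y N)) q" for q :: "('y, 'k::field) poly"
  by (rule plin_ext[where I = UNIV and S = "\<lambda>q. lin H (pvar y * q)"]) (auto simp: plin_def distrib_left smul_mult sing_mult)

lemma slot_add_mset[simp]: "slot i (add_mset (k, v) N) = (if k = i then add_mset v (slot i N) else slot i N)"
  by (simp add: slot_def)

lemma slot_empty: "N \<in> mons ({j..} \<times> UNIV) \<Longrightarrow> i < j \<Longrightarrow> slot i N = {#}"
proof (rule multiset_eqI)
  fix v assume N: "N \<in> mons ({j..} \<times> UNIV)" and i: "i < j"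
  have "(i, v) \<notin># N" using N i by auto
  then show "count (slot i N) v = count {#} v" by (simp add: count_slot not_in_iff)
qed

text \<open>The link between Sweedler sums and exponentials. Under the coproduct each variable
  \<open>v\<close> of an entry goes either to the part number \<open>t\<close>, where it contributes
  the factor \<open>L v\<close>, or to the other part, where it is added to an argument of
  \<open>f\<close>. These are the two summands in the recursion of \<open>conv\<close>.\<close>

lemma dbl_convl:
  fixes L :: "'x \<Rightarrow> ('y, 'k::field) poly"
  assumes t: "t \<le> 1"
  shows "lin (\<lambda>N. (\<Prod>v\<in>#sum_list (map (\<lambda>i. slot (2 * i + t) N) [j..<j + length l]). L v) *
      f (map (\<lambda>i. slot (2 * i + (1 - t)) N) [j..<j + length l])) (dbl (sing (enc j l) 1)) = convl L f l"
proof (induction l arbitrary: j f)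
  case Nil
  then show ?case by (simp add: dbl_def lin_one)
next
  case (Cons a l)
  define H where "H f N = (\<Prod>v\<in>#sum_list (map (\<lambda>i. slot (2 * i + t) N) [j..<j + length (a # l)]). L v) *
      f (map (\<lambda>i. slot (2 * i + (1 - t)) N) [j..<j + length (a # l)])" for f N
  have upt: "[j..<j + length (a # l)] = j # [Suc j..<Suc j + length l]" by (simp add: upt_conv_Cons del: upt_Suc)
  have "lin (H f) (dbl (sing (enc j (b # l)) 1)) = conv L (\<lambda>a'. convl L (\<lambda>l'. f (a' # l')) l) b" for b f
  proof (induction b arbitrary: f)
    case empty
    let ?q = "dbl (sing (enc (Suc j) l) 1) :: (nat \<times> 'x, 'k) poly"
    have encs: "set_mset (enc i l) \<subseteq> {i..} \<times> UNIV" for i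
    proof (induction l arbitrary: i)
      case (Cons b l)
      from Cons[of "Suc i"] show ?case by (auto simp: subset_iff)
    qed simp
    have q: "?q \<in> fsp (mons ({Suc (Suc (2 * j))..} \<times> UNIV))"
      unfolding dbl_def by (rule subst_fsp[where B = "{Suc j..} \<times> UNIV"]) (use encs[of "Suc j"] in \<open>auto intro!: fsp_closed\<close>)
    have "lin (H f) ?q = lin (\<lambda>N. (\<Prod>v\<in>#sum_list (map (\<lambda>i. slot (2 * i + t) N) [Suc j..<Suc j + length l]). L v) *
      f ({#} # map (\<lambda>i. slot (2 * i + (1 - t)) N) [Suc j..<Suc j + length l])) ?q"
    proof (rule lin_cong_fsp[OF q])
      fix N :: "(nat \<times> 'x) multiset" assume N: "N \<in> mons ({Suc (Suc (2 * j))..} \<times> UNIV)"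
      have "slot (2 * j + t) N = {#}" "slot (2 * j + (1 - t)) N = {#}" by (rule slot_empty[OF N], use t in simp)+
      then show "H f N = (\<Prod>v\<in>#sum_list (map (\<lambda>i. slot (2 * i + t) N) [Suc j..<Suc j + length l]). L v) *
        f ({#} # map (\<lambda>i. slot (2 * i + (1 - t)) N) [Suc j..<Suc j + length l])"
        unfolding H_def upt by simp
    qed
    also have "\<dots> = convl L (\<lambda>l'. f ({#} # l')) l" by (rule Cons.IH)
    finally show ?case by simp
  next
    case (add v b)
    let ?q = "dbl (sing (enc j (b # l)) 1) :: (nat \<times> 'x, 'k) poly"
    \<comment> \<open>The head of the list collects the variables of the current factor that go to
      the argument of \<open>f\<close>.\<close>
    define f' where "f' k = f (add_mset v (hd k) # tl k)" for k
    define R where "R s N = map (\<lambda>i. slot (2 * i + s) N) [Suc j..<Suc j + length l]" for s and N :: "(nat \<times> 'x) multiset"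
    have H: "H f N = (\<Prod>v\<in>#slot (2 * j + t) N + sum_list (R t N). L v) * f (slot (2 * j + (1 - t)) N # R (1 - t) N)" for f N
      unfolding H_def upt R_def by simp
    have R: "R s (add_mset (2 * j + s', v) N) = R s N" if "s \<le> 1" "s' \<le> 1" for s s' N
    proof -
      have "2 * j + s' \<noteq> 2 * i + s" if "Suc j \<le> i" for i using that \<open>s \<le> 1\<close> \<open>s' \<le> 1\<close> by linarith
      then show ?thesis unfolding R_def slot_add_mset by (intro map_cong[OF refl] if_not_P) (metis atLeastLessThan_iff set_upt)
    qed
    have t': "t \<le> 1" "1 - t \<le> 1" "2 * j + t \<noteq> 2 * j + (1 - t)" "2 * j + (1 - t) \<noteq> 2 * j + t" using t by presburger+
    have 1: "H f (add_mset (2 * j + t, v) N) = L v * H f N" for N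
      unfolding H R[OF t'(1,1)] R[OF t'(2,1)] slot_add_mset using t'(3,4) by (simp del: One_nat_def add: mult.assoc)
    have 2: "H f (add_mset (2 * j + (1 - t), v) N) = H f' N" for N
      unfolding H R[OF t'(1,2)] R[OF t'(2,2)] slot_add_mset f'_def using t'(3,4) by (simp del: One_nat_def)
    have "dbl (sing (enc j (add_mset v b # l)) 1) = (pvar (2 * j, v) + pvar (Suc (2 * j), v)) * ?q"
      using subst_mult[of "\<lambda>(j, v). pvar (2 * j, v) + pvar (Suc (2 * j), v)" "pvar (j, v)" "sing (enc j (b # l)) 1"]
      by (simp add: dbl_def sing_mult)
    also have "pvar (2 * j, v) + pvar (Suc (2 * j), v) = (pvar (2 * j + t, v) + pvar (2 * j + (1 - t), v) :: (nat \<times> 'x, 'k) poly)"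
      using t by (cases t) (auto simp: add.commute)
    finally have "lin (H f) (dbl (sing (enc j (add_mset v b # l)) 1)) = lin (\<lambda>N. L v * H f N) ?q + lin (H f') ?q"
      by (simp only: distrib_right lin_add lin_var_mult 1 2)
    also have "lin (\<lambda>N. L v * H f N) ?q = L v * lin (H f) ?q" by (simp only: lin_mult)
    finally show ?case unfolding add.IH by (simp add: f'_def)
  qed
  then show ?case unfolding H_def by simp
qed

lemma lin_swap: "lin (\<lambda>i. lin (\<lambda>j. F i j) q) p = lin (\<lambda>j. lin (\<lambda>i. F i j) p) q"
  unfolding lin_def smul_sum by (subst sum.swap) (simp add: mult.commute)

abbreviation "evs_of m w \<equiv> map (\<lambda>j. w ! (2 * j)) [0..<m]"
abbreviation "ods_of m w \<equiv> map (\<lambda>j. w ! (2 * j + 1)) [0..<m]"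

lemma evs_of_Cons: "evs_of (Suc m) (a # c # w) = a # evs_of m w" "ods_of (Suc m) (a # c # w) = c # ods_of m w"
  by (simp_all add: upt_conv_Cons map_Suc_upt[symmetric] comp_def del: upt_Suc)

text \<open>\<open>comults\<close> interleaves the two parts of the factors, whereas the
  differentials take the first parts and the second parts as separate lists; passing between these
  orders is an exchange of sums.\<close>

lemma lin_tens_pairs:
  "length ps = 2 * m \<Longrightarrow> lin (\<lambda>w. g (evs_of m w) (ods_of m w)) (tens ps) =
    lin (\<lambda>w1. lin (\<lambda>w2. g w1 w2) (tens (ods_of m ps))) (tens (evs_of m ps))"
proof (induction m arbitrary: ps g)
  case (Suc m)
  then obtain p q qs where ps: "ps = p # q # qs" "length qs = 2 * m"
    by (metis (no_types, lifting) add_Suc_right length_Suc_conv mult_2 mult_Suc_right add_2_eq_Suc)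
  show ?case
    unfolding ps(1) evs_of_Cons lin_tens_Cons Suc.IH[OF ps(2), of "\<lambda>w1 w2. g (_ # w1) (_ # w2)"]
    by (subst lin_swap[of _ "tens (evs_of m qs)" q]) (rule refl)
qed simp

lemma prod_list_tens: "prod_list ps = lin (\<lambda>w. sing (sum_list w) 1) (tens ps)" for ps :: "('x, 'k::field) poly list"
proof (induction ps)
  case (Cons p ps)
  have "lin (\<lambda>w. sing (sum_list w) 1) (tens (p # ps)) = lin (\<lambda>i. lin (\<lambda>w. sing i 1 * sing (sum_list w) 1) (tens ps)) p"
    by (simp only: lin_tens_Cons) (simp add: sing_mult)
  also have "\<dots> = lin (\<lambda>i. sing i 1) p * prod_list ps" by (simp only: lin_mult(1)[symmetric] lin_mult(2)[symmetric] Cons)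
  finally show ?case by simp
qed simp

context poly_bialgebra
begin

lemma comults:
  "set l \<subseteq> carrier A \<Longrightarrow> comults A l \<in> carrier (tensor_space A (2 * length l)) \<and> pcoord \<kappa> (comults A l) = dbl (pens 0 (map \<kappa> l))"
proof (induction l)
  case Nil
  have "[] \<in> words A 0" by simp
  from pure_carrier[OF this] pcoord_pure[OF this] show ?case by (simp add: dbl_def)
next
  case (Cons a l)
  then have a: "a \<in> carrier A" by simp
  have IH: "comults A l \<in> carrier (tensor_space A (2 * length l))" "pcoord \<kappa> (comults A l) = dbl (pens 0 (map \<kappa> l))"
    using Cons by auto
  have "2 * Suc (length l) = 2 + 2 * length l" by simp
  note * = tconcat[OF comult_closed[OF a] IH(1) this]
  have "dbl (pens 0 (map \<kappa> (a # l))) = dbl (emb 0 (\<kappa> a)) * dbl (shift 1 (pens 0 (map \<kappa> l)))"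
    by (simp add: shift_pens dbl_def)
  also have "dbl (emb 0 (\<kappa> a)) = pcoord \<kappa> (comult A a)" by (simp add: coord_comult[OF a] dbl_def emb_def subst_subst)
  also have "dbl (shift 1 (pens 0 (map \<kappa> l))) = shift 2 (dbl (pens 0 (map \<kappa> l)))"
    by (simp add: dbl_def shift_def subst_subst case_prod_unfold)
  finally show ?case using * IH by simp
qed

text \<open>\<open>g\<close> holds the coordinates of \<open>f\<close> on pairs of words of
  monomials. After the coproducts, the two words are read off from the factors with even and with
  odd number.\<close>

lemma sweedler:
  assumes W: "coord W \<kappa>' J" and f: "\<And>b c. b \<in> words A m \<Longrightarrow> c \<in> words A m \<Longrightarrow> f b c \<in> carrier W"
    and fg: "\<And>b c. b \<in> words A m \<Longrightarrow> c \<in> words A m \<Longrightarrow> \<kappa>' (f b c) = lin (\<lambda>w1. lin (\<lambda>w2. g w1 w2) (tens (map \<kappa> c))) (tens (map \<kappa> b))"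
    and l: "l \<in> words A m"
  shows "sweedler W A f l \<in> carrier W"
    "\<kappa>' (sweedler W A f l) = lin (\<lambda>N. g (map (\<lambda>j. slot (2 * j) N) [0..<m]) (map (\<lambda>j. slot (2 * j + 1) N) [0..<m])) (dbl (pens 0 (map \<kappa> l)))"
proof -
  have len: "length l = m" "set l \<subseteq> carrier A" using l by (auto simp: words_def)
  have P: "comults A l \<in> carrier (tensor_space A (2 * m))" "pcoord \<kappa> (comults A l) = dbl (pens 0 (map \<kappa> l))"
    using comults[OF len(2)] len(1) by auto
  have w: "evs_of m u \<in> words A m" "ods_of m u \<in> words A m" if "u \<in> words A (2 * m)" for u
    using that by (auto simp: words_def)
  have T: "plin (lin (\<lambda>w. g (evs_of m w) (ods_of m w)))" by simp
  have fT: "\<kappa>' (f (evs_of m u) (ods_of m u)) = lin (\<lambda>w. g (evs_of m w) (ods_of m w)) (tens (map \<kappa> u))"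
    if u: "u \<in> words A (2 * m)" for u
  proof -
    have lu: "length (map \<kappa> u) = 2 * m" using u by (simp add: words_def)
    have "evs_of m (map \<kappa> u) = map \<kappa> (evs_of m u)" "ods_of m (map \<kappa> u) = map \<kappa> (ods_of m u)" using lu by auto
    then show ?thesis unfolding lin_tens_pairs[OF lu] fg[OF w[OF u]] by (simp only:)
  qed
  note * = linear_ext_through[OF coord W f[OF w] T fT P(1)]
  have s: "sweedler W A f l = linear_ext W (\<lambda>u. f (evs_of m u) (ods_of m u)) (comults A l)"
    by (simp add: sweedler_def len)
  show "sweedler W A f l \<in> carrier W" unfolding s by (rule *(1))
  have "\<kappa>' (sweedler W A f l) = lin (\<lambda>w. g (evs_of m w) (ods_of m w)) (tcoord \<kappa> (comults A l))" unfolding s by (rule *(2))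
  also have "\<dots> = lin (\<lambda>w. g (map (\<lambda>j. slot (2 * j) (enc 0 w)) [0..<m]) (map (\<lambda>j. slot (2 * j + 1) (enc 0 w)) [0..<m])) (tcoord \<kappa> (comults A l))"
  proof (rule lin_cong_fsp[OF coordD(5)[OF coord_tensor_space[OF coord] P(1)]])
    fix w assume w: "w \<in> wds (mons B) (2 * m)"
    have "slot j (enc 0 w) = w ! j" if "j < 2 * m" for j
      by (rule multiset_eqI) (use that w in \<open>simp add: count_slot count_enc\<close>)
    then have "evs_of m w = map (\<lambda>j. slot (2 * j) (enc 0 w)) [0..<m]" "ods_of m w = map (\<lambda>j. slot (2 * j + 1) (enc 0 w)) [0..<m]"
      by auto
    then show "g (evs_of m w) (ods_of m w) = g (map (\<lambda>j. slot (2 * j) (enc 0 w)) [0..<m]) (map (\<lambda>j. slot (2 * j + 1) (enc 0 w)) [0..<m])"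
      by (simp only:)
  qed
  also have "\<dots> = lin (\<lambda>N. g (map (\<lambda>j. slot (2 * j) N) [0..<m]) (map (\<lambda>j. slot (2 * j + 1) N) [0..<m])) (pcoord \<kappa> (comults A l))"
    unfolding pcoord_def lin_lin by simp
  finally show "\<kappa>' (sweedler W A f l) = lin (\<lambda>N. g (map (\<lambda>j. slot (2 * j) N) [0..<m]) (map (\<lambda>j. slot (2 * j + 1) N) [0..<m])) (dbl (pens 0 (map \<kappa> l)))"
    unfolding P(2) .
qed

lemma alg_prod: "set b \<subseteq> carrier A \<Longrightarrow> alg_prod A b \<in> carrier A \<and> \<kappa> (alg_prod A b) = prod_list (map \<kappa> b)"
  unfolding alg_prod_def by (induction b) (auto simp: one_closed coord_one mult_closed coord_mult)

abbreviation "ell n \<equiv> \<lambda>v::'x. \<Sum>j<n. pvar (j, v) :: (nat \<times> 'x, 'k) poly"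

text \<open>A monomial acts on the tensor power by multiplication with its iterated coproduct, a
  product of the sums \<open>ell n v\<close>. Polynomials commute, so the actions from the two sides
  agree, and the result is a Hochschild differential with coefficients
  \<open>act (ell n)\<close>.\<close>

lemma GS_d1:
  assumes \<Psi>: "\<Psi> \<in> carrier (GS_bicomplex A m n)"
  shows "GS_d1 A m n \<Psi> \<in> carrier (GS_bicomplex A (Suc m) n)"
    "l \<in> wds (mons B) (Suc m) \<Longrightarrow> psi (Suc m) (GS_d1 A m n \<Psi>) l = del (act (ell n)) (psi m \<Psi>) l"
proof -
  let ?W = "tensor_power A n"
  note W = coord_tensor_power[of n]
  note W' = coordD[OF W]
  note \<Psi>' = \<Psi>[unfolded GS_bicomplex_def]
  interpret Wm: module ground ?W by (rule W')
  define G where "G l = pcoord \<kappa> (\<Psi> (pure_tensor A m l))" for l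
  define mg where "mg i l = take i l @ [l ! i \<otimes>\<^bsub>A\<^esub> l ! (i + 1)] @ drop (i + 2) l" for i l
  define F where "F l = iter_comult A n (hd l) \<otimes>\<^bsub>?W\<^esub> \<Psi> (pure_tensor A m (tl l))
     \<oplus>\<^bsub>?W\<^esub> (\<Oplus>\<^bsub>?W\<^esub>i\<in>{..<m}. (-1) ^ (i + 1) \<odot>\<^bsub>?W\<^esub> \<Psi> (pure_tensor A m (mg i l)))
     \<oplus>\<^bsub>?W\<^esub> (-1) ^ (m + 1) \<odot>\<^bsub>?W\<^esub> (\<Psi> (pure_tensor A m (butlast l)) \<otimes>\<^bsub>?W\<^esub> iter_comult A n (last l))" for l
  have d1: "GS_d1 A m n \<Psi> = (\<lambda>x\<in>carrier (tensor_power A (Suc m)). linear_ext ?W F x)"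
    unfolding GS_d1_def Let_def F_def[abs_def] mg_def by simp
  have \<Psi>c: "\<Psi> (pure_tensor A m l) \<in> carrier ?W" if "l \<in> words A m" for l
    by (rule hom_spaceD(1)[OF \<Psi>']) (use pure_carrier[OF that] in simp)
  have Gm: "multilin A m G" unfolding G_def by (rule psi_multilin[OF \<Psi>'])
  have F: "F l \<in> carrier ?W \<and> pcoord \<kappa> (F l) = subst (ell n) (\<kappa> (hd l)) * G (tl l)
      + (\<Sum>i<m. smul ((-1) ^ (i + 1)) (G (mg i l))) + smul ((-1) ^ (m + 1)) (G (butlast l) * subst (ell n) (\<kappa> (last l)))"
    if l: "l \<in> words A (Suc m)" for l
  proof -
    have w: "tl l \<in> words A m" "butlast l \<in> words A m" "hd l \<in> carrier A" "last l \<in> carrier A"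
      using l by (auto simp: words_def dest: in_set_butlastD list.set_sel(2)) (auto simp: length_Suc_conv)
    have wm: "mg i l \<in> words A m" if "i < m" for i unfolding mg_def by (rule merge_words[OF l that])
    have it: "iter_comult A n a \<in> carrier ?W" "pcoord \<kappa> (iter_comult A n a) = subst (ell n) (\<kappa> a)" if "a \<in> carrier A" for a
      using iter_comult[OF that, of n] by auto
    have fs: "(\<lambda>i. (-1) ^ (i + 1) \<odot>\<^bsub>?W\<^esub> \<Psi> (pure_tensor A m (mg i l))) \<in> {..<m} \<rightarrow> carrier ?W"
      using W'(10) \<Psi>c wm by auto
    have fc: "(\<Oplus>\<^bsub>?W\<^esub>i\<in>{..<m}. (-1) ^ (i + 1) \<odot>\<^bsub>?W\<^esub> \<Psi> (pure_tensor A m (mg i l))) \<in> carrier ?W"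
      using fs by (rule Wm.finsum_closed)
    have fe: "pcoord \<kappa> (\<Oplus>\<^bsub>?W\<^esub>i\<in>{..<m}. (-1) ^ (i + 1) \<odot>\<^bsub>?W\<^esub> \<Psi> (pure_tensor A m (mg i l))) =
       (\<Sum>i<m. smul ((-1) ^ (i + 1)) (G (mg i l)))"
      unfolding lin_on_finsum[OF W'(1,2) fs finite_lessThan] G_def
      by (rule sum.cong[OF refl], rule W'(7)) (use \<Psi>c wm in auto)
    note t1 = tensor_mult[OF it(1)[OF w(3)] \<Psi>c[OF w(1)]] and t2 = tensor_mult[OF \<Psi>c[OF w(2)] it(1)[OF w(4)]]
    show ?thesis unfolding F_def
      using t1 t2 fc fe it w by (simp only: W'(6,7,9,10) G_def simp_thms)
  qed
  have ml: "multilin A (Suc m) (\<lambda>l. pcoord \<kappa> (F l))"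
  proof (rule multilin_cong[OF coord])
    have lL: "lin_on A (\<lambda>a. subst (ell n) (\<kappa> a))" using coordD[OF coord] by (auto simp: lin_on_def)
    have "multilin A (Suc m) (\<lambda>l. subst (ell n) (\<kappa> (hd l)) * G (tl l))"
      using lL Gm by (auto simp: lin_on_def distrib_right smul_mult intro!: multilin_plin[OF _ plin_mult(1)])
    then show "multilin A (Suc m) (\<lambda>l. subst (ell n) (\<kappa> (hd l)) * G (tl l)
      + (\<Sum>i<m. smul ((-1) ^ (i + 1)) (G (mg i l))) + smul ((-1) ^ (m + 1)) (G (butlast l) * subst (ell n) (\<kappa> (last l))))"
      unfolding mg_def
      by (intro multilin_add multilin_sum multilin_smul multilin_merge[OF Gm] multilin_snoc[OF lL Gm]) auto
  qed (use F in blast)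
  show "GS_d1 A m n \<Psi> \<in> carrier (GS_bicomplex A (Suc m) n)"
    unfolding GS_bicomplex_def d1 by (rule hom_linear_ext[OF W _ ml]) (use F in blast)
  show "psi (Suc m) (GS_d1 A m n \<Psi>) l = del (act (ell n)) (psi m \<Psi>) l" if l: "l \<in> wds (mons B) (Suc m)"
  proof -
    let ?b = "map (bas A \<kappa>)"
    have w: "?b l \<in> words A (Suc m)" by (rule map_bas_words[OF l])
    have len: "length l = Suc m" using l by simp
    have mem: "l ! i \<in> mons B" if "i < Suc m" for i using l that by (metis (mono_tags, lifting) mem_Collect_eq nth_mem subsetD)
    have "psi (Suc m) (GS_d1 A m n \<Psi>) l = pcoord \<kappa> (F (?b l))"
      unfolding psi_def d1 using linear_ext_pure[OF coord W _ ml w] F pure_carrier[OF w] by simp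
    also have "\<dots> = subst (ell n) (\<kappa> (hd (?b l))) * G (tl (?b l))
      + (\<Sum>i<m. smul ((-1) ^ (i + 1)) (G (mg i (?b l)))) + smul ((-1) ^ (m + 1)) (G (butlast (?b l)) * subst (ell n) (\<kappa> (last (?b l))))"
      using F[OF w] by blast
    also have "G (tl (?b l)) = psi m \<Psi> (tl l)" by (simp add: G_def psi_def map_tl)
    also have "G (butlast (?b l)) = psi m \<Psi> (butlast l)" by (simp add: G_def psi_def map_butlast)
    also have "subst (ell n) (\<kappa> (hd (?b l))) = (\<Prod>v\<in>#hd l. ell n v)"
      using mem[of 0] bas_mons(2)[of "hd l"] len by (cases l) auto
    also have "subst (ell n) (\<kappa> (last (?b l))) = (\<Prod>v\<in>#last l. ell n v)"
    proof -
      have ne: "l \<noteq> []" using len by auto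
      then have "last l \<in> mons B" using mem[of m] len by (simp add: last_conv_nth)
      then show ?thesis using bas_mons(2)[of "last l"] ne by (simp add: last_map)
    qed
    also have "(\<Sum>i<m. smul ((-1) ^ (i + 1)) (G (mg i (?b l)))) =
      (\<Sum>i<m. smul ((-1) ^ (i + 1)) (psi m \<Psi> (take i l @ [l ! i + l ! Suc i] @ drop (i + 2) l)))"
    proof (rule sum.cong[OF refl])
      fix i assume i: "i \<in> {..<m}"
      have "mg i (?b l) = ?b (take i l @ [l ! i + l ! Suc i] @ drop (i + 2) l)"
        unfolding mg_def using i len mem[of i] mem[of "Suc i"] by (simp add: take_map drop_map bas_mult)
      then show "smul ((-1) ^ (i + 1)) (G (mg i (?b l))) = smul ((-1) ^ (i + 1)) (psi m \<Psi> (take i l @ [l ! i + l ! Suc i] @ drop (i + 2) l))"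
        by (simp only: G_def psi_def)
    qed
    also have "(\<Prod>v\<in>#hd l. ell n v) * psi m \<Psi> (tl l) = lft (act (ell n)) (psi m \<Psi>) l"
      using len by (cases l) auto
    finally have e: "psi (Suc m) (GS_d1 A m n \<Psi>) l = lft (act (ell n)) (psi m \<Psi>) l
      + (\<Sum>i<m. smul ((-1) ^ (i + 1)) (psi m \<Psi> (take i l @ [l ! i + l ! Suc i] @ drop (i + 2) l)))
      + smul ((-1) ^ (m + 1)) (psi m \<Psi> (butlast l) * (\<Prod>v\<in>#last l. ell n v))" .
    have neg: "smul ((-1) ^ (i + 1)) p = - smul ((-1) ^ i) p" for i and p :: "(nat \<times> 'x, 'k) poly"
      by (simp only: power_add power_one_right mult_minus_right mult_1_right smul_simps(8))
    show ?thesis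
      unfolding del_def bar_sum[OF len] minus_one_power_smul e neg sum_negf mult.commute[of "psi m \<Psi> (butlast l)"]
      by (simp only: diff_diff_eq[symmetric] add_uminus_conv_diff)
  qed
qed

text \<open>By \<open>dbl_convl\<close> the two outer Sweedler terms are multiplications by
  exponentials, whose exponents use the variables of the new factor: number \<open>0\<close> in
  front and number \<open>n\<close> at the end.\<close>

lemma GS_d2:
  assumes \<Psi>: "\<Psi> \<in> carrier (GS_bicomplex A m n)"
  shows "GS_d2 A m n \<Psi> \<in> carrier (GS_bicomplex A m (Suc n))"
    "l \<in> wds (mons B) m \<Longrightarrow> psi m (GS_d2 A m n \<Psi>) l = convl (\<lambda>v. pvar (0, v)) (\<lambda>l. shift 1 (psi m \<Psi> l)) l
       + (\<Sum>i=1..n. (-1) ^ i * theta_at (i - 1) (psi m \<Psi> l)) + (-1) ^ (n + 1) * convl (\<lambda>v. pvar (n, v)) (psi m \<Psi>) l"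
proof -
  let ?W = "tensor_power A (Suc n)"
  note W = coord_tensor_power[of "Suc n"]
  note W' = coordD[OF W]
  note \<Psi>' = \<Psi>[unfolded GS_bicomplex_def]
  interpret Wm: module ground ?W by (rule W')
  define G where "G l = pcoord \<kappa> (\<Psi> (pure_tensor A m l))" for l
  define f1 where "f1 b c = tconcat A (Suc n) (pure_tensor A 1 [alg_prod A b]) (\<Psi> (pure_tensor A m c))" for b c
  define f2 where "f2 b c = tconcat A (Suc n) (\<Psi> (pure_tensor A m b)) (pure_tensor A 1 [alg_prod A c])" for b c
  define g1 where "g1 w1 w2 = (\<Prod>v\<in>#sum_list w1. pvar (0, v)) * shift 1 (psi m \<Psi> w2)" for w1 w2
  define g2 where "g2 w1 w2 = psi m \<Psi> w1 * (\<Prod>v\<in>#sum_list w2. pvar (n, v))" for w1 w2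
  define F where "F l = sweedler ?W A f1 l
     \<oplus>\<^bsub>?W\<^esub> (\<Oplus>\<^bsub>?W\<^esub>i\<in>{1..n}. (-1) ^ i \<odot>\<^bsub>?W\<^esub> comult_at A n (i - 1) (\<Psi> (pure_tensor A m l)))
     \<oplus>\<^bsub>?W\<^esub> (-1) ^ (n + 1) \<odot>\<^bsub>?W\<^esub> sweedler ?W A f2 l" for l
  have d2: "GS_d2 A m n \<Psi> = (\<lambda>x\<in>carrier (tensor_power A m). linear_ext ?W F x)"
    unfolding GS_d2_def Let_def F_def[abs_def] f1_def[abs_def] f2_def[abs_def] by simp
  have \<Psi>c: "\<Psi> (pure_tensor A m l) \<in> carrier (tensor_space A n)" if "l \<in> words A m" for l
    using hom_spaceD(1)[OF \<Psi>', of "pure_tensor A m l"] pure_carrier[OF that] by simp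
  have pr: "pure_tensor A 1 [alg_prod A b] \<in> carrier (tensor_space A 1)"
     "pcoord \<kappa> (pure_tensor A 1 [alg_prod A b]) = emb 0 (lin (\<lambda>w. sing (sum_list w) 1) (tens (map \<kappa> b)))" if "b \<in> words A m" for b
  proof -
    have "set b \<subseteq> carrier A" using that by (auto simp: words_def)
    note a = alg_prod[OF this]
    have w: "[alg_prod A b] \<in> words A 1" using a by (auto simp: words_def)
    show "pure_tensor A 1 [alg_prod A b] \<in> carrier (tensor_space A 1)" by (rule pure_carrier[OF w])
    show "pcoord \<kappa> (pure_tensor A 1 [alg_prod A b]) = emb 0 (lin (\<lambda>w. sing (sum_list w) 1) (tens (map \<kappa> b)))"
      using a pcoord_pure[OF w] by (simp add: prod_list_tens del: One_nat_def)
  qed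
  have embl: "emb j (lin (\<lambda>w. sing (sum_list w) 1) p) = lin (\<lambda>w. \<Prod>v\<in>#sum_list w. pvar (j, v)) p"
    for j and p :: "'x multiset list \<Rightarrow>\<^sub>0 'k"
    unfolding emb_def by (simp add: plin_lin_comp[OF plin_subst])
  have f1: "f1 b c \<in> carrier ?W" "pcoord \<kappa> (f1 b c) = lin (\<lambda>w1. lin (\<lambda>w2. g1 w1 w2) (tens (map \<kappa> c))) (tens (map \<kappa> b))"
    if b: "b \<in> words A m" and c: "c \<in> words A m" for b c
  proof -
    note t = tconcat[OF pr(1)[OF b] \<Psi>c[OF c], of "Suc n"]
    show "f1 b c \<in> carrier ?W" unfolding f1_def using t by simp
    have "pcoord \<kappa> (f1 b c) = lin (\<lambda>w. \<Prod>v\<in>#sum_list w. pvar (0, v)) (tens (map \<kappa> b)) * shift 1 (lin (psi m \<Psi>) (tens (map \<kappa> c)))"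
      unfolding f1_def using t by (simp only: pr(2)[OF b] embl psi_pure[OF \<Psi>' c] plus_1_eq_Suc)
    also have "\<dots> = lin (\<lambda>w1. lin (\<lambda>w2. g1 w1 w2) (tens (map \<kappa> c))) (tens (map \<kappa> b))"
      unfolding g1_def lin_mult(1)[symmetric] shift_def plin_lin_comp[OF plin_subst] by (rule lin_mult(2))
    finally show "pcoord \<kappa> (f1 b c) = lin (\<lambda>w1. lin (\<lambda>w2. g1 w1 w2) (tens (map \<kappa> c))) (tens (map \<kappa> b))" .
  qed
  have f2: "f2 b c \<in> carrier ?W" "pcoord \<kappa> (f2 b c) = lin (\<lambda>w1. lin (\<lambda>w2. g2 w1 w2) (tens (map \<kappa> c))) (tens (map \<kappa> b))"
    if b: "b \<in> words A m" and c: "c \<in> words A m" for b c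
  proof -
    note t = tconcat[OF \<Psi>c[OF b] pr(1)[OF c], of "Suc n"]
    show "f2 b c \<in> carrier ?W" unfolding f2_def using t by simp
    have e: "shift n (emb 0 p) = emb n p" for p :: "('x, 'k) poly" by (simp add: shift_def emb_def subst_subst)
    have e': "shift n (lin (\<lambda>w. \<Prod>v\<in>#sum_list w. pvar (0, v)) p) = lin (\<lambda>w. \<Prod>v\<in>#sum_list w. pvar (n, v)) p"
      for p :: "'x multiset list \<Rightarrow>\<^sub>0 'k"
      by (simp only: embl[symmetric] e)
    have "pcoord \<kappa> (f2 b c) = lin (psi m \<Psi>) (tens (map \<kappa> b)) * lin (\<lambda>w. \<Prod>v\<in>#sum_list w. pvar (n, v)) (tens (map \<kappa> c))"
      unfolding f2_def using t by (simp add: pr(2)[OF c, simplified] e' embl psi_pure[OF \<Psi>' b])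
    also have "\<dots> = lin (\<lambda>w1. lin (\<lambda>w2. g2 w1 w2) (tens (map \<kappa> c))) (tens (map \<kappa> b))"
      unfolding g2_def lin_mult(1)[symmetric] by (rule lin_mult(2))
    finally show "pcoord \<kappa> (f2 b c) = lin (\<lambda>w1. lin (\<lambda>w2. g2 w1 w2) (tens (map \<kappa> c))) (tens (map \<kappa> b))" .
  qed
  define S where "S g p = lin (\<lambda>N. g (map (\<lambda>j. slot (2 * j) N) [0..<m]) (map (\<lambda>j. slot (2 * j + 1) N) [0..<m])) (dbl p)"
    for g :: "'x multiset list \<Rightarrow> 'x multiset list \<Rightarrow> (nat \<times> 'x, 'k) poly" and p :: "(nat \<times> 'x, 'k) poly"
  note s1 = sweedler[where f = f1 and g = g1, OF W f1(1) f1(2)] and s2 = sweedler[where f = f2 and g = g2, OF W f2(1) f2(2)]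
  have F: "F l \<in> carrier ?W \<and> pcoord \<kappa> (F l) = S g1 (pens 0 (map \<kappa> l))
      + (\<Sum>i=1..n. smul ((-1) ^ i) (theta_at (i - 1) (G l))) + smul ((-1) ^ (n + 1)) (S g2 (pens 0 (map \<kappa> l)))"
    if l: "l \<in> words A m" for l
  proof -
    have ca: "comult_at A n (i - 1) (\<Psi> (pure_tensor A m l)) \<in> carrier ?W"
       "pcoord \<kappa> (comult_at A n (i - 1) (\<Psi> (pure_tensor A m l))) = theta_at (i - 1) (G l)" if "i \<in> {1..n}" for i
      using comult_at[OF _ \<Psi>c[OF l], of "i - 1"] that by (auto simp: G_def)
    have fs: "(\<lambda>i. (-1) ^ i \<odot>\<^bsub>?W\<^esub> comult_at A n (i - 1) (\<Psi> (pure_tensor A m l))) \<in> {1..n} \<rightarrow> carrier ?W"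
      using ca(1) W'(10) by blast
    have fc: "(\<Oplus>\<^bsub>?W\<^esub>i\<in>{1..n}. (-1) ^ i \<odot>\<^bsub>?W\<^esub> comult_at A n (i - 1) (\<Psi> (pure_tensor A m l))) \<in> carrier ?W"
      using fs by (rule Wm.finsum_closed)
    have fe: "pcoord \<kappa> (\<Oplus>\<^bsub>?W\<^esub>i\<in>{1..n}. (-1) ^ i \<odot>\<^bsub>?W\<^esub> comult_at A n (i - 1) (\<Psi> (pure_tensor A m l))) =
       (\<Sum>i=1..n. smul ((-1) ^ i) (theta_at (i - 1) (G l)))"
      unfolding lin_on_finsum[OF W'(1,2) fs finite_atLeastAtMost]
      by (rule sum.cong[OF refl]) (simp only: W'(7) ca)
    show ?thesis unfolding F_def
      using fc fe s1[OF _ _ _ _ l] s2[OF _ _ _ _ l] by (simp only: S_def W'(6,7,9,10) simp_thms)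
  qed
  have plS: "plin (S g)" for g unfolding S_def dbl_def by (rule plin_comp) simp_all
  have ml: "multilin A m (\<lambda>l. pcoord \<kappa> (F l))"
  proof (rule multilin_cong[OF coord])
    have "multilin A m (\<lambda>l. S g (pens 0 (map \<kappa> l)))" for g
      unfolding lin_enc_tens[symmetric] by (rule multilin_plin[OF multilin_tens[OF coord] plin_comp[OF plS]]) simp
    moreover have "multilin A m (\<lambda>l. theta_at i (G l))" for i
      unfolding G_def theta_at_def by (rule multilin_plin[OF psi_multilin[OF \<Psi>']]) simp
    ultimately show "multilin A m (\<lambda>l. S g1 (pens 0 (map \<kappa> l))
      + (\<Sum>i=1..n. smul ((-1) ^ i) (theta_at (i - 1) (G l))) + smul ((-1) ^ (n + 1)) (S g2 (pens 0 (map \<kappa> l))))"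
      by (intro multilin_add multilin_sum multilin_smul)
  qed (use F in blast)
  show "GS_d2 A m n \<Psi> \<in> carrier (GS_bicomplex A m (Suc n))"
    unfolding GS_bicomplex_def d2 by (rule hom_linear_ext[OF W _ ml]) (use F in blast)
  show "psi m (GS_d2 A m n \<Psi>) l = convl (\<lambda>v. pvar (0, v)) (\<lambda>l. shift 1 (psi m \<Psi> l)) l
       + (\<Sum>i=1..n. (-1) ^ i * theta_at (i - 1) (psi m \<Psi> l)) + (-1) ^ (n + 1) * convl (\<lambda>v. pvar (n, v)) (psi m \<Psi>) l"
    if l: "l \<in> wds (mons B) m"
  proof -
    let ?b = "map (bas A \<kappa>)"
    have w: "?b l \<in> words A m" by (rule map_bas_words[OF l])
    have len: "length l = m" using l by simp
    have "psi m (GS_d2 A m n \<Psi>) l = pcoord \<kappa> (F (?b l))"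
      unfolding psi_def d2 using linear_ext_pure[OF coord W _ ml w] F pure_carrier[OF w] by simp
    also have "\<dots> = S g1 (pens 0 (map \<kappa> (?b l)))
      + (\<Sum>i=1..n. smul ((-1) ^ i) (theta_at (i - 1) (G (?b l)))) + smul ((-1) ^ (n + 1)) (S g2 (pens 0 (map \<kappa> (?b l))))"
      using F[OF w] by blast
    also have "pens 0 (map \<kappa> (?b l)) = sing (enc 0 l) 1" by (rule pens_map_bas[OF l])
    \<comment> \<open>With \<open>t = 0\<close> the first Sweedler parts are multiplied together and
      the second ones are arguments; with \<open>t = 1\<close> below the roles are
      exchanged.\<close>
    also have "S g1 (sing (enc 0 l) 1) = convl (\<lambda>v. pvar (0, v)) (\<lambda>l. shift 1 (psi m \<Psi> l)) l"
      using dbl_convl[of 0 "\<lambda>v. pvar (0, v) :: (nat \<times> 'x, 'k) poly" 0 l "\<lambda>l. shift 1 (psi m \<Psi> l)"] by (simp add: S_def g1_def len)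
    also have "S g2 (sing (enc 0 l) 1) = convl (\<lambda>v. pvar (n, v)) (psi m \<Psi>) l"
      using dbl_convl[of 1 "\<lambda>v. pvar (n, v) :: (nat \<times> 'x, 'k) poly" 0 l "psi m \<Psi>"] by (simp add: S_def g2_def len mult.commute)
    finally show ?thesis by (simp only: minus_one_power_smul G_def psi_def)
  qed
qed

end

section \<open>The cohomology\<close>

text \<open>Moves the functional \<open>evm\<close> inside the differential, from polynomial values
  to scalar entries.\<close>

lemma del_additive:
  fixes \<phi> :: "'b::ab_group_add \<Rightarrow> 'c::ab_group_add" and f :: "'a multiset list \<Rightarrow> 'b"
  assumes "\<phi> 0 = 0" "\<And>a b. \<phi> (a - b) = \<phi> a - \<phi> b"
  shows "\<phi> (del aug f l) = del aug (\<lambda>k. \<phi> (f k)) l"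
proof -
  have a: "\<phi> (aug x w) = aug x (\<phi> w)" for x :: "'a multiset" and w by (simp add: aug_def assms)
  have "\<phi> (bar aug f l) = bar aug (\<lambda>k. \<phi> (f k)) l" for f :: "'a multiset list \<Rightarrow> 'b" and l
    by (induction l arbitrary: f rule: induct_list012) (simp_all add: assms a)
  moreover have "\<phi> (lft aug f l) = lft aug (\<lambda>k. \<phi> (f k)) l" by (cases l) (simp_all add: assms a)
  ultimately show ?thesis by (simp add: del_def assms)
qed

lemma tdel_lin:
  fixes c :: "'w::comm_ring_1"
  shows "tdel (\<lambda>l l'. F l l' + G l l') l l' = tdel F l l' + tdel G l l'" "tdel (\<lambda>l l'. c * F l l') l l' = c * tdel F l l'"
  by (simp_all add: tdel_def evs_plus[OF evs_del] evs_scale[OF evs_del] algebra_simps)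

lemma theta_lin:
  fixes c :: "'w::comm_ring_1"
  shows "theta (\<lambda>l l'. F l l' + G l l') s t = theta F s t + theta G s t" "theta (\<lambda>l l'. c * F l l') s t = c * theta F s t"
  by (simp_all add: theta_def evs_plus[OF evs_alt] evs_scale[OF evs_alt])

lemma theta_nonzero: "theta F s t \<noteq> 0 \<Longrightarrow> F \<in> cochains Z N \<Longrightarrow> length s + length t = N"
proof -
  assume th: "theta F s t \<noteq> 0" and F: "F \<in> cochains Z N"
  obtain l where l: "l \<in> {l. sum_list l = mset s \<and> length l = length s}" "alt (F l) t \<noteq> 0"
    by (rule evs_supp[OF evs_alt[of s], where f = "\<lambda>l. alt (F l) t"]) (use th in \<open>auto simp: theta_def\<close>)
  obtain l' where l': "l' \<in> {l. sum_list l = mset t \<and> length l = length t}" "F l l' \<noteq> 0"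
    by (rule evs_supp[OF evs_alt[of t] l(2)])
  show "length s + length t = N" proof -
    have "length l + length l' = N" using F l'(2) unfolding cochains_def by blast
    then show ?thesis using l(1) l'(1) by simp
  qed
qed

lemma lists_over_iff: "lists_over Z l \<longleftrightarrow> l \<in> wds (mons Z) (length l)"
  by (induction l) (auto simp: lists_over_def)

lemma lists_over_sub: "l \<in> wds (mons Z) n \<Longrightarrow> length k = length l \<Longrightarrow> sum_list k \<subseteq># sum_list l \<Longrightarrow> k \<in> wds (mons Z) n"
proof -
  assume l: "l \<in> wds (mons Z) n" and k: "length k = length l" "sum_list k \<subseteq># sum_list l"
  have n: "length l = n" using l by simp
  then have "lists_over Z l" using l by (simp add: lists_over_iff)
  then have "lists_over Z k" using set_mset_mono[OF k(2)] unfolding lists_over_def by (rule order_trans[rotated])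
  then show "k \<in> wds (mons Z) n" using n k(1) by (simp add: lists_over_iff)
qed

lemma wds_sum: "l \<in> wds (mons Z) n \<Longrightarrow> v \<in># sum_list l \<Longrightarrow> v \<in> Z"
  using lists_over_iff[of Z l] by (auto simp: lists_over_def)

text \<open>The exponents for different \<open>n\<close> are compatible with the coproduct at any
  factor; this lets \<open>untwist\<close> pass through the inner terms of the cobar
  differential.\<close>

lemma theta_at_ell: "i < n \<Longrightarrow> theta_at i (\<Sum>j<n. pvar (j, v)) = (\<Sum>j<Suc n. pvar (j, v) :: (nat \<times> 'x, 'k::field) poly)"
proof (induction n)
  case (Suc n)
  show ?case
  proof (cases "i = n")
    case True
    have "theta_at i (\<Sum>j<n. pvar (j, v)) = (\<Sum>j<n. pvar (j, v) :: (nat \<times> 'x, 'k) poly)"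
      unfolding theta_at_def subst_sum by (rule sum.cong) (auto simp: True)
    then show ?thesis by (simp add: theta_at_def True add.assoc)
  next
    case False
    with Suc have "theta_at i (\<Sum>j<n. pvar (j, v)) = (\<Sum>j<Suc n. pvar (j, v) :: (nat \<times> 'x, 'k) poly)" by simp
    then show ?thesis using False Suc.prems by (simp add: theta_at_def)
  qed
qed simp

locale poly_bialgebra_char_0 = poly_bialgebra A \<kappa> B
  for A :: "('k::field_char_0, 'a) bialgebra" and \<kappa> :: "'a \<Rightarrow> ('x, 'k) poly" and B
begin

text \<open>
  In generating functions, where \<open>\<Psi>\<close> is replaced by its values on products of exponentials, the two
  actions in \<open>d\<^sub>1\<close> and the two end terms of \<open>d\<^sub>2\<close> are multiplications by exponentials of \<open>\<xi>\<^sub>i x\<^sub>j\<close>. Dividing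
  by the exponential of \<open>(\<Sum>i. \<xi>\<^sub>i) (\<Sum>j. x\<^sub>j)\<close> turns both differentials into those with trivial coefficients.
\<close>

definition untwist :: "nat \<Rightarrow> ('x multiset list \<Rightarrow> (nat \<times> 'x, 'k) poly) \<Rightarrow> 'x multiset list \<Rightarrow> (nat \<times> 'x, 'k) poly" where
  "untwist n f = convl (\<lambda>v. - ell n v) f"

lemma ell_fsp: "v \<in> B \<Longrightarrow> ell n v \<in> fsp (mons ({..<n} \<times> B))"
  by (auto intro!: fsp_sum)

lemma untwist_fsp:
  assumes "l \<in> wds (mons B) m" "\<And>l. l \<in> wds (mons B) m \<Longrightarrow> f l \<in> fsp (mons ({..<n} \<times> B))"
  shows "untwist n f l \<in> fsp (mons ({..<n} \<times> B))" "convl (ell n) f l \<in> fsp (mons ({..<n} \<times> B))"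
proof -
  note v = ell_fsp[OF wds_sum[OF assms(1)], of _ n] and k = assms(2)[OF lists_over_sub[OF assms(1)]]
  show "untwist n f l \<in> fsp (mons ({..<n} \<times> B))" unfolding untwist_def by (rule convl_fsp) (use v k in auto)
  show "convl (ell n) f l \<in> fsp (mons ({..<n} \<times> B))" by (rule convl_fsp) (use v k in auto)
qed

lemma untwist_cong: "l \<in> wds (mons B) m \<Longrightarrow> (\<And>l. l \<in> wds (mons B) m \<Longrightarrow> f l = g l) \<Longrightarrow> untwist n f l = untwist n g l"
  unfolding untwist_def by (rule convl_cong) (use lists_over_sub in blast)

lemma untwist_inverse: "untwist n (convl (ell n) f) l = f l" "convl (ell n) (untwist n f) l = f l"
  unfolding untwist_def convl_convl by simp_all

lemma untwist_del: "untwist n (del (act (ell n)) f) l = del aug (untwist n f) l"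
  unfolding untwist_def convl_del left_minus act_zero ..

text \<open>The exponent \<open>ell (Suc n)\<close> is the image of \<open>ell n\<close> under each
  inner coproduct. It also equals the shift of \<open>ell n\<close> plus the variable of factor
  \<open>0\<close>, and \<open>ell n\<close> plus the variable of factor \<open>n\<close>, so the
  exponentials of the outer terms cancel and \<open>untwist n\<close> remains in all
  summands.\<close>

lemma untwist_cobar:
  "untwist (Suc n) (\<lambda>l. convl (\<lambda>v. pvar (0, v)) (\<lambda>l. shift 1 (f l)) l
       + (\<Sum>i=1..n. (-1) ^ i * theta_at (i - 1) (f l)) + (-1) ^ (n + 1) * convl (\<lambda>v. pvar (n, v)) f l) l = cobar n (untwist n f l)"
proof -
  have s: "shift 1 (ell n v) = ell (Suc n) v - pvar (0, v)" for v
    unfolding sum.lessThan_Suc_shift by (simp add: shift_def subst_sum)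
  have 1: "convl (\<lambda>v. - ell (Suc n) v) (convl (\<lambda>v. pvar (0, v)) (\<lambda>l. shift 1 (f l))) l = shift 1 (untwist n f l)"
    unfolding convl_convl untwist_def shift_def subst_convl subst_simps(3) s[unfolded shift_def] by (simp add: algebra_simps)
  have 2: "convl (\<lambda>v. - ell (Suc n) v) (\<lambda>l. theta_at i (f l)) l = theta_at i (untwist n f l)" if "i < n" for i
    unfolding untwist_def theta_at_def subst_convl subst_simps(3) theta_at_ell[OF that, unfolded theta_at_def] ..
  have 3: "convl (\<lambda>v. - ell (Suc n) v) (convl (\<lambda>v. pvar (n, v)) f) l = untwist n f l"
    unfolding convl_convl untwist_def by simp
  have "(\<Sum>i=1..n. convl (\<lambda>v. - ell (Suc n) v) (\<lambda>l. (-1) ^ i * theta_at (i - 1) (f l)) l) =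
     (\<Sum>i=1..n. (-1) ^ i * theta_at (i - 1) (untwist n f l))"
    by (rule sum.cong[OF refl], unfold convl_lin, subst 2) auto
  then show ?thesis
    unfolding untwist_def[of "Suc n"] convl_lin convl_sum 1 3 cobar_def by simp
qed

text \<open>The matrix of a total cochain. The bidegree is read off from the lengths of the two
  lists, and all other entries are zero as membership in \<open>cochains\<close> requires.\<close>

definition cochain_of :: "nat \<Rightarrow> (nat \<times> nat \<Rightarrow> ('k, 'a) tensor \<Rightarrow> ('k, 'a) tensor) \<Rightarrow> 'x multiset list \<Rightarrow> 'x multiset list \<Rightarrow> 'k" where
  "cochain_of N \<Phi> l l' = (if lists_over B l \<and> lists_over B l' \<and> length l + length l' = N
     then evm (enc 0 l') (untwist (length l') (psi (length l) (\<Phi> (length l, length l'))) l) else 0)"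

abbreviation "tot N \<equiv> carrier (GS_total A N)"

lemma total_simps:
  "\<Phi> \<in> tot N \<longleftrightarrow> \<Phi> \<in> extensional {(m, n). m + n = N} \<and> (\<forall>m n. m + n = N \<longrightarrow> \<Phi> (m, n) \<in> carrier (GS_bicomplex A m n))"
  "m + n = N \<Longrightarrow> (\<Phi> \<oplus>\<^bsub>GS_total A N\<^esub> \<Phi>') (m, n) = \<Phi> (m, n) \<oplus>\<^bsub>GS_bicomplex A m n\<^esub> \<Phi>' (m, n)"
  "m + n = N \<Longrightarrow> (c \<odot>\<^bsub>GS_total A N\<^esub> \<Phi>) (m, n) = c \<odot>\<^bsub>GS_bicomplex A m n\<^esub> \<Phi> (m, n)"
  "m + n = N \<Longrightarrow> \<zero>\<^bsub>GS_total A N\<^esub> (m, n) = \<zero>\<^bsub>GS_bicomplex A m n\<^esub>"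
  by (auto simp: GS_total_def direct_sum_def PiE_iff)

lemma bicomplex_closed:
  "\<zero>\<^bsub>GS_bicomplex A m n\<^esub> \<in> carrier (GS_bicomplex A m n)"
  "\<Psi> \<in> carrier (GS_bicomplex A m n) \<Longrightarrow> \<Psi>' \<in> carrier (GS_bicomplex A m n) \<Longrightarrow> \<Psi> \<oplus>\<^bsub>GS_bicomplex A m n\<^esub> \<Psi>' \<in> carrier (GS_bicomplex A m n)"
  "\<Psi> \<in> carrier (GS_bicomplex A m n) \<Longrightarrow> c \<odot>\<^bsub>GS_bicomplex A m n\<^esub> \<Psi> \<in> carrier (GS_bicomplex A m n)"
proof -
  note M = coordD[OF coord_tensor_power[of m]] and N = coordD[OF coord_tensor_power[of n]]
  let ?T = "tensor_power A n"
  have add: "(a \<oplus>\<^bsub>?T\<^esub> b) \<oplus>\<^bsub>?T\<^esub> (a' \<oplus>\<^bsub>?T\<^esub> b') = (a \<oplus>\<^bsub>?T\<^esub> a') \<oplus>\<^bsub>?T\<^esub> (b \<oplus>\<^bsub>?T\<^esub> b')"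
    if "a \<in> carrier ?T" "b \<in> carrier ?T" "a' \<in> carrier ?T" "b' \<in> carrier ?T" for a b a' b'
    by (rule N(12)) (use that N(6,9) in \<open>simp_all add: algebra_simps del: tensor_power_simps\<close>)
  have dist: "e \<odot>\<^bsub>?T\<^esub> (a \<oplus>\<^bsub>?T\<^esub> b) = e \<odot>\<^bsub>?T\<^esub> a \<oplus>\<^bsub>?T\<^esub> e \<odot>\<^bsub>?T\<^esub> b"
    if "a \<in> carrier ?T" "b \<in> carrier ?T" for a b e
    by (rule N(12)) (use that N(6,7,9,10) in \<open>simp_all add: smul_simps del: tensor_power_simps\<close>)
  have comm: "e \<odot>\<^bsub>?T\<^esub> (c \<odot>\<^bsub>?T\<^esub> a) = c \<odot>\<^bsub>?T\<^esub> (e \<odot>\<^bsub>?T\<^esub> a)" if "a \<in> carrier ?T" for a e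
    by (rule N(12)) (use that N(7,10) in \<open>simp_all add: smul_simps mult.commute del: tensor_power_simps\<close>)
  have zero: "\<zero>\<^bsub>?T\<^esub> \<oplus>\<^bsub>?T\<^esub> \<zero>\<^bsub>?T\<^esub> = \<zero>\<^bsub>?T\<^esub>" "e \<odot>\<^bsub>?T\<^esub> \<zero>\<^bsub>?T\<^esub> = \<zero>\<^bsub>?T\<^esub>" for e
    by (rule N(12); use N(6,7,8,9,10,11) in \<open>simp_all del: tensor_power_simps\<close>)+
  show "\<zero>\<^bsub>GS_bicomplex A m n\<^esub> \<in> carrier (GS_bicomplex A m n)"
    unfolding GS_bicomplex_def hom_space_def using M(9,10) N(11) zero by (simp del: tensor_power_simps)
  show "\<Psi> \<oplus>\<^bsub>GS_bicomplex A m n\<^esub> \<Psi>' \<in> carrier (GS_bicomplex A m n)"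
    if "\<Psi> \<in> carrier (GS_bicomplex A m n)" "\<Psi>' \<in> carrier (GS_bicomplex A m n)"
  proof -
    note h = that[unfolded GS_bicomplex_def, THEN hom_spaceD(1)] that[unfolded GS_bicomplex_def, THEN hom_spaceD(2)]
      that[unfolded GS_bicomplex_def, THEN hom_spaceD(3)]
    show ?thesis unfolding GS_bicomplex_def hom_space_def
      using M(9,10) N(9,10) h by (simp add: dist add del: tensor_power_simps)
  qed
  show "c \<odot>\<^bsub>GS_bicomplex A m n\<^esub> \<Psi> \<in> carrier (GS_bicomplex A m n)" if "\<Psi> \<in> carrier (GS_bicomplex A m n)"
  proof -
    note h = that[unfolded GS_bicomplex_def, THEN hom_spaceD(1)] that[unfolded GS_bicomplex_def, THEN hom_spaceD(2)]
      that[unfolded GS_bicomplex_def, THEN hom_spaceD(3)]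
    show ?thesis unfolding GS_bicomplex_def hom_space_def
      using M(9,10) N(9,10) h by (simp add: dist comm[symmetric] del: tensor_power_simps)
  qed
qed

lemma psi_lin:
  assumes l: "l \<in> wds (mons B) m" and \<Psi>: "\<Psi> \<in> carrier (GS_bicomplex A m n)"
  shows "\<Psi>' \<in> carrier (GS_bicomplex A m n) \<Longrightarrow> psi m (\<Psi> \<oplus>\<^bsub>GS_bicomplex A m n\<^esub> \<Psi>') l = psi m \<Psi> l + psi m \<Psi>' l"
    "psi m (c \<odot>\<^bsub>GS_bicomplex A m n\<^esub> \<Psi>) l = smul c (psi m \<Psi> l)" "psi m \<zero>\<^bsub>GS_bicomplex A m n\<^esub> l = 0"
proof -
  have P: "pure_tensor A m (map (bas A \<kappa>) l) \<in> carrier (tensor_power A m)" using pure_carrier[OF map_bas_words[OF l]] by simp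
  note N = coordD[OF coord_tensor_power[of n]] and h = hom_spaceD(1)[OF _ P, of _ "tensor_power A n"]
  show "psi m (\<Psi> \<oplus>\<^bsub>GS_bicomplex A m n\<^esub> \<Psi>') l = psi m \<Psi> l + psi m \<Psi>' l" if "\<Psi>' \<in> carrier (GS_bicomplex A m n)"
    using h \<Psi> that P N(6) by (simp add: psi_def GS_bicomplex_def hom_space_def del: tensor_power_simps)
  show "psi m (c \<odot>\<^bsub>GS_bicomplex A m n\<^esub> \<Psi>) l = smul c (psi m \<Psi> l)" "psi m \<zero>\<^bsub>GS_bicomplex A m n\<^esub> l = 0"
    using h \<Psi> P N(7,8) by (simp_all add: psi_def GS_bicomplex_def hom_space_def del: tensor_power_simps)
qed

lemma untwist_psi_fsp:
  assumes "\<Phi> \<in> tot N" "m + n = N" "l \<in> wds (mons B) m"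
  shows "untwist n (psi m (\<Phi> (m, n))) l \<in> fsp (mons ({..<n} \<times> B))"
  by (rule untwist_fsp[OF assms(3)], rule psi_fsp)
    (use assms(1,2) in \<open>auto simp: total_simps GS_bicomplex_def\<close>)

lemma cochain_of_cochains:
  assumes \<Phi>: "\<Phi> \<in> tot N" shows "cochain_of N \<Phi> \<in> cochains B N"
  unfolding cochains_def
proof (intro CollectI conjI allI impI)
  fix l :: "'x multiset list"
  define n where "n = N - length l"
  let ?p = "untwist n (psi (length l) (\<Phi> (length l, n))) l"
  have "{l'. cochain_of N \<Phi> l l' \<noteq> 0} \<subseteq> {l' \<in> wds (mons B) n. enc 0 l' \<in> Poly_Mapping.keys ?p}"
    by (auto simp: cochain_of_def n_def lists_over_iff evm_def in_keys_iff split: if_splits)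
  moreover have "finite {l' \<in> wds (mons B) n. enc 0 l' \<in> Poly_Mapping.keys ?p}"
  proof (rule finite_imageD[of "enc 0"])
    show "inj_on (enc 0) {l' \<in> wds (mons B) n. enc 0 l' \<in> Poly_Mapping.keys ?p}"
      using enc_bij[of B n] by (auto simp: bij_betw_def intro: inj_on_subset)
    show "finite (enc 0 ` {l' \<in> wds (mons B) n. enc 0 l' \<in> Poly_Mapping.keys ?p})"
      by (rule finite_subset[of _ "Poly_Mapping.keys ?p"]) auto
  qed
  ultimately show "finite {l'. cochain_of N \<Phi> l l' \<noteq> 0}" by (rule finite_subset)
qed (auto simp: cochain_of_def split: if_splits)

lemma cochain_of_lin:
  assumes \<Phi>: "\<Phi> \<in> tot N"
  shows "\<Phi>' \<in> tot N \<Longrightarrow> cochain_of N (\<Phi> \<oplus>\<^bsub>GS_total A N\<^esub> \<Phi>') = (\<lambda>l l'. cochain_of N \<Phi> l l' + cochain_of N \<Phi>' l l')"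
    "cochain_of N (c \<odot>\<^bsub>GS_total A N\<^esub> \<Phi>) = (\<lambda>l l'. c * cochain_of N \<Phi> l l')" "cochain_of N \<zero>\<^bsub>GS_total A N\<^esub> = (\<lambda>l l'. 0)"
proof -
  have c: "\<Phi> (m, n) \<in> carrier (GS_bicomplex A m n)" if "m + n = N" "\<Phi> \<in> tot N" for m n \<Phi> using that by (simp add: total_simps)
  have "untwist n (psi m ((\<Phi> \<oplus>\<^bsub>GS_total A N\<^esub> \<Phi>') (m, n))) l = untwist n (psi m (\<Phi> (m, n))) l + untwist n (psi m (\<Phi>' (m, n))) l"
    if "\<Phi>' \<in> tot N" "m + n = N" "l \<in> wds (mons B) m" for m n l
  proof -
    have "untwist n (psi m ((\<Phi> \<oplus>\<^bsub>GS_total A N\<^esub> \<Phi>') (m, n))) l = untwist n (\<lambda>l. psi m (\<Phi> (m, n)) l + psi m (\<Phi>' (m, n)) l) l"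
      by (rule untwist_cong[OF that(3)]) (simp add: total_simps(2) that(2) psi_lin(1)[OF _ c[OF that(2) \<Phi>] c[OF that(2,1)]])
    then show ?thesis by (simp only: untwist_def convl_lin)
  qed
  then show "\<Phi>' \<in> tot N \<Longrightarrow> cochain_of N (\<Phi> \<oplus>\<^bsub>GS_total A N\<^esub> \<Phi>') = (\<lambda>l l'. cochain_of N \<Phi> l l' + cochain_of N \<Phi>' l l')"
    by (simp add: fun_eq_iff cochain_of_def lists_over_iff)
  have "untwist n (psi m ((c \<odot>\<^bsub>GS_total A N\<^esub> \<Phi>) (m, n))) l = smul c (untwist n (psi m (\<Phi> (m, n))) l)"
    if "m + n = N" "l \<in> wds (mons B) m" for m n l c
  proof -
    \<comment> \<open>The scalar is written as a constant polynomial, because \<open>convl\<close>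
      is linear over the ring of its values.\<close>
    have "untwist n (psi m ((c \<odot>\<^bsub>GS_total A N\<^esub> \<Phi>) (m, n))) l = untwist n (\<lambda>l. sing {#} c * psi m (\<Phi> (m, n)) l) l"
      by (rule untwist_cong[OF that(2)]) (simp add: total_simps(3) that(1) psi_lin(2)[OF _ c[OF that(1) \<Phi>]] mult_map_scale_conv_mult)
    then show ?thesis by (simp only: untwist_def convl_lin mult_map_scale_conv_mult)
  qed
  then show "cochain_of N (c \<odot>\<^bsub>GS_total A N\<^esub> \<Phi>) = (\<lambda>l l'. c * cochain_of N \<Phi> l l')"
    by (simp add: fun_eq_iff cochain_of_def lists_over_iff)
  have "untwist n (psi m (\<zero>\<^bsub>GS_total A N\<^esub> (m, n))) l = 0" if "m + n = N" "l \<in> wds (mons B) m" for m n l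
  proof -
    have "untwist n (psi m (\<zero>\<^bsub>GS_total A N\<^esub> (m, n))) l = untwist n (\<lambda>l. 0) l"
      by (rule untwist_cong[OF that(2)]) (simp add: total_simps(4) that(1) psi_lin(3)[OF _ c[OF that(1) \<Phi>]])
    then show ?thesis by (simp only: untwist_def convl_lin)
  qed
  then show "cochain_of N \<zero>\<^bsub>GS_total A N\<^esub> = (\<lambda>l l'. 0)" by (simp add: fun_eq_iff cochain_of_def lists_over_iff)
qed

text \<open>As the factorials are nonzero, the entries recover the untwisted polynomials. Twisting
  back gives the values on monomial tensors, and these determine each component.\<close>

lemma cochain_of_inj:
  assumes \<Phi>: "\<Phi> \<in> tot N" "\<Phi>' \<in> tot N" and eq: "cochain_of N \<Phi> = cochain_of N \<Phi>'"
  shows "\<Phi> = \<Phi>'"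
proof (rule extensionalityI[of _ "{(m, n). m + n = N}"])
  fix mn assume "mn \<in> {(m, n). m + n = N}"
  then obtain m n where mn: "mn = (m, n)" "m + n = N" by auto
  have c: "\<Phi> (m, n) \<in> carrier (GS_bicomplex A m n)" if "\<Phi> \<in> tot N" for \<Phi> using that mn by (simp add: total_simps)
  have u: "untwist n (psi m (\<Phi> (m, n))) l = untwist n (psi m (\<Phi>' (m, n))) l" if l: "l \<in> wds (mons B) m" for l
  proof (rule poly_mapping_eqI)
    fix M
    note f = untwist_psi_fsp[OF \<Phi>(1) mn(2) l] untwist_psi_fsp[OF \<Phi>(2) mn(2) l]
    show "lkp (untwist n (psi m (\<Phi> (m, n))) l) M = lkp (untwist n (psi m (\<Phi>' (m, n))) l) M"
    proof (cases "M \<in> mons ({..<n} \<times> B)")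
      case True
      then have "M \<in> enc 0 ` wds (mons B) n" using enc_bij[of B n] by (simp only: bij_betw_def)
      then obtain l' where l': "l' \<in> wds (mons B) n" "M = enc 0 l'" by blast
      have "cochain_of N \<Phi> l l' = cochain_of N \<Phi>' l l'" by (simp add: eq)
      then show ?thesis using l l' mn(2) by (auto simp: cochain_of_def lists_over_iff evm_def)
    next
      case False
      then show ?thesis using f unfolding fsp_iff by metis
    qed
  qed
  have p: "psi m (\<Phi> (m, n)) l = psi m (\<Phi>' (m, n)) l" if l: "l \<in> wds (mons B) m" for l
  proof -
    have "convl (ell n) (untwist n (psi m (\<Phi> (m, n)))) l = convl (ell n) (untwist n (psi m (\<Phi>' (m, n)))) l"
      by (rule convl_cong, rule u) (use lists_over_sub[OF l] in blast)
    then show ?thesis by (simp only: untwist_inverse)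
  qed
  show "\<Phi> mn = \<Phi>' mn" unfolding mn(1)
  proof (rule extensionalityI[of _ "carrier (tensor_power A m)"])
    note h = c[OF \<Phi>(1), unfolded GS_bicomplex_def] c[OF \<Phi>(2), unfolded GS_bicomplex_def]
    show "\<Phi> (m, n) \<in> extensional (carrier (tensor_power A m))" "\<Phi>' (m, n) \<in> extensional (carrier (tensor_power A m))"
      by (rule hom_spaceD(4)[OF h(1)], rule hom_spaceD(4)[OF h(2)])
    fix P assume P: "P \<in> carrier (tensor_power A m)"
    then have P': "P \<in> carrier (tensor_space A m)" by simp
    show "\<Phi> (m, n) P = \<Phi>' (m, n) P"
    proof (rule coordD(12)[OF coord_tensor_power])
      show "pcoord \<kappa> (\<Phi> (m, n) P) = pcoord \<kappa> (\<Phi>' (m, n) P)"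
        unfolding psi_expand[OF h(1) P'] psi_expand[OF h(2) P']
        by (rule lin_cong_fsp[OF coordD(5)[OF coord_tensor_space[OF coord] P']]) (rule p)
    qed (use hom_spaceD(1)[OF h(1) P] hom_spaceD(1)[OF h(2) P] in auto)
  qed
qed (use \<Phi> in \<open>simp_all add: total_simps\<close>)

lemma psi_surj:
  assumes "\<And>l. l \<in> wds (mons B) m \<Longrightarrow> f l \<in> fsp (mons ({..<n} \<times> B))"
  shows "\<exists>\<Psi>\<in>carrier (GS_bicomplex A m n). \<forall>l\<in>wds (mons B) m. psi m \<Psi> l = f l"
proof -
  note M = coordD[OF coord_tensor_power'[of m]] and N = coordD[OF coord_tensor_power[of n]]
  define \<Psi> where "\<Psi> = (\<lambda>P\<in>carrier (tensor_power A m). inv_into (carrier (tensor_power A n)) (pcoord \<kappa>) (lin f (tcoord \<kappa> P)))"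
  have \<Psi>: "\<Psi> P \<in> carrier (tensor_power A n)" "pcoord \<kappa> (\<Psi> P) = lin f (tcoord \<kappa> P)" if P: "P \<in> carrier (tensor_power A m)" for P
  proof -
    have "lin f (tcoord \<kappa> P) \<in> fsp (mons ({..<n} \<times> B))" by (rule lin_fsp'[OF M(5)[OF P] assms])
    then have "lin f (tcoord \<kappa> P) \<in> pcoord \<kappa> ` carrier (tensor_power A n)" using N(3) by (simp add: bij_betw_def)
    from inv_into_into[OF this] f_inv_into_f[OF this]
    show "\<Psi> P \<in> carrier (tensor_power A n)" "pcoord \<kappa> (\<Psi> P) = lin f (tcoord \<kappa> P)" using P by (simp_all add: \<Psi>_def)
  qed
  have "\<Psi> (x \<oplus>\<^bsub>tensor_power A m\<^esub> y) = \<Psi> x \<oplus>\<^bsub>tensor_power A n\<^esub> \<Psi> y" if x: "x \<in> carrier (tensor_power A m)" and y: "y \<in> carrier (tensor_power A m)" for x y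
    by (rule N(12)) (use \<Psi>[OF M(9)[OF x y]] \<Psi>[OF x] \<Psi>[OF y] M(6)[OF x y] N(6,9) in \<open>simp_all del: tensor_power_simps\<close>)
  moreover have "\<Psi> (c \<odot>\<^bsub>tensor_power A m\<^esub> x) = c \<odot>\<^bsub>tensor_power A n\<^esub> \<Psi> x" if x: "x \<in> carrier (tensor_power A m)" for x c
    by (rule N(12)) (use \<Psi>[OF M(10)[OF x]] \<Psi>[OF x] M(7)[OF x] N(7,10) in \<open>simp_all del: tensor_power_simps\<close>)
  ultimately have "\<Psi> \<in> carrier (GS_bicomplex A m n)"
    using \<Psi>(1) by (simp add: GS_bicomplex_def hom_space_def \<Psi>_def del: tensor_power_simps)
  moreover have "psi m \<Psi> l = f l" if l: "l \<in> wds (mons B) m" for l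
  proof -
    note w = map_bas_words[OF l]
    have "pure_tensor A m (map (bas A \<kappa>) l) \<in> carrier (tensor_power A m)" using pure_carrier[OF w] by simp
    from \<Psi>(2)[OF this] show ?thesis unfolding psi_def tcoord_pure[OF coord w] tens_map_bas[OF coord l] by simp
  qed
  ultimately show ?thesis by blast
qed

lemma cochain_of_surj:
  assumes F: "F \<in> cochains B N" obtains \<Phi> where "\<Phi> \<in> tot N" "cochain_of N \<Phi> = F"
proof -
  \<comment> \<open>Finiteness in the second argument makes this a polynomial; dividing by
    \<open>mfact\<close> undoes the factor in \<open>evm\<close>.\<close>
  define p where "p l = (\<Sum>l' | F l l' \<noteq> 0. sing (enc 0 l') (F l l' / mfact (enc 0 l')))" for l
  have fin: "finite {l'. F l l' \<noteq> 0}" for l using F by (simp add: cochains_def)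
  have Fl: "F l l' \<noteq> 0 \<Longrightarrow> l' \<in> wds (mons B) (N - length l) \<and> length l \<le> N" for l l'
  proof -
    assume "F l l' \<noteq> 0"
    then have "lists_over B l'" "length l + length l' = N" using F unfolding cochains_def by blast+
    then show ?thesis using lists_over_iff[of B l'] by auto
  qed
  have pf: "p l \<in> fsp (mons ({..<n} \<times> B))" if "l \<in> wds (mons B) m" "m + n = N" for l m n
    unfolding p_def
  proof (rule fsp_sum, rule fsp_closed(6))
    fix l' assume "l' \<in> {l'. F l l' \<noteq> 0}"
    then have "l' \<in> wds (mons B) n" using Fl[of l l'] that by auto
    then show "enc 0 l' \<in> mons ({..<n} \<times> B)" using enc_bij[of B n] unfolding bij_betw_def by blast
  qed
  have ev: "evm (enc 0 k) (p l) = F l k" if k: "k \<in> wds (mons B) n" and l: "length l + n = N" for k l n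
  proof -
    have "lkp (p l) (enc 0 k) = (\<Sum>l' | F l l' \<noteq> 0. if l' = k then F l l' / mfact (enc 0 l') else 0)"
      unfolding p_def lookup_sum
    proof (rule sum.cong[OF refl])
      fix l' assume "l' \<in> {l'. F l l' \<noteq> 0}"
      then have "l' \<in> wds (mons B) n" using Fl[of l l'] l by auto
      then have "enc 0 l' = enc 0 k \<longleftrightarrow> l' = k" using enc_bij[of B n] k by (auto simp: bij_betw_def inj_on_def)
      then show "lkp (sing (enc 0 l') (F l l' / mfact (enc 0 l'))) (enc 0 k) = (if l' = k then F l l' / mfact (enc 0 l') else 0)"
        by (simp add: lookup_single when_def)
    qed
    then show ?thesis using fin by (simp add: evm_def)
  qed
  have "\<exists>\<Psi>. m + n = N \<longrightarrow> \<Psi> \<in> carrier (GS_bicomplex A m n) \<and> (\<forall>l\<in>wds (mons B) m. psi m \<Psi> l = convl (ell n) p l)" for m n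
  proof (cases "m + n = N")
    case True
    \<comment> \<open>The values to be realized are obtained from \<open>p\<close> by the opposite
      exponential, which \<open>untwist\<close> removes again.\<close>
    have "convl (ell n) p l \<in> fsp (mons ({..<n} \<times> B))" if "l \<in> wds (mons B) m" for l
      by (rule untwist_fsp(2)[OF that pf]) (use True in auto)
    from psi_surj[of m "convl (ell n) p" n, OF this] show ?thesis by blast
  qed simp
  then have "\<forall>m. \<exists>\<Psi>. \<forall>n. m + n = N \<longrightarrow> \<Psi> n \<in> carrier (GS_bicomplex A m n) \<and> (\<forall>l\<in>wds (mons B) m. psi m (\<Psi> n) l = convl (ell n) p l)"
    by (intro choice allI)
  then have "\<exists>\<Psi>. \<forall>m n. m + n = N \<longrightarrow> \<Psi> m n \<in> carrier (GS_bicomplex A m n) \<and> (\<forall>l\<in>wds (mons B) m. psi m (\<Psi> m n) l = convl (ell n) p l)"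
    by (rule choice)
  then obtain \<Psi> where \<Psi>: "\<And>m n. m + n = N \<Longrightarrow> \<Psi> m n \<in> carrier (GS_bicomplex A m n)"
    "\<And>m n l. m + n = N \<Longrightarrow> l \<in> wds (mons B) m \<Longrightarrow> psi m (\<Psi> m n) l = convl (ell n) p l" by blast
  define \<Phi> where "\<Phi> = (\<lambda>(m, n)\<in>{(m, n). m + n = N}. \<Psi> m n)"
  have "\<Phi> \<in> tot N" using \<Psi>(1) by (auto simp: total_simps \<Phi>_def)
  moreover have "cochain_of N \<Phi> l l' = F l l'" for l l'
  proof (cases "lists_over B l \<and> lists_over B l' \<and> length l + length l' = N")
    case True
    then have l: "l \<in> wds (mons B) (length l)" and l': "l' \<in> wds (mons B) (length l')" by (auto simp: lists_over_iff)
    have "untwist (length l') (psi (length l) (\<Phi> (length l, length l'))) l = untwist (length l') (convl (ell (length l')) p) l"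
      by (rule untwist_cong[OF l]) (use True \<Psi>(2)[of "length l" "length l'"] in \<open>simp add: \<Phi>_def\<close>)
    then show ?thesis using True ev[OF l', of l] by (simp add: cochain_of_def untwist_inverse)
  next
    case False
    then have "F l l' = 0" using F by (auto simp: cochains_def)
    then show ?thesis using False by (auto simp: cochain_of_def)
  qed
  ultimately show ?thesis using that by (simp add: fun_eq_iff)
qed

text \<open>Entry by entry, the component from \<open>GS_d1\<close> becomes the bar differential in
  \<open>l\<close>, the one from \<open>GS_d2\<close> the bar differential in \<open>l'\<close>, and
  the sign \<open>(-1) ^ m\<close> is \<open>sgn1 (length l)\<close>.\<close>

lemma GS_differential_cochain_of:
  assumes \<Phi>: "\<Phi> \<in> tot N"
  shows "GS_differential A N \<Phi> \<in> tot (Suc N)" "cochain_of (Suc N) (GS_differential A N \<Phi>) = tdel (cochain_of N \<Phi>)"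
proof -
  let ?D = "GS_differential A N \<Phi>"
  define D1 where "D1 m n = (if m = 0 then \<zero>\<^bsub>GS_bicomplex A m n\<^esub> else GS_d1 A (m - 1) n (\<Phi> (m - 1, n)))" for m n
  define D2 where "D2 m n = (if n = 0 then \<zero>\<^bsub>GS_bicomplex A m n\<^esub>
         else (-1) ^ m \<odot>\<^bsub>GS_bicomplex A m n\<^esub> GS_d2 A m (n - 1) (\<Phi> (m, n - 1)))" for m n
  have D: "?D (m, n) = D1 m n \<oplus>\<^bsub>GS_bicomplex A m n\<^esub> D2 m n" if "m + n = Suc N" for m n
    using that by (simp add: GS_differential_def D1_def D2_def)
  have c: "\<Phi> (m, n) \<in> carrier (GS_bicomplex A m n)" if "m + n = N" for m n using that \<Phi> by (simp add: total_simps)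
  have Dc: "D1 m n \<in> carrier (GS_bicomplex A m n)" "D2 m n \<in> carrier (GS_bicomplex A m n)" if mn: "m + n = Suc N" for m n
  proof -
    show "D1 m n \<in> carrier (GS_bicomplex A m n)"
      using mn bicomplex_closed(1) GS_d1(1)[OF c, of "m - 1" n] by (cases m) (auto simp: D1_def)
    show "D2 m n \<in> carrier (GS_bicomplex A m n)"
      using mn bicomplex_closed(1) bicomplex_closed(3)[OF GS_d2(1)[OF c, of m "n - 1"]] by (cases n) (auto simp: D2_def)
  qed
  show DT: "?D \<in> tot (Suc N)"
    using D Dc bicomplex_closed(2) by (auto simp: total_simps) (simp add: GS_differential_def)
  have main: "cochain_of (Suc N) ?D l l' = tdel (cochain_of N \<Phi>) l l'" if l: "lists_over B l" and l': "lists_over B l'" and len: "length l + length l' = Suc N" for l l'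
  proof -
    define m n where "m = length l" and "n = length l'"
    have mn: "m + n = Suc N" using len by (simp add: m_def n_def)
    have lw: "l \<in> wds (mons B) m" using l by (simp add: lists_over_iff m_def)
    have psiD: "psi m (?D (m, n)) k = psi m (D1 m n) k + psi m (D2 m n) k" if "k \<in> wds (mons B) m" for k
      unfolding D[OF mn] by (rule psi_lin(1)[OF that Dc[OF mn]])
    have "untwist n (psi m (?D (m, n))) l = untwist n (\<lambda>k. psi m (D1 m n) k + psi m (D2 m n) k) l"
      by (rule untwist_cong[OF lw psiD])
    then have "cochain_of (Suc N) ?D l l' = evm (enc 0 l') (untwist n (psi m (D1 m n)) l) + evm (enc 0 l') (untwist n (psi m (D2 m n)) l)"
      using l l' len by (simp add: cochain_of_def m_def[symmetric] n_def[symmetric]) (simp add: untwist_def convl_lin)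
    also have "evm (enc 0 l') (untwist n (psi m (D1 m n)) l) = del aug (\<lambda>k. cochain_of N \<Phi> k l') l"
    proof (cases m)
      case 0
      have "untwist n (psi m (D1 m n)) l = untwist n (\<lambda>l. 0) l"
        by (rule untwist_cong[OF lw]) (simp add: D1_def 0 psi_lin(3)[OF _ Dc(1)[OF mn]] del: untwist_def flip: 0)
      moreover have "l = []" using 0 by (simp add: m_def)
      ultimately show ?thesis by (simp add: untwist_def del_def)
    next
      case (Suc m')
      have "m' + n = N" using mn Suc by simp
      note d1 = GS_d1(2)[OF c[OF this]]
      have "untwist n (psi m (D1 m n)) l = untwist n (del (act (ell n)) (psi m' (\<Phi> (m', n)))) l"
        by (rule untwist_cong[OF lw]) (simp add: D1_def Suc d1)
      then have "evm (enc 0 l') (untwist n (psi m (D1 m n)) l) = del aug (\<lambda>k. evm (enc 0 l') (untwist n (psi m' (\<Phi> (m', n))) k)) l"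
        unfolding untwist_del by (simp add: del_additive[of "evm (enc 0 l')"])
      also have "\<dots> = del aug (\<lambda>k. cochain_of N \<Phi> k l') l"
      proof (rule del_cong)
        fix k assume k: "sum_list k = sum_list l" "Suc (length k) = length l"
        then have "lists_over B k" "length k = m'" using l Suc by (auto simp: lists_over_def m_def)
        then show "evm (enc 0 l') (untwist n (psi m' (\<Phi> (m', n))) k) = cochain_of N \<Phi> k l'"
          using l' \<open>m' + n = N\<close> by (simp add: cochain_of_def n_def)
      qed
      finally show ?thesis .
    qed
    also have "evm (enc 0 l') (untwist n (psi m (D2 m n)) l) = sgn1 (length l) * del aug (cochain_of N \<Phi> l) l'"
    proof (cases n)
      case 0
      have "untwist n (psi m (D2 m n)) l = untwist n (\<lambda>l. 0) l"
        by (rule untwist_cong[OF lw]) (simp add: D2_def 0 psi_lin(3)[OF _ Dc(2)[OF mn]] flip: 0)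
      moreover have "l' = []" using 0 by (simp add: n_def)
      ultimately show ?thesis by (simp add: untwist_def del_def convl_lin)
    next
      case (Suc n')
      have mn': "m + n' = N" using mn Suc by simp
      note cc = c[OF mn']
      let ?P = "\<lambda>l. convl (\<lambda>v. pvar (0, v)) (\<lambda>l. shift 1 (psi m (\<Phi> (m, n')) l)) l
        + (\<Sum>i=1..n'. (-1) ^ i * theta_at (i - 1) (psi m (\<Phi> (m, n')) l)) + (-1) ^ (n' + 1) * convl (\<lambda>v. pvar (n', v)) (psi m (\<Phi> (m, n'))) l"
      have "untwist n (psi m (D2 m n)) l = untwist n (\<lambda>l. (-1) ^ m * ?P l) l"
        by (rule untwist_cong[OF lw]) (simp add: D2_def Suc psi_lin(2)[OF _ GS_d2(1)[OF cc]] GS_d2(2)[OF cc] minus_one_power_smul[of m])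
      also have "\<dots> = smul ((-1) ^ m) (cobar n' (untwist n' (psi m (\<Phi> (m, n'))) l))"
        unfolding untwist_def[of n] convl_lin(1) unfolding untwist_def[symmetric] Suc untwist_cobar by (rule minus_one_power_smul)
      finally have "evm (enc 0 l') (untwist n (psi m (D2 m n)) l) = (-1) ^ m * evm (enc 0 l') (cobar n' (untwist n' (psi m (\<Phi> (m, n'))) l))"
        by simp
      also have "evm (enc 0 l') (cobar n' (untwist n' (psi m (\<Phi> (m, n'))) l)) = del aug (\<lambda>k. evm (enc 0 k) (untwist n' (psi m (\<Phi> (m, n'))) l)) l'"
      proof (rule evm_cobar)
        show "untwist n' (psi m (\<Phi> (m, n'))) l \<in> fsp (mons ({..<n'} \<times> UNIV))"
          using untwist_psi_fsp[OF \<Phi> mn' lw] unfolding fsp_iff by blast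
        show "length l' = Suc n'" using Suc by (simp add: n_def)
      qed
      also have "\<dots> = del aug (cochain_of N \<Phi> l) l'"
      proof (rule del_cong)
        fix k assume k: "sum_list k = sum_list l'" "Suc (length k) = length l'"
        then have "lists_over B k" "length k = n'" using l' Suc by (auto simp: lists_over_def n_def)
        then show "evm (enc 0 k) (untwist n' (psi m (\<Phi> (m, n'))) l) = cochain_of N \<Phi> l k"
          using l mn' by (simp add: cochain_of_def m_def)
      qed
      finally show ?thesis by (simp add: sgn1_def m_def)
    qed
    finally show ?thesis by (simp add: tdel_def)
  qed
  show "cochain_of (Suc N) ?D = tdel (cochain_of N \<Phi>)"
  proof (intro ext)
    fix l l'
    show "cochain_of (Suc N) ?D l l' = tdel (cochain_of N \<Phi>) l l'"
    proof (cases "lists_over B l \<and> lists_over B l' \<and> length l + length l' = Suc N")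
      case False
      then have "tdel (cochain_of N \<Phi>) l l' = 0" using tdel_cochains[OF cochain_of_cochains[OF \<Phi>]] by (auto simp: cochains_def)
      with False show ?thesis by (auto simp: cochain_of_def)
    qed (use main in blast)
  qed
qed

lemma total_closed:
  "\<zero>\<^bsub>GS_total A N\<^esub> \<in> tot N" "\<Phi> \<in> tot N \<Longrightarrow> \<Phi>' \<in> tot N \<Longrightarrow> \<Phi> \<oplus>\<^bsub>GS_total A N\<^esub> \<Phi>' \<in> tot N"
  "\<Phi> \<in> tot N \<Longrightarrow> c \<odot>\<^bsub>GS_total A N\<^esub> \<Phi> \<in> tot N"
  by (auto simp: GS_total_def direct_sum_def PiE_iff bicomplex_closed)

lemma cocycles_eq: "GS_cocycles A N = {\<Phi> \<in> tot N. \<forall>l l'. tdel (cochain_of N \<Phi>) l l' = 0}"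
proof -
  have "GS_differential A N \<Phi> = \<zero>\<^bsub>GS_total A (Suc N)\<^esub> \<longleftrightarrow> (\<forall>l l'. tdel (cochain_of N \<Phi>) l l' = 0)" if \<Phi>: "\<Phi> \<in> tot N" for \<Phi>
  proof -
    have D: "cochain_of (Suc N) (GS_differential A N \<Phi>) = tdel (cochain_of N \<Phi>)" by (rule GS_differential_cochain_of(2)[OF \<Phi>])
    have Z: "cochain_of (Suc N) \<zero>\<^bsub>GS_total A (Suc N)\<^esub> = (\<lambda>l l'. 0)" by (rule cochain_of_lin(3)[OF total_closed(1)])
    show ?thesis
    proof
      assume "GS_differential A N \<Phi> = \<zero>\<^bsub>GS_total A (Suc N)\<^esub>"
      then have "tdel (cochain_of N \<Phi>) = (\<lambda>l l'. 0)" unfolding D[symmetric] Z[symmetric] by (rule arg_cong)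
      then show "\<forall>l l'. tdel (cochain_of N \<Phi>) l l' = 0" by simp
    next
      assume "\<forall>l l'. tdel (cochain_of N \<Phi>) l l' = 0"
      then have "tdel (cochain_of N \<Phi>) = (\<lambda>l l'. 0)" by (intro ext) blast
      then show "GS_differential A N \<Phi> = \<zero>\<^bsub>GS_total A (Suc N)\<^esub>"
        by (intro cochain_of_inj[OF GS_differential_cochain_of(1)[OF \<Phi>] total_closed(1)]) (simp only: D Z)
    qed
  qed
  then show ?thesis unfolding GS_cocycles_def by blast
qed

text \<open>\<open>theta\<close> supplies the coordinates of classes: it reaches every table of
  values by \<open>theta_surj\<close>, vanishes on coboundaries by \<open>theta_tdel\<close>, and
  its kernel consists of coboundaries by \<open>theta_exact\<close>. Cochains and matrices
  correspond under \<open>cochain_of\<close>.\<close>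

theorem coord_GS_cohomology:
  assumes xs: "distinct xs" "set xs = B"
  shows "\<exists>\<phi>. coord (GS_cohomology A N) \<phi>
    (Sigma {(i, j). i + j = N} (\<lambda>(i, j). {t \<in> set (subseqs xs). length t = i} \<times> {s \<in> set (subseqs xs). length s = j}))"
    (is "\<exists>\<phi>. coord _ \<phi> ?J")
proof -
  let ?Z = "GS_cocycles A N" and ?M = "(GS_total A N)\<lparr>carrier := GS_cocycles A N\<rparr>"
  define ST where "ST = {(s, t). s \<in> set (subseqs xs) \<and> t \<in> set (subseqs xs) \<and> length s + length t = N}"
  have finST: "finite ST" by (rule finite_subset[of _ "set (subseqs xs) \<times> set (subseqs xs)"]) (auto simp: ST_def)
  \<comment> \<open>The order is reversed: \<open>t\<close> comes from the values and stands for the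
    exterior power of \<open>V\<close>, while \<open>s\<close> comes from the arguments and stands
    for that of the dual space.\<close>
  define \<phi> where "\<phi> \<Phi> = (\<Sum>(s, t)\<in>ST. sing ((length t, length s), (t, s)) (theta (cochain_of N \<Phi>) s t))" for \<Phi>
  have lk: "lkp (\<Sum>(s, t)\<in>ST. sing ((length t, length s), (t, s)) (h s t)) ((i, j), (t, s)) =
     (if (s, t) \<in> ST \<and> i = length t \<and> j = length s then h s t else 0)" for h :: "'x list \<Rightarrow> 'x list \<Rightarrow> 'k" and i j s t
  proof -
    have "lkp (\<Sum>(s, t)\<in>ST. sing ((length t, length s), (t, s)) (h s t)) ((i, j), (t, s)) =
      (\<Sum>st\<in>ST. if st = (s, t) then (if i = length t \<and> j = length s then h s t else 0) else 0)"
      unfolding lookup_sum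
    proof (rule sum.cong[OF refl])
      fix st assume "st \<in> ST"
      obtain s' t' where st: "st = (s', t')" by (cases st)
      show "lkp (case st of (s, t) \<Rightarrow> sing ((length t, length s), (t, s)) (h s t)) ((i, j), (t, s)) =
        (if st = (s, t) then (if i = length t \<and> j = length s then h s t else 0) else 0)"
        unfolding st prod.case lookup_single when_def by (cases "s' = s \<and> t' = t") auto
    qed
    then show ?thesis using finST by simp
  qed
  have Z: "\<Phi> \<in> ?Z \<longleftrightarrow> \<Phi> \<in> tot N \<and> (\<forall>l l'. tdel (cochain_of N \<Phi>) l l' = 0)" for \<Phi> by (auto simp: cocycles_eq)
  have zero: "tdel (\<lambda>l l'. 0 :: 'k) l l' = 0" for l l' :: "'x multiset list" using tdel_lin(2)[of 0 "\<lambda>l l'. 0" l l'] by simp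
  have ZN: "\<zero>\<^bsub>GS_total A N\<^esub> \<in> ?Z" unfolding Z using total_closed(1) cochain_of_lin(3)[OF total_closed(1)] zero by simp
  have M: "module ground ?M"
  \<comment> \<open>Cocycles have no coordinates yet, so the axioms are checked on all matrix
    entries, each viewed as a map to a one-dimensional space.\<close>
  proof (rule module_transfer[where \<kappa> = "\<lambda>(l, l') \<Phi>. sing () (cochain_of N \<Phi> l l')"])
    fix x x' assume x: "x \<in> carrier ?M" "x' \<in> carrier ?M" and eq: "\<And>y. (case y of (l, l') \<Rightarrow> \<lambda>\<Phi>. sing () (cochain_of N \<Phi> l l')) x = (case y of (l, l') \<Rightarrow> \<lambda>\<Phi>. sing () (cochain_of N \<Phi> l l')) x'"
    have "cochain_of N x l l' = cochain_of N x' l l'" for l l'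
      using arg_cong[OF eq[of "(l, l')"], of "\<lambda>p. lkp p ()"] by simp
    then show "x = x'" using x by (intro cochain_of_inj) (auto simp: Z fun_eq_iff)
  qed (use total_closed ZN cochain_of_lin(3)[OF total_closed(1)] in \<open>auto simp: lin_on_def Z cochain_of_lin single_add tdel_lin\<close>)
  have lin: "lin_on ?M \<phi>"
    unfolding lin_on_def \<phi>_def
    by (auto simp: Z cochain_of_lin theta_lin single_add sum.distrib[symmetric] smul_sum intro!: sum.cong)
  have img: "\<phi> ` carrier ?M = fsp ?J"
  proof (intro equalityI subsetI)
    fix p assume "p \<in> \<phi> ` carrier ?M"
    then show "p \<in> fsp ?J" by (auto simp: \<phi>_def ST_def intro!: fsp_sum fsp_closed)
  next
    fix p :: "(nat \<times> nat) \<times> 'x list \<times> 'x list \<Rightarrow>\<^sub>0 'k" assume p: "p \<in> fsp ?J"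
    define g where "g s t = (if length s + length t = N then lkp p ((length t, length s), (t, s)) else 0)" for s t
    obtain F where F: "F \<in> cochains (set xs) N" "\<And>l l'. tdel F l l' = 0"
      "\<And>s t. s \<in> set (subseqs xs) \<Longrightarrow> t \<in> set (subseqs xs) \<Longrightarrow> theta F s t = g s t"
      by (rule theta_surj[OF xs(1), of g N]) (auto simp: g_def split: if_splits)
    obtain \<Phi> where \<Phi>: "\<Phi> \<in> tot N" "cochain_of N \<Phi> = F" by (rule cochain_of_surj[OF F(1)[unfolded xs(2)]])
    have "\<phi> \<Phi> = p"
    proof (rule poly_mapping_eqI)
      fix k :: "(nat \<times> nat) \<times> 'x list \<times> 'x list"
      obtain i j t s where k: "k = ((i, j), (t, s))" by (metis prod.collapse)
      show "lkp (\<phi> \<Phi>) k = lkp p k"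
      proof (cases "k \<in> ?J")
        case True
        then show ?thesis unfolding \<phi>_def k lk by (auto simp: ST_def \<Phi> F(3) g_def)
      next
        case False
        then have "lkp p k = 0" using p unfolding fsp_iff by blast
        moreover have "\<not> ((s, t) \<in> ST \<and> i = length t \<and> j = length s)" using False by (auto simp: k ST_def)
        ultimately show ?thesis unfolding \<phi>_def k lk by auto
      qed
    qed
    then show "p \<in> \<phi> ` carrier ?M" using \<Phi> F(2) by (auto simp: Z intro!: rev_image_eqI[of \<Phi>])
  qed
  have \<phi>0: "theta (cochain_of N \<Phi>) s t = 0" if \<Phi>: "\<Phi> \<in> tot N" "\<phi> \<Phi> = 0" and st: "s \<in> set (subseqs xs)" "t \<in> set (subseqs xs)" for \<Phi> s t
  proof (rule ccontr)
    assume ne: "theta (cochain_of N \<Phi>) s t \<noteq> 0"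
    from theta_nonzero[OF this cochain_of_cochains[OF \<Phi>(1)]] have "(s, t) \<in> ST" using st by (simp add: ST_def)
    then have "lkp (\<phi> \<Phi>) ((length t, length s), (t, s)) = theta (cochain_of N \<Phi>) s t" unfolding \<phi>_def lk by simp
    with ne \<Phi>(2) show False by simp
  qed
  have ker: "GS_coboundaries A N = {z \<in> carrier ?M. \<phi> z = 0}"
  proof (cases N)
    case 0
    have z0: "z = \<zero>\<^bsub>GS_total A N\<^esub>" if z: "z \<in> ?Z" "\<phi> z = 0" for z
    proof -
      have g: "cochain_of N z = (\<lambda>_ _. 0)"
      proof -
        have "z \<in> tot N" "\<forall>l l'. tdel (cochain_of N z) l l' = 0" using z(1) unfolding Z by blast+
        then show ?thesis
          using theta_exact[OF xs(1), of "cochain_of N z" N] cochain_of_cochains[of z N] \<phi>0[of z] z(2) by (simp add: xs(2) 0)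
      qed
      have g0: "cochain_of N \<zero>\<^bsub>GS_total A N\<^esub> = (\<lambda>_ _. 0)" by (rule cochain_of_lin(3)[OF total_closed(1)])
      have "z \<in> tot N" using z(1) unfolding Z by blast
      then show ?thesis by (rule cochain_of_inj[OF _ total_closed(1)]) (unfold g g0, rule refl)
    qed
    have p0: "\<phi> \<zero>\<^bsub>GS_total A N\<^esub> = 0" by (rule lin_on_zero[OF M lin, simplified])
    have "{z \<in> ?Z. \<phi> z = 0} = {\<zero>\<^bsub>GS_total A N\<^esub>}"
    proof (intro equalityI subsetI)
      fix z assume "z \<in> {z \<in> ?Z. \<phi> z = 0}"
      then have "z \<in> ?Z" "\<phi> z = 0" by (simp_all only: mem_Collect_eq)
      then show "z \<in> {\<zero>\<^bsub>GS_total A N\<^esub>}" unfolding singleton_iff by (rule z0)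
    next
      fix z assume "z \<in> {\<zero>\<^bsub>GS_total A N\<^esub>}"
      then show "z \<in> {z \<in> ?Z. \<phi> z = 0}" unfolding singleton_iff mem_Collect_eq by (simp only: ZN p0)
    qed
    then show ?thesis by (simp add: 0)
  next
    case (Suc N')
    show ?thesis unfolding Suc GS_coboundaries.simps
    proof (intro equalityI subsetI)
      fix z assume "z \<in> GS_differential A N' ` tot N'"
      then obtain \<Phi> where \<Phi>: "\<Phi> \<in> tot N'" "z = GS_differential A N' \<Phi>" by auto
      have g: "cochain_of N z = tdel (cochain_of N' \<Phi>)" unfolding \<Phi>(2) Suc by (rule GS_differential_cochain_of(2)[OF \<Phi>(1)])
      have "z \<in> tot N" unfolding \<Phi>(2) Suc by (rule GS_differential_cochain_of(1)[OF \<Phi>(1)])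
      then show "z \<in> {z \<in> carrier ((GS_total A (Suc N'))\<lparr>carrier := GS_cocycles A (Suc N')\<rparr>). \<phi> z = 0}"
        unfolding Suc[symmetric] by (simp add: Z g tdel_tdel \<phi>_def theta_tdel case_prod_unfold)
    next
      fix z assume "z \<in> {z \<in> carrier ((GS_total A (Suc N'))\<lparr>carrier := GS_cocycles A (Suc N')\<rparr>). \<phi> z = 0}"
      then have z: "z \<in> tot N" "\<And>l l'. tdel (cochain_of N z) l l' = 0" "\<phi> z = 0" by (auto simp: Suc[symmetric] Z)
      have "\<exists>G\<in>cochains (set xs) (N - 1). tdel G = cochain_of N z"
        using theta_exact[OF xs(1), of "cochain_of N z" N] cochain_of_cochains[OF z(1)] z(2) \<phi>0[OF z(1,3)] by (simp add: xs(2) Suc)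
      then obtain G where G: "G \<in> cochains B N'" "tdel G = cochain_of N z" by (auto simp: xs(2) Suc)
      obtain \<Phi> where \<Phi>: "\<Phi> \<in> tot N'" "cochain_of N' \<Phi> = G" by (rule cochain_of_surj[OF G(1)])
      have "z = GS_differential A N' \<Phi>"
        by (rule cochain_of_inj[OF z(1)[unfolded Suc] GS_differential_cochain_of(1)[OF \<Phi>(1)]])
          (use GS_differential_cochain_of(2)[OF \<Phi>(1)] \<Phi>(2) G(2) Suc in simp)
      then show "z \<in> GS_differential A N' ` tot N'" using \<Phi>(1) by blast
    qed
  qed
  show ?thesis unfolding GS_cohomology_def by (rule exI, rule coord_quotient[OF M lin img ker])
qed

end

text \<open>Matches the index set of the contraction with the sorted words that index the exterior
  powers.\<close>

lemma subseqs_upt: "set (subseqs [0..<d]) = {s. set s \<subseteq> {..<d} \<and> sorted s \<and> distinct s}"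
proof (intro equalityI subsetI)
  have "s \<in> set (subseqs xs) \<Longrightarrow> sorted xs \<Longrightarrow> distinct xs \<Longrightarrow> set s \<subseteq> set xs \<and> sorted s \<and> distinct s" for s xs :: "nat list"
  proof (induction xs arbitrary: s)
    case (Cons x xs)
    then show ?case by (auto simp: Let_def) (meson subsetD)+
  qed simp
  from this[of _ "[0..<d]"] show "s \<in> set (subseqs [0..<d]) \<Longrightarrow> s \<in> {s. set s \<subseteq> {..<d} \<and> sorted s \<and> distinct s}" for s by fastforce
next
  fix s assume "s \<in> {s. set s \<subseteq> {..<d} \<and> sorted s \<and> distinct s}"
  then have s: "set s \<subseteq> {..<d}" "sorted s" "distinct s" by auto
  have f: "filter P xs \<in> set (subseqs xs)" for P and xs :: "nat list"
    by (induction xs) (auto simp: Let_def)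
  have "filter (\<lambda>i. i \<in> set s) [0..<d] = s"
    by (rule sorted_distinct_set_unique) (use s in \<open>auto simp: sorted_wrt_filter\<close>)
  with f show "s \<in> set (subseqs [0..<d])" by metis
qed

theorem proposition6p10:
  fixes scale :: "'k::field_char_0 \<Rightarrow> 'v::ab_group_add \<Rightarrow> 'v"
    and Basis :: "'v set"
    and m :: nat
  assumes "finite_dimensional_vector_space scale Basis"
  shows "linearly_isomorphic
           (GS_cohomology (symmetric_bialgebra scale) m)
           (direct_sum {(i, j). i + j = m}
              (\<lambda>(i, j). tensor_product (exterior_power (space_of scale) i)
                          (exterior_power (dual_space (space_of scale)) j)))"
proof -
  let ?V = "space_of scale"
  let ?R = "\<lambda>(i, j). tensor_product (exterior_power ?V i) (exterior_power (dual_space ?V) j)"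
  interpret V: finite_dimensional_vector_space scale Basis by (rule assms)
  obtain e where e: "bij_betw e {..<card Basis} Basis"
    using ex_bij_betw_nat_finite[OF V.finite_Basis] by (auto simp: atLeast0LessThan)
  let ?d = "card Basis" and ?E = "\<lambda>i. {s \<in> set (subseqs [0..<card Basis]). length s = i}"
  interpret poly_bialgebra "symmetric_bialgebra scale" "scoord scale Basis e ?d" "{..<?d}"
    by (rule poly_bialgebra_sym[OF assms e])
  interpret poly_bialgebra_char_0 "symmetric_bialgebra scale" "scoord scale Basis e ?d" "{..<?d}" ..
  have E: "{s \<in> wds {..<?d} i. sorted s \<and> distinct s} = ?E i" for i by (auto simp: subseqs_upt)
  note cV = coord_space_of[OF assms e]
  have "\<exists>\<phi>. coord (?R t) \<phi> ((\<lambda>(i, j). ?E i \<times> ?E j) t)" for t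
  proof -
    obtain i j where t: "t = (i, j)" by (cases t)
    obtain \<phi>1 where "coord (exterior_power ?V i) \<phi>1 (?E i)" using coord_exterior_power[OF cV, of i] unfolding E by blast
    \<comment> \<open>The dual basis has the index set of the basis of \<open>V\<close>, so its
      exterior powers are indexed by the same words.\<close>
    moreover obtain \<phi>2 where "coord (exterior_power (dual_space ?V) j) \<phi>2 (?E j)"
      using coord_exterior_power[OF coord_dual_space[OF cV], of j] unfolding E by auto
    ultimately show ?thesis unfolding t prod.case by (rule coord_tensor_product)
  qed
  then have "\<exists>\<phi>. \<forall>t. coord (?R t) (\<phi> t) ((\<lambda>(i, j). ?E i \<times> ?E j) t)" by (intro choice allI)
  then obtain \<phi> where \<phi>: "\<And>t. coord (?R t) (\<phi> t) ((\<lambda>(i, j). ?E i \<times> ?E j) t)" by blast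
  have "finite {(i, j). i + j = m}"
    by (rule finite_subset[of _ "{..m} \<times> {..m}"]) auto
  note rhs = coord_direct_sum[OF \<phi> this]
  have "distinct [0..<?d]" "set [0..<?d] = {..<?d}" by auto
  from coord_GS_cohomology[OF this, of m] obtain \<psi> where
    lhs: "coord (GS_cohomology (symmetric_bialgebra scale) m) \<psi> (Sigma {(i, j). i + j = m} (\<lambda>(i, j). ?E i \<times> ?E j))" by blast
  show ?thesis by (rule lin_isoI[OF lhs rhs])
qed

end
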